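(* Let $\Omega\subset\mathbb{C}^2$ be an open set, let $T$ be a uniformly laminar current in $\Omega$, and let $S$ be a positive closed current in $\Omega$ of bidimension $(1,1)$ such that $S\le T$. Then $S$ is uniformly laminar in $\Omega$.
   Context: Lamination by graphs over the unit disk $\mathbb{D}$: a family $\mathcal{L}$ of pairwise disjoint graphs $L_\alpha=\{(z,\varphi_\alpha(z)):z\in\mathbb{D}\}$ of holomorphic functions $\varphi_\alpha$, indexed by $\alpha\in\tau$, where $\tau\subset\mathbb{D}$ is closed, $\varphi_\alpha(0)=\alpha$, and there is $\eta>0$ with $|\varphi_\alpha(z)|\le 1-\eta$ for all $\alpha\in\tau$, $z\in\mathbb{D}$. Uniformly laminar current in the bidisk: a positive closed current in $\mathbb{D}^2$ of the form $\int_\tau [L_\alpha]\,d\mu(\alpha)$, where $\mathcal{L}=\{L_\alpha\}_{\alpha\in\tau}$ is a lamination by graphs over $\mathbb{D}$ (that is, a family of pairwise disjoint graphs $L_\alpha=\{(z,\varphi_\alpha(z)):z\in\mathbb{D}\}$ of holomorphic functions $\varphi_\alpha$, with $\tau\subset\mathbb{D}$ closed, $\varphi_\alpha(0)=\alpha$, and $|\varphi_\alpha(z)|\le 1-\eta$ for all $\alpha\in\tau$, $z\in\mathbb{D}$, for some $\eta>0$), $[L_\alpha]$ is the current of integration on $L_\alpha$, and $\mu$ is a finite positive measure on $\tau$. Uniformly laminar current in an open set $\Omega$ (the notion is local): a positive current $T$ in $\Omega$ such that every point of $\Omega$ has an open neighbourhood $V\subset\Omega$ and a biholomorphism $\psi$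 from $V$ onto an open subset of $\mathbb{D}^2$ such that $\psi_*(T|_V)$ is the restriction to $\psi(V)$ of a uniformly laminar current in $\mathbb{D}^2$. $S\le T$ means that $T-S$ is a positive current. *)

theory Defs
  imports "HOL-Analysis.Analysis"
begin

type_synonym C2 = "complex \<times> complex"

primrec iter_deriv :: "'a::real_normed_vector list \<Rightarrow> ('a \<Rightarrow> complex) \<Rightarrow> 'a \<Rightarrow> complex" where
  "iter_deriv [] f = f"
| "iter_deriv (v # vs) f = (\<lambda>p. frechet_derivative (iter_deriv vs f) (at p) v)"

text \<open>All iterated directional derivatives exist and are differentiable; on a
  finite-dimensional space this is \<open>C\<^sup>\<infinity>\<close>.\<close>

definition Cinf :: "('a::real_normed_vector \<Rightarrow> complex) \<Rightarrow> bool" where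
  "Cinf f \<longleftrightarrow> (\<forall>vs p. iter_deriv vs f differentiable (at p))"

definition cscale :: "complex \<Rightarrow> C2 \<Rightarrow> C2" where
  "cscale c v = (c * fst v, c * snd v)"

text \<open>Complex-valued 1-forms and 2-forms are functions of the point and of real tangent vectors.
  A test form on \<open>\<Omega>\<close> is extended by zero to the whole space.\<close>

type_synonym form1 = "C2 \<Rightarrow> C2 \<Rightarrow> complex"
type_synonym form2 = "C2 \<Rightarrow> C2 \<Rightarrow> C2 \<Rightarrow> complex"

definition test_form1 :: "C2 set \<Rightarrow> form1 \<Rightarrow> bool" where
  "test_form1 \<Omega> \<theta> \<longleftrightarrow>
     (\<forall>p. linear (\<theta> p)) \<and>
     (\<forall>u. Cinf (\<lambda>p. \<theta> p u)) \<and>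
     (\<exists>K. compact K \<and> K \<subseteq> \<Omega> \<and> (\<forall>p. p \<notin> K \<longrightarrow> (\<forall>u. \<theta> p u = 0)))"

definition supported_in :: "C2 set \<Rightarrow> form2 \<Rightarrow> bool" where
  "supported_in K \<omega> \<longleftrightarrow> (\<forall>p. p \<notin> K \<longrightarrow> (\<forall>u v. \<omega> p u v = 0))"

definition test_form2 :: "C2 set \<Rightarrow> form2 \<Rightarrow> bool" where
  "test_form2 \<Omega> \<omega> \<longleftrightarrow>
     (\<forall>p. bilinear (\<omega> p) \<and> (\<forall>u. \<omega> p u u = 0)) \<and>
     (\<forall>u v. Cinf (\<lambda>p. \<omega> p u v)) \<and>
     (\<exists>K. compact K \<and> K \<subseteq> \<Omega> \<and> supported_in K \<omega>)"

definition ext_deriv :: "form1 \<Rightarrow> form2" where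
  "ext_deriv \<theta> = (\<lambda>p u v. frechet_derivative (\<lambda>q. \<theta> q v) (at p) u
                        - frechet_derivative (\<lambda>q. \<theta> q u) (at p) v)"

definition type_20 :: "form2 \<Rightarrow> bool" where
  "type_20 \<omega> \<longleftrightarrow> (\<forall>p u v. \<omega> p (cscale \<i> u) v = \<i> * \<omega> p u v)"

definition type_02 :: "form2 \<Rightarrow> bool" where
  "type_02 \<omega> \<longleftrightarrow> (\<forall>p u v. \<omega> p (cscale \<i> u) v = - \<i> * \<omega> p u v)"

definition type_11 :: "form2 \<Rightarrow> bool" where
  "type_11 \<omega> \<longleftrightarrow> (\<forall>p u v. \<omega> p (cscale \<i> u) (cscale \<i> v) = \<omega> p u v)"

text \<open>Positive (1,1)-forms: the restriction to every complex line is nonnegative, i.e. the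
  coefficient matrix of \<open>\<i> \<Sum> h\<^sub>j\<^sub>k dz\<^sub>j \<and> d\<bar>z\<^sub>k\<close> is positive semidefinite. (In bidegree (1,1) weak
  and strong positivity agree.)\<close>

definition positive_form :: "form2 \<Rightarrow> bool" where
  "positive_form \<omega> \<longleftrightarrow> type_11 \<omega> \<and> (\<forall>p u. \<omega> p u (cscale \<i> u) \<in> \<real>\<^sub>\<ge>\<^sub>0)"

text \<open>A current on \<open>\<Omega>\<close> is a functional of which only the values on test forms of \<open>\<Omega>\<close> matter, so
  that restriction to a smaller open set does not change the function. Continuity is sequential
  continuity on the space of test forms: supports in a fixed compact set, and uniform convergence
  of all derivatives.\<close>

type_synonym current = "form2 \<Rightarrow> complex"

definition test_form2_null_seq :: "C2 set \<Rightarrow> (nat \<Rightarrow> form2) \<Rightarrow> bool" where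
  "test_form2_null_seq \<Omega> w \<longleftrightarrow>
     (\<forall>n. test_form2 \<Omega> (w n)) \<and>
     (\<exists>K. compact K \<and> K \<subseteq> \<Omega> \<and> (\<forall>n. supported_in K (w n))) \<and>
     (\<forall>u v vs. uniform_limit UNIV (\<lambda>n. iter_deriv vs (\<lambda>p. w n p u v)) (\<lambda>p. 0) sequentially)"

definition current2 :: "C2 set \<Rightarrow> current \<Rightarrow> bool" where
  "current2 \<Omega> T \<longleftrightarrow>
     (\<forall>a b \<omega> \<omega>'. test_form2 \<Omega> \<omega> \<longrightarrow> test_form2 \<Omega> \<omega>' \<longrightarrow>
        T (\<lambda>p u v. a * \<omega> p u v + b * \<omega>' p u v) = a * T \<omega> + b * T \<omega>') \<and>
     (\<forall>w. test_form2_null_seq \<Omega> w \<longrightarrow> (\<lambda>n. T (w n)) \<longlonglongrightarrow> 0)"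

definition current11 :: "C2 set \<Rightarrow> current \<Rightarrow> bool" where
  "current11 \<Omega> T \<longleftrightarrow> current2 \<Omega> T \<and>
     (\<forall>\<omega>. test_form2 \<Omega> \<omega> \<longrightarrow> type_20 \<omega> \<or> type_02 \<omega> \<longrightarrow> T \<omega> = 0)"

definition closed_current :: "C2 set \<Rightarrow> current \<Rightarrow> bool" where
  "closed_current \<Omega> T \<longleftrightarrow> (\<forall>\<theta>. test_form1 \<Omega> \<theta> \<longrightarrow> T (ext_deriv \<theta>) = 0)"

definition positive_current :: "C2 set \<Rightarrow> current \<Rightarrow> bool" where
  "positive_current \<Omega> T \<longleftrightarrow> current11 \<Omega> T \<and>
     (\<forall>\<omega>. test_form2 \<Omega> \<omega> \<longrightarrow> positive_form \<omega> \<longrightarrow> T \<omega> \<in> \<real>\<^sub>\<ge>\<^sub>0)"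

definition current_le :: "C2 set \<Rightarrow> current \<Rightarrow> current \<Rightarrow> bool" where
  "current_le \<Omega> S T \<longleftrightarrow> positive_current \<Omega> (\<lambda>\<omega>. T \<omega> - S \<omega>)"

definition holomorphic_C2_on :: "C2 set \<Rightarrow> (C2 \<Rightarrow> C2) \<Rightarrow> bool" where
  "holomorphic_C2_on V \<psi> \<longleftrightarrow>
     (\<forall>p\<in>V. \<exists>D. (\<psi> has_derivative D) (at p) \<and> (\<forall>c u. D (cscale c u) = cscale c (D u)))"

definition biholomorphism :: "C2 set \<Rightarrow> C2 set \<Rightarrow> (C2 \<Rightarrow> C2) \<Rightarrow> bool" where
  "biholomorphism V W \<psi> \<longleftrightarrow> open V \<and> open W \<and> bij_betw \<psi> V W \<and>
     holomorphic_C2_on V \<psi> \<and> holomorphic_C2_on W (inv_into V \<psi>)"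

definition pullback :: "C2 set \<Rightarrow> (C2 \<Rightarrow> C2) \<Rightarrow> form2 \<Rightarrow> form2" where
  "pullback V \<psi> \<omega> = (\<lambda>p u v. if p \<in> V
     then \<omega> (\<psi> p) (frechet_derivative \<psi> (at p) u) (frechet_derivative \<psi> (at p) v) else 0)"

definition pushforward :: "C2 set \<Rightarrow> (C2 \<Rightarrow> C2) \<Rightarrow> current \<Rightarrow> current" where
  "pushforward V \<psi> T = (\<lambda>\<omega>. T (pullback V \<psi> \<omega>))"

abbreviation unit_disc :: "complex set" where
  "unit_disc \<equiv> ball 0 1"

abbreviation bidisc :: "C2 set" where
  "bidisc \<equiv> unit_disc \<times> unit_disc"

definition graph_over_disc :: "(complex \<Rightarrow> complex) \<Rightarrow> C2 set" where
  "graph_over_disc f = (\<lambda>z. (z, f z)) ` unit_disc"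

text \<open>Since \<open>\<phi> \<alpha> 0 = \<alpha>\<close>, the bound \<open>1 - \<eta>\<close> makes a relatively closed \<open>\<tau>\<close> closed in the plane.\<close>

definition lamination_by_graphs :: "complex set \<Rightarrow> (complex \<Rightarrow> complex \<Rightarrow> complex) \<Rightarrow> bool" where
  "lamination_by_graphs \<tau> \<phi> \<longleftrightarrow>
     closedin (top_of_set unit_disc) \<tau> \<and>
     (\<forall>\<alpha>\<in>\<tau>. \<phi> \<alpha> holomorphic_on unit_disc \<and> \<phi> \<alpha> 0 = \<alpha>) \<and>
     disjoint_family_on (\<lambda>\<alpha>. graph_over_disc (\<phi> \<alpha>)) \<tau> \<and>
     (\<exists>\<eta>>0. \<forall>\<alpha>\<in>\<tau>. \<forall>z\<in>unit_disc. cmod (\<phi> \<alpha> z) \<le> 1 - \<eta>)"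

text \<open>Integration over the graph of a holomorphic function: the form is pulled back by
  \<open>z \<mapsto> (z, f z)\<close>, whose derivative sends the oriented real basis \<open>1, \<i>\<close> to \<open>(1, f' z)\<close> and
  \<open>\<i> (1, f' z)\<close>.\<close>

definition integration_current :: "(complex \<Rightarrow> complex) \<Rightarrow> current" where
  "integration_current f = (\<lambda>\<omega>.
     LINT z:unit_disc|lborel. \<omega> (z, f z) (1, deriv f z) (cscale \<i> (1, deriv f z)))"

definition finite_measure_on :: "complex set \<Rightarrow> complex measure \<Rightarrow> bool" where
  "finite_measure_on \<tau> \<mu> \<longleftrightarrow> sets \<mu> = sets (restrict_space borel \<tau>) \<and> finite_measure \<mu>"

definition uniformly_laminar_bidisc :: "current \<Rightarrow> bool" where
  "uniformly_laminar_bidisc T \<longleftrightarrow>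
     positive_current bidisc T \<and> closed_current bidisc T \<and>
     (\<exists>\<tau> \<phi> \<mu>. lamination_by_graphs \<tau> \<phi> \<and> finite_measure_on \<tau> \<mu> \<and>
        (\<forall>\<omega>. test_form2 bidisc \<omega> \<longrightarrow> T \<omega> = (LINT \<alpha>|\<mu>. integration_current (\<phi> \<alpha>) \<omega>)))"

definition uniformly_laminar :: "C2 set \<Rightarrow> current \<Rightarrow> bool" where
  "uniformly_laminar \<Omega> T \<longleftrightarrow>
     positive_current \<Omega> T \<and>
     (\<forall>p\<in>\<Omega>. \<exists>V W \<psi> R. p \<in> V \<and> V \<subseteq> \<Omega> \<and> W \<subseteq> bidisc \<and> biholomorphism V W \<psi> \<and>
        uniformly_laminar_bidisc R \<and>
        (\<forall>\<omega>. test_form2 W \<omega> \<longrightarrow> pushforward V \<psi> T \<omega> = R \<omega>))"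

end

theory Submission
  imports Defs "HOL-Complex_Analysis.Complex_Analysis"
begin

text \<open>
  In a chart in which \<open>T\<close> is an average of almost horizontal leaves, \<open>S \<le> T\<close> and the Cauchy--Schwarz inequality bound
  \<open>S \<omega>\<close> by the \<open>L\<^sup>2\<close> norm of the restriction of \<open>\<omega>\<close> to the leaves, so \<open>S\<close> is given by a density on the
  product of the disc with the transversal. Testing \<open>dS = 0\<close> against \<open>dH \<and> d(Re z)\<close> and \<open>dH \<and> d(Im z)\<close>, with \<open>H\<close>
  the product of a function of \<open>z\<close> and a smooth function that is almost constant along the leaves, shows that the density is
  constant on almost every leaf near the centre of the chart. It therefore weights the transverse measure, and
  \<open>S\<close> is the corresponding average of the leaves.
\<close>

section \<open>Smooth functions\<close>

text \<open>The main obstacle is that holonomy is only Hoelder continuous in the transversal: a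
  function of the leaf alone has in general no smooth extension, so \<open>dS = 0\<close> cannot be
  tested against it directly. A smooth \<open>H\<close> leaves an error, and since the density is
  known only to be integrable, that error must be uniformly small on the leaves, for the values of
  \<open>H\<close> and for its leafwise derivative alike. The weights \<open>bump_weight\<close> are
  made for this: their logarithmic derivative along leaves grows like log(1/\<epsilon>), while the
  mean oscillation of the averaged data decays like a power of \<epsilon>. Domination acts through
  positivity: a real form lies between plus and minus a Hermitian form whose transversal coefficient
  may be huge, because on leaves it multiplies the squared error of a slope approximation. The
  density is defined almost everywhere and the exceptional leaves may depend on a translation, so
  its constancy is stated for mollified averages and used under integrals. Charts are shrunk until a
  leaf drifts by at most 1/4: labels below 1/2 then stay below height 3/4, and a leaf reaching
  heights below 1/4 has label below 1/2.\<close>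

primrec Ck_on :: "nat \<Rightarrow> 'a::real_normed_vector set \<Rightarrow> ('a \<Rightarrow> complex) \<Rightarrow> bool" where
  "Ck_on 0 U f \<longleftrightarrow> True"
| "Ck_on (Suc n) U f \<longleftrightarrow> (\<forall>p\<in>U. f differentiable (at p)) \<and>
     (\<forall>v. Ck_on n U (\<lambda>p. frechet_derivative f (at p) v))"

text \<open>\<open>Ck_on\<close> recurses through directional derivatives, so that every stage is
  again a complex-valued function on the same space; the Frechet derivative itself would change the
  codomain. A finite level records only differentiability. The continuity of each derivative comes
  from the next level, available here for all \<open>n\<close>.\<close>

definition smooth_on :: "'a::real_normed_vector set \<Rightarrow> ('a \<Rightarrow> complex) \<Rightarrow> bool" where
  "smooth_on U f \<longleftrightarrow> (\<forall>n. Ck_on n U f)"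

lemma Ck_on_cong:
  assumes "open U" "\<And>p. p \<in> U \<Longrightarrow> f p = g p" "Ck_on n U f"
  shows "Ck_on n U g"
  using assms(2,3)
proof (induction n arbitrary: f g)
  case (Suc n)
  have d: "(f has_derivative frechet_derivative f (at p)) (at p)" if "p \<in> U" for p
    using Suc.prems(2) that frechet_derivative_works by auto
  have d': "(g has_derivative frechet_derivative f (at p)) (at p)" if "p \<in> U" for p
    by (rule has_derivative_transform_within_open[OF d[OF that] assms(1) that Suc.prems(1)])
  have e: "frechet_derivative f (at p) = frechet_derivative g (at p)" if "p \<in> U" for p
    using frechet_derivative_at[OF d'[OF that]] .
  show ?case
  proof (simp, intro conjI allI ballI)
    fix p assume "p \<in> U" then show "g differentiable at p" using d' differentiable_def by blast
  next
    fix v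
    show "Ck_on n U (\<lambda>p. frechet_derivative g (at p) v)"
      by (rule Suc.IH[of "\<lambda>p. frechet_derivative f (at p) v"]) (use e Suc.prems in auto)
  qed
qed simp

lemma Ck_on_SucI:
  assumes "open U" "\<And>p. p \<in> U \<Longrightarrow> (f has_derivative D p) (at p)" "\<And>v. Ck_on n U (\<lambda>p. D p v)"
  shows "Ck_on (Suc n) U f"
proof (simp, intro conjI allI ballI)
  fix p assume "p \<in> U" then show "f differentiable at p" using assms(2) differentiable_def by blast
next
  fix v
  show "Ck_on n U (\<lambda>p. frechet_derivative f (at p) v)"
    by (rule Ck_on_cong[OF assms(1) _ assms(3)[of v]]) (use frechet_derivative_at[OF assms(2)] in auto)
qed

lemma Ck_on_SucD:
  assumes "Ck_on (Suc n) U f" "p \<in> U"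
  shows "(f has_derivative frechet_derivative f (at p)) (at p)"
  using assms frechet_derivative_works by auto

lemma Ck_on_Suc_imp: "Ck_on (Suc n) U f \<Longrightarrow> Ck_on n U f"
  by (induction n arbitrary: f) auto

lemma Ck_on_subset: "Ck_on n U f \<Longrightarrow> V \<subseteq> U \<Longrightarrow> Ck_on n V f"
  by (induction n arbitrary: f) auto

lemma Ck_on_Un: "Ck_on n U f \<Longrightarrow> Ck_on n V f \<Longrightarrow> Ck_on n (U \<union> V) f"
  by (induction n arbitrary: f) auto

lemma Ck_on_const: "Ck_on n U (\<lambda>p. c)"
proof (induction n arbitrary: c)
  case (Suc n) then show ?case by simp
qed simp

lemma Ck_on_add:
  assumes "open U" "Ck_on n U f" "Ck_on n U g"
  shows "Ck_on n U (\<lambda>p. f p + g p)"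
  using assms(2,3)
proof (induction n arbitrary: f g)
  case (Suc n)
  show ?case
    by (rule Ck_on_SucI[OF assms(1)
          has_derivative_add[OF Ck_on_SucD[OF Suc.prems(1)] Ck_on_SucD[OF Suc.prems(2)]]])
       (use Suc in auto)
qed simp

lemma Ck_on_linear:
  assumes "open U" "bounded_linear L" "Ck_on n U f"
  shows "Ck_on n U (\<lambda>p. L (f p))"
  using assms(3)
proof (induction n arbitrary: f)
  case (Suc n)
  show ?case
    by (rule Ck_on_SucI[OF assms(1)
          bounded_linear.has_derivative[OF assms(2) Ck_on_SucD[OF Suc.prems]]])
       (use Suc in auto)
qed simp

lemma Ck_on_mult:
  assumes "open U" "Ck_on n U f" "Ck_on n U g"
  shows "Ck_on n U (\<lambda>p. f p * g p)"
  using assms(2,3)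
proof (induction n arbitrary: f g)
  case (Suc n)
  show ?case
  proof (rule Ck_on_SucI[OF assms(1)
          has_derivative_mult[OF Ck_on_SucD[OF Suc.prems(1)] Ck_on_SucD[OF Suc.prems(2)]]])
    fix v
    have "Ck_on n U (\<lambda>p. frechet_derivative f (at p) v)" "Ck_on n U (\<lambda>p. frechet_derivative g (at p) v)"
      using Suc.prems by auto
    then show "Ck_on n U (\<lambda>p. f p * frechet_derivative g (at p) v + frechet_derivative f (at p) v * g p)"
      by (intro Ck_on_add assms(1) Suc.IH Ck_on_Suc_imp[OF Suc.prems(1)] Ck_on_Suc_imp[OF Suc.prems(2)])
  qed
qed simp

lemma Ck_on_bounded_linear:
  assumes "open U" "bounded_linear L"
  shows "Ck_on n U L"
proof (cases n)
  case (Suc m)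
  show ?thesis unfolding Suc
    by (rule Ck_on_SucI[OF assms(1) bounded_linear.has_derivative[OF assms(2) has_derivative_ident]])
       (auto intro: Ck_on_const)
qed simp

lemma Ck_on_precompose_linear:
  assumes "open U" "bounded_linear L" "Ck_on n U f"
  shows "Ck_on n (L -` U) (\<lambda>p. f (L p))"
  using assms(3)
proof (induction n arbitrary: f)
  case (Suc n)
  have o: "open (L -` U)"
    using assms(1,2) by (metis continuous_open_vimage linear_continuous_at)
  show ?case
  proof (rule Ck_on_SucI[OF o])
    fix p assume "p \<in> L -` U"
    then have "(f has_derivative frechet_derivative f (at (L p))) (at (L p))"
      using Ck_on_SucD[OF Suc.prems] by simp
    from has_derivative_compose[OF bounded_linear.has_derivative[OF assms(2) has_derivative_ident] this]
    show "((\<lambda>p. f (L p)) has_derivative (\<lambda>v. frechet_derivative f (at (L p)) (L v))) (at p)" .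
  next
    fix v show "Ck_on n (L -` U) (\<lambda>p. frechet_derivative f (at (L p)) (L v))"
      using Suc.IH[of "\<lambda>q. frechet_derivative f (at q) (L v)"] Suc.prems by auto
  qed
qed simp

text \<open>The tower \<open>H\<close> makes the induction close: differentiating
  \<open>H k (f p)\<close> gives \<open>H (Suc k) (f p)\<close> times a derivative of
  \<open>f\<close>, so the claim is proved for all \<open>k\<close> at once. It is applied with the
  iterated derivatives of a holomorphic function.\<close>

lemma Ck_on_chain:
  assumes "open U" "Ck_on n U f"
    and "\<And>k p. p \<in> U \<Longrightarrow> f differentiable (at p) \<Longrightarrow> ((\<lambda>q. H k (f q)) has_derivative
           (\<lambda>v. H (Suc k) (f p) * frechet_derivative f (at p) v)) (at p)"
  shows "Ck_on n U (\<lambda>p. H k (f p))"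
  using assms(2)
proof (induction n arbitrary: k)
  case (Suc n)
  show ?case
  proof (rule Ck_on_SucI[OF assms(1)])
    show "((\<lambda>q. H k (f q)) has_derivative
           (\<lambda>v. H (Suc k) (f p) * frechet_derivative f (at p) v)) (at p)" if "p \<in> U" for p
      using assms(3)[OF that] Suc.prems that by auto
    fix v
    show "Ck_on n U (\<lambda>p. H (Suc k) (f p) * frechet_derivative f (at p) v)"
      by (rule Ck_on_mult[OF assms(1) Suc.IH[OF Ck_on_Suc_imp[OF Suc.prems]]]) (use Suc.prems in auto)
  qed
qed simp

lemma smooth_on_D:
  assumes "smooth_on U f" "p \<in> U"
  shows "(f has_derivative frechet_derivative f (at p)) (at p)"
  using assms Ck_on_SucD unfolding smooth_on_def by blast

lemma smooth_on_frechet: "smooth_on U f \<Longrightarrow> smooth_on U (\<lambda>p. frechet_derivative f (at p) v)"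
  unfolding smooth_on_def by (metis Ck_on.simps(2))

lemma smooth_on_continuous: "smooth_on U f \<Longrightarrow> continuous_on U f"
  by (meson continuous_at_imp_continuous_on has_derivative_continuous smooth_on_D)

lemma smooth_on_cong: "open U \<Longrightarrow> (\<And>p. p \<in> U \<Longrightarrow> f p = g p) \<Longrightarrow> smooth_on U f \<Longrightarrow> smooth_on U g"
  unfolding smooth_on_def using Ck_on_cong by blast
lemma smooth_on_subset: "smooth_on U f \<Longrightarrow> V \<subseteq> U \<Longrightarrow> smooth_on V f"
  unfolding smooth_on_def using Ck_on_subset by blast
lemma smooth_on_const: "smooth_on U (\<lambda>p. c)"
  unfolding smooth_on_def using Ck_on_const by blast
lemma smooth_on_add: "open U \<Longrightarrow> smooth_on U f \<Longrightarrow> smooth_on U g \<Longrightarrow> smooth_on U (\<lambda>p. f p + g p)"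
  unfolding smooth_on_def using Ck_on_add by blast
lemma smooth_on_mult: "open U \<Longrightarrow> smooth_on U f \<Longrightarrow> smooth_on U g \<Longrightarrow> smooth_on U (\<lambda>p. f p * g p)"
  unfolding smooth_on_def using Ck_on_mult by blast
lemma smooth_on_linear: "open U \<Longrightarrow> bounded_linear L \<Longrightarrow> smooth_on U f \<Longrightarrow> smooth_on U (\<lambda>p. L (f p))"
  unfolding smooth_on_def using Ck_on_linear by blast
lemma smooth_on_bounded_linear: "open U \<Longrightarrow> bounded_linear L \<Longrightarrow> smooth_on U L"
  unfolding smooth_on_def using Ck_on_bounded_linear by blast
lemma smooth_on_precompose_linear:
  "open U \<Longrightarrow> bounded_linear L \<Longrightarrow> smooth_on U f \<Longrightarrow> smooth_on (L -` U) (\<lambda>p. f (L p))"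
  unfolding smooth_on_def using Ck_on_precompose_linear by blast

lemma smooth_on_minus: "open U \<Longrightarrow> smooth_on U f \<Longrightarrow> smooth_on U (\<lambda>p. - f p)"
  by (rule smooth_on_linear[OF _ bounded_linear_minus[OF bounded_linear_ident]])
lemma smooth_on_diff: "open U \<Longrightarrow> smooth_on U f \<Longrightarrow> smooth_on U g \<Longrightarrow> smooth_on U (\<lambda>p. f p - g p)"
  using smooth_on_add[of U f "\<lambda>p. - g p"] smooth_on_minus by auto
lemma smooth_on_cnj: "open U \<Longrightarrow> smooth_on U f \<Longrightarrow> smooth_on U (\<lambda>p. cnj (f p))"
  by (rule smooth_on_linear[OF _ bounded_linear_cnj])
lemma smooth_on_Re: "open U \<Longrightarrow> smooth_on U f \<Longrightarrow> smooth_on U (\<lambda>p. complex_of_real (Re (f p)))"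
  by (rule smooth_on_linear[OF _ bounded_linear_compose[OF bounded_linear_of_real bounded_linear_Re]])
lemma smooth_on_Im: "open U \<Longrightarrow> smooth_on U f \<Longrightarrow> smooth_on U (\<lambda>p. complex_of_real (Im (f p)))"
  by (rule smooth_on_linear[OF _ bounded_linear_compose[OF bounded_linear_of_real bounded_linear_Im]])
lemma smooth_on_sum:
  "open U \<Longrightarrow> (\<And>i. i \<in> I \<Longrightarrow> smooth_on U (f i)) \<Longrightarrow> smooth_on U (\<lambda>p. \<Sum>i\<in>I. f i p)"
  by (induction I rule: infinite_finite_induct) (auto intro: smooth_on_const smooth_on_add)
lemma smooth_on_power: "open U \<Longrightarrow> smooth_on U f \<Longrightarrow> smooth_on U (\<lambda>p. f p ^ n)"
  by (induction n) (auto intro: smooth_on_const smooth_on_mult)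
lemma smooth_on_norm2: "open U \<Longrightarrow> smooth_on U f \<Longrightarrow> smooth_on U (\<lambda>p. complex_of_real ((cmod (f p))\<^sup>2))"
  by (simp only: complex_norm_square) (intro smooth_on_mult smooth_on_cnj)

lemma smooth_on_fst: "open U \<Longrightarrow> smooth_on U f \<Longrightarrow> smooth_on (U \<times> UNIV) (\<lambda>p. f (fst p))"
  using smooth_on_precompose_linear[OF _ bounded_linear_fst] by (simp add: fst_vimage_eq_Times)
lemma smooth_on_snd: "open U \<Longrightarrow> smooth_on U f \<Longrightarrow> smooth_on (UNIV \<times> U) (\<lambda>p. f (snd p))"
  using smooth_on_precompose_linear[OF _ bounded_linear_snd] by (simp add: snd_vimage_eq_Times)

lemma has_derivative_holomorphic_comp:
  assumes "h holomorphic_on A" "open A" "f p \<in> A" "(f has_derivative D) (at p)"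
  shows "((\<lambda>q. h (f q)) has_derivative (\<lambda>v. deriv h (f p) * D v)) (at p)"
  using has_derivative_compose[OF assms(4) has_field_derivative_imp_has_derivative
      [OF holomorphic_derivI[OF assms(1-3)]]] .

lemma smooth_on_holomorphic_comp:
  assumes "open U" "smooth_on U f" "h holomorphic_on A" "open A" "f ` U \<subseteq> A"
  shows "smooth_on U (\<lambda>p. h (f p))"
  unfolding smooth_on_def
proof
  fix n
  have "Ck_on n U (\<lambda>p. ((deriv ^^ 0) h) (f p))"
  proof (rule Ck_on_chain[OF assms(1), where f=f and H="\<lambda>k. (deriv ^^ k) h"])
    show "Ck_on n U f" using assms(2) smooth_on_def by blast
    fix k p assume p: "p \<in> U" "f differentiable (at p)"
    then have "f p \<in> A" using assms(5) by auto
    from has_derivative_holomorphic_comp[where f=f and p=p, OF holomorphic_higher_deriv[OF assms(3,4), of k] assms(4) this]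
    show "((\<lambda>q. (deriv ^^ k) h (f q)) has_derivative
           (\<lambda>v. (deriv ^^ Suc k) h (f p) * frechet_derivative f (at p) v)) (at p)"
      using p(2) frechet_derivative_works by auto
  qed
  then show "Ck_on n U (\<lambda>p. h (f p))" by simp
qed

lemma smooth_on_inverse:
  assumes "open U" "smooth_on U f" "\<And>p. p \<in> U \<Longrightarrow> f p \<noteq> 0"
  shows "smooth_on U (\<lambda>p. inverse (f p))"
  by (rule smooth_on_holomorphic_comp[OF assms(1,2), where A="- {0}"])
     (use assms(3) in \<open>auto intro!: holomorphic_intros\<close>)

lemma smooth_on_holomorphic:
  assumes "open U" "h holomorphic_on U"
  shows "smooth_on U h"
  using smooth_on_holomorphic_comp[OF assms(1) smooth_on_bounded_linear[OF assms(1) bounded_linear_ident] assms(2,1)]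
  by auto

text \<open>Smoothness is local, and \<open>U\<close> together with the open complement of
  \<open>K\<close> covers the space.\<close>

lemma smooth_on_extend_zero:
  assumes "open U" "smooth_on U f" "compact K" "K \<subseteq> U" "\<And>p. p \<notin> K \<Longrightarrow> f p = 0"
  shows "smooth_on UNIV f"
  unfolding smooth_on_def
proof
  fix n
  have "open (- K)" using assms(3) compact_imp_closed by auto
  then have "Ck_on n (- K) f"
    by (rule Ck_on_cong[of _ "\<lambda>p. 0"]) (use assms(5) Ck_on_const in auto)
  then have "Ck_on n (U \<union> - K) f" using Ck_on_Un assms(2) smooth_on_def by blast
  moreover have "UNIV \<subseteq> U \<union> - K" using assms(4) by auto
  ultimately show "Ck_on n UNIV f" by (rule Ck_on_subset)
qed

text \<open>\<open>iter_deriv\<close> differentiates in the direction of the head last, whereas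
  \<open>Ck_on\<close> strips off the innermost derivative; appending at the end of the list
  reconciles the two orders.\<close>

lemma iter_deriv_snoc:
  "iter_deriv (vs @ [v]) f = iter_deriv vs (\<lambda>p. frechet_derivative f (at p) v)"
  by (induction vs) auto

lemma Cinf_iff_smooth_on: "Cinf f \<longleftrightarrow> smooth_on UNIV f"
proof
  assume C: "Cinf f"
  have "Ck_on n UNIV f" if "\<forall>vs p. iter_deriv vs f differentiable at p" for n
    using that
  proof (induction n arbitrary: f)
    case (Suc n)
    have "f differentiable at p" for p using Suc.prems[rule_format, of "[]" p] by simp
    moreover have "Ck_on n UNIV (\<lambda>p. frechet_derivative f (at p) v)" for v
      using Suc.IH[of "\<lambda>p. frechet_derivative f (at p) v"] Suc.prems iter_deriv_snoc by metis
    ultimately show ?case by auto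
  qed simp
  then show "smooth_on UNIV f" using C unfolding Cinf_def smooth_on_def by blast
next
  assume "smooth_on UNIV f"
  then have "smooth_on UNIV (iter_deriv vs f)" for vs
    by (induction vs) (auto intro: smooth_on_frechet)
  then show "Cinf f" unfolding Cinf_def using smooth_on_D differentiable_def by blast
qed

lemma C2_basis:
  "(u::C2) = Re (fst u) *\<^sub>R (1,0) + Im (fst u) *\<^sub>R (\<i>,0) + Re (snd u) *\<^sub>R (0,1) + Im (snd u) *\<^sub>R (0,\<i>)"
  by (auto simp: prod_eq_iff complex_eq_iff)

lemma linear_C2_expand:
  assumes "linear (L :: C2 \<Rightarrow> complex)"
  shows "L u = of_real (Re (fst u)) * L (1,0) + of_real (Im (fst u)) * L (\<i>,0)
     + of_real (Re (snd u)) * L (0,1) + of_real (Im (snd u)) * L (0,\<i>)"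
  by (subst C2_basis[of u]) (simp only: linear_add[OF assms] linear_scale[OF assms] scaleR_conv_of_real)

text \<open>Expanding the derivative of \<open>c\<close> in the real basis turns the chain rule into
  a sum of products in which the derivatives of \<open>c\<close> occur only as functions of
  \<open>\<psi> p\<close>. These have the shape of the claim again, hence the induction over
  arbitrary \<open>c\<close>.\<close>

lemma Ck_on_compose:
  fixes c :: "C2 \<Rightarrow> complex" and \<psi> :: "'a::real_normed_vector \<Rightarrow> C2"
  assumes "open V" "smooth_on UNIV c" "Ck_on n V (\<lambda>p. fst (\<psi> p))" "Ck_on n V (\<lambda>p. snd (\<psi> p))"
  shows "Ck_on n V (\<lambda>p. c (\<psi> p))"
  using assms(2-4)
proof (induction n arbitrary: c)
  case (Suc n)
  let ?D1 = "\<lambda>p. frechet_derivative (\<lambda>p. fst (\<psi> p)) (at p)"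
  let ?D2 = "\<lambda>p. frechet_derivative (\<lambda>p. snd (\<psi> p)) (at p)"
  let ?C = "\<lambda>p e. frechet_derivative c (at (\<psi> p)) e"
  show ?case
  proof (rule Ck_on_SucI[OF assms(1)])
    fix p assume p: "p \<in> V"
    have "((\<lambda>p. (fst (\<psi> p), snd (\<psi> p))) has_derivative (\<lambda>v. (?D1 p v, ?D2 p v))) (at p)"
      by (intro has_derivative_Pair Ck_on_SucD[OF Suc.prems(2) p] Ck_on_SucD[OF Suc.prems(3) p])
    then have "(\<psi> has_derivative (\<lambda>v. (?D1 p v, ?D2 p v))) (at p)" by simp
    from has_derivative_compose[OF this smooth_on_D[OF Suc.prems(1)]]
    have 1: "((\<lambda>p. c (\<psi> p)) has_derivative (\<lambda>v. ?C p (?D1 p v, ?D2 p v))) (at p)" by simp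
    have "linear (frechet_derivative c (at (\<psi> p)))"
      using smooth_on_D[OF Suc.prems(1)] has_derivative_linear by blast
    from linear_C2_expand[OF this]
    have "?C p (?D1 p v, ?D2 p v) = of_real (Re (?D1 p v)) * ?C p (1,0) + of_real (Im (?D1 p v)) * ?C p (\<i>,0)
       + of_real (Re (?D2 p v)) * ?C p (0,1) + of_real (Im (?D2 p v)) * ?C p (0,\<i>)" for v
      by (metis fst_conv snd_conv)
    with 1 show "((\<lambda>p. c (\<psi> p)) has_derivative (\<lambda>v. of_real (Re (?D1 p v)) * ?C p (1,0) + of_real (Im (?D1 p v)) * ?C p (\<i>,0)
       + of_real (Re (?D2 p v)) * ?C p (0,1) + of_real (Im (?D2 p v)) * ?C p (0,\<i>))) (at p)" by simp
  next
    fix v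
    have C: "Ck_on n V (\<lambda>p. ?C p e)" for e
      using Suc.IH[OF smooth_on_frechet[OF Suc.prems(1)]] Suc.prems(2,3)[THEN Ck_on_Suc_imp] by simp
    have D: "Ck_on n V (\<lambda>p. ?D1 p v)" "Ck_on n V (\<lambda>p. ?D2 p v)"
      using Suc.prems(2,3) by auto
    note R = Ck_on_linear[OF assms(1) bounded_linear_compose[OF bounded_linear_of_real bounded_linear_Re]]
    note I = Ck_on_linear[OF assms(1) bounded_linear_compose[OF bounded_linear_of_real bounded_linear_Im]]
    show "Ck_on n V (\<lambda>p. of_real (Re (?D1 p v)) * ?C p (1,0) + of_real (Im (?D1 p v)) * ?C p (\<i>,0)
       + of_real (Re (?D2 p v)) * ?C p (0,1) + of_real (Im (?D2 p v)) * ?C p (0,\<i>))"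
      by (intro Ck_on_add Ck_on_mult assms(1) C R I D)
  qed
qed simp

lemma smooth_on_compose:
  fixes c :: "C2 \<Rightarrow> complex"
  assumes "open V" "smooth_on UNIV c" "smooth_on V (\<lambda>p. fst (\<psi> p))" "smooth_on V (\<lambda>p. snd (\<psi> p))"
  shows "smooth_on V (\<lambda>p. c (\<psi> p))"
  using assms Ck_on_compose unfolding smooth_on_def by blast

subsection \<open>Cutoff functions\<close>

text \<open>The classical flat function exp(-1/x), multiplied by x^(-k). With these factors the
  family is closed under differentiation up to linear combinations, so smoothness follows by
  induction.\<close>

definition flat_exp :: "nat \<Rightarrow> real \<Rightarrow> real" where
  "flat_exp k x = (if x > 0 then exp (- inverse x) * inverse x ^ k else 0)"

lemma flat_exp_tendsto: "(flat_exp k \<longlongrightarrow> 0) (at_right 0)"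
proof -
  have "((\<lambda>y::real. y ^ k / exp y) \<longlongrightarrow> 0) at_top" by (rule tendsto_power_div_exp_0)
  then have "((\<lambda>x::real. inverse x ^ k / exp (inverse x)) \<longlongrightarrow> 0) (at_right 0)"
    using filterlim_compose filterlim_inverse_at_top_right by blast
  then show ?thesis
    by (rule Lim_transform_eventually)
       (auto simp: flat_exp_def eventually_at_filter exp_minus field_simps)
qed

lemma flat_exp_deriv:
  "(flat_exp k has_real_derivative (flat_exp (k + 2) x - real k * flat_exp (k + 1) x)) (at x)"
proof -
  consider "x > 0" | "x < 0" | "x = 0" by linarith
  then show ?thesis
  proof cases
    case 1
    have i: "(inverse has_real_derivative - (inverse x)\<^sup>2) (at x)"
      using DERIV_inverse[of x UNIV] 1 by (simp add: numeral_2_eq_2)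
    have k: "inverse x * inverse x ^ (k - Suc 0) = inverse x ^ k" if "k \<noteq> 0"
      using that by (cases k) auto
    have "((\<lambda>x. exp (- inverse x) * inverse x ^ k) has_real_derivative
        (flat_exp (k + 2) x - real k * flat_exp (k + 1) x)) (at x)"
      using 1 DERIV_mult[OF DERIV_chain2[OF DERIV_exp DERIV_minus[OF i]] DERIV_power[OF i, of k]]
      by (cases "k = 0") (simp_all add: flat_exp_def algebra_simps power2_eq_square k[symmetric])
    then show ?thesis
      by (rule has_field_derivative_transform_within_open[where S="{0<..}"]) (use 1 in \<open>auto simp: flat_exp_def\<close>)
  next
    case 2
    have "((\<lambda>x. 0) has_real_derivative (flat_exp (k + 2) x - real k * flat_exp (k + 1) x)) (at x)"
      using 2 by (auto simp: flat_exp_def)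
    then show ?thesis
      by (rule has_field_derivative_transform_within_open[where S="{..<0}"]) (use 2 in \<open>auto simp: flat_exp_def\<close>)
  next
    case 3
    \<comment> \<open>On the right of 0 the difference quotient is \<open>flat_exp (Suc k)\<close>,
      which tends to 0 because exp beats every power.\<close>
    have r: "((\<lambda>h. flat_exp k h / h) \<longlongrightarrow> 0) (at_right 0)"
      by (rule Lim_transform_eventually[OF flat_exp_tendsto[of "Suc k"]])
         (auto simp: flat_exp_def eventually_at_filter field_simps)
    have l: "((\<lambda>h. flat_exp k h / h) \<longlongrightarrow> 0) (at_left 0)"
      by (rule Lim_transform_eventually[OF tendsto_const[of 0]])
         (auto simp: flat_exp_def eventually_at_filter)
    have "((\<lambda>h. flat_exp k h / h) \<longlongrightarrow> 0) (at 0)"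
      using l r filterlim_at_split by blast
    then show ?thesis using 3 by (simp add: DERIV_def flat_exp_def)
  qed
qed

lemma smooth_on_flat_exp:
  assumes "open U" "smooth_on U (\<lambda>p. complex_of_real (f p))"
  shows "smooth_on U (\<lambda>p. complex_of_real (flat_exp k (f p)))"
proof -
  have "Ck_on n U (\<lambda>p. complex_of_real (flat_exp k (f p)))" for n
  proof (induction n arbitrary: k)
    case (Suc n)
    let ?f = "\<lambda>p. complex_of_real (f p)"
    let ?D = "\<lambda>p. frechet_derivative ?f (at p)"
    show ?case
    proof (rule Ck_on_SucI[OF assms(1)])
      fix p assume p: "p \<in> U"
      have "(?f has_derivative ?D p) (at p)" using smooth_on_D[OF assms(2) p] .
      note dRe = bounded_linear.has_derivative[OF bounded_linear_Re this]
      have df: "(f has_derivative (\<lambda>v. Re (?D p v))) (at p)" using dRe by simp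
      have "(?f has_derivative (\<lambda>v. complex_of_real (Re (?D p v)))) (at p)"
        using bounded_linear.has_derivative[OF bounded_linear_of_real df] .
      then have re: "?D p = (\<lambda>v. complex_of_real (Re (?D p v)))"
        using frechet_derivative_at by metis
      have "((\<lambda>p. flat_exp k (f p)) has_derivative
          (\<lambda>v. (flat_exp (k + 2) (f p) - real k * flat_exp (k + 1) (f p)) * Re (?D p v))) (at p)"
        using has_derivative_compose[OF df has_field_derivative_imp_has_derivative[OF flat_exp_deriv]] .
      from bounded_linear.has_derivative[OF bounded_linear_of_real this]
      show "((\<lambda>p. complex_of_real (flat_exp k (f p))) has_derivative
          (\<lambda>v. (complex_of_real (flat_exp (k + 2) (f p)) + (- complex_of_real (real k)) * complex_of_real (flat_exp (k + 1) (f p))) * ?D p v)) (at p)"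
        by (subst re) simp
    next
      fix v
      have "Ck_on n U (\<lambda>p. ?D p v)" using assms(2) smooth_on_frechet smooth_on_def by blast
      then show "Ck_on n U (\<lambda>p. (complex_of_real (flat_exp (k + 2) (f p)) + (- complex_of_real (real k)) * complex_of_real (flat_exp (k + 1) (f p))) * ?D p v)"
        by (intro Ck_on_mult Ck_on_add assms(1) Suc.IH Ck_on_const)
    qed
  qed simp
  then show ?thesis unfolding smooth_on_def by blast
qed

text \<open>The quotient a/(a+b), where the flat function \<open>a\<close> lives on |z| < R and
  \<open>b\<close> on |z| > r. As r < R these two regions cover the plane, so the denominator never
  vanishes.\<close>

lemma exists_cutoff:
  fixes r R :: real
  assumes "0 \<le> r" "r < R"
  obtains \<kappa> :: "complex \<Rightarrow> real" where "smooth_on UNIV (\<lambda>z. complex_of_real (\<kappa> z))"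
    "\<And>z. 0 \<le> \<kappa> z" "\<And>z. \<kappa> z \<le> 1" "\<And>z. cmod z \<le> r \<Longrightarrow> \<kappa> z = 1" "\<And>z. cmod z \<ge> R \<Longrightarrow> \<kappa> z = 0"
proof -
  define a where "a z = flat_exp 0 (R\<^sup>2 - (cmod z)\<^sup>2)" for z
  define b where "b z = flat_exp 0 ((cmod z)\<^sup>2 - r\<^sup>2)" for z
  define \<kappa> where "\<kappa> z = a z * inverse (a z + b z)" for z
  have nn: "a z \<ge> 0" "b z \<ge> 0" for z by (auto simp: a_def b_def flat_exp_def)
  have rR: "r\<^sup>2 < R\<^sup>2" using assms by (simp add: power_strict_mono)
  have pos: "a z + b z > 0" for z
    using rR by (auto simp: a_def b_def flat_exp_def intro: add_pos_pos)
  have id: "smooth_on UNIV (\<lambda>z::complex. z)" by (rule smooth_on_bounded_linear[OF open_UNIV bounded_linear_ident])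
  have n2: "smooth_on UNIV (\<lambda>z. complex_of_real ((cmod z)\<^sup>2))"
    by (rule smooth_on_norm2[OF open_UNIV id])
  have sa: "smooth_on UNIV (\<lambda>z. complex_of_real (a z))"
    unfolding a_def by (rule smooth_on_flat_exp[OF open_UNIV])
      (use smooth_on_diff[OF open_UNIV smooth_on_const n2, of "complex_of_real (R\<^sup>2)"] in \<open>simp\<close>)
  have sb: "smooth_on UNIV (\<lambda>z. complex_of_real (b z))"
    unfolding b_def by (rule smooth_on_flat_exp[OF open_UNIV])
      (use smooth_on_diff[OF open_UNIV n2 smooth_on_const, of "complex_of_real (r\<^sup>2)"] in \<open>simp\<close>)
  have "smooth_on UNIV (\<lambda>z. complex_of_real (a z) * inverse (complex_of_real (a z) + complex_of_real (b z)))"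
    by (intro smooth_on_mult smooth_on_inverse smooth_on_add open_UNIV sa sb)
       (simp flip: of_real_add add: pos[THEN less_imp_neq, symmetric])
  then have s: "smooth_on UNIV (\<lambda>z. complex_of_real (\<kappa> z))" by (simp add: \<kappa>_def)
  show ?thesis
  proof (rule that[OF s])
    fix z
    show "0 \<le> \<kappa> z" using nn pos[of z] by (simp add: \<kappa>_def)
    show "\<kappa> z \<le> 1" using nn[of z] pos[of z] by (simp add: \<kappa>_def field_simps)
    show "cmod z \<le> r \<Longrightarrow> \<kappa> z = 1"
    proof -
      assume "cmod z \<le> r"
      then have "b z = 0" using power_mono[of "cmod z" r 2] by (simp add: b_def flat_exp_def)
      then show ?thesis using pos[of z] by (simp add: \<kappa>_def)
    qed
    show "cmod z \<ge> R \<Longrightarrow> \<kappa> z = 0"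
    proof -
      assume "cmod z \<ge> R"
      then have "R\<^sup>2 \<le> (cmod z)\<^sup>2" using power_mono[of R "cmod z" 2] assms by linarith
      then have "a z = 0" by (simp add: a_def flat_exp_def)
      then show ?thesis by (simp add: \<kappa>_def)
    qed
  qed
qed

section \<open>Laminations by graphs\<close>

text \<open>A logarithm \<open>g\<close> of \<open>F\<close> maps the disc into the left half plane,
  and the Cayley transform \<open>c\<close> carries the half plane to the disc and
  \<open>g 0\<close> to 0. The Schwarz lemma for \<open>c\<close> gives a Harnack inequality for -ln
  |F| from its growth part and the second bound from its derivative part.\<close>

lemma bounded_nonvanishing_estimates:
  assumes hol: "F holomorphic_on unit_disc" and nz: "\<And>z. z \<in> unit_disc \<Longrightarrow> F z \<noteq> 0"
    and lt: "\<And>z. z \<in> unit_disc \<Longrightarrow> cmod (F z) < 1" and z: "z \<in> unit_disc"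
  shows "\<bar>ln (cmod (F z)) - ln (cmod (F 0))\<bar> \<le> cmod z * (- ln (cmod (F z)) - ln (cmod (F 0)))"
    and "cmod (deriv F 0) \<le> 2 * cmod (F 0) * (- ln (cmod (F 0)))"
proof -
  obtain g where g: "g holomorphic_on unit_disc" "\<And>z. z \<in> unit_disc \<Longrightarrow> F z = exp (g z)"
    using contractible_imp_holomorphic_log[OF hol convex_imp_contractible[OF convex_ball] nz] by auto
  have lnF: "ln (cmod (F z)) = Re (g z)" if "z \<in> unit_disc" for z
    using g(2)[OF that] by simp
  have neg: "Re (g z) < 0" if "z \<in> unit_disc" for z
    using lt[OF that] g(2)[OF that] by simp
  have 0: "0 \<in> unit_disc" by simp
  define c where "c z = (g z - g 0) / (g z + cnj (g 0))" for z
  have dnz: "g z + cnj (g 0) \<noteq> 0" if "z \<in> unit_disc" for z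
    using neg[OF that] neg[OF 0] by (auto simp: complex_eq_iff)
  have hc: "c holomorphic_on unit_disc"
    unfolding c_def using g(1) dnz by (auto intro!: holomorphic_intros)
  have key: "cmod (g z - g 0) < cmod (g z + cnj (g 0))" if "z \<in> unit_disc" for z
  proof -
    have "(cmod (g z + cnj (g 0)))\<^sup>2 - (cmod (g z - g 0))\<^sup>2 = 4 * (Re (g z) * Re (g 0))"
      unfolding cmod_power2 by (simp add: power2_eq_square algebra_simps)
    also have "\<dots> > 0" using neg[OF that] neg[OF 0] by (simp add: mult_neg_neg)
    finally show ?thesis by (simp add: power2_less_imp_less)
  qed
  have c1: "cmod (c z) < 1" if "cmod z < 1" for z
    using key[of z] that dnz[of z] by (simp add: c_def norm_divide)
  have c0: "c 0 = 0" by (simp add: c_def)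
  note S = Schwarz_Lemma[OF hc c0 c1]
  have "cmod (g z - g 0) \<le> cmod z * cmod (g z + cnj (g 0))"
    using S(1)[of z] z dnz[OF z] by (simp add: c_def norm_divide field_simps)
  then have "(cmod (g z - g 0))\<^sup>2 \<le> (cmod z * cmod (g z + cnj (g 0)))\<^sup>2"
    by (rule power_mono) simp
  then have "(Re (g z) - Re (g 0))\<^sup>2 + (Im (g z) - Im (g 0))\<^sup>2
     \<le> (cmod z)\<^sup>2 * ((Re (g z) + Re (g 0))\<^sup>2 + (Im (g z) - Im (g 0))\<^sup>2)"
    by (simp add: cmod_power2 power_mult_distrib)
  moreover have "(cmod z)\<^sup>2 * (Im (g z) - Im (g 0))\<^sup>2 \<le> 1 * (Im (g z) - Im (g 0))\<^sup>2"
    using z by (intro mult_right_mono) (auto simp: power_le_one)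
  ultimately have "(Re (g z) - Re (g 0))\<^sup>2 \<le> (cmod z * (- Re (g z) - Re (g 0)))\<^sup>2"
    by (simp add: power_mult_distrib algebra_simps power2_eq_square)
  then have "\<bar>Re (g z) - Re (g 0)\<bar> \<le> cmod z * (- Re (g z) - Re (g 0))"
  proof -
    have "0 \<le> cmod z * (- Re (g z) - Re (g 0))" using neg[OF z] neg[OF 0] by (intro mult_nonneg_nonneg) auto
    with \<open>(Re (g z) - Re (g 0))\<^sup>2 \<le> (cmod z * (- Re (g z) - Re (g 0)))\<^sup>2\<close> show ?thesis
      by (metis abs_le_square_iff abs_of_nonneg)
  qed
  then show "\<bar>ln (cmod (F z)) - ln (cmod (F 0))\<bar> \<le> cmod z * (- ln (cmod (F z)) - ln (cmod (F 0)))"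
    using lnF[OF z] lnF[OF 0] by simp
  have dg: "(g has_field_derivative deriv g 0) (at 0)"
    using holomorphic_derivI[OF g(1) open_ball 0] .
  have "(c has_field_derivative (deriv g 0 / (g 0 + cnj (g 0)))) (at 0)"
    unfolding c_def
    using DERIV_divide[OF DERIV_diff[OF dg DERIV_const[where k="g 0"]] DERIV_add[OF dg DERIV_const] dnz[OF 0]] dnz[OF 0]
    by simp
  then have "deriv c 0 = deriv g 0 / (g 0 + cnj (g 0))" by (rule DERIV_imp_deriv)
  moreover have "cmod (g 0 + cnj (g 0)) = 2 * (- Re (g 0))"
    using neg[OF 0] by (simp add: complex_add_cnj)
  ultimately have dgb: "cmod (deriv g 0) \<le> 2 * (- Re (g 0))"
    using S(2)[of 0] neg[OF 0] by (simp add: norm_divide field_simps)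
  have "(F has_field_derivative exp (g 0) * deriv g 0) (at 0)"
    by (rule has_field_derivative_transform_within_open[OF DERIV_chain2[OF DERIV_exp dg] open_ball 0])
      (use g(2) in auto)
  then have "deriv F 0 = F 0 * deriv g 0" using g(2)[OF 0] by (simp add: DERIV_imp_deriv)
  then show "cmod (deriv F 0) \<le> 2 * cmod (F 0) * (- ln (cmod (F 0)))"
    using dgb lnF[OF 0] mult_left_mono[OF dgb, of "cmod (F 0)"] by (simp add: norm_mult)
qed

text \<open>The bound 5 on the mutual distance of the leaves is only a normalisation.\<close>

locale graph_lamination =
  fixes \<tau> :: "complex set" and \<phi> :: "complex \<Rightarrow> complex \<Rightarrow> complex"
  assumes compact_tau: "compact \<tau>"
    and hol: "\<And>\<alpha>. \<alpha> \<in> \<tau> \<Longrightarrow> \<phi> \<alpha> holomorphic_on unit_disc"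
    and base: "\<And>\<alpha>. \<alpha> \<in> \<tau> \<Longrightarrow> \<phi> \<alpha> 0 = \<alpha>"
    and disj: "\<And>\<alpha> \<beta> z. \<alpha> \<in> \<tau> \<Longrightarrow> \<beta> \<in> \<tau> \<Longrightarrow> \<alpha> \<noteq> \<beta> \<Longrightarrow> z \<in> unit_disc \<Longrightarrow> \<phi> \<alpha> z \<noteq> \<phi> \<beta> z"
    and close: "\<And>\<alpha> \<beta> z. \<alpha> \<in> \<tau> \<Longrightarrow> \<beta> \<in> \<tau> \<Longrightarrow> z \<in> unit_disc \<Longrightarrow> cmod (\<phi> \<alpha> z - \<phi> \<beta> z) < 5"
begin

text \<open>The vertical distance of two leaves, scaled into [0,1) so that its logarithm is negative
  and \<open>bounded_nonvanishing_estimates\<close> applies to the scaled difference.\<close>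

definition gap :: "complex \<Rightarrow> complex \<Rightarrow> complex \<Rightarrow> real" where
  "gap \<alpha> \<beta> z = cmod (\<phi> \<alpha> z - \<phi> \<beta> z) / 5"

lemma gap_nonneg: "gap \<alpha> \<beta> z \<ge> 0" by (simp add: gap_def)
lemma gap_less_1: "\<alpha> \<in> \<tau> \<Longrightarrow> \<beta> \<in> \<tau> \<Longrightarrow> z \<in> unit_disc \<Longrightarrow> gap \<alpha> \<beta> z < 1"
  using close by (simp add: gap_def)
lemma gap_0: "\<alpha> \<in> \<tau> \<Longrightarrow> \<beta> \<in> \<tau> \<Longrightarrow> gap \<alpha> \<beta> 0 = cmod (\<alpha> - \<beta>) / 5"
  by (simp add: gap_def base)

lemma deriv_exists: "\<alpha> \<in> \<tau> \<Longrightarrow> z \<in> unit_disc \<Longrightarrow> (\<phi> \<alpha> has_field_derivative deriv (\<phi> \<alpha>) z) (at z)"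
  using holomorphic_derivI[OF hol open_ball] .

lemma gap_ln:
  assumes "\<alpha> \<in> \<tau>" "\<beta> \<in> \<tau>" "\<alpha> \<noteq> \<beta>" "z \<in> unit_disc"
  shows "\<bar>ln (gap \<alpha> \<beta> z) - ln (gap \<alpha> \<beta> 0)\<bar> \<le> cmod z * (- ln (gap \<alpha> \<beta> z) - ln (gap \<alpha> \<beta> 0))"
proof -
  have "gap \<alpha> \<beta> z = cmod ((\<phi> \<alpha> z - \<phi> \<beta> z) / 5)" for z by (simp add: gap_def norm_divide)
  moreover have "(\<lambda>z. (\<phi> \<alpha> z - \<phi> \<beta> z) / 5) holomorphic_on unit_disc"
    using assms by (auto intro!: holomorphic_intros hol)
  ultimately show ?thesis
    using bounded_nonvanishing_estimates(1)[of "\<lambda>z. (\<phi> \<alpha> z - \<phi> \<beta> z) / 5" z] assms disj close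
    by (simp add: norm_divide gap_def)
qed

text \<open>The slope is log-Lipschitz across the leaves. For |z| at most 1/2 the disc of radius 1/2
  about \<open>z\<close> stays in the unit disc; rescaling it to the unit disc halves the
  derivative, which turns the constant 2 of the derivative estimate into 4.\<close>

lemma gap_deriv:
  assumes "\<alpha> \<in> \<tau>" "\<beta> \<in> \<tau>" "\<alpha> \<noteq> \<beta>" "cmod z \<le> 1/2"
  shows "cmod (deriv (\<phi> \<alpha>) z - deriv (\<phi> \<beta>) z) / 5 \<le> 4 * gap \<alpha> \<beta> z * (- ln (gap \<alpha> \<beta> z))"
proof -
  define F where "F \<zeta> = (\<phi> \<alpha> (z + \<zeta> / 2) - \<phi> \<beta> (z + \<zeta> / 2)) / 5" for \<zeta>
  have in_disc: "z + \<zeta> / 2 \<in> unit_disc" if "\<zeta> \<in> unit_disc" for \<zeta>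
    using that assms(4) norm_triangle_ineq[of z "\<zeta>/2"] by (simp add: norm_divide)
  have h: "(\<lambda>\<zeta>. \<phi> \<gamma> (z + \<zeta> / 2)) holomorphic_on unit_disc" if "\<gamma> \<in> \<tau>" for \<gamma>
    by (rule holomorphic_on_compose_gen[OF _ hol[OF that], unfolded o_def])
      (use in_disc in \<open>auto intro!: holomorphic_intros\<close>)
  have hF: "F holomorphic_on unit_disc"
    unfolding F_def using h assms(1,2) by (auto intro!: holomorphic_intros)
  have zd: "z \<in> unit_disc" using assms(4) by simp
  have d: "((\<lambda>\<zeta>. \<phi> \<gamma> (z + \<zeta> / 2)) has_field_derivative deriv (\<phi> \<gamma>) z / 2) (at 0)" if "\<gamma> \<in> \<tau>" for \<gamma>
    by (rule DERIV_chain2[where g="\<lambda>\<zeta>. z + \<zeta> / 2" and Db="1/2" and Da="deriv (\<phi> \<gamma>) z", simplified])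
       (use deriv_exists[OF that zd] in \<open>auto intro!: derivative_eq_intros\<close>)
  have "(F has_field_derivative (deriv (\<phi> \<alpha>) z / 2 - deriv (\<phi> \<beta>) z / 2) / 5) (at 0)"
    unfolding F_def by (intro DERIV_cdivide DERIV_diff d assms(1,2))
  then have "deriv F 0 = (deriv (\<phi> \<alpha>) z - deriv (\<phi> \<beta>) z) / 10"
    by (simp add: DERIV_imp_deriv diff_divide_distrib)
  moreover have "cmod (deriv F 0) \<le> 2 * cmod (F 0) * (- ln (cmod (F 0)))"
    by (rule bounded_nonvanishing_estimates(2)[OF hF, of 0])
       (use in_disc disj[OF assms(1-3)] close[OF assms(1,2)] in \<open>auto simp: F_def norm_divide\<close>)
  moreover have "cmod (F 0) = gap \<alpha> \<beta> z" by (simp add: F_def gap_def norm_divide)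
  ultimately have "cmod ((deriv (\<phi> \<alpha>) z - deriv (\<phi> \<beta>) z) / 10) \<le> 2 * gap \<alpha> \<beta> z * (- ln (gap \<alpha> \<beta> z))"
    by (simp only: )
  then show ?thesis by (simp add: norm_divide field_simps)
qed

text \<open>Hoelder continuity of the holonomy. With |z| at most 1/2 the Harnack inequality compares
  the logarithms with ratio at most (1 + 1/2)/(1 - 1/2) = 3, in both directions.\<close>

lemma gap_cube:
  assumes "\<alpha> \<in> \<tau>" "\<beta> \<in> \<tau>" "cmod z \<le> 1/2"
  shows "gap \<alpha> \<beta> z ^ 3 \<le> gap \<alpha> \<beta> 0" "gap \<alpha> \<beta> 0 ^ 3 \<le> gap \<alpha> \<beta> z"
proof -
  have "gap \<alpha> \<beta> z ^ 3 \<le> gap \<alpha> \<beta> 0 \<and> gap \<alpha> \<beta> 0 ^ 3 \<le> gap \<alpha> \<beta> z"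
  proof (cases "\<alpha> = \<beta>")
    case False
    have zd: "z \<in> unit_disc" using assms(3) by simp
    have pos: "gap \<alpha> \<beta> z > 0" "gap \<alpha> \<beta> 0 > 0"
      using disj[OF assms(1,2) False zd] disj[OF assms(1,2) False, of 0] by (auto simp: gap_def)
    have neg: "ln (gap \<alpha> \<beta> z) < 0" "ln (gap \<alpha> \<beta> 0) < 0"
      using gap_less_1[OF assms(1,2) zd] gap_less_1[OF assms(1,2), of 0] pos by auto
    have "cmod z * (- ln (gap \<alpha> \<beta> z) - ln (gap \<alpha> \<beta> 0)) \<le> 1/2 * (- ln (gap \<alpha> \<beta> z) - ln (gap \<alpha> \<beta> 0))"
      using assms(3) neg by (intro mult_right_mono) auto
    then have "\<bar>ln (gap \<alpha> \<beta> z) - ln (gap \<alpha> \<beta> 0)\<bar> \<le> 1/2 * (- ln (gap \<alpha> \<beta> z) - ln (gap \<alpha> \<beta> 0))"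
      using gap_ln[OF assms(1,2) False zd] by linarith
    then have "3 * ln (gap \<alpha> \<beta> z) \<le> ln (gap \<alpha> \<beta> 0)" "3 * ln (gap \<alpha> \<beta> 0) \<le> ln (gap \<alpha> \<beta> z)"
      unfolding abs_le_iff by (simp_all add: field_simps)
    then have "ln (gap \<alpha> \<beta> z ^ 3) \<le> ln (gap \<alpha> \<beta> 0)" "ln (gap \<alpha> \<beta> 0 ^ 3) \<le> ln (gap \<alpha> \<beta> z)"
      using pos by (simp_all add: ln_realpow)
    then show ?thesis using pos by simp
  qed (auto simp: gap_def)
  then show "gap \<alpha> \<beta> z ^ 3 \<le> gap \<alpha> \<beta> 0" "gap \<alpha> \<beta> 0 ^ 3 \<le> gap \<alpha> \<beta> z" by auto
qed

text \<open>At radius \<open>r\<close> the Hoelder exponent is c = (1-r)/(1+r); the witness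
  \<open>d\<close> solves (d/5)^c = e/5.\<close>

lemma gap_uniform:
  assumes "0 \<le> r" "r < 1" "e > 0"
  obtains d where "d > 0"
    "\<And>\<alpha> \<beta> z. \<alpha> \<in> \<tau> \<Longrightarrow> \<beta> \<in> \<tau> \<Longrightarrow> cmod (\<alpha> - \<beta>) < d \<Longrightarrow> cmod z \<le> r \<Longrightarrow> cmod (\<phi> \<alpha> z - \<phi> \<beta> z) < e"
proof -
  define c where "c = (1 - r) / (1 + r)"
  have c: "c > 0" using assms by (simp add: c_def)
  define d where "d = 5 * exp (ln (e / 5) / c)"
  have "cmod (\<phi> \<alpha> z - \<phi> \<beta> z) < e" if "\<alpha> \<in> \<tau>" "\<beta> \<in> \<tau>" "cmod (\<alpha> - \<beta>) < d" "cmod z \<le> r" for \<alpha> \<beta> z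
  proof (cases "\<alpha> = \<beta>")
    case True then show ?thesis using assms by simp
  next
    case False
    have zd: "z \<in> unit_disc" using that assms by simp
    have pos: "gap \<alpha> \<beta> z > 0" "gap \<alpha> \<beta> 0 > 0"
      using disj[OF that(1,2) False zd] disj[OF that(1,2) False, of 0] by (auto simp: gap_def)
    have neg: "ln (gap \<alpha> \<beta> z) < 0" "ln (gap \<alpha> \<beta> 0) < 0"
      using gap_less_1[OF that(1,2) zd] gap_less_1[OF that(1,2), of 0] pos by auto
    have "cmod z * (- ln (gap \<alpha> \<beta> z) - ln (gap \<alpha> \<beta> 0)) \<le> r * (- ln (gap \<alpha> \<beta> z) - ln (gap \<alpha> \<beta> 0))"
      using that neg by (intro mult_right_mono) auto
    then have "ln (gap \<alpha> \<beta> z) - ln (gap \<alpha> \<beta> 0) \<le> r * (- ln (gap \<alpha> \<beta> z) - ln (gap \<alpha> \<beta> 0))"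
      using gap_ln[OF that(1,2) False zd] by linarith
    then have 1: "(1 + r) * ln (gap \<alpha> \<beta> z) \<le> (1 - r) * ln (gap \<alpha> \<beta> 0)"
      by (simp add: algebra_simps)
    have "ln (gap \<alpha> \<beta> 0) < ln (d / 5)"
    proof (rule ln_less_cancel_iff[THEN iffD2, OF pos(2)])
      show "0 < d / 5" by (simp add: d_def)
      show "gap \<alpha> \<beta> 0 < d / 5" using that gap_0[of \<alpha> \<beta>] by simp
    qed
    then have "ln (gap \<alpha> \<beta> 0) < ln (e / 5) / c" by (simp add: d_def)
    then have "c * ln (gap \<alpha> \<beta> 0) < ln (e / 5)" using c by (simp add: field_simps)
    moreover have "ln (gap \<alpha> \<beta> z) \<le> c * ln (gap \<alpha> \<beta> 0)"
      using 1 assms by (simp add: c_def field_simps)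
    ultimately have "ln (gap \<alpha> \<beta> z) < ln (e / 5)" by linarith
    then show ?thesis using pos assms by (simp add: gap_def)
  qed
  moreover have "d > 0" by (simp add: d_def)
  ultimately show ?thesis using that by blast
qed

text \<open>The Cauchy estimate for the difference of two leaves on a disc of radius
  \<open>s\<close>, where \<open>s\<close> is half the distance from \<open>r\<close> to 1. The
  values on the larger disc are controlled by \<open>gap_uniform\<close>.\<close>

lemma deriv_uniform:
  assumes "0 \<le> r" "r < 1" "e > 0"
  obtains d where "d > 0"
    "\<And>\<alpha> \<beta> z. \<alpha> \<in> \<tau> \<Longrightarrow> \<beta> \<in> \<tau> \<Longrightarrow> cmod (\<alpha> - \<beta>) < d \<Longrightarrow> cmod z \<le> r \<Longrightarrow>
       cmod (deriv (\<phi> \<alpha>) z - deriv (\<phi> \<beta>) z) \<le> e"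
proof -
  define s where "s = (1 - r) / 2"
  have s: "s > 0" "r + s < 1" using assms by (auto simp: s_def field_simps)
  obtain d where d: "d > 0" "\<And>\<alpha> \<beta> z. \<alpha> \<in> \<tau> \<Longrightarrow> \<beta> \<in> \<tau> \<Longrightarrow> cmod (\<alpha> - \<beta>) < d \<Longrightarrow> cmod z \<le> r + s
      \<Longrightarrow> cmod (\<phi> \<alpha> z - \<phi> \<beta> z) < e * s"
    using gap_uniform[of "r + s" "e * s"] s assms by (metis add_nonneg_nonneg less_imp_le mult_pos_pos)
  have "cmod (deriv (\<phi> \<alpha>) z - deriv (\<phi> \<beta>) z) \<le> e"
    if "\<alpha> \<in> \<tau>" "\<beta> \<in> \<tau>" "cmod (\<alpha> - \<beta>) < d" "cmod z \<le> r" for \<alpha> \<beta> z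
  proof -
    have sub: "cball z s \<subseteq> unit_disc"
    proof
      fix w assume "w \<in> cball z s"
      then have "cmod (w - z) \<le> s" by (simp add: dist_norm norm_minus_commute)
      then show "w \<in> unit_disc" using that(4) s(2) norm_triangle_ineq2[of w z] by simp
    qed
    have zd: "z \<in> unit_disc" using that assms by simp
    have h: "(\<lambda>w. \<phi> \<alpha> w - \<phi> \<beta> w) holomorphic_on unit_disc"
      using that by (auto intro!: holomorphic_intros hol)
    have "cmod ((deriv ^^ 1) (\<lambda>w. \<phi> \<alpha> w - \<phi> \<beta> w) z) \<le> fact 1 * (e * s) / s ^ 1"
    proof (rule Cauchy_inequality)
      show "(\<lambda>w. \<phi> \<alpha> w - \<phi> \<beta> w) holomorphic_on ball z s"
        using h sub by (meson ball_subset_cball holomorphic_on_subset order_trans)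
      show "continuous_on (cball z s) (\<lambda>w. \<phi> \<alpha> w - \<phi> \<beta> w)"
        using h sub holomorphic_on_imp_continuous_on continuous_on_subset by blast
      show "0 < s" by fact
      fix x assume "cmod (z - x) = s"
      then have "cmod x \<le> r + s" using that(4) norm_triangle_ineq2[of x z] by (simp add: norm_minus_commute)
      then show "cmod (\<phi> \<alpha> x - \<phi> \<beta> x) \<le> e * s" using d(2)[OF that(1-3)] by fastforce
    qed
    moreover have "deriv (\<lambda>w. \<phi> \<alpha> w - \<phi> \<beta> w) z = deriv (\<phi> \<alpha>) z - deriv (\<phi> \<beta>) z"
      by (intro DERIV_imp_deriv DERIV_diff deriv_exists that zd)
    ultimately show ?thesis using s by simp
  qed
  then show ?thesis using that d(1) by blast
qed

text \<open>Continuity in \<open>z\<close> on each leaf and equicontinuity in \<alpha>, uniform for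
  \<open>z\<close> in smaller discs, combine to joint continuity. It serves both the leaves and
  their slopes.\<close>

lemma continuous_on_family:
  assumes cont: "\<And>\<alpha>. \<alpha> \<in> \<tau> \<Longrightarrow> continuous_on unit_disc (f \<alpha>)"
    and unif: "\<And>r e. 0 \<le> r \<Longrightarrow> r < 1 \<Longrightarrow> e > 0 \<Longrightarrow> \<exists>d>0. \<forall>\<alpha>\<in>\<tau>. \<forall>\<beta>\<in>\<tau>. \<forall>z. cmod (\<alpha> - \<beta>) < d \<longrightarrow> cmod z \<le> r
       \<longrightarrow> cmod (f \<alpha> z - f \<beta> z) \<le> e"
  shows "continuous_on (unit_disc \<times> \<tau>) (\<lambda>(z, \<alpha>). f \<alpha> z)"
  unfolding continuous_on_iff
proof (intro ballI allI impI)
  fix p :: "complex \<times> complex" and e :: real assume p: "p \<in> unit_disc \<times> \<tau>" and e: "e > 0"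
  obtain z \<alpha> where pz: "p = (z, \<alpha>)" "z \<in> unit_disc" "\<alpha> \<in> \<tau>" using p by auto
  define r where "r = (1 + cmod z) / 2"
  have r: "0 \<le> r" "r < 1" "cmod z < r" using pz(2) by (auto simp: r_def)
  obtain d1 where d1: "d1 > 0" "\<And>w. w \<in> unit_disc \<Longrightarrow> dist w z < d1 \<Longrightarrow> dist (f \<alpha> w) (f \<alpha> z) < e / 2"
    using cont[OF pz(3), unfolded continuous_on_iff, rule_format, OF pz(2), of "e/2"] e by auto
  obtain d2 where d2: "d2 > 0" "\<And>\<alpha> \<beta> z. \<alpha> \<in> \<tau> \<Longrightarrow> \<beta> \<in> \<tau> \<Longrightarrow> cmod (\<alpha> - \<beta>) < d2 \<Longrightarrow> cmod z \<le> r
       \<Longrightarrow> cmod (f \<alpha> z - f \<beta> z) \<le> e / 2" using unif[OF r(1,2) half_gt_zero[OF e]] by blast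
  define d where "d = Min {d1, d2, r - cmod z}"
  have "d > 0" using d1 d2 r by (simp add: d_def)
  moreover have "dist (case q of (z, \<alpha>) \<Rightarrow> f \<alpha> z) (case p of (z, \<alpha>) \<Rightarrow> f \<alpha> z) < e"
    if q: "q \<in> unit_disc \<times> \<tau>" "dist q p < d" for q
  proof -
    obtain w \<beta> where qw: "q = (w, \<beta>)" "w \<in> unit_disc" "\<beta> \<in> \<tau>" using q by auto
    have "dist w z \<le> dist q p" "dist \<beta> \<alpha> \<le> dist q p"
      using dist_fst_le[of q p] dist_snd_le[of q p] by (auto simp: qw pz)
    then have *: "dist w z < d" "dist \<beta> \<alpha> < d" using q(2) by auto
    then have "dist w z < d1" "cmod (\<beta> - \<alpha>) < d2" "cmod (w - z) < r - cmod z" by (auto simp: d_def dist_norm)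
    moreover from this have "cmod w \<le> r" using norm_triangle_ineq2[of w z] by linarith
    ultimately have "dist (f \<alpha> w) (f \<alpha> z) < e / 2" "dist (f \<beta> w) (f \<alpha> w) \<le> e / 2"
      using d1(2)[OF qw(2)] d2(2)[OF qw(3) pz(3)] by (auto simp: dist_norm)
    then show ?thesis using dist_triangle[of "f \<beta> w" "f \<alpha> z" "f \<alpha> w"] by (simp add: qw pz)
  qed
  ultimately show "\<exists>d>0. \<forall>x'\<in>unit_disc \<times> \<tau>. dist x' p < d \<longrightarrow>
      dist (case x' of (z, \<alpha>) \<Rightarrow> f \<alpha> z) (case p of (z, \<alpha>) \<Rightarrow> f \<alpha> z) < e" by blast
qed

lemma continuous_on_leaf: "continuous_on (unit_disc \<times> \<tau>) (\<lambda>(z, \<alpha>). \<phi> \<alpha> z)"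
proof (rule continuous_on_family)
  show "continuous_on unit_disc (\<phi> \<alpha>)" if "\<alpha> \<in> \<tau>" for \<alpha>
    using hol[OF that] holomorphic_on_imp_continuous_on by blast
  fix r e :: real assume re: "0 \<le> r" "r < 1" "e > 0"
  then obtain d where "d > 0"
    "\<And>\<alpha> \<beta> z. \<alpha> \<in> \<tau> \<Longrightarrow> \<beta> \<in> \<tau> \<Longrightarrow> cmod (\<alpha> - \<beta>) < d \<Longrightarrow> cmod z \<le> r \<Longrightarrow> cmod (\<phi> \<alpha> z - \<phi> \<beta> z) < e"
    using gap_uniform[OF re] by blast
  then show "\<exists>d>0. \<forall>\<alpha>\<in>\<tau>. \<forall>\<beta>\<in>\<tau>. \<forall>z. cmod (\<alpha> - \<beta>) < d \<longrightarrow> cmod z \<le> r \<longrightarrow> cmod (\<phi> \<alpha> z - \<phi> \<beta> z) \<le> e"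
    using less_imp_le by blast
qed

lemma continuous_on_slope: "continuous_on (unit_disc \<times> \<tau>) (\<lambda>(z, \<alpha>). deriv (\<phi> \<alpha>) z)"
proof (rule continuous_on_family)
  show "continuous_on unit_disc (deriv (\<phi> \<alpha>))" if "\<alpha> \<in> \<tau>" for \<alpha>
    using holomorphic_deriv[OF hol[OF that] open_ball] holomorphic_on_imp_continuous_on by blast
  fix r e :: real assume re: "0 \<le> r" "r < 1" "e > 0"
  then obtain d where "d > 0"
    "\<And>\<alpha> \<beta> z. \<alpha> \<in> \<tau> \<Longrightarrow> \<beta> \<in> \<tau> \<Longrightarrow> cmod (\<alpha> - \<beta>) < d \<Longrightarrow> cmod z \<le> r \<Longrightarrow>
       cmod (deriv (\<phi> \<alpha>) z - deriv (\<phi> \<beta>) z) \<le> e"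
    using deriv_uniform[OF re] by blast
  then show "\<exists>d>0. \<forall>\<alpha>\<in>\<tau>. \<forall>\<beta>\<in>\<tau>. \<forall>z. cmod (\<alpha> - \<beta>) < d \<longrightarrow> cmod z \<le> r \<longrightarrow>
      cmod (deriv (\<phi> \<alpha>) z - deriv (\<phi> \<beta>) z) \<le> e" by blast
qed

end

section \<open>Test forms\<close>

lemma cscale_simps [simp]: "fst (cscale c u) = c * fst u" "snd (cscale c u) = c * snd u"
  by (auto simp: cscale_def)

lemma cscale_ii [simp]: "cscale \<i> (cscale \<i> u) = - u"
  by (auto simp: cscale_def prod_eq_iff)

lemma norm_cscale [simp]: "norm (cscale c u) = cmod c * norm u"
  by (cases u) (simp add: cscale_def norm_Pair norm_mult power_mult_distrib real_sqrt_mult flip: distrib_left)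

lemma bilinear_expand:
  fixes L :: "'a::euclidean_space \<Rightarrow> 'a \<Rightarrow> complex"
  assumes "bilinear L"
  shows "L u v = (\<Sum>e\<in>Basis. \<Sum>e'\<in>Basis. of_real (u \<bullet> e) * of_real (v \<bullet> e') * L e e')"
proof -
  have lin: "linear (\<lambda>u. L u v)" "linear (L u)" for u v using assms by (auto simp: bilinear_def)
  have "L u v = L (\<Sum>e\<in>Basis. (u \<bullet> e) *\<^sub>R e) v" by (simp add: euclidean_representation)
  also have "\<dots> = (\<Sum>e\<in>Basis. of_real (u \<bullet> e) * L e v)"
    by (simp add: linear_sum[OF lin(1)] linear_scale[OF lin(1)] scaleR_conv_of_real)
  also have "\<dots> = (\<Sum>e\<in>Basis. of_real (u \<bullet> e) * L e (\<Sum>e'\<in>Basis. (v \<bullet> e') *\<^sub>R e'))"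
    by (simp add: euclidean_representation)
  also have "\<dots> = (\<Sum>e\<in>Basis. \<Sum>e'\<in>Basis. of_real (u \<bullet> e) * of_real (v \<bullet> e') * L e e')"
    by (simp add: linear_sum[OF lin(2)] linear_scale[OF lin(2)] scaleR_conv_of_real sum_distrib_left mult.assoc)
  finally show ?thesis .
qed

text \<open>The real dimension is 4, so the expansion in a basis has 16 terms.\<close>

lemma bilinear_norm_bound:
  fixes L :: "C2 \<Rightarrow> C2 \<Rightarrow> complex"
  assumes "bilinear L" "\<And>e e'. e \<in> Basis \<Longrightarrow> e' \<in> Basis \<Longrightarrow> cmod (L e e') \<le> A"
  shows "cmod (L u v) \<le> 16 * A * norm u * norm v"
proof -
  have "cmod (L u v) \<le> (\<Sum>e\<in>(Basis::C2 set). \<Sum>e'\<in>(Basis::C2 set). norm u * norm v * A)"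
  proof (subst bilinear_expand[OF assms(1)], intro sum_norm_le)
    fix e e' :: C2 assume e: "e \<in> Basis" "e' \<in> Basis"
    have "\<bar>u \<bullet> e\<bar> \<le> norm u" "\<bar>v \<bullet> e'\<bar> \<le> norm v" using Basis_le_norm e by auto
    then show "cmod (of_real (u \<bullet> e) * of_real (v \<bullet> e') * L e e') \<le> norm u * norm v * A"
      using assms(2)[OF e] by (simp add: norm_mult mult_mono)
  qed
  also have "\<dots> = 16 * A * norm u * norm v" by simp
  finally show ?thesis .
qed

lemma smooth_on_inner_Basis:
  fixes X :: "'a::real_normed_vector \<Rightarrow> C2"
  assumes "open U" "smooth_on U (\<lambda>p. fst (X p))" "smooth_on U (\<lambda>p. snd (X p))" "e \<in> Basis"
  shows "smooth_on U (\<lambda>p. complex_of_real (X p \<bullet> e))"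
proof -
  have "e \<in> {(1,0), (\<i>,0), (0,1), (0,\<i>)}"
    using assms(4) by (auto simp: Basis_prod_def Basis_complex_def)
  then have "(\<forall>p. X p \<bullet> e = Re (fst (X p))) \<or> (\<forall>p. X p \<bullet> e = Im (fst (X p)))
    \<or> (\<forall>p. X p \<bullet> e = Re (snd (X p))) \<or> (\<forall>p. X p \<bullet> e = Im (snd (X p)))"
    by (auto simp: inner_prod_def inner_complex_def)
  then show ?thesis using assms(1-3) smooth_on_Re smooth_on_Im by fastforce
qed

lemma smooth_on_form_apply:
  fixes X Y :: "'a::real_normed_vector \<Rightarrow> C2"
  assumes "open U" "smooth_on U (\<lambda>p. fst (X p))" "smooth_on U (\<lambda>p. snd (X p))"
    "smooth_on U (\<lambda>p. fst (Y p))" "smooth_on U (\<lambda>p. snd (Y p))"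
    "\<And>p. bilinear (\<omega> p)" "\<And>e e'. smooth_on U (\<lambda>p. \<omega> p e e')"
  shows "smooth_on U (\<lambda>p. \<omega> p (X p) (Y p))"
  by (subst bilinear_expand[OF assms(6)])
     (intro smooth_on_sum smooth_on_mult assms smooth_on_inner_Basis)

section \<open>Closure properties of test forms\<close>

lemma test_form2D:
  assumes "test_form2 \<Omega> \<omega>"
  shows "bilinear (\<omega> p)" "\<omega> p u u = 0" "\<omega> p u v = - \<omega> p v u" "smooth_on UNIV (\<lambda>p. \<omega> p u v)"
proof -
  show b: "bilinear (\<omega> p)" and z: "\<omega> p u u = 0" for u
    using assms unfolding test_form2_def by blast+
  show "smooth_on UNIV (\<lambda>p. \<omega> p u v)" using assms unfolding test_form2_def Cinf_iff_smooth_on by blast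
  have "\<omega> p (u + v) (u + v) = \<omega> p u v + \<omega> p v u"
    by (simp only: bilinear_ladd[OF b] bilinear_radd[OF b]) (simp add: z)
  then have "\<omega> p u v + \<omega> p v u = 0" by (simp only: z)
  then show "\<omega> p u v = - \<omega> p v u"
    by (simp add: eq_neg_iff_add_eq_0)
qed

lemma test_form2_support:
  assumes "test_form2 \<Omega> \<omega>"
  obtains K where "compact K" "K \<subseteq> \<Omega>" "\<And>p u v. p \<notin> K \<Longrightarrow> \<omega> p u v = 0"
  using assms unfolding test_form2_def supported_in_def by blast

lemma test_form2I:
  assumes "\<And>p. bilinear (\<omega> p)" "\<And>p u. \<omega> p u u = 0" "\<And>u v. smooth_on UNIV (\<lambda>p. \<omega> p u v)"
    "compact K" "K \<subseteq> \<Omega>" "\<And>p u v. p \<notin> K \<Longrightarrow> \<omega> p u v = 0"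
  shows "test_form2 \<Omega> \<omega>"
  unfolding test_form2_def supported_in_def Cinf_iff_smooth_on
  by (intro conjI allI exI[of _ K] impI assms)

lemma test_form2_mono: "test_form2 \<Omega> \<omega> \<Longrightarrow> \<Omega> \<subseteq> \<Omega>' \<Longrightarrow> test_form2 \<Omega>' \<omega>"
  unfolding test_form2_def by blast

lemma bilinearI_C:
  fixes L :: "'a::real_vector \<Rightarrow> 'a \<Rightarrow> complex"
  assumes "\<And>x y z. L (x + y) z = L x z + L y z" "\<And>x y z. L x (y + z) = L x y + L x z"
    "\<And>r x z. L (r *\<^sub>R x) z = of_real r * L x z" "\<And>r x z. L x (r *\<^sub>R z) = of_real r * L x z"
  shows "bilinear L"
  unfolding bilinear_def using assms by (auto intro!: linearI simp: scaleR_conv_of_real)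

lemma bilinear_C_simps:
  fixes L :: "'a::real_vector \<Rightarrow> 'a \<Rightarrow> complex"
  assumes "bilinear L"
  shows "L (x + y) z = L x z + L y z" "L x (y + z) = L x y + L x z"
    "L (r *\<^sub>R x) z = of_real r * L x z" "L x (r *\<^sub>R z) = of_real r * L x z"
    "L (- x) z = - L x z" "L x (- z) = - L x z"
    "L (x - y) z = L x z - L y z" "L x (y - z) = L x y - L x z"
  by (auto simp: bilinear_ladd[OF assms] bilinear_radd[OF assms] bilinear_lmul[OF assms] bilinear_rmul[OF assms]
      bilinear_lneg[OF assms] bilinear_rneg[OF assms] bilinear_lsub[OF assms] bilinear_rsub[OF assms] scaleR_conv_of_real)

lemma cscale_add: "cscale c (u + v) = cscale c u + cscale c v"
  by (simp add: cscale_def prod_eq_iff algebra_simps)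
lemma cscale_scaleR: "cscale c (r *\<^sub>R v) = r *\<^sub>R cscale c v"
  by (simp add: cscale_def prod_eq_iff)

lemma test_form2_comb:
  assumes "test_form2 \<Omega> \<omega>" "test_form2 \<Omega> \<omega>'"
  shows "test_form2 \<Omega> (\<lambda>p u v. a * \<omega> p u v + b * \<omega>' p u v)"
proof -
  obtain K where K: "compact K" "K \<subseteq> \<Omega>" "\<And>p u v. p \<notin> K \<Longrightarrow> \<omega> p u v = 0"
    using test_form2_support[OF assms(1)] by metis
  obtain K' where K': "compact K'" "K' \<subseteq> \<Omega>" "\<And>p u v. p \<notin> K' \<Longrightarrow> \<omega>' p u v = 0"
    using test_form2_support[OF assms(2)] by metis
  show ?thesis
  proof (rule test_form2I[where K="K \<union> K'"])
    show "bilinear (\<lambda>u v. a * \<omega> p u v + b * \<omega>' p u v)" for p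
      by (rule bilinearI_C)
         (simp_all add: bilinear_C_simps[OF test_form2D(1)[OF assms(1)]] bilinear_C_simps[OF test_form2D(1)[OF assms(2)]] algebra_simps)
    show "smooth_on UNIV (\<lambda>p. a * \<omega> p u v + b * \<omega>' p u v)" for u v
      by (intro smooth_on_add smooth_on_mult smooth_on_const open_UNIV test_form2D(4)[OF assms(1)] test_form2D(4)[OF assms(2)])
  qed (use K K' test_form2D(2)[OF assms(1)] test_form2D(2)[OF assms(2)] in auto)
qed

lemma test_form2_scale: "test_form2 \<Omega> \<omega> \<Longrightarrow> test_form2 \<Omega> (\<lambda>p u v. a * \<omega> p u v)"
  using test_form2_comb[of \<Omega> \<omega> \<omega> a 0] by simp

text \<open>Suitable choices of \<open>a\<close>, \<open>b\<close>, \<open>c\<close> give the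
  components of \<omega> of type (1,1), (2,0) and (0,2), so all three are test forms with the same
  support bound.\<close>

lemma test_form2_J:
  assumes "test_form2 \<Omega> \<omega>"
  shows "test_form2 \<Omega> (\<lambda>p u v. a * \<omega> p u v + b * \<omega> p (cscale \<i> u) (cscale \<i> v)
     + c * (\<omega> p (cscale \<i> u) v + \<omega> p u (cscale \<i> v)))"
proof -
  obtain K where K: "compact K" "K \<subseteq> \<Omega>" "\<And>p u v. p \<notin> K \<Longrightarrow> \<omega> p u v = 0"
    using test_form2_support[OF assms] by metis
  show ?thesis
  proof (rule test_form2I[where K=K])
    show "bilinear (\<lambda>u v. a * \<omega> p u v + b * \<omega> p (cscale \<i> u) (cscale \<i> v)
       + c * (\<omega> p (cscale \<i> u) v + \<omega> p u (cscale \<i> v)))" for p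
      by (rule bilinearI_C)
         (simp_all add: bilinear_C_simps[OF test_form2D(1)[OF assms(1)]] cscale_add cscale_scaleR algebra_simps)
    show "smooth_on UNIV (\<lambda>p. a * \<omega> p u v + b * \<omega> p (cscale \<i> u) (cscale \<i> v)
       + c * (\<omega> p (cscale \<i> u) v + \<omega> p u (cscale \<i> v)))" for u v
      by (intro smooth_on_add smooth_on_mult smooth_on_const open_UNIV test_form2D(4)[OF assms(1)])
    show "a * \<omega> p u u + b * \<omega> p (cscale \<i> u) (cscale \<i> u)
       + c * (\<omega> p (cscale \<i> u) u + \<omega> p u (cscale \<i> u)) = 0" for p u
      using test_form2D(2)[OF assms] test_form2D(3)[OF assms, of p "cscale \<i> u" u] by simp
  qed (use K in auto)
qed

lemma test_form2_Re:
  assumes "test_form2 \<Omega> \<omega>"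
  shows "test_form2 \<Omega> (\<lambda>p u v. complex_of_real (Re (\<omega> p u v)))"
proof -
  obtain K where K: "compact K" "K \<subseteq> \<Omega>" "\<And>p u v. p \<notin> K \<Longrightarrow> \<omega> p u v = 0"
    using test_form2_support[OF assms] by metis
  show ?thesis
  proof (rule test_form2I[where K=K])
    show "bilinear (\<lambda>u v. complex_of_real (Re (\<omega> p u v)))" for p
      by (rule bilinearI_C) (simp_all add: bilinear_C_simps[OF test_form2D(1)[OF assms(1)]])
    show "smooth_on UNIV (\<lambda>p. complex_of_real (Re (\<omega> p u v)))" for u v
      by (intro smooth_on_Re open_UNIV test_form2D(4)[OF assms(1)])
  qed (use K test_form2D(2)[OF assms] in auto)
qed

text \<open>The Euclidean area form of the plane, that is i/2 dz wedge d(z-bar), evaluated on two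
  real tangent vectors.\<close>

definition form_pairing :: "complex \<Rightarrow> complex \<Rightarrow> complex" where
  "form_pairing x y = complex_of_real (Im (cnj x * y))"

lemma form_pairing_self [simp]: "form_pairing x x = 0" "form_pairing x (\<i> * x) = complex_of_real ((cmod x)\<^sup>2)"
  by (simp_all add: form_pairing_def cmod_power2) (simp add: power2_eq_square)
lemma form_pairing_i [simp]: "form_pairing (\<i> * x) (\<i> * y) = form_pairing x y"
  by (auto simp: form_pairing_def)

lemma smooth_on_form_pairing:
  "open U \<Longrightarrow> smooth_on U f \<Longrightarrow> smooth_on U g \<Longrightarrow> smooth_on U (\<lambda>p. form_pairing (f p) (g p))"
  unfolding form_pairing_def by (intro smooth_on_Im smooth_on_mult smooth_on_cnj)

text \<open>\<open>f * \<i>/2 dz \<and> d\<bar>z\<close> plus \<open>g * \<i>/2 \<theta> \<and> \<theta>\<bar>\<close> with \<open>\<theta> = dw - \<sigma> dz\<close>.\<close>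

definition hermitian_form :: "(C2 \<Rightarrow> complex) \<Rightarrow> (C2 \<Rightarrow> complex) \<Rightarrow> (C2 \<Rightarrow> complex) \<Rightarrow> form2" where
  "hermitian_form f g \<sigma> = (\<lambda>p u v. f p * form_pairing (fst u) (fst v)
     + g p * form_pairing (snd u - \<sigma> p * fst u) (snd v - \<sigma> p * fst v))"

lemma test_form2_hermitian:
  assumes "smooth_on UNIV f" "smooth_on UNIV g" "smooth_on UNIV \<sigma>" "compact K" "K \<subseteq> \<Omega>"
    "\<And>p. p \<notin> K \<Longrightarrow> f p = 0" "\<And>p. p \<notin> K \<Longrightarrow> g p = 0"
  shows "test_form2 \<Omega> (hermitian_form f g \<sigma>)"
  unfolding hermitian_form_def
proof (rule test_form2I[OF _ _ _ assms(4,5)])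
  show "bilinear (\<lambda>u v. f p * form_pairing (fst u) (fst v) + g p * form_pairing (snd u - \<sigma> p * fst u) (snd v - \<sigma> p * fst v))" for p
    by (rule bilinearI_C) (simp_all add: form_pairing_def scaleR_conv_of_real algebra_simps)
  show "smooth_on UNIV (\<lambda>p. f p * form_pairing (fst u) (fst v) + g p * form_pairing (snd u - \<sigma> p * fst u) (snd v - \<sigma> p * fst v))" for u v
    by (intro smooth_on_add smooth_on_mult smooth_on_form_pairing smooth_on_diff smooth_on_const open_UNIV assms)
qed (use assms in auto)

lemma hermitian_form_11: "type_11 (hermitian_form f g \<sigma>)"
proof -
  have "\<i> * b - s * (\<i> * a) = \<i> * (b - s * a)" for a b s :: complex by (simp add: algebra_simps)
  then show ?thesis unfolding type_11_def hermitian_form_def by simp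
qed

lemma hermitian_form_J:
  "hermitian_form f g \<sigma> p u (cscale \<i> u) = f p * of_real ((cmod (fst u))\<^sup>2) + g p * of_real ((cmod (snd u - \<sigma> p * fst u))\<^sup>2)"
proof -
  have "\<i> * snd u - \<sigma> p * (\<i> * fst u) = \<i> * (snd u - \<sigma> p * fst u)" by (simp add: algebra_simps)
  then show ?thesis unfolding hermitian_form_def by simp
qed

lemma compact_in_disc_radius:
  assumes "compact K" "K \<subseteq> unit_disc"
  obtains r where "0 \<le> r" "r < 1" "K \<subseteq> cball 0 r"
proof (cases "K = {}")
  case True then show ?thesis using that[of 0] by auto
next
  case False
  obtain x where x: "x \<in> K" "\<And>y. y \<in> K \<Longrightarrow> cmod y \<le> cmod x"
    using continuous_attains_sup[OF assms(1) False continuous_on_norm[OF continuous_on_id]] by auto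
  show ?thesis by (rule that[of "cmod x"]) (use x assms(2) in auto)
qed

lemma compact_in_bidisc_radius:
  assumes "compact K" "K \<subseteq> bidisc"
  obtains r where "0 \<le> r" "r < 1" "K \<subseteq> cball 0 r \<times> cball 0 r"
proof -
  have "compact (fst ` K)" "compact (snd ` K)"
    using assms(1) by (auto intro!: compact_continuous_image continuous_intros)
  moreover have "fst ` K \<subseteq> unit_disc" "snd ` K \<subseteq> unit_disc" using assms(2) by auto
  ultimately obtain r s where rs: "0 \<le> r" "r < 1" "fst ` K \<subseteq> cball 0 r" "0 \<le> s" "s < 1" "snd ` K \<subseteq> cball 0 s"
    using compact_in_disc_radius by metis
  show ?thesis by (rule that[of "max r s"]) (use rs in \<open>force+\<close>)
qed

lemma smooth_on_real_polynomial:
  fixes f :: "'a::real_normed_vector \<Rightarrow> real"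
  assumes "real_polynomial_function f"
  shows "smooth_on UNIV (\<lambda>p. complex_of_real (f p))"
  using assms
proof induction
  case (linear f)
  then show ?case
    by (intro smooth_on_bounded_linear open_UNIV bounded_linear_compose[OF bounded_linear_of_real])
next
  case (const c) then show ?case by (rule smooth_on_const)
next
  case (add f g) then show ?case using smooth_on_add[OF open_UNIV add.IH] by simp
next
  case (mult f g) then show ?case using smooth_on_mult[OF open_UNIV mult.IH] by simp
qed

lemma smooth_on_polynomial:
  fixes f :: "'a::real_normed_vector \<Rightarrow> complex"
  assumes "polynomial_function f"
  shows "smooth_on UNIV f"
proof -
  have "real_polynomial_function (\<lambda>p. Re (f p))" "real_polynomial_function (\<lambda>p. Im (f p))"
    using assms bounded_linear_Re bounded_linear_Im unfolding polynomial_function_def o_def by auto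
  then have "smooth_on UNIV (\<lambda>p. complex_of_real (Re (f p)) + \<i> * complex_of_real (Im (f p)))"
    by (intro smooth_on_add smooth_on_mult smooth_on_const open_UNIV smooth_on_real_polynomial)
  then show ?thesis by (simp flip: complex_eq)
qed

section \<open>Restriction of forms to the leaves\<close>

text \<open>Lebesgue measure of the disc, kept as a measure on the whole plane: all measurability
  questions on products then concern Borel sets only.\<close>

definition disc_measure :: "complex measure" where
  "disc_measure = density lborel (\<lambda>z. ennreal (indicator unit_disc z))"

lemma unit_disc_borel [measurable]: "unit_disc \<in> sets borel"
  by (rule borel_open) simp

lemma sets_disc_measure [simp, measurable_cong]: "sets disc_measure = sets borel"
  by (simp add: disc_measure_def)
lemma space_disc_measure [simp]: "space disc_measure = UNIV"
  by (simp add: disc_measure_def)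

lemma integral_disc_measure:
  fixes f :: "complex \<Rightarrow> 'b::{banach, second_countable_topology}"
  assumes [measurable]: "f \<in> borel_measurable borel"
  shows "integral\<^sup>L disc_measure f = (LINT z:unit_disc|lborel. f z)"
  unfolding disc_measure_def set_lebesgue_integral_def
  by (subst integral_density) auto

lemma finite_disc_measure: "finite_measure disc_measure"
proof (rule finite_measureI)
  have "emeasure disc_measure UNIV = (\<integral>\<^sup>+z. ennreal (indicator unit_disc z) * indicator UNIV z \<partial>lborel)"
    unfolding disc_measure_def by (rule emeasure_density) auto
  also have "\<dots> = emeasure lborel unit_disc" by (simp add: ennreal_indicator)
  also have "\<dots> < \<infinity>" by (rule emeasure_lborel_ball_finite)
  finally show "emeasure disc_measure (space disc_measure) \<noteq> \<infinity>" by simp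
qed

lemma test_form2_bound:
  assumes "test_form2 \<Omega> \<omega>"
  obtains A where "A > 0" "\<And>p u v. cmod (\<omega> p u v) \<le> A * norm u * norm v"
proof -
  obtain K where K: "compact K" "K \<subseteq> \<Omega>" "\<And>p u v. p \<notin> K \<Longrightarrow> \<omega> p u v = 0"
    using test_form2_support[OF assms] by metis
  have "\<exists>B. \<forall>p. cmod (\<omega> p e e') \<le> B" for e e'
  proof -
    have "compact ((\<lambda>p. \<omega> p e e') ` K)"
      by (intro compact_continuous_image K continuous_on_subset[OF smooth_on_continuous[OF test_form2D(4)[OF assms]]]) auto
    then obtain B where "\<forall>x\<in>((\<lambda>p. \<omega> p e e') ` K). cmod x \<le> B" using compact_imp_bounded bounded_iff by metis
    then have "cmod (\<omega> p e e') \<le> max B 0" for p using K(3)[of p e e'] by (cases "p \<in> K") (auto simp: max.coboundedI1)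
    then show ?thesis by blast
  qed
  then obtain B where B: "\<And>p e e'. cmod (\<omega> p e e') \<le> B e e'" by metis
  define A where "A = (\<Sum>e\<in>Basis. \<Sum>e'\<in>Basis. \<bar>B e e'\<bar>) + 1"
  have *: "cmod (\<omega> p e e') \<le> A" if "e \<in> Basis" "e' \<in> Basis" for p e e'
  proof -
    have "\<bar>B e e'\<bar> \<le> (\<Sum>e'\<in>Basis. \<bar>B e e'\<bar>)" using that by (intro member_le_sum) auto
    also have "\<dots> \<le> (\<Sum>e\<in>Basis. \<Sum>e'\<in>Basis. \<bar>B e e'\<bar>)" using that by (intro member_le_sum) (auto intro: sum_nonneg)
    finally show ?thesis using B[of p e e'] by (simp add: A_def)
  qed
  have "A \<ge> 1" unfolding A_def by (simp add: sum_nonneg)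
  then show ?thesis
    by (intro that[of "16 * A"] bilinear_norm_bound test_form2D(1)[OF assms] *) auto
qed

context graph_lamination
begin

definition leaf_form :: "form2 \<Rightarrow> complex \<Rightarrow> complex \<Rightarrow> complex" where
  "leaf_form \<omega> z \<alpha> = \<omega> (z, \<phi> \<alpha> z) (1, deriv (\<phi> \<alpha>) z) (cscale \<i> (1, deriv (\<phi> \<alpha>) z))"

text \<open>The restriction of \<omega> to the leaves as a function of the point \<open>z\<close>
  and the label \<alpha>. Extension by zero off the product of disc and transversal makes it a Borel
  function on the whole product of two planes.\<close>

definition trace :: "form2 \<Rightarrow> complex \<times> complex \<Rightarrow> complex" where
  "trace \<omega> = (\<lambda>(z, \<alpha>). if z \<in> unit_disc \<and> \<alpha> \<in> \<tau> then leaf_form \<omega> z \<alpha> else 0)"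

lemma integration_current_leaf:
  "integration_current (\<phi> \<alpha>) \<omega> = (LINT z:unit_disc|lborel. leaf_form \<omega> z \<alpha>)"
  unfolding integration_current_def leaf_form_def ..

lemma continuous_on_leaf_point: "continuous_on (unit_disc \<times> \<tau>) (\<lambda>(z, \<alpha>). (z, \<phi> \<alpha> z))"
  using continuous_on_leaf by (auto intro!: continuous_intros simp: case_prod_beta)

lemma continuous_on_leaf_form:
  assumes "test_form2 \<Omega> \<omega>"
  shows "continuous_on (unit_disc \<times> \<tau>) (\<lambda>(z, \<alpha>). leaf_form \<omega> z \<alpha>)"
proof -
  have c: "continuous_on (unit_disc \<times> \<tau>) (\<lambda>p. deriv (\<phi> (snd p)) (fst p))"
    using continuous_on_slope by (simp add: case_prod_beta)
  have w: "continuous_on (unit_disc \<times> \<tau>) (\<lambda>p. \<omega> (fst p, \<phi> (snd p) (fst p)) e e')" for e e'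
    using continuous_on_compose2[OF smooth_on_continuous[OF test_form2D(4)[OF assms, of e e']] continuous_on_leaf_point]
    by (simp add: case_prod_beta)
  show ?thesis
    unfolding leaf_form_def case_prod_beta
    by (subst bilinear_expand[OF test_form2D(1)[OF assms]])
       (auto simp: cscale_def intro!: continuous_intros c w)
qed

lemma trace_measurable [measurable]:
  assumes "test_form2 \<Omega> \<omega>"
  shows "trace \<omega> \<in> borel_measurable borel"
proof -
  have "unit_disc \<times> \<tau> \<in> sets borel"
    by (intro borel_Times) (auto simp: compact_imp_closed[OF compact_tau])
  from borel_measurable_continuous_on_indicator[OF this continuous_on_leaf_form[OF assms]]
  show ?thesis
    by (rule measurable_cong[THEN iffD1, rotated]) (auto simp: trace_def indicator_def split: if_splits)
qed

lemma slope_bound: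
  assumes "0 \<le> r" "r < 1"
  obtains B where "B > 0" "\<And>z \<alpha>. cmod z \<le> r \<Longrightarrow> \<alpha> \<in> \<tau> \<Longrightarrow> cmod (deriv (\<phi> \<alpha>) z) \<le> B"
proof -
  have "compact ((\<lambda>(z, \<alpha>). deriv (\<phi> \<alpha>) z) ` (cball 0 r \<times> \<tau>))"
    by (intro compact_continuous_image continuous_on_subset[OF continuous_on_slope] compact_Times compact_tau compact_cball) (use assms in auto)
  then obtain B where B: "\<forall>x\<in>(\<lambda>(z, \<alpha>). deriv (\<phi> \<alpha>) z) ` (cball 0 r \<times> \<tau>). cmod x \<le> B"
    using compact_imp_bounded bounded_iff by metis
  show ?thesis
  proof (rule that[of "max B 1"])
    fix z \<alpha> assume "cmod z \<le> r" "\<alpha> \<in> \<tau>"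
    then have "deriv (\<phi> \<alpha>) z \<in> (\<lambda>(z, \<alpha>). deriv (\<phi> \<alpha>) z) ` (cball 0 r \<times> \<tau>)"
      by (auto intro!: image_eqI[of _ _ "(z, \<alpha>)"])
    then show "cmod (deriv (\<phi> \<alpha>) z) \<le> max B 1" using B by (meson max.coboundedI1)
  qed simp
qed

lemma norm_tangent_le: "cmod s \<le> B \<Longrightarrow> norm (1::complex, s) \<le> 1 + B"
  using norm_Pair_le[of "1::complex" s] by simp

text \<open>The slopes may blow up at the boundary of the disc, but the support of \<omega> projects
  into a smaller closed disc, over which they are bounded by compactness.\<close>

lemma trace_bounded:
  assumes "test_form2 \<Omega> \<omega>" "\<Omega> \<subseteq> unit_disc \<times> UNIV"
  obtains B where "\<And>p. cmod (trace \<omega> p) \<le> B"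
proof -
  obtain K where K: "compact K" "K \<subseteq> \<Omega>" "\<And>p u v. p \<notin> K \<Longrightarrow> \<omega> p u v = 0"
    using test_form2_support[OF assms(1)] by metis
  have "compact (fst ` K)" using K(1) by (auto intro!: compact_continuous_image continuous_intros)
  then obtain r where r: "0 \<le> r" "r < 1" "fst ` K \<subseteq> cball 0 r"
    by (rule compact_in_disc_radius) (use K(2) assms(2) in auto)
  obtain B where B: "B > 0" "\<And>z \<alpha>. cmod z \<le> r \<Longrightarrow> \<alpha> \<in> \<tau> \<Longrightarrow> cmod (deriv (\<phi> \<alpha>) z) \<le> B"
    using slope_bound[OF r(1,2)] by metis
  obtain A where A: "A > 0" "\<And>p u v. cmod (\<omega> p u v) \<le> A * norm u * norm v"
    using test_form2_bound[OF assms(1)] by metis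
  have "cmod (trace \<omega> p) \<le> A * (1 + B) * (1 + B)" for p
  proof (cases "fst p \<in> cball 0 r \<and> snd p \<in> \<tau>")
    case True
    then have p: "cmod (fst p) \<le> r" "snd p \<in> \<tau>" by auto
    have n: "norm (1::complex, deriv (\<phi> (snd p)) (fst p)) \<le> 1 + B"
      by (rule norm_tangent_le[OF B(2)[OF p]])
    have "trace \<omega> p = leaf_form \<omega> (fst p) (snd p)" using p r by (auto simp: trace_def case_prod_beta)
    also have "cmod \<dots> \<le> A * norm (1::complex, deriv (\<phi> (snd p)) (fst p)) * norm (1::complex, deriv (\<phi> (snd p)) (fst p))"
      unfolding leaf_form_def using A(2)[of _ _ "cscale \<i> _"] by simp
    also have "\<dots> \<le> A * (1 + B) * (1 + B)"
      using n A(1) B(1) by (intro mult_mono) auto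
    finally show ?thesis .
  next
    case False
    have "trace \<omega> p = 0"
    proof (cases "snd p \<in> \<tau>")
      case True
      with False have "(fst p, \<phi> (snd p) (fst p)) \<notin> K" using r(3) by force
      then show ?thesis using K(3) by (auto simp: trace_def leaf_form_def case_prod_beta)
    qed (auto simp: trace_def case_prod_beta)
    then show ?thesis using A(1) B(1) by simp
  qed
  then show ?thesis using that by blast
qed

lemma trace_comb:
  "trace (\<lambda>p u v. a * \<omega> p u v + b * \<omega>' p u v) x = a * trace \<omega> x + b * trace \<omega>' x"
  by (auto simp: trace_def leaf_form_def case_prod_beta)

lemma trace_Re: "trace (\<lambda>p u v. complex_of_real (Re (\<omega> p u v))) x = complex_of_real (Re (trace \<omega> x))"
  by (auto simp: trace_def leaf_form_def case_prod_beta)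

lemma trace_hermitian:
  "trace (hermitian_form f g \<sigma>) (z, \<alpha>) = (if z \<in> unit_disc \<and> \<alpha> \<in> \<tau> then
     f (z, \<phi> \<alpha> z) + g (z, \<phi> \<alpha> z) * of_real ((cmod (deriv (\<phi> \<alpha>) z - \<sigma> (z, \<phi> \<alpha> z)))\<^sup>2) else 0)"
  by (auto simp: trace_def leaf_form_def hermitian_form_J)

text \<open>The map \<open>(z, \<alpha>) \<mapsto> (z, \<phi> \<alpha> z)\<close> is a homeomorphism of compact sets, so the slope of the leaves is a
  continuous function on their union and can be approximated by polynomials.\<close>

lemma slope_polynomial_approx:
  assumes "0 \<le> r" "r < 1" "\<delta> > 0"
  obtains \<sigma> :: "C2 \<Rightarrow> complex" where "smooth_on UNIV \<sigma>"
    "\<And>z \<alpha>. cmod z \<le> r \<Longrightarrow> \<alpha> \<in> \<tau> \<Longrightarrow> cmod (deriv (\<phi> \<alpha>) z - \<sigma> (z, \<phi> \<alpha> z)) < \<delta>"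
proof -
  let ?X = "cball (0::complex) r \<times> \<tau>" and ?\<Theta> = "\<lambda>(z, \<alpha>). (z, \<phi> \<alpha> z)"
  have sub: "?X \<subseteq> unit_disc \<times> \<tau>" using assms by auto
  have cX: "compact ?X" by (intro compact_Times compact_tau compact_cball)
  have cont: "continuous_on ?X ?\<Theta>" using continuous_on_subset[OF continuous_on_leaf_point sub] .
  have inj: "inj_on ?\<Theta> ?X"
    using disj assms by (fastforce simp: inj_on_def)
  define \<Theta>' where "\<Theta>' = inv_into ?X ?\<Theta>"
  have inv: "\<Theta>' (?\<Theta> x) = x" if "x \<in> ?X" for x
    unfolding \<Theta>'_def using that by (intro inv_into_f_f inj)
  have "continuous_on (?\<Theta> ` ?X) \<Theta>'"
    by (rule continuous_on_inv[OF cont cX]) (use inv in blast)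
  moreover have "\<Theta>' ` ?\<Theta> ` ?X \<subseteq> ?X" using inv by force
  ultimately have "continuous_on (?\<Theta> ` ?X) (\<lambda>p. (\<lambda>(z, \<alpha>). deriv (\<phi> \<alpha>) z) (\<Theta>' p))"
    by (rule continuous_on_compose2[OF continuous_on_subset[OF continuous_on_slope sub]])
  from Stone_Weierstrass_polynomial_function[OF compact_continuous_image[OF cont cX] this assms(3)]
  obtain \<sigma> where \<sigma>: "polynomial_function \<sigma>"
      "\<forall>p \<in> ?\<Theta> ` ?X. norm ((\<lambda>(z, \<alpha>). deriv (\<phi> \<alpha>) z) (\<Theta>' p) - \<sigma> p) < \<delta>"
    by (elim exE conjE)
  show ?thesis
  proof (rule that[OF smooth_on_polynomial[OF \<sigma>(1)]])
    fix z \<alpha> assume "cmod z \<le> r" "\<alpha> \<in> \<tau>"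
    then have "(z, \<alpha>) \<in> ?X" by simp
    from \<sigma>(2)[rule_format, OF imageI[OF this]] inv[OF this]
    show "cmod (deriv (\<phi> \<alpha>) z - \<sigma> (z, \<phi> \<alpha> z)) < \<delta>" by simp
  qed
qed

end

section \<open>Representation by a density on the leaves\<close>

lemma bilinear_J_diff:
  fixes L :: "C2 \<Rightarrow> C2 \<Rightarrow> complex"
  assumes "bilinear L"
  shows "L x (cscale \<i> x) - L y (cscale \<i> y) = L (x - y) (cscale \<i> x) + L y (cscale \<i> (x - y))"
proof -
  have "cscale \<i> (x - y) = cscale \<i> x - cscale \<i> y" by (simp add: cscale_def prod_eq_iff algebra_simps)
  then show ?thesis by (simp add: bilinear_C_simps[OF assms])
qed

text \<open>Write u = a (1,s) + b (0,1). The pure part is |a|^2 |q|, where \<open>q\<close> is the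
  value on the line of slope \<open>s\<close>, and |q| is at most q^2/(2t) + t/2. The mixed terms
  are absorbed by \<delta> |a|^2 at the price of a large coefficient of |b|^2. That coefficient is
  harmless later, since on a leaf \<open>b\<close> becomes the error of a slope
  approximation.\<close>

lemma alternating_line_bound:
  fixes L :: "C2 \<Rightarrow> C2 \<Rightarrow> complex"
  assumes bil: "bilinear L" and alt: "\<And>u. L u u = 0" and anti: "\<And>u v. L u v = - L v u"
    and A: "\<And>u v. cmod (L u v) \<le> A * norm u * norm v" "A > 0" and pos: "t > 0" "\<delta> > 0"
  shows "cmod (L u (cscale \<i> u)) \<le> ((cmod (L (1, s) (cscale \<i> (1, s))))\<^sup>2 / (2 * t) + t / 2 + \<delta>) * (cmod (fst u))\<^sup>2
     + (A + A\<^sup>2 * (1 + (cmod s)\<^sup>2) / \<delta>) * (cmod (snd u - s * fst u))\<^sup>2"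
proof -
  define a b where "a = fst u" and "b = snd u - s * fst u"
  define e :: C2 where "e = (1, s)"
  define x y where "x = cscale a e" and "y = cscale b (0, 1)"
  define q where "q = L e (cscale \<i> e)"
  note bs = bilinear_C_simps[OF bil]
  have u: "u = x + y" by (simp add: x_def y_def a_def b_def e_def cscale_def prod_eq_iff)
  have x: "x = Re a *\<^sub>R e + Im a *\<^sub>R cscale \<i> e"
    by (simp add: x_def e_def cscale_def prod_eq_iff complex_eq_iff)
  have "L x (cscale \<i> x) = of_real ((Re a)\<^sup>2 + (Im a)\<^sup>2) * q"
    unfolding x cscale_add cscale_scaleR cscale_ii bs q_def using alt anti[of "cscale \<i> e" e]
    by (simp add: power2_eq_square algebra_simps)
  then have xx: "cmod (L x (cscale \<i> x)) = (cmod a)\<^sup>2 * cmod q"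
    by (simp add: norm_mult cmod_power2 del: of_real_add of_real_power)
  have ne: "(norm e)\<^sup>2 = 1 + (cmod s)\<^sup>2" by (simp add: e_def norm_Pair)
  have nx: "norm x = cmod a * norm e" and ny: "norm y = cmod b" by (simp_all add: x_def y_def norm_Pair)
  have "L u (cscale \<i> u) = L x (cscale \<i> x) + L x (cscale \<i> y) + (L y (cscale \<i> x) + L y (cscale \<i> y))"
    unfolding u cscale_add bs by simp
  also have "cmod \<dots> \<le> cmod (L x (cscale \<i> x)) + cmod (L x (cscale \<i> y)) + (cmod (L y (cscale \<i> x)) + cmod (L y (cscale \<i> y)))"
    by (intro norm_triangle_mono order_refl)
  also have "\<dots> \<le> (cmod a)\<^sup>2 * cmod q + A * norm x * norm y + (A * norm y * norm x + A * norm y * norm y)"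
    using A(1)[of x "cscale \<i> y"] A(1)[of y "cscale \<i> x"] A(1)[of y "cscale \<i> y"] xx by (intro add_mono) auto
  also have "\<dots> = (cmod a)\<^sup>2 * cmod q + 2 * (cmod a * (A * norm e * cmod b)) + A * (cmod b)\<^sup>2"
    by (simp add: nx ny power2_eq_square algebra_simps)
  also have "\<dots> \<le> (cmod a)\<^sup>2 * ((cmod q)\<^sup>2 / (2 * t) + t / 2) + (\<delta> * (cmod a)\<^sup>2 + (A * norm e * cmod b)\<^sup>2 / \<delta>) + A * (cmod b)\<^sup>2"
  proof (intro add_mono mult_left_mono)
    have "0 \<le> (cmod q - t)\<^sup>2" by simp
    then show "cmod q \<le> (cmod q)\<^sup>2 / (2 * t) + t / 2"
      using pos(1) by (simp add: field_simps power2_eq_square)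
    have "0 \<le> (\<delta> * cmod a - A * norm e * cmod b)\<^sup>2" by simp
    then show "2 * (cmod a * (A * norm e * cmod b)) \<le> \<delta> * (cmod a)\<^sup>2 + (A * norm e * cmod b)\<^sup>2 / \<delta>"
      using pos(2) by (simp add: field_simps power2_eq_square)
  qed (use A(2) in auto)
  also have "\<dots> = ((cmod q)\<^sup>2 / (2 * t) + t / 2 + \<delta>) * (cmod a)\<^sup>2 + (A + A\<^sup>2 * (norm e)\<^sup>2 / \<delta>) * (cmod b)\<^sup>2"
    by (simp add: power_mult_distrib algebra_simps)
  finally show ?thesis by (simp add: q_def e_def[symmetric] ne a_def b_def)
qed

text \<open>What a small chart provides. \<open>S_dom\<close> bounds \<open>S\<close> on positive
  forms by an integral of traces over the product of the disc with the transversal.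
  \<open>S_closed\<close> is closedness for the expanded forms dH wedge d(Re z) and dH wedge d(Im
  z). The measure \<mu> lives on all Borel sets of the plane; that it is carried by \<tau> is added
  in an extension of the locale.\<close>

locale dominated_current = graph_lamination +
  fixes \<mu> :: "complex measure" and S :: current
  assumes finite_mu: "finite_measure \<mu>" and sets_mu [simp, measurable_cong]: "sets \<mu> = sets borel"
    and near: "\<And>\<alpha> z. \<alpha> \<in> \<tau> \<Longrightarrow> z \<in> unit_disc \<Longrightarrow> cmod (\<phi> \<alpha> z - \<alpha>) \<le> 1/4"
    and S_lin: "\<And>a b \<omega> \<omega>'. test_form2 bidisc \<omega> \<Longrightarrow> test_form2 bidisc \<omega>' \<Longrightarrow>
        S (\<lambda>p u v. a * \<omega> p u v + b * \<omega>' p u v) = a * S \<omega> + b * S \<omega>'"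
    and S_type: "\<And>\<omega>. test_form2 bidisc \<omega> \<Longrightarrow> type_20 \<omega> \<or> type_02 \<omega> \<Longrightarrow> S \<omega> = 0"
    and S_pos: "\<And>\<omega>. test_form2 bidisc \<omega> \<Longrightarrow> positive_form \<omega> \<Longrightarrow> S \<omega> \<in> \<real>\<^sub>\<ge>\<^sub>0"
    and S_dom: "\<And>\<omega>. test_form2 bidisc \<omega> \<Longrightarrow> positive_form \<omega> \<Longrightarrow>
        (LINT p|(disc_measure \<Otimes>\<^sub>M \<mu>). trace \<omega> p) - S \<omega> \<in> \<real>\<^sub>\<ge>\<^sub>0"
    and S_closed: "\<And>H L K. smooth_on UNIV H \<Longrightarrow> compact K \<Longrightarrow> K \<subseteq> bidisc \<Longrightarrow> (\<And>p. p \<notin> K \<Longrightarrow> H p = 0) \<Longrightarrow>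
        L \<in> {Re, Im} \<Longrightarrow> S (\<lambda>p u v. frechet_derivative H (at p) u * complex_of_real (L (fst v))
            - frechet_derivative H (at p) v * complex_of_real (L (fst u))) = 0"
begin

definition M :: "(complex \<times> complex) measure" where "M = disc_measure \<Otimes>\<^sub>M \<mu>"

lemma sets_M [simp, measurable_cong]: "sets M = sets borel"
proof -
  have "sets M = sets (borel \<Otimes>\<^sub>M borel :: (complex \<times> complex) measure)"
    unfolding M_def by (rule sets_pair_measure_cong) simp_all
  then show ?thesis by (simp only: borel_prod)
qed
lemma space_M [simp]: "space M = UNIV"
  using sets_eq_imp_space_eq[OF sets_M] by simp
lemma space_mu [simp]: "space \<mu> = UNIV"
  using sets_eq_imp_space_eq[OF sets_mu] by simp

sublocale mu: finite_measure \<mu> by (rule finite_mu)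
sublocale dm: finite_measure disc_measure by (rule finite_disc_measure)
sublocale M: finite_measure M
  unfolding M_def by (rule finite_measure_pair_measure[OF finite_mu finite_disc_measure])
sublocale pair: pair_sigma_finite disc_measure \<mu> ..

lemma integrable_M_bounded:
  fixes f :: "complex \<times> complex \<Rightarrow> 'b::{banach, second_countable_topology}"
  assumes "f \<in> borel_measurable borel" "\<And>p. norm (f p) \<le> B"
  shows "integrable M f"
proof (rule M.integrable_const_bound[where B=B])
  show "f \<in> borel_measurable M" using assms(1) by simp
qed (use assms in auto)

text \<open>Replacing \<omega> by its (1,1) component does not change \<open>S\<close>. This is
  needed because positivity is available for (1,1) forms only.\<close>

lemma S_11: assumes "test_form2 bidisc \<omega>"
  shows "S (\<lambda>p u v. 1/2 * \<omega> p u v + 1/2 * \<omega> p (cscale \<i> u) (cscale \<i> v) + 0 * (\<omega> p (cscale \<i> u) v + \<omega> p u (cscale \<i> v))) = S \<omega>"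
proof -
  let ?P = "\<lambda>a b c p u v. a * \<omega> p u v + b * \<omega> p (cscale \<i> u) (cscale \<i> v) + c * (\<omega> p (cscale \<i> u) v + \<omega> p u (cscale \<i> v))"
  note T = test_form2_J[OF assms]
  note bs = bilinear_C_simps[OF test_form2D(1)[OF assms]]
  \<comment> \<open>The coefficients 1/4, -1/4, -i/4 single out the (2,0) component; changing the
    sign of the last one gives the (0,2) component.\<close>
  have z: "S (?P (1/4) (-1/4) (-\<i>/4)) = 0"
    by (rule S_type[OF T]) (auto simp: type_20_def bs algebra_simps)
  have z': "S (?P (1/4) (-1/4) (\<i>/4)) = 0"
    by (rule S_type[OF T]) (auto simp: type_02_def bs algebra_simps)
  have 1: "S (\<lambda>p u v. 1 * ?P (1/4) (-1/4) (-\<i>/4) p u v + 1 * ?P (1/4) (-1/4) (\<i>/4) p u v) = 0"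
    by (subst S_lin[OF T T]) (simp only: z z', simp)
  have "S (\<lambda>p u v. 1 * ?P (1/2) (1/2) 0 p u v + 1 * (1 * ?P (1/4) (-1/4) (-\<i>/4) p u v + 1 * ?P (1/4) (-1/4) (\<i>/4) p u v))
     = S (?P (1/2) (1/2) 0)"
    by (subst S_lin[OF T test_form2_comb[OF T T]]) (simp only: 1, simp)
  also have "(\<lambda>p u v. 1 * ?P (1/2) (1/2) 0 p u v + 1 * (1 * ?P (1/4) (-1/4) (-\<i>/4) p u v + 1 * ?P (1/4) (-1/4) (\<i>/4) p u v)) = \<omega>"
    by (intro ext) (simp add: algebra_simps)
  finally show ?thesis by simp
qed

text \<open>A positive Hermitian form adapted to a smooth approximation \<sigma> of the slope
  dominates \<omega> and -\<omega> in the sense of positive forms. Hence |S \<omega>| is at most its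
  mass for \<open>S\<close>, and then at most the integral of its trace, which is close to (trace
  \<omega>)^2/(2t) + t/2. Optimising over \<open>t\<close> would give Cauchy--Schwarz; the form
  linear in the square suffices and avoids square roots.\<close>

lemma L2_bound:
  assumes \<omega>: "test_form2 bidisc \<omega>" and real: "\<And>p u v. \<omega> p u v \<in> \<real>" and t: "t > 0"
  shows "Im (S \<omega>) = 0"
    and "\<bar>Re (S \<omega>)\<bar> \<le> (LINT p|M. (Re (trace \<omega> p))\<^sup>2) / (2 * t) + t / 2 * measure M UNIV"
proof -
  obtain K where K: "compact K" "K \<subseteq> bidisc" "\<And>p u v. p \<notin> K \<Longrightarrow> \<omega> p u v = 0"
    using test_form2_support[OF \<omega>] by metis
  obtain r where r: "0 \<le> r" "r < 1" "K \<subseteq> cball 0 r \<times> cball 0 r"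
    using compact_in_bidisc_radius[OF K(1,2)] by metis
  \<comment> \<open>The margin between \<open>r\<close> and 1 leaves room for a cutoff that is 1 on
    the support of \<omega>, so that the dominating form is itself a test form.\<close>
  define R where "R = (1 + r) / 2"
  have R: "r < R" "R < 1" "0 \<le> R" using r by (auto simp: R_def)
  obtain \<kappa> where k: "smooth_on UNIV (\<lambda>z. complex_of_real (\<kappa> z))"
    "\<And>z. 0 \<le> \<kappa> z" "\<And>z. \<kappa> z \<le> 1" "\<And>z. cmod z \<le> r \<Longrightarrow> \<kappa> z = 1" "\<And>z. cmod z \<ge> R \<Longrightarrow> \<kappa> z = 0"
    using exists_cutoff[OF r(1) R(1)] by metis
  obtain A where A: "A > 0" "\<And>p u v. cmod (\<omega> p u v) \<le> A * norm u * norm v"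
    using test_form2_bound[OF \<omega>] by metis
  obtain B0 where B0: "B0 > 0" "\<And>z \<alpha>. cmod z \<le> R \<Longrightarrow> \<alpha> \<in> \<tau> \<Longrightarrow> cmod (deriv (\<phi> \<alpha>) z) \<le> B0"
    using slope_bound[OF R(3,2)] by metis
  define B where "B = B0 + 1"
  define \<kappa>2 where "\<kappa>2 p = \<kappa> (fst p) * \<kappa> (snd p)" for p :: C2
  have k2: "0 \<le> \<kappa>2 p" "\<kappa>2 p \<le> 1" for p using k(2,3) by (auto simp: \<kappa>2_def mult_le_one)
  have k2K: "\<kappa>2 p = 1" if "p \<in> K" for p using that r(3) k(4) by (auto simp: \<kappa>2_def)
  have k2s: "smooth_on UNIV (\<lambda>p. complex_of_real (\<kappa>2 p))"
    using smooth_on_mult[OF open_UNIV smooth_on_fst[OF open_UNIV k(1), unfolded UNIV_Times_UNIV]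
      smooth_on_snd[OF open_UNIV k(1), unfolded UNIV_Times_UNIV]] by (simp add: \<kappa>2_def)
  have k20: "\<kappa>2 p = 0" if "p \<notin> cball 0 R \<times> cball 0 R" for p
    using that k(5)[of "fst p"] k(5)[of "snd p"] by (cases p) (auto simp: \<kappa>2_def)
  have main: "Im (S \<omega>) = 0 \<and> \<bar>Re (S \<omega>)\<bar> \<le> (LINT p|M. (Re (trace \<omega> p))\<^sup>2) / (2 * t) + (t / 2 + e) * measure M UNIV"
    if e: "e > 0" for e
  proof -
    \<comment> \<open>The error budget \<open>e\<close> is split in two. One half, \<delta>1,
      absorbs the mixed terms. The other covers \<open>C * \<delta>\<close>, the change of q^2/(2t)
      when the slope is replaced by \<sigma>, and \<open>M1 * \<delta>\<close>, the transversal
      term, with \<open>M1\<close> bounding its coefficient. Since \<delta> is at most 1,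
      \<open>B\<close> bounds \<sigma> as well as the slopes.\<close>
    define \<delta>1 where "\<delta>1 = e / 2"
    define C where "C = 2 * (A * (1 + B) * (1 + B)) * (2 * A * (1 + B)) / (2 * t)"
    define M1 where "M1 = A + A\<^sup>2 * (1 + B\<^sup>2) / \<delta>1"
    have pos: "\<delta>1 > 0" "C \<ge> 0" "M1 \<ge> 0" using e A B0 t by (auto simp: \<delta>1_def C_def M1_def B_def)
    define \<delta> where "\<delta> = min 1 (e / 2 / (C + M1 + 1))"
    have d: "\<delta> > 0" "\<delta> \<le> 1" using e pos by (auto simp: \<delta>_def)
    have "\<delta> \<le> e / 2 / (C + M1 + 1)" by (simp add: \<delta>_def)
    then have "\<delta> * (C + M1 + 1) \<le> e / 2" using pos by (simp add: pos_le_divide_eq algebra_simps)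
    then have dC: "C * \<delta> + M1 * \<delta> \<le> e / 2" using d by (simp add: algebra_simps)
    obtain \<sigma> :: "C2 \<Rightarrow> complex" where \<sigma>: "smooth_on UNIV \<sigma>"
      "\<And>z \<alpha>. cmod z \<le> R \<Longrightarrow> \<alpha> \<in> \<tau> \<Longrightarrow> cmod (deriv (\<phi> \<alpha>) z - \<sigma> (z, \<phi> \<alpha> z)) < \<delta>"
      using slope_polynomial_approx[OF R(3,2) d(1)] by metis
    define q where "q p = \<omega> p (1, \<sigma> p) (cscale \<i> (1, \<sigma> p))" for p
    have q_real: "q p = of_real (Re (q p))" for p using real unfolding q_def by simp
    have qs: "smooth_on UNIV q"
      unfolding q_def
      by (rule smooth_on_form_apply) (auto intro!: smooth_on_const smooth_on_mult \<sigma>(1) test_form2D[OF \<omega>])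
    define f0 where "f0 p = (Re (q p))\<^sup>2 / (2 * t) + t / 2 + \<delta>1" for p
    define g0 where "g0 p = A + A\<^sup>2 * (1 + (cmod (\<sigma> p))\<^sup>2) / \<delta>1" for p
    have fg0: "f0 p \<ge> 0" "g0 p \<ge> 0" for p using t pos A by (auto simp: f0_def g0_def intro!: add_nonneg_nonneg)
    define f where "f p = complex_of_real (\<kappa>2 p * f0 p)" for p
    define g where "g p = complex_of_real (\<kappa>2 p * g0 p)" for p
    have f_alt: "f = (\<lambda>p. complex_of_real (\<kappa>2 p) * (complex_of_real (Re (q p)) ^ 2 * complex_of_real (1 / (2 * t)) + complex_of_real (t / 2 + \<delta>1)))"
      by (rule ext) (simp add: f_def f0_def)
    have g_alt: "g = (\<lambda>p. complex_of_real (\<kappa>2 p) * (complex_of_real A + complex_of_real (A\<^sup>2 / \<delta>1) * (1 + complex_of_real ((cmod (\<sigma> p))\<^sup>2))))"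
      by (rule ext) (simp add: g_def g0_def)
    have fs: "smooth_on UNIV f" unfolding f_alt
      by (intro smooth_on_mult smooth_on_add smooth_on_power smooth_on_Re smooth_on_const open_UNIV k2s qs)
    have gs: "smooth_on UNIV g" unfolding g_alt
      by (intro smooth_on_mult smooth_on_add smooth_on_norm2 smooth_on_const open_UNIV k2s \<sigma>(1))
    let ?H = "hermitian_form f g \<sigma>"
    have tH: "test_form2 bidisc ?H"
      by (rule test_form2_hermitian[OF fs gs \<sigma>(1), where K="cball 0 R \<times> cball 0 R"])
         (use R k20 in \<open>auto simp: f_def g_def compact_Times\<close>)
    let ?\<omega>11 = "\<lambda>p u v. 1/2 * \<omega> p u v + 1/2 * \<omega> p (cscale \<i> u) (cscale \<i> v) + 0 * (\<omega> p (cscale \<i> u) v + \<omega> p u (cscale \<i> v))"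
    note t11 = test_form2_J[OF \<omega>, of "1/2" "1/2" 0]
    note bs = bilinear_C_simps[OF test_form2D(1)[OF \<omega>]]
    have J11: "?\<omega>11 p u (cscale \<i> u) = \<omega> p u (cscale \<i> u)" for p u
      using test_form2D(3)[OF \<omega>, of p "cscale \<i> u" u] by (simp add: bs)
    have HJ: "?H p u (cscale \<i> u) = of_real (\<kappa>2 p * (f0 p * (cmod (fst u))\<^sup>2 + g0 p * (cmod (snd u - \<sigma> p * fst u))\<^sup>2))" for p u
      unfolding hermitian_form_J f_def g_def by (simp add: algebra_simps)
    have bound: "cmod (\<omega> p u (cscale \<i> u)) \<le> \<kappa>2 p * (f0 p * (cmod (fst u))\<^sup>2 + g0 p * (cmod (snd u - \<sigma> p * fst u))\<^sup>2)" for p u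
    proof (cases "p \<in> K")
      case True
      have "(cmod (q p))\<^sup>2 = (Re (q p))\<^sup>2" by (subst q_real) simp
      then show ?thesis
        using alternating_line_bound[OF test_form2D(1,2,3)[OF \<omega>, of p] A(2,1) t pos(1), of u "\<sigma> p"] k2K[OF True]
        by (simp add: f0_def g0_def q_def)
    next
      case False
      then show ?thesis using K(3)[OF False] k2 fg0 by (simp add: mult_nonneg_nonneg)
    qed
    have pH: "positive_form ?H"
      unfolding positive_form_def using hermitian_form_11 k2 fg0 by (simp add: HJ mult_nonneg_nonneg nonneg_Reals_of_real_iff del: of_real_mult of_real_add)
    have pP: "positive_form (\<lambda>p u v. 1 * ?H p u v + s * ?\<omega>11 p u v)" if s: "s = 1 \<or> s = -1" for s
      unfolding positive_form_def
    proof (intro conjI allI)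
      have "?\<omega>11 p (cscale \<i> u) (cscale \<i> v) = ?\<omega>11 p u v" for p u v by (simp add: bs)
      then show "type_11 (\<lambda>p u v. 1 * ?H p u v + s * ?\<omega>11 p u v)"
        using hermitian_form_11[of f g \<sigma>] unfolding type_11_def by simp
      fix p u
      have re: "\<omega> p u (cscale \<i> u) = of_real (Re (\<omega> p u (cscale \<i> u)))" using real by simp
      have "\<bar>Re (\<omega> p u (cscale \<i> u))\<bar> \<le> \<kappa>2 p * (f0 p * (cmod (fst u))\<^sup>2 + g0 p * (cmod (snd u - \<sigma> p * fst u))\<^sup>2)"
        using bound[of p u] abs_Re_le_cmod order_trans by blast
      then show "1 * ?H p u (cscale \<i> u) + s * ?\<omega>11 p u (cscale \<i> u) \<in> \<real>\<^sub>\<ge>\<^sub>0"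
        unfolding J11 HJ by (subst re) (use s in \<open>auto simp: complex_nonneg_Reals_iff\<close>)
    qed
    \<comment> \<open>Both signs together give the two-sided bound, and also the vanishing of the
      imaginary part: \<open>S ?H + S \<omega>\<close> and \<open>S ?H - S \<omega>\<close> are both
      real.\<close>
    have SP: "1 * S ?H + s * S \<omega> \<in> \<real>\<^sub>\<ge>\<^sub>0" if s: "s = 1 \<or> s = -1" for s
      using S_pos[OF test_form2_comb[OF tH t11] pP[OF s]] S_lin[OF tH t11, of 1 s] S_11[OF \<omega>] by simp
    have SH: "(LINT p|M. trace ?H p) - S ?H \<in> \<real>\<^sub>\<ge>\<^sub>0"
      using S_dom[OF tH pH] unfolding M_def .
    from SP[of 1] SP[of "-1"] have 1: "Im (S \<omega>) = 0" "\<bar>Re (S \<omega>)\<bar> \<le> Re (S ?H)"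
      by (auto simp: complex_nonneg_Reals_iff)
    have 2: "Re (S ?H) \<le> Re (LINT p|M. trace ?H p)" using SH by (auto simp: complex_nonneg_Reals_iff)
    obtain BH where BH: "\<And>p. cmod (trace ?H p) \<le> BH" using trace_bounded[OF tH] by auto
    have iH: "integrable M (trace ?H)" by (rule integrable_M_bounded[OF trace_measurable[OF tH] BH])
    obtain Bw where Bw: "\<And>p. cmod (trace \<omega> p) \<le> Bw" using trace_bounded[OF \<omega>] by auto
    have iw: "integrable M (\<lambda>p. (Re (trace \<omega> p))\<^sup>2)"
    proof (rule integrable_M_bounded)
      show "(\<lambda>p. (Re (trace \<omega> p))\<^sup>2) \<in> borel_measurable borel" using trace_measurable[OF \<omega>] by measurable
      fix p have "\<bar>Re (trace \<omega> p)\<bar> \<le> Bw" using Bw abs_Re_le_cmod order_trans by blast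
      from power_mono[OF this, of 2] show "norm ((Re (trace \<omega> p))\<^sup>2) \<le> Bw\<^sup>2" by simp
    qed
    have pw: "Re (trace ?H p) \<le> (Re (trace \<omega> p))\<^sup>2 / (2 * t) + (t / 2 + e)" for p
    proof (cases "cmod (fst p) \<le> R \<and> snd p \<in> \<tau>")
      case True
      then obtain z \<alpha> where p: "p = (z, \<alpha>)" "cmod z \<le> R" "\<alpha> \<in> \<tau>" by (cases p) auto
      have zd: "z \<in> unit_disc" using p R by simp
      let ?p = "(z, \<phi> \<alpha> z)" and ?d = "deriv (\<phi> \<alpha>) z"
      have s1: "cmod (?d - \<sigma> ?p) < \<delta>" using \<sigma>(2)[OF p(2,3)] .
      have dB: "cmod ?d \<le> B" using B0(2)[OF p(2,3)] by (simp add: B_def)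
      have sB: "cmod (\<sigma> ?p) \<le> B" using s1 d(2) B0(2)[OF p(2,3)] norm_triangle_ineq3[of ?d "\<sigma> ?p"] by (simp add: B_def)
      let ?e = "(1::complex, \<sigma> ?p)" and ?e' = "(1::complex, ?d)"
      have ne: "norm ?e \<le> 1 + B" "norm ?e' \<le> 1 + B" using norm_tangent_le sB dB by auto
      have nd: "norm (?e - ?e') \<le> \<delta>" using s1 by (simp add: norm_Pair norm_minus_commute)
      have tr: "trace \<omega> p = \<omega> ?p ?e' (cscale \<i> ?e')" using p zd by (simp add: trace_def leaf_form_def)
      have qt: "q ?p - trace \<omega> p = \<omega> ?p (?e - ?e') (cscale \<i> ?e) + \<omega> ?p ?e' (cscale \<i> (?e - ?e'))"
        unfolding tr q_def by (rule bilinear_J_diff[OF test_form2D(1)[OF \<omega>]])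
      have "cmod (q ?p - trace \<omega> p) \<le> A * norm (?e - ?e') * norm ?e + A * norm ?e' * norm (?e - ?e')"
        unfolding qt by (intro norm_triangle_mono order_trans[OF A(2)]) (simp_all del: diff_Pair)
      also have "\<dots> \<le> A * \<delta> * (1 + B) + A * (1 + B) * \<delta>"
        using ne nd A(1) d(1) B0(1) by (intro add_mono mult_mono mult_nonneg_nonneg) (auto simp: B_def)
      finally have qd: "cmod (q ?p - trace \<omega> p) \<le> 2 * A * (1 + B) * \<delta>" by (simp add: algebra_simps)
      have qb: "cmod (q ?p) \<le> A * (1 + B) * (1 + B)"
      proof -
        have "cmod (q ?p) \<le> A * norm ?e * norm ?e" unfolding q_def using A(2)[of ?p ?e "cscale \<i> ?e"] by simp
        also have "\<dots> \<le> A * (1 + B) * (1 + B)" using ne A(1) B0(1) by (intro mult_mono) (auto simp: B_def)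
        finally show ?thesis .
      qed
      have tb: "cmod (trace \<omega> p) \<le> A * (1 + B) * (1 + B)"
      proof -
        have "cmod (trace \<omega> p) \<le> A * norm ?e' * norm ?e'" unfolding tr using A(2)[of ?p ?e' "cscale \<i> ?e'"] by simp
        also have "\<dots> \<le> A * (1 + B) * (1 + B)" using ne A(1) B0(1) by (intro mult_mono) (auto simp: B_def)
        finally show ?thesis .
      qed
      define x y where "x = Re (q ?p)" and "y = Re (trace \<omega> p)"
      have "\<bar>x - y\<bar> \<le> 2 * A * (1 + B) * \<delta>" "\<bar>x\<bar> \<le> A * (1 + B) * (1 + B)" "\<bar>y\<bar> \<le> A * (1 + B) * (1 + B)"
        using qd qb tb abs_Re_le_cmod[of "q ?p - trace \<omega> p"] abs_Re_le_cmod[of "q ?p"] abs_Re_le_cmod[of "trace \<omega> p"]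
        by (auto simp: x_def y_def)
      then have "\<bar>x - y\<bar> * \<bar>x + y\<bar> \<le> (2 * A * (1 + B) * \<delta>) * (2 * (A * (1 + B) * (1 + B)))"
        using A(1) d(1) B0(1) by (intro mult_mono) (auto simp: B_def)
      moreover have "x\<^sup>2 - y\<^sup>2 \<le> \<bar>x - y\<bar> * \<bar>x + y\<bar>"
        unfolding abs_mult[symmetric] by (simp add: power2_eq_square algebra_simps)
      ultimately have xy: "x\<^sup>2 / (2 * t) \<le> y\<^sup>2 / (2 * t) + C * \<delta>"
        using t by (simp add: C_def field_simps)
      have "Re (trace ?H p) = \<kappa>2 ?p * (f0 ?p + g0 ?p * (cmod (?d - \<sigma> ?p))\<^sup>2)"
        unfolding p(1) trace_hermitian using zd p by (simp add: f_def g_def algebra_simps)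
      also have "\<dots> \<le> 1 * (f0 ?p + g0 ?p * (cmod (?d - \<sigma> ?p))\<^sup>2)"
        using k2 fg0 by (intro mult_right_mono) auto
      \<comment> \<open>On the leaf the large transversal coefficient meets the square of the slope
        error, and \<delta>^2 is at most \<delta>.\<close>
      also have "g0 ?p * (cmod (?d - \<sigma> ?p))\<^sup>2 \<le> M1 * \<delta>"
      proof (rule mult_mono)
        show "g0 ?p \<le> M1" unfolding g0_def M1_def using sB pos by (intro add_left_mono divide_right_mono mult_left_mono power_mono) auto
        have "(cmod (?d - \<sigma> ?p))\<^sup>2 \<le> \<delta>\<^sup>2" using s1 by (intro power_mono) auto
        also have "\<dots> \<le> \<delta>" using d by (simp add: power2_eq_square mult_left_le)
        finally show "(cmod (?d - \<sigma> ?p))\<^sup>2 \<le> \<delta>" .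
      qed (use pos in auto)
      finally have "Re (trace ?H p) \<le> f0 ?p + M1 * \<delta>" by simp
      also have "\<dots> \<le> y\<^sup>2 / (2 * t) + t / 2 + \<delta>1 + (C * \<delta> + M1 * \<delta>)" using xy by (simp add: f0_def x_def)
      also have "\<dots> \<le> y\<^sup>2 / (2 * t) + (t / 2 + e)" using dC by (simp add: \<delta>1_def)
      finally show ?thesis unfolding y_def .
    next
      case False
      then have "trace ?H p = 0" using k20[of "(fst p, \<phi> (snd p) (fst p))"] 
        by (cases p) (auto simp: trace_hermitian f_def g_def)
      then show ?thesis using t e by (simp add: add_nonneg_nonneg)
    qed
    have "Re (LINT p|M. trace ?H p) = (LINT p|M. Re (trace ?H p))" using integral_Re[OF iH] by simp
    also have "\<dots> \<le> (LINT p|M. (Re (trace \<omega> p))\<^sup>2 / (2 * t) + (t / 2 + e))"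
      by (intro integral_mono pw Bochner_Integration.integrable_add integrable_Re[OF iH]) (use iw in auto)
    also have "\<dots> = (LINT p|M. (Re (trace \<omega> p))\<^sup>2) / (2 * t) + (t / 2 + e) * measure M UNIV"
      using iw by simp
    finally show ?thesis using 1 2 by linarith
  qed
  show "Im (S \<omega>) = 0" using main[of 1] by simp
  show "\<bar>Re (S \<omega>)\<bar> \<le> (LINT p|M. (Re (trace \<omega> p))\<^sup>2) / (2 * t) + t / 2 * measure M UNIV"
  \<comment> \<open>The approximation error \<open>c\<close> is scaled by the total mass plus 1, so
    that its contribution is at most \<open>e\<close> even for zero mass.\<close>
  proof (rule field_le_epsilon)
    fix e :: real assume e: "e > 0"
    let ?m = "measure M UNIV"
    define c where "c = e / (?m + 1)"
    have m: "?m \<ge> 0" by simp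
    have "c * (?m + 1) = e" unfolding c_def using m by (simp add: add_nonneg_eq_0_iff)
    moreover have c: "c > 0" unfolding c_def using e m by (intro divide_pos_pos add_nonneg_pos) auto
    ultimately have "c * ?m \<le> e" by (simp add: algebra_simps)
    moreover have "\<bar>Re (S \<omega>)\<bar> \<le> (LINT p|M. (Re (trace \<omega> p))\<^sup>2) / (2 * t) + (t / 2 + c) * ?m"
      using main[OF c] by blast
    ultimately show "\<bar>Re (S \<omega>)\<bar> \<le> (LINT p|M. (Re (trace \<omega> p))\<^sup>2) / (2 * t) + t / 2 * ?m + e"
      unfolding distrib_right by linarith
  qed
qed

end

text \<open>A linear functional that is bounded in the \<open>L\<^sup>2\<close> seminorm is represented by the \<open>L\<^sup>2\<close> limit of a
  minimising sequence of \<open>i \<mapsto> \<integral>(tr i)\<^sup>2/2 - \<Lambda> i\<close>; no completeness of \<open>L\<^sup>2\<close> is used beyond the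
  almost everywhere convergence of a subsequence.\<close>

lemma L2_functional_density:
  fixes N :: "'a measure" and tr :: "'i \<Rightarrow> 'a \<Rightarrow> real" and \<Lambda> :: "'i \<Rightarrow> real"
  assumes fin: "finite_measure N" and ne: "E \<noteq> {}"
    and meas: "\<And>i. i \<in> E \<Longrightarrow> tr i \<in> borel_measurable N"
    and bdd: "\<And>i. i \<in> E \<Longrightarrow> \<exists>B. \<forall>x. \<bar>tr i x\<bar> \<le> B"
    and lin: "\<And>i j c. i \<in> E \<Longrightarrow> j \<in> E \<Longrightarrow> \<exists>k\<in>E. (\<forall>x. tr k x = tr i x + c * tr j x) \<and> \<Lambda> k = \<Lambda> i + c * \<Lambda> j"
    and bound: "\<And>i. i \<in> E \<Longrightarrow> \<Lambda> i \<le> (LINT x|N. (tr i x)\<^sup>2) / 2 + C"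
  obtains k where "integrable N k" "\<And>i. i \<in> E \<Longrightarrow> \<Lambda> i = (LINT x|N. k x * tr i x)"
proof -
  interpret finite_measure N by fact
  have intb: "integrable N f" if "f \<in> borel_measurable N" "\<And>x. \<bar>f x\<bar> \<le> B" for f :: "'a \<Rightarrow> real" and B
    by (rule integrable_const_bound[where B=B]) (use that in auto)
  have int1: "integrable N (tr i)" if "i \<in> E" for i
    using bdd[OF that] intb[OF meas[OF that]] by blast
  have int2: "integrable N (\<lambda>x. tr i x * tr j x)" if ij: "i \<in> E" "j \<in> E" for i j
  proof -
    obtain B where B: "\<And>x. \<bar>tr i x\<bar> \<le> B" using bdd[OF ij(1)] by blast
    obtain B' where B': "\<And>x. \<bar>tr j x\<bar> \<le> B'" using bdd[OF ij(2)] by blast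
    show ?thesis
      by (rule intb[where B="B * B'"])
         (use meas[OF ij(1)] meas[OF ij(2)] in \<open>auto simp: abs_mult intro!: mult_mono B B' order_trans[OF abs_ge_zero B]\<close>)
  qed
  define J where "J i = (LINT x|N. (tr i x)\<^sup>2) / 2 - \<Lambda> i" for i
  define m where "m = Inf (J ` E)"
  have bb: "bdd_below (J ` E)"
    by (rule bdd_belowI[of _ "- C"]) (use bound in \<open>force simp: J_def\<close>)
  have mJ: "m \<le> J i" if "i \<in> E" for i
    unfolding m_def using bb that by (simp add: cInf_lower)
  have "\<exists>i\<in>E. J i < m + 1 / (real n + 1)" for n :: nat
  proof -
    have "Inf (J ` E) < m + 1 / (real n + 1)" by (simp add: m_def)
    then show ?thesis using cInf_lessD[of "J ` E"] ne by blast
  qed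
  then obtain w where w: "\<And>n. w n \<in> E" "\<And>n. J (w n) < m + 1 / (real n + 1)" by metis
  have Jexp: "J k = J i + c * ((LINT x|N. tr i x * tr j x) - \<Lambda> j) + c\<^sup>2 * (LINT x|N. (tr j x)\<^sup>2) / 2"
    if "i \<in> E" "j \<in> E" "\<And>x. tr k x = tr i x + c * tr j x" "\<Lambda> k = \<Lambda> i + c * \<Lambda> j" for i j k c
  proof -
    have "(LINT x|N. (tr k x)\<^sup>2) = (LINT x|N. tr i x * tr i x + (2 * c) * (tr i x * tr j x) + c\<^sup>2 * (tr j x * tr j x))"
      by (rule Bochner_Integration.integral_cong) (auto simp: that power2_eq_square algebra_simps)
    also have "\<dots> = (LINT x|N. tr i x * tr i x) + (2 * c) * (LINT x|N. tr i x * tr j x) + c\<^sup>2 * (LINT x|N. tr j x * tr j x)"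
      using int2 that(1,2) by simp
    finally show ?thesis unfolding J_def that(4) by (simp add: power2_eq_square algebra_simps)
  qed
  have par: "(LINT x|N. (tr i x - tr j x)\<^sup>2) \<le> 4 * (J i + J j - 2 * m)" if ij: "i \<in> E" "j \<in> E" for i j
  proof -
    \<comment> \<open>Parallelogram law through the difference \<open>a\<close> and the midpoint
      \<open>b\<close>: the energy of \<open>b\<close> is the mean of the two energies minus D/8,
      and it is at least \<open>m\<close>.\<close>
    obtain a where a: "a \<in> E" "\<And>x. tr a x = tr j x + (-1) * tr i x" "\<Lambda> a = \<Lambda> j + (-1) * \<Lambda> i"
      using lin[OF ij(2,1), of "-1"] by blast
    obtain b where b: "b \<in> E" "\<And>x. tr b x = tr i x + (1/2) * tr a x" "\<Lambda> b = \<Lambda> i + (1/2) * \<Lambda> a"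
      using lin[OF ij(1) a(1), of "1/2"] by blast
    define D where "D = (LINT x|N. (tr i x - tr j x)\<^sup>2)"
    have Da: "(LINT x|N. (tr a x)\<^sup>2) = D" unfolding D_def a(2) by (simp add: power2_commute)
    define X where "X = (LINT x|N. tr i x * tr a x) - \<Lambda> a"
    have j: "J j = J i + 1 * X + 1\<^sup>2 * D / 2"
      unfolding X_def Da[symmetric] by (rule Jexp[OF ij(1) a(1)]) (auto simp: a)
    have "J b = J i + (1/2) * X + (1/2)\<^sup>2 * D / 2"
      unfolding X_def Da[symmetric] by (rule Jexp[OF ij(1) a(1) b(2,3)])
    with j mJ[OF b(1)] have "D \<le> 4 * (J i + J j - 2 * m)"
      by (simp add: power2_eq_square)
    then show ?thesis by (simp add: D_def)
  qed
  let ?s = "\<lambda>n. tr (w n)"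
  \<comment> \<open>The elementary bound |x| <= x^2/(2 \<epsilon>) + \<epsilon>/2 passes from
    squares to the L1 norm on a finite measure space.\<close>
  have L1: "(LINT x|N. \<bar>?s i x - ?s j x\<bar>) \<le> 2 * (1 / (real i + 1) + 1 / (real j + 1)) / \<epsilon> + \<epsilon> / 2 * measure N (space N)"
    if "\<epsilon> > 0" for i j \<epsilon>
  proof -
    have sq: "integrable N (\<lambda>x. (?s i x - ?s j x)\<^sup>2)"
    proof -
      have "(\<lambda>x. (?s i x - ?s j x)\<^sup>2) = (\<lambda>x. ?s i x * ?s i x + ?s j x * ?s j x - 2 * (?s i x * ?s j x))"
        by (auto simp: power2_eq_square algebra_simps)
      then show ?thesis using int2 w(1) by simp
    qed
    have "(LINT x|N. \<bar>?s i x - ?s j x\<bar>) \<le> (LINT x|N. (?s i x - ?s j x)\<^sup>2 / (2 * \<epsilon>) + \<epsilon> / 2)"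
    proof (intro integral_mono)
      fix x
      have "0 \<le> (\<bar>?s i x - ?s j x\<bar> - \<epsilon>)\<^sup>2" by simp
      also have "\<dots> = (?s i x - ?s j x)\<^sup>2 + \<epsilon>\<^sup>2 - 2 * \<epsilon> * \<bar>?s i x - ?s j x\<bar>"
        by (subst power2_diff) (simp only: power2_abs, simp)
      finally show "\<bar>?s i x - ?s j x\<bar> \<le> (?s i x - ?s j x)\<^sup>2 / (2 * \<epsilon>) + \<epsilon> / 2"
        using that by (simp add: field_simps power2_eq_square)
    qed (use sq int1 w(1) in auto)
    also have "\<dots> = (LINT x|N. (?s i x - ?s j x)\<^sup>2) / (2 * \<epsilon>) + \<epsilon> / 2 * measure N (space N)"
      using sq by simp
    also have "(LINT x|N. (?s i x - ?s j x)\<^sup>2) / (2 * \<epsilon>) \<le> (2 * (2 * (1 / (real i + 1) + 1 / (real j + 1)))) / (2 * \<epsilon>)"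
      using par[OF w(1)[of i] w(1)[of j]] w(2)[of i] w(2)[of j] that by (intro divide_right_mono) auto
    also have "\<dots> = 2 * (1 / (real i + 1) + 1 / (real j + 1)) / \<epsilon>" by (rule mult_divide_mult_cancel_left) simp
    finally show ?thesis by simp
  qed
  have cauchy: "\<exists>n. \<forall>i\<ge>n. \<forall>j\<ge>n. (LINT x|N. norm (?s i x - ?s j x)) < e" if e: "e > 0" for e
  proof -
    define \<epsilon> where "\<epsilon> = e / (measure N (space N) + 1)"
    have m0: "measure N (space N) \<ge> 0" by simp
    have eps: "\<epsilon> > 0" "\<epsilon> / 2 * measure N (space N) \<le> e / 2"
    proof -
      have "\<epsilon> * (measure N (space N) + 1) = e" unfolding \<epsilon>_def using m0 by (simp add: add_nonneg_eq_0_iff)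
      moreover show p: "\<epsilon> > 0" unfolding \<epsilon>_def using e m0 by (intro divide_pos_pos add_nonneg_pos) auto
      ultimately show "\<epsilon> / 2 * measure N (space N) \<le> e / 2" by (simp add: algebra_simps)
    qed
    obtain n where n: "1 / (real n + 1) < \<epsilon> * e / 8"
      using eps e reals_Archimedean[of "\<epsilon> * e / 8"] by (auto simp: inverse_eq_divide algebra_simps)
    have "(LINT x|N. norm (?s i x - ?s j x)) < e" if ij: "i \<ge> n" "j \<ge> n" for i j
    proof -
      have "1 / (real i + 1) \<le> 1 / (real n + 1)" "1 / (real j + 1) \<le> 1 / (real n + 1)"
        using ij by (auto simp: frac_le)
      moreover have "2 * (a + b) < d / 2" if "a \<le> c" "b \<le> c" "c < d / 8" for a b c d :: real
        using that unfolding distrib_left by simp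
      ultimately have "2 * (1 / (real i + 1) + 1 / (real j + 1)) < \<epsilon> * e / 2" using n by blast
      then have "2 * (1 / (real i + 1) + 1 / (real j + 1)) / \<epsilon> < e / 2"
        using eps(1) by (simp add: pos_divide_less_eq mult.commute)
      from le_less_trans[OF L1[OF eps(1), of i j] add_less_le_mono[OF this eps(2)]]
      show ?thesis by (simp only: real_norm_def field_sum_of_halves)
    qed
    then show ?thesis by blast
  qed
  obtain r where r: "strict_mono r" "AE x in N. Cauchy (\<lambda>i. ?s (r i) x)"
    by (rule cauchy_L1_AE_cauchy_subseq[OF int1[OF w(1)] cauchy])
  define k where "k x = lim (\<lambda>i. ?s (r i) x)" for x
  have [measurable]: "\<And>n. ?s n \<in> borel_measurable N" using meas w(1) by blast
  have km [measurable]: "k \<in> borel_measurable N" unfolding k_def by measurable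
  have conv: "AE x in N. (\<lambda>i. ?s (r i) x) \<longlonglongrightarrow> k x"
    using r(2) by eventually_elim (simp add: k_def Cauchy_convergent_iff convergent_LIMSEQ_iff)
  have tail: "\<exists>n. \<forall>i\<ge>n. integrable N (\<lambda>x. ?s (r i) x - k x) \<and> (LINT x|N. \<bar>?s (r i) x - k x\<bar>) \<le> e" if e: "e > 0" for e
  proof -
    obtain n where n: "\<And>i j. i \<ge> n \<Longrightarrow> j \<ge> n \<Longrightarrow> (LINT x|N. norm (?s i x - ?s j x)) < e"
      using cauchy[OF e] by blast
    have "integrable N (\<lambda>x. ?s (r i) x - k x) \<and> (LINT x|N. \<bar>?s (r i) x - k x\<bar>) \<le> e" if i: "i \<ge> n" for i
    proof -
      \<comment> \<open>Fatou's lemma in \<open>j\<close> transfers the L1 Cauchy estimate to the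
        almost everywhere limit \<open>k\<close>.\<close>
      have "(\<integral>\<^sup>+x. ennreal \<bar>?s (r i) x - k x\<bar> \<partial>N) = (\<integral>\<^sup>+x. liminf (\<lambda>j. ennreal \<bar>?s (r i) x - ?s (r j) x\<bar>) \<partial>N)"
      proof (rule nn_integral_cong_AE)
        show "AE x in N. ennreal \<bar>?s (r i) x - k x\<bar> = liminf (\<lambda>j. ennreal \<bar>?s (r i) x - ?s (r j) x\<bar>)"
          using conv
        proof eventually_elim
          case (elim x)
          have "(\<lambda>j. ennreal \<bar>?s (r i) x - ?s (r j) x\<bar>) \<longlonglongrightarrow> ennreal \<bar>?s (r i) x - k x\<bar>"
            by (intro tendsto_ennrealI tendsto_rabs tendsto_diff tendsto_const elim)
          from lim_imp_Liminf[OF trivial_limit_sequentially this] show ?case by (rule sym)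
        qed
      qed
      also have "\<dots> \<le> liminf (\<lambda>j. \<integral>\<^sup>+x. ennreal \<bar>?s (r i) x - ?s (r j) x\<bar> \<partial>N)"
        by (rule nn_integral_liminf) simp
      also have "\<dots> \<le> liminf (\<lambda>j. ennreal e)"
      proof (rule Liminf_mono)
        show "\<forall>\<^sub>F j in sequentially. (\<integral>\<^sup>+x. ennreal \<bar>?s (r i) x - ?s (r j) x\<bar> \<partial>N) \<le> ennreal e"
          using eventually_ge_at_top[of n]
        proof eventually_elim
          case (elim j)
          have "r i \<ge> n" "r j \<ge> n" using r(1) i elim seq_suble le_trans by blast+
          from n[OF this] show ?case
            by (subst nn_integral_eq_integral) (use int1 w(1) in \<open>auto intro!: ennreal_leI\<close>)
        qed
      qed
      finally have fin: "(\<integral>\<^sup>+x. ennreal \<bar>?s (r i) x - k x\<bar> \<partial>N) \<le> ennreal e"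
        by (simp only: Liminf_const[OF trivial_limit_sequentially])
      have int: "integrable N (\<lambda>x. ?s (r i) x - k x)"
        by (rule integrableI_bounded) (use fin in \<open>auto intro: le_less_trans\<close>)
      moreover have "(LINT x|N. \<bar>?s (r i) x - k x\<bar>) \<le> e"
        using fin e by (subst (asm) nn_integral_eq_integral) (use int in auto)
      ultimately show ?thesis by blast
    qed
    then show ?thesis by blast
  qed
  have ik: "integrable N k"
  proof -
    obtain n where "integrable N (\<lambda>x. ?s (r n) x - k x)" using tail[of 1] by auto
    from Bochner_Integration.integrable_diff[OF int1[OF w(1)[of "r n"]] this]
    show ?thesis by simp
  qed
  have "\<Lambda> g = (LINT x|N. k x * tr g x)" if g: "g \<in> E" for g
  proof -
    obtain B where B: "\<And>x. \<bar>tr g x\<bar> \<le> B" using bdd[OF g] by blast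
    have B0: "B \<ge> 0" using B order_trans[OF abs_ge_zero] by blast
    have ikg: "integrable N (\<lambda>x. k x * tr g x)"
    proof (rule Bochner_Integration.integrable_bound[where f="\<lambda>x. B * k x"])
      show "AE x in N. norm (k x * tr g x) \<le> norm (B * k x)"
      proof (rule AE_I2)
        fix x
        have "\<bar>k x\<bar> * \<bar>tr g x\<bar> \<le> \<bar>k x\<bar> * \<bar>B\<bar>"
          using B[of x] by (intro mult_left_mono) auto
        then show "norm (k x * tr g x) \<le> norm (B * k x)" by (simp add: abs_mult mult.commute)
      qed
    qed (use ik meas[OF g] in auto)
    define a where "a = (LINT x|N. k x * tr g x) - \<Lambda> g"
    define Q where "Q = (LINT x|N. (tr g x)\<^sup>2)"
    have Q0: "Q \<ge> 0" by (simp add: Q_def)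
    \<comment> \<open>First variation at an almost minimal element in the direction
      \<open>g\<close>. Half of \<open>e\<close> pays for the missing minimality, the other half for
      replacing the almost minimiser by its limit \<open>k\<close> in the pairing with
      \<open>tr g\<close>.\<close>
    have low: "0 \<le> c * a + c\<^sup>2 * Q / 2 + e" if e: "e > 0" for c e
    proof -
      define e1 where "e1 = e / 2 / ((\<bar>c\<bar> + 1) * (B + 1))"
      have e1: "e1 > 0" using e B0 by (simp add: e1_def)
      obtain n where n: "\<And>i. i \<ge> n \<Longrightarrow> integrable N (\<lambda>x. ?s (r i) x - k x)"
         "\<And>i. i \<ge> n \<Longrightarrow> (LINT x|N. \<bar>?s (r i) x - k x\<bar>) \<le> e1" using tail[OF e1] by blast
      obtain n' :: nat where n': "1 / (real n' + 1) < e / 2"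
        using e reals_Archimedean[of "e / 2"] by (auto simp: inverse_eq_divide algebra_simps)
      define i where "i = max n n'"
      have "r i \<ge> n'" using seq_suble[OF r(1), of i] by (simp add: i_def)
      then have "1 / (real (r i) + 1) \<le> 1 / (real n' + 1)" by (auto simp: frac_le)
      then have Ji: "J (w (r i)) < m + e / 2" using w(2)[of "r i"] n' by linarith
      obtain h where h: "h \<in> E" "\<And>x. tr h x = ?s (r i) x + c * tr g x" "\<Lambda> h = \<Lambda> (w (r i)) + c * \<Lambda> g"
        using lin[OF w(1) g, of "r i" c] by blast
      have 1: "m \<le> J (w (r i)) + c * ((LINT x|N. ?s (r i) x * tr g x) - \<Lambda> g) + c\<^sup>2 * Q / 2"
        using mJ[OF h(1)] Jexp[OF w(1) g h(2,3)] unfolding Q_def by simp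
      have "\<bar>(LINT x|N. ?s (r i) x * tr g x) - (LINT x|N. k x * tr g x)\<bar> = \<bar>LINT x|N. (?s (r i) x - k x) * tr g x\<bar>"
        using int2[OF w(1) g] ikg by (simp add: left_diff_distrib)
      also have "\<dots> \<le> (LINT x|N. \<bar>?s (r i) x - k x\<bar> * B)"
      proof (rule order_trans[OF integral_abs_bound], rule integral_mono')
        show "integrable N (\<lambda>x. \<bar>?s (r i) x - k x\<bar> * B)" using n(1)[of i] by (simp add: i_def)
      qed (use B B0 in \<open>auto simp: abs_mult intro!: mult_mono\<close>)
      also have "\<dots> \<le> e1 * (B + 1)"
        using n(2)[of i] B0 e1 by (simp add: i_def mult_mono)
      finally have "\<bar>c * ((LINT x|N. ?s (r i) x * tr g x) - (LINT x|N. k x * tr g x))\<bar> \<le> (\<bar>c\<bar> + 1) * (e1 * (B + 1))"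
        unfolding abs_mult by (intro mult_mono) (use B0 e1 in auto)
      also have "\<dots> = e / 2"
      proof -
        have "(\<bar>c\<bar> + 1) * (B + 1) \<noteq> 0" using B0 by auto
        moreover have "x / d * d = x" if "d \<noteq> 0" for x d :: real using that by simp
        ultimately have "e1 * ((\<bar>c\<bar> + 1) * (B + 1)) = e / 2" unfolding e1_def by blast
        then show ?thesis by (simp only: mult.commute mult.left_commute)
      qed
      finally have "c * (LINT x|N. ?s (r i) x * tr g x) - c * (LINT x|N. k x * tr g x) \<le> e / 2"
        unfolding right_diff_distrib by (rule abs_le_D1)
      then show ?thesis using 1 Ji unfolding a_def right_diff_distrib by linarith
    qed
    have low0: "0 \<le> c * a + c\<^sup>2 * Q / 2" for c
      by (rule field_le_epsilon) (use low in simp)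
    have "a = 0"
    proof (rule ccontr)
      assume a0: "a \<noteq> 0"
      \<comment> \<open>Close to the minimiser -a/Q of the quadratic expression; adding 1 to the
        denominator covers Q = 0.\<close>
      define c where "c = - a / (Q + 1)"
      have Q1: "Q + 1 > 0" using Q0 by simp
      have ca: "a = - (c * (Q + 1))" using Q1 by (simp add: c_def)
      have c0: "c \<noteq> 0" using a0 Q1 by (simp add: c_def)
      have "0 \<le> c * a + c\<^sup>2 * Q / 2" by (rule low0)
      also have "\<dots> = - (c\<^sup>2 * (Q / 2 + 1))" by (subst ca) (simp add: power2_eq_square algebra_simps)
      also have "\<dots> < 0" using Q0 c0 by (simp add: add_nonneg_pos)
      finally show False by simp
    qed
    then show ?thesis by (simp add: a_def)
  qed
  then show ?thesis using that ik by blast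
qed

context dominated_current
begin

text \<open>The L2 estimate with t = 1 makes the real part of \<open>S\<close> on real test forms
  eligible for \<open>L2_functional_density\<close>. Complex forms are recovered from their real and
  imaginary parts.\<close>

lemma density_exists:
  obtains k :: "complex \<times> complex \<Rightarrow> real" where "integrable M k"
    "\<And>\<omega>. test_form2 bidisc \<omega> \<Longrightarrow> S \<omega> = (LINT p|M. of_real (k p) * trace \<omega> p)"
proof -
  define E where "E = {\<omega>. test_form2 bidisc \<omega> \<and> (\<forall>p u v. \<omega> p u v \<in> \<real>)}"
  have z: "test_form2 bidisc (\<lambda>p u v. 0)"
    by (rule test_form2I[where K="{}"]) (auto intro: smooth_on_const bilinearI_C)
  obtain k where k: "integrable M k" "\<And>\<omega>. \<omega> \<in> E \<Longrightarrow> Re (S \<omega>) = (LINT p|M. k p * Re (trace \<omega> p))"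
  proof (rule L2_functional_density[of M E "\<lambda>\<omega> p. Re (trace \<omega> p)" "\<lambda>\<omega>. Re (S \<omega>)" "measure M UNIV / 2"])
    show "finite_measure M" by unfold_locales
    show "E \<noteq> {}" using z by (auto simp: E_def)
    fix \<omega> assume w: "\<omega> \<in> E"
    then have t: "test_form2 bidisc \<omega>" by (simp add: E_def)
    show "(\<lambda>p. Re (trace \<omega> p)) \<in> borel_measurable M" using trace_measurable[OF t] by simp
    show "\<exists>B. \<forall>x. \<bar>Re (trace \<omega> x)\<bar> \<le> B"
      using trace_bounded[OF t] by (metis abs_Re_le_cmod order_trans Sigma_mono subset_UNIV order_refl)
    show "Re (S \<omega>) \<le> (LINT x|M. (Re (trace \<omega> x))\<^sup>2) / 2 + measure M UNIV / 2"
    proof -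
      have re: "\<And>p u v. \<omega> p u v \<in> \<real>" using w unfolding E_def by blast
      show ?thesis using L2_bound(2)[OF t re, of 1] by simp
    qed
    fix \<omega>' c assume w': "\<omega>' \<in> E"
    then have t': "test_form2 bidisc \<omega>'" by (simp add: E_def)
    let ?w = "\<lambda>p u v. 1 * \<omega> p u v + complex_of_real c * \<omega>' p u v"
    have "?w \<in> E" using w w' test_form2_comb[OF t t', of 1 "complex_of_real c"] by (auto simp: E_def)
    then show "\<exists>k\<in>E. (\<forall>x. Re (trace k x) = Re (trace \<omega> x) + c * Re (trace \<omega>' x)) \<and> Re (S k) = Re (S \<omega>) + c * Re (S \<omega>')"
      by (intro bexI[of _ ?w]) (simp_all only: trace_comb S_lin[OF t t'], auto)
  qed (rule that)
  have rep: "S \<omega> = (LINT p|M. of_real (k p) * trace \<omega> p)" if t: "test_form2 bidisc \<omega>" for \<omega>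
  proof -
    let ?R = "\<lambda>\<omega> p u v. complex_of_real (Re (\<omega> p u v))"
    have real: "S (?R \<omega>) = of_real (LINT p|M. k p * Re (trace \<omega> p))" if t: "test_form2 bidisc \<omega>" for \<omega> :: form2
    proof -
      have "?R \<omega> \<in> E" using test_form2_Re[OF t] by (simp add: E_def)
      moreover have "Im (S (?R \<omega>)) = 0" using L2_bound(1)[OF test_form2_Re[OF t], of 1] by simp
      ultimately show ?thesis using k(2)[of "?R \<omega>"] by (simp add: complex_eq_iff trace_Re)
    qed
    \<comment> \<open>Multiplication by -i turns the imaginary part of \<omega> into a real part, so
      one statement about real parts covers both.\<close>
    let ?w' = "\<lambda>p u v. - \<i> * \<omega> p u v"
    have t': "test_form2 bidisc ?w'" by (rule test_form2_scale[OF t])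
    have "(\<lambda>p u v. 1 * ?R \<omega> p u v + \<i> * ?R ?w' p u v) = \<omega>"
      by (intro ext) (auto simp: complex_eq_iff)
    then have "S \<omega> = 1 * S (?R \<omega>) + \<i> * S (?R ?w')"
      using S_lin[OF test_form2_Re[OF t] test_form2_Re[OF t'], of 1 \<i>] by simp
    also have "\<dots> = of_real (LINT p|M. k p * Re (trace \<omega> p)) + \<i> * of_real (LINT p|M. k p * Im (trace \<omega> p))"
    proof -
      have "trace ?w' p = - \<i> * trace \<omega> p" for p using trace_comb[of "-\<i>" \<omega> 0 \<omega>] by simp
      then show ?thesis unfolding real[OF t] real[OF t'] by simp
    qed
    also have "\<dots> = (LINT p|M. of_real (k p) * trace \<omega> p)"
    proof -
      obtain B where B: "\<And>p. cmod (trace \<omega> p) \<le> B" using trace_bounded[OF t] by auto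
      have [measurable]: "trace \<omega> \<in> borel_measurable M" using trace_measurable[OF t] by simp
      have [measurable]: "k \<in> borel_measurable M" using k(1) by simp
      have int: "integrable M (\<lambda>p. of_real (k p) * trace \<omega> p)"
      proof (rule Bochner_Integration.integrable_bound[where f="\<lambda>x. B * k x"])
        show "AE p in M. norm (of_real (k p) * trace \<omega> p) \<le> norm (B * k p)"
        proof (rule AE_I2)
          fix p
          have "\<bar>k p\<bar> * cmod (trace \<omega> p) \<le> \<bar>k p\<bar> * \<bar>B\<bar>"
            using B[of p] by (intro mult_left_mono) auto
          then show "norm (of_real (k p) * trace \<omega> p) \<le> norm (B * k p)"
            by (simp add: norm_mult abs_mult mult.commute)
        qed
      qed (use k(1) in auto)
      have "Re (LINT p|M. of_real (k p) * trace \<omega> p) = (LINT p|M. k p * Re (trace \<omega> p))"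
        using integral_Re[OF int] by simp
      moreover have "Im (LINT p|M. of_real (k p) * trace \<omega> p) = (LINT p|M. k p * Im (trace \<omega> p))"
        using integral_Im[OF int] by simp
      ultimately show ?thesis by (simp add: complex_eq_iff)
    qed
    finally show ?thesis .
  qed
  show ?thesis using that[OF k(1) rep] .
qed

end

section \<open>Smooth functions that are almost constant along the leaves\<close>

text \<open>One representative is taken from each occupied cell of a square grid of side 1/m. Two
  points of a cell are at distance at most 2/m, and a bounded set meets O(m^2) cells.\<close>

lemma bounded_net:
  fixes T :: "complex set"
  assumes "bounded T"
  obtains C where "C \<ge> 0" "\<And>m::nat. m \<ge> 1 \<Longrightarrow> \<exists>I. finite I \<and> I \<subseteq> T \<and> real (card I) \<le> C * (real m)\<^sup>2 \<and>
     (\<forall>\<alpha>\<in>T. \<exists>\<beta>\<in>I. cmod (\<alpha> - \<beta>) \<le> 2 / real m)"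
proof -
  obtain c0 where c0: "\<And>x. x \<in> T \<Longrightarrow> cmod x \<le> c0" using assms bounded_iff by blast
  obtain c :: nat where c: "c \<ge> 1" "c0 \<le> real c" using real_arch_simple[of "max c0 1"] by auto
  have cT: "cmod x \<le> real c" if "x \<in> T" for x using c0[OF that] c(2) by linarith
  have "\<exists>I. finite I \<and> I \<subseteq> T \<and> real (card I) \<le> (9 * (real c)\<^sup>2) * (real m)\<^sup>2 \<and>
     (\<forall>\<alpha>\<in>T. \<exists>\<beta>\<in>I. cmod (\<alpha> - \<beta>) \<le> 2 / real m)" if m: "m \<ge> 1" for m :: nat
  proof -
    define cell where "cell \<alpha> = (\<lfloor>real m * Re \<alpha>\<rfloor>, \<lfloor>real m * Im \<alpha>\<rfloor>)" for \<alpha>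
    let ?B = "{- int (c * m)..int (c * m)}"
    have fl: "\<lfloor>real m * x\<rfloor> \<in> ?B" if "\<bar>x\<bar> \<le> real c" for x
    proof -
      have "\<bar>real m * x\<bar> \<le> real (c * m)" using that by (simp add: abs_mult mult.commute mult_mono)
      then have "- real (c * m) \<le> real m * x" "real m * x \<le> real (c * m)" by linarith+
      then show ?thesis by (auto simp: le_floor_iff floor_le_iff)
    qed
    have sub: "cell ` T \<subseteq> ?B \<times> ?B"
    proof
      fix y assume "y \<in> cell ` T"
      then obtain x where x: "x \<in> T" "y = cell x" by auto
      then have "\<bar>Re x\<bar> \<le> real c" "\<bar>Im x\<bar> \<le> real c" using cT[OF x(1)] abs_Re_le_cmod[of x] abs_Im_le_cmod[of x] by auto
      then show "y \<in> ?B \<times> ?B" using fl x(2) by (auto simp: cell_def)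
    qed
    define I where "I = inv_into T cell ` (cell ` T)"
    have fin: "finite (cell ` T)" by (rule finite_subset[OF sub]) simp
    have "card I \<le> card (cell ` T)" unfolding I_def by (rule card_image_le[OF fin])
    also have "\<dots> \<le> card (?B \<times> ?B)" by (rule card_mono[OF _ sub]) simp
    also have "\<dots> = (2 * c * m + 1)\<^sup>2"
    proof -
      have "card ?B = nat (int (2 * c * m + 1))" by (simp add: algebra_simps)
      then show ?thesis by (simp only: card_cartesian_product power2_eq_square nat_int)
    qed
    also have "\<dots> \<le> (3 * (c * m))\<^sup>2" using m c(1) mult_le_mono[of 1 c 1 m] by (intro power_mono) auto
    finally have "real (card I) \<le> real ((3 * (c * m))\<^sup>2)" by (simp only: of_nat_le_iff)
    then have "real (card I) \<le> (9 * (real c)\<^sup>2) * (real m)\<^sup>2" by (simp add: power_mult_distrib)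
    moreover have "I \<subseteq> T" by (auto simp: I_def inv_into_into)
    moreover have "\<exists>\<beta>\<in>I. cmod (\<alpha> - \<beta>) \<le> 2 / real m" if "\<alpha> \<in> T" for \<alpha>
    proof (intro bexI)
      let ?b = "inv_into T cell (cell \<alpha>)"
      show "?b \<in> I" using that by (auto simp: I_def)
      have "cell ?b = cell \<alpha>" using that by (simp add: f_inv_into_f)
      then have *: "\<lfloor>real m * Re ?b\<rfloor> = \<lfloor>real m * Re \<alpha>\<rfloor>" "\<lfloor>real m * Im ?b\<rfloor> = \<lfloor>real m * Im \<alpha>\<rfloor>" by (auto simp: cell_def)
      then have "\<bar>real m * Re \<alpha> - real m * Re ?b\<bar> \<le> 1" "\<bar>real m * Im \<alpha> - real m * Im ?b\<bar> \<le> 1" by linarith+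
      then have "real m * \<bar>Re \<alpha> - Re ?b\<bar> \<le> 1" "real m * \<bar>Im \<alpha> - Im ?b\<bar> \<le> 1"
        by (simp_all add: right_diff_distrib[symmetric] abs_mult)
      then have "\<bar>Re (\<alpha> - ?b)\<bar> \<le> 1 / real m" "\<bar>Im (\<alpha> - ?b)\<bar> \<le> 1 / real m" using m by (simp_all add: field_simps)
      then show "cmod (\<alpha> - ?b) \<le> 2 / real m" using cmod_le[of "\<alpha> - ?b"] by simp
    qed
    moreover have "finite I" using fin unfolding I_def by simp
    ultimately show ?thesis by (intro exI[of _ I] conjI ballI)
  qed
  then show ?thesis by (rule that[rotated]) simp_all
qed

text \<open>\<open>y\<close> are the weights, \<open>y'\<close> their derivatives, and
  \<open>Q\<close> is the mean oscillation of \<open>g\<close> about \<open>c\<close>. Subtracting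
  \<open>c\<close> from \<open>g\<close> shifts the weighted mean by a constant and leaves the
  quotient-rule expression unchanged, so both are bounded by oscillation only.\<close>

lemma weighted_mean_bounds:
  fixes y y' g :: "'i \<Rightarrow> real" and c L :: real
  assumes fin: "finite I" "I \<noteq> {}" and y: "\<And>i. i \<in> I \<Longrightarrow> y i > 0"
    and y': "\<And>i. i \<in> I \<Longrightarrow> \<bar>y' i\<bar> \<le> L * y i"
  defines "Y \<equiv> sum y I" and "Q \<equiv> (\<Sum>i\<in>I. \<bar>g i - c\<bar> * y i) / sum y I"
  shows "\<bar>(\<Sum>i\<in>I. g i * y i) / Y - c\<bar> \<le> Q"
    "\<bar>((\<Sum>i\<in>I. g i * y' i) * Y - (\<Sum>i\<in>I. g i * y i) * sum y' I) / (Y * Y)\<bar> \<le> 2 * L * Q"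
proof -
  have Y: "Y > 0" unfolding Y_def using fin y by (intro sum_pos) auto
  define P where "P = (\<Sum>i\<in>I. \<bar>g i - c\<bar> * y i)"
  have QP: "Q = P / Y" by (simp add: Q_def P_def Y_def)
  have a: "\<bar>\<Sum>i\<in>I. (g i - c) * y i\<bar> \<le> P"
    unfolding P_def by (rule order_trans[OF sum_abs sum_mono]) (use y in \<open>auto simp: abs_mult less_imp_le\<close>)
  have b: "\<bar>\<Sum>i\<in>I. (g i - c) * y' i\<bar> \<le> L * P"
    unfolding P_def sum_distrib_left
  proof (rule order_trans[OF sum_abs sum_mono])
    fix i assume "i \<in> I"
    then show "\<bar>(g i - c) * y' i\<bar> \<le> L * (\<bar>g i - c\<bar> * y i)"
      using mult_left_mono[OF y'[OF \<open>i \<in> I\<close>], of "\<bar>g i - c\<bar>"] by (simp add: abs_mult mult.commute mult.left_commute)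
  qed
  have d: "\<bar>sum y' I\<bar> \<le> L * Y"
    unfolding Y_def sum_distrib_left by (rule order_trans[OF sum_abs sum_mono]) (use y' in auto)
  have P0: "P \<ge> 0" unfolding P_def by (intro sum_nonneg mult_nonneg_nonneg) (use y in \<open>auto simp: less_imp_le\<close>)
  have s1: "(\<Sum>i\<in>I. (g i - c) * y i) = (\<Sum>i\<in>I. g i * y i) - c * Y"
    unfolding Y_def by (simp add: left_diff_distrib sum_subtractf sum_distrib_left)
  have s2: "(\<Sum>i\<in>I. (g i - c) * y' i) = (\<Sum>i\<in>I. g i * y' i) - c * sum y' I"
    by (simp add: left_diff_distrib sum_subtractf sum_distrib_left)
  have "(\<Sum>i\<in>I. g i * y i) / Y - c = (\<Sum>i\<in>I. (g i - c) * y i) / Y"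
    unfolding s1 using Y by (simp add: field_simps)
  then show "\<bar>(\<Sum>i\<in>I. g i * y i) / Y - c\<bar> \<le> Q"
    using a Y by (simp add: QP abs_divide divide_right_mono)
  have "(\<Sum>i\<in>I. g i * y' i) * Y - (\<Sum>i\<in>I. g i * y i) * sum y' I
     = (\<Sum>i\<in>I. (g i - c) * y' i) * Y - (\<Sum>i\<in>I. (g i - c) * y i) * sum y' I"
    unfolding s1 s2 by (simp add: algebra_simps)
  also have "\<bar>\<dots>\<bar> \<le> (L * P) * Y + P * (L * Y)"
  proof (rule order_trans[OF abs_triangle_ineq4 add_mono])
    show "\<bar>(\<Sum>i\<in>I. (g i - c) * y' i) * Y\<bar> \<le> L * P * Y" using b Y by (simp add: abs_mult)
    show "\<bar>(\<Sum>i\<in>I. (g i - c) * y i) * sum y' I\<bar> \<le> P * (L * Y)"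
      unfolding abs_mult by (rule mult_mono[OF a d P0]) simp
  qed
  also have "\<dots> = 2 * L * Q * (Y * Y)" using Y by (simp add: QP)
  finally show "\<bar>((\<Sum>i\<in>I. g i * y' i) * Y - (\<Sum>i\<in>I. g i * y i) * sum y' I) / (Y * Y)\<bar> \<le> 2 * L * Q"
    using Y by (simp add: abs_divide pos_divide_le_eq)
qed

context graph_lamination
begin

text \<open>On a leaf this is (1 + gap^2/\<epsilon>^2)^(-7). A rational profile keeps the
  logarithmic derivative under control at every distance, also where the weight is tiny. The power 7
  is chosen so that leaves far from \<beta> are negligible: each has weight at most n^(-42), against
  O(n^36) leaves in the net.\<close>

definition bump_weight :: "real \<Rightarrow> complex \<Rightarrow> C2 \<Rightarrow> real" where
  "bump_weight \<epsilon> \<beta> p = inverse (1 + (cmod (snd p - \<phi> \<beta> (fst p)))\<^sup>2 / (25 * \<epsilon>\<^sup>2)) ^ 7"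

lemma bump_weight_pos: "bump_weight \<epsilon> \<beta> p > 0"
  unfolding bump_weight_def by (intro zero_less_power positive_imp_inverse_positive add_pos_nonneg) auto

lemma smooth_on_bump_weight:
  assumes "\<beta> \<in> \<tau>"
  shows "smooth_on (unit_disc \<times> UNIV) (\<lambda>p. complex_of_real (bump_weight \<epsilon> \<beta> p))"
proof -
  have o: "open (unit_disc \<times> (UNIV :: complex set))" by (intro open_Times) auto
  have 1: "smooth_on (unit_disc \<times> UNIV) (\<lambda>p. \<phi> \<beta> (fst p))"
    by (intro smooth_on_fst smooth_on_holomorphic hol assms open_ball)
  have 2: "smooth_on (unit_disc \<times> UNIV) (snd :: C2 \<Rightarrow> complex)"
    by (rule smooth_on_bounded_linear[OF o bounded_linear_snd])
  have 3: "smooth_on (unit_disc \<times> UNIV) (\<lambda>p. complex_of_real ((cmod (snd p - \<phi> \<beta> (fst p)))\<^sup>2))"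
    by (intro smooth_on_norm2 smooth_on_diff 1 2 o)
  have 4: "smooth_on (unit_disc \<times> UNIV) (\<lambda>p. 1 + complex_of_real ((cmod (snd p - \<phi> \<beta> (fst p)))\<^sup>2) * complex_of_real (1 / (25 * \<epsilon>\<^sup>2)))"
    by (intro smooth_on_add smooth_on_mult smooth_on_const 3 o)
  have "smooth_on (unit_disc \<times> UNIV) (\<lambda>p. inverse (1 + complex_of_real ((cmod (snd p - \<phi> \<beta> (fst p)))\<^sup>2) * complex_of_real (1 / (25 * \<epsilon>\<^sup>2))) ^ 7)"
  proof (intro smooth_on_power smooth_on_inverse 4 o)
    fix p :: C2
    have "1 + (cmod (snd p - \<phi> \<beta> (fst p)))\<^sup>2 * (1 / (25 * \<epsilon>\<^sup>2)) > 0" by (intro add_pos_nonneg) auto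
    then have "complex_of_real (1 + (cmod (snd p - \<phi> \<beta> (fst p)))\<^sup>2 * (1 / (25 * \<epsilon>\<^sup>2))) \<noteq> 0"
      by (simp only: of_real_eq_0_iff)
    then show "1 + complex_of_real ((cmod (snd p - \<phi> \<beta> (fst p)))\<^sup>2) * complex_of_real (1 / (25 * \<epsilon>\<^sup>2)) \<noteq> 0"
      by simp
  qed
  then show ?thesis by (simp add: bump_weight_def)
qed

lemma bump_weight_leaf:
  assumes "\<epsilon> > 0"
  shows "bump_weight \<epsilon> \<beta> (z, \<phi> \<alpha> z) = inverse (1 + (gap \<alpha> \<beta> z)\<^sup>2 / \<epsilon>\<^sup>2) ^ 7"
  by (simp add: bump_weight_def gap_def power_divide)

text \<open>With h = 1 + d^2/\<epsilon>^2 and \<open>d\<close> the gap, the logarithmic derivative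
  is -7 h'/h. The log-Lipschitz slope bounds |h'| by 8 d^2 (-ln d)/\<epsilon>^2, and division by
  \<open>h\<close> replaces \<epsilon>^2 by \<epsilon>^2 + d^2; comparing -ln d with -ln \<epsilon>
  yields 56 = 7 * 8.\<close>

lemma bump_weight_leaf_deriv:
  assumes "\<epsilon> > 0" "\<epsilon> \<le> 1" "\<alpha> \<in> \<tau>" "\<beta> \<in> \<tau>" "cmod z \<le> 1/2" "cmod v = 1"
  obtains y' where "((\<lambda>t. bump_weight \<epsilon> \<beta> (z + of_real t * v, \<phi> \<alpha> (z + of_real t * v))) has_real_derivative y') (at 0)"
    "\<bar>y'\<bar> \<le> 56 * (1 - ln \<epsilon>) * bump_weight \<epsilon> \<beta> (z, \<phi> \<alpha> z)"
proof -
  have zd: "z \<in> unit_disc" using assms by simp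
  define f where "f t = \<phi> \<alpha> (z + of_real t * v) - \<phi> \<beta> (z + of_real t * v)" for t :: real
  define f' where "f' = (deriv (\<phi> \<alpha>) z - deriv (\<phi> \<beta>) z) * v"
  have df: "(f has_vector_derivative f') (at 0)"
  proof -
    have l: "((\<lambda>t::real. z + of_real t * v) has_vector_derivative v) (at 0)"
      by (auto intro!: derivative_eq_intros simp: has_vector_derivative_def scaleR_conv_of_real)
    have "((\<lambda>t::real. \<phi> \<gamma> (z + of_real t * v)) has_vector_derivative v * deriv (\<phi> \<gamma>) z) (at 0)" if "\<gamma> \<in> \<tau>" for \<gamma>
      using field_vector_diff_chain_at[OF l, of "\<phi> \<gamma>" "deriv (\<phi> \<gamma>) z"] deriv_exists[OF that zd] by (simp add: o_def)
    from has_vector_derivative_diff[OF this[OF assms(3)] this[OF assms(4)]]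
    show ?thesis unfolding f_def f'_def by (simp add: algebra_simps)
  qed
  define h where "h t = 1 + (cmod (f t))\<^sup>2 / (25 * \<epsilon>\<^sup>2)" for t
  define h' where "h' = 2 * (f 0 \<bullet> f') / (25 * \<epsilon>\<^sup>2)"
  have dn: "((\<lambda>t. (cmod (f t))\<^sup>2) has_real_derivative 2 * (f 0 \<bullet> f')) (at 0)"
    unfolding power2_norm_eq_inner
    by (rule has_derivative_imp_has_field_derivative[OF has_derivative_inner[OF df[unfolded has_vector_derivative_def] df[unfolded has_vector_derivative_def]]])
       (simp add: inner_commute algebra_simps)
  have dh: "(h has_real_derivative h') (at 0)"
    unfolding h_def h'_def using DERIV_add[OF DERIV_const DERIV_cdivide[OF dn], of 1] by simp
  have h0: "h t > 0" for t unfolding h_def by (intro add_pos_nonneg) auto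
  define Y where "Y = inverse (h 0) ^ 7"
  define y' where "y' = - 7 * (h' / h 0) * Y"
  have "((\<lambda>t. inverse (h t) ^ 7) has_real_derivative y') (at 0)"
  proof -
    have "((\<lambda>t. inverse (h t)) has_real_derivative - (inverse (h 0) * h' * inverse (h 0))) (at 0)"
      by (rule DERIV_inverse'[OF dh]) (use h0[of 0] in simp)
    from DERIV_power[OF this, of 7]
    show ?thesis unfolding y'_def Y_def by (simp add: field_simps power_Suc numeral_eq_Suc)
  qed
  moreover have "bump_weight \<epsilon> \<beta> (z + of_real t * v, \<phi> \<alpha> (z + of_real t * v)) = inverse (h t) ^ 7" for t
    by (simp add: bump_weight_def h_def f_def)
  ultimately have D: "((\<lambda>t. bump_weight \<epsilon> \<beta> (z + of_real t * v, \<phi> \<alpha> (z + of_real t * v))) has_real_derivative y') (at 0)"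
    by simp
  have Y: "Y = bump_weight \<epsilon> \<beta> (z, \<phi> \<alpha> z)" "Y > 0" using bump_weight_pos by (auto simp: Y_def bump_weight_def h_def f_def)
  define d where "d = gap \<alpha> \<beta> z"
  have d0: "d \<ge> 0" by (simp add: d_def gap_nonneg)
  have fd: "cmod (f 0) = 5 * d" by (simp add: d_def gap_def f_def)
  have hd: "h 0 = 1 + d\<^sup>2 / \<epsilon>\<^sup>2" unfolding h_def fd by (simp add: power_mult_distrib)
  have hb: "\<bar>h' / h 0\<bar> \<le> 8 * (1 - ln \<epsilon>)"
  proof (cases "d = 0")
    case True
    then have "h' = 0" using fd by (simp add: h'_def)
    moreover have "ln \<epsilon> \<le> 0" using assms(1,2) by simp
    ultimately show ?thesis by simp
  next
    case False
    then have dp: "d > 0" using d0 by simp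
    then have ne: "\<alpha> \<noteq> \<beta>" by (auto simp: d_def gap_def)
    have "cmod f' / 5 \<le> 4 * d * (- ln d)"
      using gap_deriv[OF assms(3,4) ne assms(5)] assms(6) by (simp add: f'_def norm_mult d_def)
    then have fb: "cmod f' \<le> 20 * d * (- ln d)" by simp
    have "\<bar>h'\<bar> \<le> 2 * (cmod (f 0) * cmod f') / (25 * \<epsilon>\<^sup>2)"
      unfolding h'_def using Cauchy_Schwarz_ineq2[of "f 0" f'] by (simp add: abs_mult divide_right_mono)
    also have "\<dots> \<le> 2 * (5 * d * (20 * d * (- ln d))) / (25 * \<epsilon>\<^sup>2)"
      unfolding fd using fb d0 by (intro divide_right_mono mult_left_mono) auto
    also have "\<dots> = 8 * (d\<^sup>2 * (- ln d)) / \<epsilon>\<^sup>2" by (simp add: power2_eq_square)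
    finally have h'b: "\<bar>h'\<bar> \<le> 8 * (d\<^sup>2 * (- ln d)) / \<epsilon>\<^sup>2" .
    \<comment> \<open>This trades ln d for ln \<epsilon> at the price of \<epsilon>/d, which becomes
      d \<epsilon> after multiplication by d^2 and is absorbed by \<epsilon>^2 + d^2.\<close>
    have "ln (\<epsilon> / d) \<le> \<epsilon> / d - 1" using dp assms(1) by (intro ln_le_minus_one) auto
    then have "- ln d \<le> - ln \<epsilon> + \<epsilon> / d" using dp assms(1) by (simp add: ln_div)
    then have "d\<^sup>2 * (- ln d) \<le> d\<^sup>2 * (- ln \<epsilon> + \<epsilon> / d)" by (intro mult_left_mono) auto
    also have "\<dots> = d\<^sup>2 * (- ln \<epsilon>) + d * \<epsilon>" using dp by (simp add: power2_eq_square field_simps)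
    also have "\<dots> \<le> (\<epsilon>\<^sup>2 + d\<^sup>2) * (- ln \<epsilon>) + (\<epsilon>\<^sup>2 + d\<^sup>2)"
    proof (rule add_mono)
      show "d\<^sup>2 * (- ln \<epsilon>) \<le> (\<epsilon>\<^sup>2 + d\<^sup>2) * (- ln \<epsilon>)" using assms(1,2) by (intro mult_right_mono) auto
      have "0 \<le> (d - \<epsilon>)\<^sup>2" by simp
      moreover have "0 \<le> \<epsilon>\<^sup>2 + d\<^sup>2" by simp
      ultimately show "d * \<epsilon> \<le> \<epsilon>\<^sup>2 + d\<^sup>2" unfolding power2_diff by linarith
    qed
    finally have "d\<^sup>2 * (- ln d) \<le> (\<epsilon>\<^sup>2 + d\<^sup>2) * (1 - ln \<epsilon>)" by (simp add: algebra_simps)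
    then have "8 * (d\<^sup>2 * (- ln d)) / \<epsilon>\<^sup>2 \<le> 8 * ((\<epsilon>\<^sup>2 + d\<^sup>2) * (1 - ln \<epsilon>)) / \<epsilon>\<^sup>2"
      by (intro divide_right_mono mult_left_mono) auto
    also have "\<dots> = 8 * (1 - ln \<epsilon>) * h 0" unfolding hd using assms(1) by (simp add: field_simps)
    finally have "\<bar>h'\<bar> \<le> 8 * (1 - ln \<epsilon>) * h 0" using h'b by linarith
    then show ?thesis using h0[of 0] by (simp add: abs_divide pos_divide_le_eq)
  qed
  have "\<bar>y'\<bar> = 7 * \<bar>h' / h 0\<bar> * Y" unfolding y'_def abs_mult using Y by simp
  also have "\<dots> \<le> 7 * (8 * (1 - ln \<epsilon>)) * Y" using hb Y by (intro mult_right_mono mult_left_mono) auto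
  finally have "\<bar>y'\<bar> \<le> 56 * (1 - ln \<epsilon>) * Y" by simp
  then show ?thesis using that[OF D] Y(1) by simp
qed

lemma leaf_curve_derivative:
  assumes "\<alpha> \<in> \<tau>" "z \<in> unit_disc" "(G has_derivative G') (at (z, \<phi> \<alpha> z))"
  shows "((\<lambda>t::real. G (z + of_real t * v, \<phi> \<alpha> (z + of_real t * v))) has_vector_derivative G' (v, deriv (\<phi> \<alpha>) z * v)) (at 0)"
proof -
  have l: "((\<lambda>t::real. z + of_real t * v) has_vector_derivative v) (at 0)"
    by (auto intro!: derivative_eq_intros simp: has_vector_derivative_def scaleR_conv_of_real)
  have "((\<lambda>t::real. \<phi> \<alpha> (z + of_real t * v)) has_vector_derivative v * deriv (\<phi> \<alpha>) z) (at 0)"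
    using field_vector_diff_chain_at[OF l, of "\<phi> \<alpha>" "deriv (\<phi> \<alpha>) z"] deriv_exists[OF assms(1,2)] by (simp add: o_def)
  from has_vector_derivative_Pair[OF l this] 
  have c: "((\<lambda>t::real. (z + of_real t * v, \<phi> \<alpha> (z + of_real t * v))) has_vector_derivative (v, deriv (\<phi> \<alpha>) z * v)) (at 0)"
    by (simp add: mult.commute)
  have "(G has_derivative G') (at (z + complex_of_real 0 * v, \<phi> \<alpha> (z + complex_of_real 0 * v)))" using assms(3) by simp
  from has_derivative_compose[OF c[unfolded has_vector_derivative_def] this]
  show ?thesis
    unfolding has_vector_derivative_def
    by (simp add: linear_scale[OF has_derivative_linear[OF assms(3)]] del: scaleR_Pair)
qed

text \<open>The holonomy of the lamination is only Hoelder continuous, but the slope of the leaves is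
  log-Lipschitz in the transversal. Hence the average of the values of \<open>g\<close> over a net of leaves, with weights
  concentrated at scale \<open>\<epsilon>\<close>, has leafwise derivative \<open>O(osc g * log (1/\<epsilon>))\<close>. Here the net has mesh
  of order \<open>\<epsilon>\<^sup>3\<close>, \<open>\<epsilon> = n\<^sup>-\<^sup>6\<close>, and the leaves at distance more than \<open>5/n\<close> have negligible weight.\<close>

lemma leafwise_constant_approximation:
  fixes g :: "complex \<Rightarrow> real"
  assumes lip: "\<And>\<alpha> \<beta>. \<alpha> \<in> \<tau> \<Longrightarrow> \<beta> \<in> \<tau> \<Longrightarrow> \<bar>g \<alpha> - g \<beta>\<bar> \<le> \<Lambda> * cmod (\<alpha> - \<beta>)" and "\<Lambda> \<ge> 0"
    and bnd: "\<And>\<alpha>. \<alpha> \<in> \<tau> \<Longrightarrow> \<bar>g \<alpha>\<bar> \<le> \<Gamma>" and e: "e > 0"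
  shows "\<exists>G :: C2 \<Rightarrow> real. smooth_on (unit_disc \<times> UNIV) (\<lambda>p. complex_of_real (G p)) \<and>
    ((\<forall>\<alpha>\<in>\<tau>. 0 \<le> g \<alpha>) \<longrightarrow> (\<forall>p. 0 \<le> G p)) \<and>
    (\<forall>\<alpha> z. \<alpha> \<in> \<tau> \<longrightarrow> cmod z \<le> 1/2 \<longrightarrow> \<bar>G (z, \<phi> \<alpha> z) - g \<alpha>\<bar> \<le> e) \<and>
    (\<forall>\<alpha> z v. \<alpha> \<in> \<tau> \<longrightarrow> cmod z \<le> 1/2 \<longrightarrow> cmod v = 1 \<longrightarrow>
       cmod (frechet_derivative (\<lambda>p. complex_of_real (G p)) (at (z, \<phi> \<alpha> z)) (v, deriv (\<phi> \<alpha>) z * v)) \<le> e)"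
proof (cases "\<tau> = {}")
  case True
  show ?thesis by (rule exI[of _ "\<lambda>p. 0"]) (use True smooth_on_const[of _ 0] in auto)
next
  case False
  obtain C where C: "C \<ge> 0" "\<And>m::nat. m \<ge> 1 \<Longrightarrow> \<exists>I. finite I \<and> I \<subseteq> \<tau> \<and> real (card I) \<le> C * (real m)\<^sup>2 \<and>
     (\<forall>\<alpha>\<in>\<tau>. \<exists>\<beta>\<in>I. cmod (\<alpha> - \<beta>) \<le> 2 / real m)"
    using bounded_net[OF compact_imp_bounded[OF compact_tau]] by metis
  have G0: "\<Gamma> \<ge> 0" using bnd False by fastforce
  \<comment> \<open>\<open>q n\<close> bounds the mean oscillation: 5 \<Lambda>/n comes from the
    near leaves, and the far leaves contribute the second term, with 2^7 the reciprocal of a lower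
    bound for the total weight. \<open>l n\<close> bounds the logarithmic derivatives of the
    weights, and the product \<open>l n * q n\<close> is of order log n / n.\<close>
  define c where "c = 5 * \<Lambda> + 2 * \<Gamma> * (C * 2 ^ 7)"
  define q where "q n = c * (1 / real n)" for n :: nat
  define l where "l n = 56 * (1 - ln ((1 / real n) ^ 6))" for n :: nat
  have "(\<lambda>n. c * (1 / real n)) \<longlonglongrightarrow> c * 0" by (intro tendsto_intros lim_1_over_n)
  then have "(\<lambda>n. q n) \<longlonglongrightarrow> 0" unfolding q_def by simp
  moreover have "(\<lambda>n. 2 * l n * q n) \<longlonglongrightarrow> 0"
  proof (rule Lim_transform_eventually)
    have "(\<lambda>n. 112 * c * (1 / real n + 6 * (ln (real n) / real n))) \<longlonglongrightarrow> 112 * c * (0 + 6 * 0)"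
      by (intro tendsto_intros lim_1_over_n lim_ln_over_n)
    then show "(\<lambda>n. 112 * c * (1 / real n + 6 * (ln (real n) / real n))) \<longlonglongrightarrow> 0" by simp
    show "\<forall>\<^sub>F n in sequentially. 112 * c * (1 / real n + 6 * (ln (real n) / real n)) = 2 * l n * q n"
      using eventually_gt_at_top[of 0]
      by eventually_elim (simp add: l_def q_def ln_realpow ln_div field_simps)
  qed
  ultimately have "\<forall>\<^sub>F n in sequentially. q n < e \<and> 2 * l n * q n < e \<and> n \<ge> 1"
    using order_tendstoD(2)[of _ 0 sequentially e] e eventually_ge_at_top[of 1] by (auto intro!: eventually_conj)
  then obtain n :: nat where n: "q n < e" "2 * l n * q n < e" "n \<ge> 1"
    using eventually_happens by force
  define \<epsilon> where "\<epsilon> = (1 / real n) ^ 6"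
  have eps: "\<epsilon> > 0" "\<epsilon> \<le> 1" using n(3) by (auto simp: \<epsilon>_def power_le_one)
  \<comment> \<open>n^18 is \<epsilon>^(-3): by \<open>gap_cube\<close> every leaf has a net leaf
    within gap \<epsilon> over the whole disc |z| <= 1/2.\<close>
  obtain I where I: "finite I" "I \<subseteq> \<tau>" "real (card I) \<le> C * (real (n ^ 18))\<^sup>2"
     "\<And>\<alpha>. \<alpha> \<in> \<tau> \<Longrightarrow> \<exists>\<beta>\<in>I. cmod (\<alpha> - \<beta>) \<le> 2 / real (n ^ 18)"
    using C(2)[of "n ^ 18"] n(3) by auto
  have Ine: "I \<noteq> {}" using I(4) False by blast
  let ?w = "bump_weight \<epsilon>"
  define G where "G p = (\<Sum>\<beta>\<in>I. g \<beta> * ?w \<beta> p) / (\<Sum>\<beta>\<in>I. ?w \<beta> p)" for p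
  have o: "open (unit_disc \<times> (UNIV :: complex set))" by (intro open_Times) auto
  have wpos: "(\<Sum>\<beta>\<in>I. ?w \<beta> p) > 0" for p using I(1) Ine bump_weight_pos by (intro sum_pos) auto
  have "smooth_on (unit_disc \<times> UNIV) (\<lambda>p. (\<Sum>\<beta>\<in>I. complex_of_real (g \<beta>) * complex_of_real (?w \<beta> p)) * inverse (\<Sum>\<beta>\<in>I. complex_of_real (?w \<beta> p)))"
  proof (intro smooth_on_mult smooth_on_sum smooth_on_inverse smooth_on_const smooth_on_bump_weight o)
    fix p show "(\<Sum>\<beta>\<in>I. complex_of_real (?w \<beta> p)) \<noteq> 0"
      using wpos[of p] by (simp only: of_real_sum[symmetric] of_real_eq_0_iff)
  qed (use I(2) in auto)
  then have Gs: "smooth_on (unit_disc \<times> UNIV) (\<lambda>p. complex_of_real (G p))"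
    by (simp add: G_def divide_inverse)
  have pos: "0 \<le> G p" if "\<forall>\<alpha>\<in>\<tau>. 0 \<le> g \<alpha>" for p
    unfolding G_def using that I(2) bump_weight_pos wpos[of p] by (intro divide_nonneg_pos sum_nonneg mult_nonneg_nonneg) (auto simp: less_imp_le)
  have est: "(\<Sum>\<beta>\<in>I. \<bar>g \<beta> - g \<alpha>\<bar> * ?w \<beta> (z, \<phi> \<alpha> z)) / (\<Sum>\<beta>\<in>I. ?w \<beta> (z, \<phi> \<alpha> z)) \<le> q n"
    if az: "\<alpha> \<in> \<tau>" "cmod z \<le> 1/2" for \<alpha> z
  proof -
    let ?p = "(z, \<phi> \<alpha> z)"
    have zd: "z \<in> unit_disc" using az by simp
    obtain \<beta>0 where b0: "\<beta>0 \<in> I" "cmod (\<alpha> - \<beta>0) \<le> 2 / real (n ^ 18)" using I(4)[OF az(1)] by blast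
    have "gap \<alpha> \<beta>0 z ^ 3 \<le> gap \<alpha> \<beta>0 0" using gap_cube(1)[OF az(1) _ az(2)] b0 I(2) by auto
    also have "\<dots> = cmod (\<alpha> - \<beta>0) / 5" using gap_0 az(1) b0(1) I(2) by auto
    also have "\<dots> \<le> 1 / real (n ^ 18)" using b0(2) n(3) by (simp add: field_simps)
    also have "\<dots> = \<epsilon> ^ 3" by (simp add: \<epsilon>_def power_mult[symmetric] power_one_over)
    finally have "gap \<alpha> \<beta>0 z \<le> \<epsilon>" using eps gap_nonneg by (simp add: power_mono_iff)
    then have "(gap \<alpha> \<beta>0 z)\<^sup>2 \<le> \<epsilon>\<^sup>2" using gap_nonneg by (intro power_mono) auto
    then have "1 + (gap \<alpha> \<beta>0 z)\<^sup>2 / \<epsilon>\<^sup>2 \<le> 2" using eps by (simp add: field_simps)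
    moreover have "1 + (gap \<alpha> \<beta>0 z)\<^sup>2 / \<epsilon>\<^sup>2 > 0" by (intro add_pos_nonneg) auto
    ultimately have "inverse 2 ^ 7 \<le> ?w \<beta>0 ?p"
      unfolding bump_weight_leaf[OF eps(1)] by (intro power_mono le_imp_inverse_le) auto
    also have "?w \<beta>0 ?p \<le> (\<Sum>\<beta>\<in>I. ?w \<beta> ?p)"
      by (rule member_le_sum[OF b0(1)]) (use I(1) bump_weight_pos in \<open>auto simp: less_imp_le\<close>)
    finally have low: "inverse 2 ^ 7 \<le> (\<Sum>\<beta>\<in>I. ?w \<beta> ?p)" .
    define far where "far = 2 * \<Gamma> * (1 / real n) ^ 42"
    have far0: "far \<ge> 0" using G0 by (simp add: far_def)
    have termwise: "\<bar>g \<beta> - g \<alpha>\<bar> * ?w \<beta> ?p \<le> (5 * \<Lambda> / real n) * ?w \<beta> ?p + far" if b: "\<beta> \<in> I" for \<beta>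
    proof (cases "cmod (\<alpha> - \<beta>) \<le> 5 / real n")
      case True
      have "\<bar>g \<beta> - g \<alpha>\<bar> \<le> \<Lambda> * cmod (\<beta> - \<alpha>)" using lip b az I(2) by auto
      also have "\<dots> \<le> \<Lambda> * (5 / real n)" using True assms(2) by (intro mult_left_mono) (auto simp: norm_minus_commute)
      finally have "\<bar>g \<beta> - g \<alpha>\<bar> \<le> 5 * \<Lambda> / real n" by (simp add: mult.commute)
      then have "\<bar>g \<beta> - g \<alpha>\<bar> * ?w \<beta> ?p \<le> (5 * \<Lambda> / real n) * ?w \<beta> ?p"
        by (rule mult_right_mono[OF _ less_imp_le[OF bump_weight_pos]])
      then show ?thesis using far0 by linarith
    next
      case False
      have bt: "\<beta> \<in> \<tau>" using b I(2) by auto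
      \<comment> \<open>A far leaf has gap at least 1/n at 0, hence at least n^(-3) at
        \<open>z\<close>. As \<epsilon> = n^(-6) is the square of that, its weight is at most
        \<epsilon>^7 = n^(-42).\<close>
      have "1 / real n \<le> gap \<alpha> \<beta> 0" using False gap_0[OF az(1) bt] by simp
      then have "(1 / real n) ^ 3 \<le> gap \<alpha> \<beta> 0 ^ 3" by (intro power_mono) auto
      also have "\<dots> \<le> gap \<alpha> \<beta> z" using gap_cube(2)[OF az(1) bt az(2)] .
      finally have g3: "(1 / real n) ^ 3 \<le> gap \<alpha> \<beta> z" .
      have n0: "(1 / real n) ^ 3 > 0" using n(3) by simp
      have "?w \<beta> ?p \<le> ((1 / real n) ^ 6) ^ 7"
        unfolding bump_weight_leaf[OF eps(1)]
      proof (intro power_mono)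
        have "((1 / real n) ^ 3)\<^sup>2 \<le> (gap \<alpha> \<beta> z)\<^sup>2" using g3 n0 by (intro power_mono) auto
        then have "\<epsilon> \<le> (gap \<alpha> \<beta> z)\<^sup>2" by (simp add: \<epsilon>_def power_mult[symmetric])
        then have "\<epsilon> / \<epsilon>\<^sup>2 \<le> (gap \<alpha> \<beta> z)\<^sup>2 / \<epsilon>\<^sup>2" by (intro divide_right_mono) auto
        moreover have "\<epsilon> / \<epsilon>\<^sup>2 = inverse \<epsilon>" using eps by (simp add: power2_eq_square field_simps)
        ultimately have "inverse \<epsilon> \<le> 1 + (gap \<alpha> \<beta> z)\<^sup>2 / \<epsilon>\<^sup>2" by linarith
        then have "inverse (1 + (gap \<alpha> \<beta> z)\<^sup>2 / \<epsilon>\<^sup>2) \<le> inverse (inverse \<epsilon>)" using eps by (intro le_imp_inverse_le) auto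
        then show "inverse (1 + (gap \<alpha> \<beta> z)\<^sup>2 / \<epsilon>\<^sup>2) \<le> (1 / real n) ^ 6" by (simp add: \<epsilon>_def)
      qed (auto intro!: add_nonneg_nonneg)
      moreover have "\<bar>g \<beta> - g \<alpha>\<bar> \<le> 2 * \<Gamma>" using bnd[OF bt] bnd[OF az(1)] by linarith
      ultimately have "\<bar>g \<beta> - g \<alpha>\<bar> * ?w \<beta> ?p \<le> (2 * \<Gamma>) * ((1 / real n) ^ 6) ^ 7"
        using bump_weight_pos[of \<epsilon> \<beta> ?p] G0 by (intro mult_mono) (auto simp: less_imp_le)
      also have "\<dots> = far" by (simp add: far_def power_mult[symmetric])
      finally show ?thesis using bump_weight_pos[of \<epsilon> \<beta> ?p] assms(2) by (simp add: add_increasing)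
    qed
    have "(\<Sum>\<beta>\<in>I. \<bar>g \<beta> - g \<alpha>\<bar> * ?w \<beta> ?p) \<le> (\<Sum>\<beta>\<in>I. (5 * \<Lambda> / real n) * ?w \<beta> ?p + far)"
      by (intro sum_mono termwise)
    also have "\<dots> = (5 * \<Lambda> / real n) * (\<Sum>\<beta>\<in>I. ?w \<beta> ?p) + real (card I) * far"
      by (simp add: sum.distrib sum_distrib_left)
    also have "real (card I) * far \<le> (C * (real (n ^ 18))\<^sup>2) * far" using I(3) far0 by (intro mult_right_mono)
    \<comment> \<open>The count n^36 is cancelled against n^(-42), with n^(-6) to spare.\<close>
    also have "(C * (real (n ^ 18))\<^sup>2) * far = (C * (real n) ^ 36) * (2 * \<Gamma> * ((1 / real n) ^ 36 * (1 / real n) ^ 6))"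
      by (simp add: far_def power_mult[symmetric] flip: power_add)
    also have "\<dots> = 2 * \<Gamma> * (C * 2 ^ 7) * (1 / real n) ^ 6 * inverse 2 ^ 7"
      using n(3) by (simp add: power_one_over field_simps)
    also have "\<dots> \<le> 2 * \<Gamma> * (C * 2 ^ 7) * (1 / real n) * (\<Sum>\<beta>\<in>I. ?w \<beta> ?p)"
    proof (rule mult_mono[OF _ low])
      have "(1 / real n) ^ 6 \<le> (1 / real n) ^ 1" using n(3) by (intro power_decreasing) auto
      then show "2 * \<Gamma> * (C * 2 ^ 7) * (1 / real n) ^ 6 \<le> 2 * \<Gamma> * (C * 2 ^ 7) * (1 / real n)"
        using C(1) G0 by (intro mult_left_mono) auto
    qed (use C(1) G0 in auto)
    finally have "(\<Sum>\<beta>\<in>I. \<bar>g \<beta> - g \<alpha>\<bar> * ?w \<beta> ?p) \<le> q n * (\<Sum>\<beta>\<in>I. ?w \<beta> ?p)"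
      by (simp add: q_def c_def distrib_right add_divide_distrib)
    then show ?thesis using wpos[of ?p] by (simp add: pos_divide_le_eq)
  qed
  have est1: "\<bar>G (z, \<phi> \<alpha> z) - g \<alpha>\<bar> \<le> e" if az: "\<alpha> \<in> \<tau>" "cmod z \<le> 1/2" for \<alpha> z
    using weighted_mean_bounds(1)[of I "\<lambda>\<beta>. ?w \<beta> (z, \<phi> \<alpha> z)" "\<lambda>_. 0" 0 g "g \<alpha>"] I(1) Ine bump_weight_pos est[OF az] n(1)
    by (simp add: G_def)
  have est2: "cmod (frechet_derivative (\<lambda>p. complex_of_real (G p)) (at (z, \<phi> \<alpha> z)) (v, deriv (\<phi> \<alpha>) z * v)) \<le> e"
    if az: "\<alpha> \<in> \<tau>" "cmod z \<le> 1/2" and v: "cmod v = 1" for \<alpha> z v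
  proof -
    have zd: "z \<in> unit_disc" using az by simp
    let ?c = "\<lambda>t::real. (z + of_real t * v, \<phi> \<alpha> (z + of_real t * v))" and ?p = "(z, \<phi> \<alpha> z)"
    have c0: "?c 0 = ?p" by simp
    have "\<exists>y'. ((\<lambda>t. ?w \<beta> (?c t)) has_real_derivative y') (at 0) \<and> \<bar>y'\<bar> \<le> l n * ?w \<beta> ?p" if "\<beta> \<in> I" for \<beta>
      using bump_weight_leaf_deriv[OF eps az(1) _ az(2) v, of \<beta>] that I(2) unfolding l_def \<epsilon>_def[symmetric] by blast
    then have "\<forall>\<beta>\<in>I. \<exists>y'. ((\<lambda>t. ?w \<beta> (?c t)) has_real_derivative y') (at 0) \<and> \<bar>y'\<bar> \<le> l n * ?w \<beta> ?p"
      by (rule ballI)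
    from bchoice[OF this] obtain y' where
      y0: "\<forall>\<beta>\<in>I. ((\<lambda>t. ?w \<beta> (?c t)) has_real_derivative y' \<beta>) (at 0) \<and> \<bar>y' \<beta>\<bar> \<le> l n * ?w \<beta> ?p"
      by (elim exE)
    note y' = conjunct1[OF bspec[OF y0]] conjunct2[OF bspec[OF y0]]
    let ?g' = "((\<Sum>\<beta>\<in>I. g \<beta> * y' \<beta>) * (\<Sum>\<beta>\<in>I. ?w \<beta> ?p) - (\<Sum>\<beta>\<in>I. g \<beta> * ?w \<beta> ?p) * sum y' I) / ((\<Sum>\<beta>\<in>I. ?w \<beta> ?p) * (\<Sum>\<beta>\<in>I. ?w \<beta> ?p))"
    have d1: "((\<lambda>t. \<Sum>\<beta>\<in>I. g \<beta> * ?w \<beta> (?c t)) has_real_derivative (\<Sum>\<beta>\<in>I. g \<beta> * y' \<beta>)) (at 0)"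
      by (intro DERIV_sum DERIV_cmult y')
    have d2: "((\<lambda>t. \<Sum>\<beta>\<in>I. ?w \<beta> (?c t)) has_real_derivative sum y' I) (at 0)"
      by (intro DERIV_sum y')
    have "((\<lambda>t. G (?c t)) has_real_derivative ?g') (at 0)"
      using DERIV_divide[OF d1 d2] wpos[of ?p] unfolding G_def c0 by simp
    then have "((\<lambda>t. complex_of_real (G (?c t))) has_vector_derivative complex_of_real ?g') (at 0)"
      by (rule has_vector_derivative_of_real)
    moreover have "?p \<in> unit_disc \<times> UNIV" using zd by simp
    note leaf_curve_derivative[OF az(1) zd smooth_on_D[OF Gs this], of v]
    ultimately have eq: "frechet_derivative (\<lambda>p. complex_of_real (G p)) (at ?p) (v, deriv (\<phi> \<alpha>) z * v) = complex_of_real ?g'"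
      by (rule vector_derivative_unique_at[rotated])
    have "\<bar>?g'\<bar> \<le> 2 * l n * ((\<Sum>\<beta>\<in>I. \<bar>g \<beta> - g \<alpha>\<bar> * ?w \<beta> ?p) / (\<Sum>\<beta>\<in>I. ?w \<beta> ?p))"
      by (rule weighted_mean_bounds(2)[OF I(1) Ine bump_weight_pos y'(2)])
    also have "\<dots> \<le> 2 * l n * q n"
    proof (intro mult_left_mono est[OF az])
      have "ln \<epsilon> \<le> 0" using eps by simp
      then show "0 \<le> 2 * l n" unfolding l_def \<epsilon>_def[symmetric] by simp
    qed
    also have "\<dots> \<le> e" using n(2) by simp
    finally show ?thesis unfolding eq by (simp only: norm_of_real)
  qed
  show ?thesis
    by (intro exI[of _ G] conjI allI impI Gs pos est1 est2)
qed

end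

section \<open>The density is constant along the leaves\<close>

lemma smooth_compact_bounded:
  assumes "smooth_on UNIV f" "compact K" "\<And>p. p \<notin> K \<Longrightarrow> f p = 0"
  obtains B where "B > 0" "\<And>p. cmod (f p) \<le> B"
proof -
  have "compact (f ` K)"
    by (intro compact_continuous_image assms(2) continuous_on_subset[OF smooth_on_continuous[OF assms(1)]]) auto
  then obtain B where B: "\<forall>x\<in>f ` K. cmod x \<le> B" using compact_imp_bounded bounded_iff by metis
  have "cmod (f p) \<le> max B 1" for p
    using B assms(3)[of p] by (cases "p \<in> K") (auto simp: max.coboundedI1)
  then show ?thesis using that[of "max B 1"] by simp
qed

lemma frechet_zero_outside:
  assumes "closed K" "\<And>p. p \<notin> K \<Longrightarrow> f p = 0" "p \<notin> K"
  shows "frechet_derivative f (at p) v = 0"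
proof -
  have "((\<lambda>p. 0) has_derivative (\<lambda>v. 0)) (at p)" by simp
  then have "(f has_derivative (\<lambda>v. 0)) (at p)"
    by (rule has_derivative_transform_within_open[OF _ open_Compl[OF assms(1)]]) (use assms in auto)
  then show ?thesis using frechet_derivative_at by metis
qed

lemma smooth_compact_deriv_bounded:
  fixes f :: "'a::euclidean_space \<Rightarrow> complex"
  assumes "smooth_on UNIV f" "compact K" "\<And>p. p \<notin> K \<Longrightarrow> f p = 0"
  obtains B where "B > 0" "\<And>p v. cmod (frechet_derivative f (at p) v) \<le> B * norm v"
proof -
  have "\<exists>B>0. \<forall>p. cmod (frechet_derivative f (at p) e) \<le> B" for e
    using smooth_compact_bounded[OF smooth_on_frechet[OF assms(1), of e] assms(2)
        frechet_zero_outside[OF compact_imp_closed[OF assms(2)] assms(3)]] by metis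
  then obtain B where B: "\<And>e. B e > 0" "\<And>e p. cmod (frechet_derivative f (at p) e) \<le> B e" by metis
  have "cmod (frechet_derivative f (at p) v) \<le> (\<Sum>e\<in>Basis. B e) * norm v" for p v
  proof -
    have lin: "linear (frechet_derivative f (at p))"
      using smooth_on_D[OF assms(1)] has_derivative_linear by blast
    have "frechet_derivative f (at p) v = frechet_derivative f (at p) (\<Sum>e\<in>Basis. (v \<bullet> e) *\<^sub>R e)"
      by (simp add: euclidean_representation)
    also have "\<dots> = (\<Sum>e\<in>Basis. (v \<bullet> e) *\<^sub>R frechet_derivative f (at p) e)"
      by (simp add: linear_sum[OF lin] linear_scale[OF lin])
    also have "cmod \<dots> \<le> (\<Sum>e\<in>Basis. norm v * B e)"
      by (intro sum_norm_le) (use B Basis_le_norm in \<open>auto intro!: mult_mono\<close>)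
    finally show ?thesis by (simp add: sum_distrib_left mult.commute)
  qed
  moreover have "(\<Sum>e\<in>(Basis::'a set). B e) > 0" using B(1) by (intro sum_pos) auto
  ultimately show ?thesis using that by blast
qed

lemma smooth_compact_lipschitz:
  fixes f :: "'a::euclidean_space \<Rightarrow> complex"
  assumes "smooth_on UNIV f" "compact K" "\<And>p. p \<notin> K \<Longrightarrow> f p = 0"
  obtains B where "B > 0" "\<And>p q. cmod (f p - f q) \<le> B * norm (p - q)"
proof -
  obtain B where B: "B > 0" "\<And>p v. cmod (frechet_derivative f (at p) v) \<le> B * norm v"
    using smooth_compact_deriv_bounded[OF assms] by metis
  have "cmod (f p - f q) \<le> B * norm (p - q)" for p q
  proof (rule differentiable_bound[of UNIV])
    show "(f has_derivative frechet_derivative f (at x)) (at x within UNIV)" for x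
      using smooth_on_D[OF assms(1)] by simp
    show "onorm (frechet_derivative f (at x)) \<le> B" for x by (rule onorm_le[OF B(2)])
  qed auto
  then show ?thesis using that B(1) by blast
qed

context dominated_current
begin

definition leaf_density :: "complex \<times> complex \<Rightarrow> real" where
  "leaf_density = (SOME k. integrable M k \<and> (\<forall>\<omega>. test_form2 bidisc \<omega> \<longrightarrow> S \<omega> = (LINT p|M. of_real (k p) * trace \<omega> p)))"

lemma integrable_density: "integrable M leaf_density"
  and S_density: "test_form2 bidisc \<omega> \<Longrightarrow> S \<omega> = (LINT p|M. of_real (leaf_density p) * trace \<omega> p)"
proof -
  have "\<exists>k. integrable M k \<and> (\<forall>\<omega>. test_form2 bidisc \<omega> \<longrightarrow> S \<omega> = (LINT p|M. of_real (k p) * trace \<omega> p))"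
    using density_exists by metis
  from someI_ex[OF this]
  show "integrable M leaf_density" "test_form2 bidisc \<omega> \<Longrightarrow> S \<omega> = (LINT p|M. of_real (leaf_density p) * trace \<omega> p)"
    unfolding leaf_density_def by auto
qed

lemma density_measurable [measurable]: "leaf_density \<in> borel_measurable borel"
  using integrable_density by simp

lemma integrable_density_mult:
  fixes f :: "complex \<times> complex \<Rightarrow> complex"
  assumes "f \<in> borel_measurable borel" "\<And>p. cmod (f p) \<le> B"
  shows "integrable M (\<lambda>p. of_real (leaf_density p) * f p)"
proof (rule Bochner_Integration.integrable_bound[where f="\<lambda>p. B * leaf_density p"])
  have [measurable]: "f \<in> borel_measurable M" "leaf_density \<in> borel_measurable M" using assms(1) by simp_all
  show "(\<lambda>p. of_real (leaf_density p) * f p) \<in> borel_measurable M" by measurable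
  show "AE p in M. norm (of_real (leaf_density p) * f p) \<le> norm (B * leaf_density p)"
  proof (rule AE_I2)
    fix p
    have "\<bar>leaf_density p\<bar> * cmod (f p) \<le> \<bar>leaf_density p\<bar> * \<bar>B\<bar>"
      using assms(2)[of p] by (intro mult_left_mono) auto
    then show "norm (of_real (leaf_density p) * f p) \<le> norm (B * leaf_density p)"
      by (simp add: norm_mult abs_mult mult.commute)
  qed
qed (use integrable_density in auto)

text \<open>Only integrability of the density is exploited from here on, so an approximation of a
  test function has to be uniform almost everywhere.\<close>

lemma density_integral_bound:
  fixes f :: "complex \<times> complex \<Rightarrow> complex"
  assumes "f \<in> borel_measurable borel" "AE p in M. cmod (f p) \<le> B" "\<And>p. cmod (f p) \<le> B'"
  shows "cmod (LINT p|M. of_real (leaf_density p) * f p) \<le> B * (LINT p|M. \<bar>leaf_density p\<bar>)"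
proof -
  have "cmod (LINT p|M. of_real (leaf_density p) * f p) \<le> (LINT p|M. norm (of_real (leaf_density p) * f p))"
    by (rule integral_norm_bound)
  also have "\<dots> \<le> (LINT p|M. B * \<bar>leaf_density p\<bar>)"
  proof (rule integral_mono_AE)
    show "integrable M (\<lambda>p. norm (of_real (leaf_density p) * f p))"
      using integrable_density_mult[OF assms(1,3)] by simp
    show "AE p in M. norm (of_real (leaf_density p) * f p) \<le> B * \<bar>leaf_density p\<bar>"
      using assms(2) by eventually_elim (simp add: norm_mult mult.commute mult_right_mono)
  qed (use integrable_density in auto)
  also have "\<dots> = B * (LINT p|M. \<bar>leaf_density p\<bar>)" by simp
  finally show ?thesis .
qed

text \<open>Lipschitz functions are what \<open>leafwise_constant_approximation\<close> accepts and
  what distance functions supply. The bound 1/2 on the support, with a drift of at most 1/4, keeps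
  the leaves that matter below height 3/4, inside the bidisc with room for a cutoff.\<close>

definition transversal_test :: "(complex \<Rightarrow> real) \<Rightarrow> bool" where
  "transversal_test g \<longleftrightarrow> (\<exists>\<Lambda>\<ge>0. \<forall>\<alpha> \<beta>. \<bar>g \<alpha> - g \<beta>\<bar> \<le> \<Lambda> * cmod (\<alpha> - \<beta>)) \<and> (\<exists>\<Gamma>. \<forall>\<alpha>. \<bar>g \<alpha>\<bar> \<le> \<Gamma>) \<and>
     (\<forall>\<alpha>. cmod \<alpha> \<ge> 1/2 \<longrightarrow> g \<alpha> = 0)"

lemma transversal_test_measurable [measurable]: assumes "transversal_test g" shows "g \<in> borel_measurable borel"
proof (rule borel_measurable_continuous_onI)
  obtain \<Lambda> where L: "\<Lambda> \<ge> 0" "\<And>\<alpha> \<beta>. \<bar>g \<alpha> - g \<beta>\<bar> \<le> \<Lambda> * cmod (\<alpha> - \<beta>)"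
    using assms unfolding transversal_test_def by blast
  show "continuous_on UNIV g"
    by (rule lipschitz_on_continuous_on[of \<Lambda>]) (use L in \<open>auto simp: lipschitz_on_def dist_norm\<close>)
qed

definition leaf_extension :: "(complex \<Rightarrow> complex) \<Rightarrow> (complex \<Rightarrow> real) \<Rightarrow> (C2 \<Rightarrow> real) \<Rightarrow> C2 \<Rightarrow> complex" where
  "leaf_extension a \<kappa> G p = a (fst p) * complex_of_real (G p) * complex_of_real (\<kappa> (snd p))"

lemma AE_M_leaf: 
  assumes "AE \<alpha> in \<mu>. \<alpha> \<in> \<tau>" 
  shows "AE p in M. fst p \<in> unit_disc \<and> snd p \<in> \<tau>"
proof -
  have [measurable]: "\<tau> \<in> sets borel" using compact_imp_closed[OF compact_tau] by auto
  have 1: "AE z in disc_measure. z \<in> unit_disc"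
    unfolding disc_measure_def by (subst AE_density) (auto simp: indicator_def)
  have "AE z in disc_measure. AE \<alpha> in \<mu>. z \<in> unit_disc \<and> \<alpha> \<in> \<tau>"
    using 1 by eventually_elim (use assms in auto)
  moreover have "unit_disc \<times> \<tau> \<in> sets (disc_measure \<Otimes>\<^sub>M \<mu>)" by (intro pair_measureI) auto
  moreover have "unit_disc \<times> \<tau> = {p \<in> space (disc_measure \<Otimes>\<^sub>M \<mu>). fst p \<in> unit_disc \<and> snd p \<in> \<tau>}"
    by (auto simp: space_pair_measure)
  ultimately have "AE p in disc_measure \<Otimes>\<^sub>M \<mu>. fst p \<in> unit_disc \<and> snd p \<in> \<tau>"
    by (intro pair.AE_pair_measure) auto
  then show ?thesis unfolding M_def .
qed

end

text \<open>The radius 1/2 is that of the disc over which the leafwise approximation is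
  controlled.\<close>

definition disc_test :: "(complex \<Rightarrow> complex) \<Rightarrow> bool" where
  "disc_test a \<longleftrightarrow> smooth_on UNIV a \<and> (\<forall>z. cmod z > 1/2 \<longrightarrow> a z = 0)"

lemma disc_testD:
  assumes "disc_test a"
  shows "smooth_on UNIV a" "cmod z > 1/2 \<Longrightarrow> a z = 0"
  using assms unfolding disc_test_def by auto

locale dominated_leaf_current = dominated_current +
  assumes AE_tau: "AE \<alpha> in \<mu>. \<alpha> \<in> \<tau>"
begin

text \<open>\<open>H\<close> is the product of \<open>a z\<close>, the leafwise almost constant
  \<open>G\<close> and a cutoff in the vertical variable. On leaves with nonzero
  \<open>g \<alpha>\<close> the cutoff is locally 1; on the other leaves \<open>G\<close> itself is
  small, so the cutoff and its derivative only multiply small quantities.\<close>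

lemma leaf_extension_exists:
  assumes disc: "disc_test a" and g: "transversal_test g" and e: "e > 0"
  shows "\<exists>H K. smooth_on UNIV H \<and> compact K \<and> K \<subseteq> bidisc \<and> (\<forall>p. p \<notin> K \<longrightarrow> H p = 0) \<and>
    (\<forall>z \<alpha>. z \<in> unit_disc \<longrightarrow> \<alpha> \<in> \<tau> \<longrightarrow> cmod (H (z, \<phi> \<alpha> z) - a z * of_real (g \<alpha>)) \<le> e) \<and>
    (\<forall>z \<alpha> v. z \<in> unit_disc \<longrightarrow> \<alpha> \<in> \<tau> \<longrightarrow> cmod v = 1 \<longrightarrow>
       cmod (frechet_derivative H (at (z, \<phi> \<alpha> z)) (v, deriv (\<phi> \<alpha>) z * v) - frechet_derivative a (at z) v * of_real (g \<alpha>)) \<le> e) \<and>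
    ((\<forall>z. a z \<in> \<real>\<^sub>\<ge>\<^sub>0) \<longrightarrow> (\<forall>\<alpha>. g \<alpha> \<ge> 0) \<longrightarrow> (\<forall>p. H p \<in> \<real>\<^sub>\<ge>\<^sub>0))"
proof -
  note a = disc_testD[OF disc]
  have aK: "a z = 0" if "z \<notin> cball 0 (1/2)" for z using a(2) that by auto
  obtain A0 where A0: "A0 > 0" "\<And>z. cmod (a z) \<le> A0"
    using smooth_compact_bounded[OF a(1) compact_cball aK] by metis
  obtain A1 where A1: "A1 > 0" "\<And>z v. cmod (frechet_derivative a (at z) v) \<le> A1 * cmod v"
    using smooth_compact_deriv_bounded[OF a(1) compact_cball aK] by metis
  obtain \<kappa> :: "complex \<Rightarrow> real" where k: "smooth_on UNIV (\<lambda>z. complex_of_real (\<kappa> z))"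
    "\<And>z. 0 \<le> \<kappa> z" "\<And>z. \<kappa> z \<le> 1" "\<And>z. cmod z \<le> 3/4 \<Longrightarrow> \<kappa> z = 1" "\<And>z. cmod z \<ge> 7/8 \<Longrightarrow> \<kappa> z = 0"
    using exists_cutoff[of "3/4" "7/8"] by auto
  have kK: "complex_of_real (\<kappa> z) = 0" if "z \<notin> cball 0 (7/8)" for z using k(5)[of z] that by auto
  obtain K1 where K1: "K1 > 0" "\<And>z v. cmod (frechet_derivative (\<lambda>z. complex_of_real (\<kappa> z)) (at z) v) \<le> K1 * cmod v"
    using smooth_compact_deriv_bounded[OF k(1) compact_cball kK] by metis
  obtain B where B: "B > 0" "\<And>z \<alpha>. cmod z \<le> 1/2 \<Longrightarrow> \<alpha> \<in> \<tau> \<Longrightarrow> cmod (deriv (\<phi> \<alpha>) z) \<le> B"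
    using slope_bound[of "1/2"] by auto
  obtain \<Lambda> where L: "\<Lambda> \<ge> 0" "\<And>\<alpha> \<beta>. \<bar>g \<alpha> - g \<beta>\<bar> \<le> \<Lambda> * cmod (\<alpha> - \<beta>)"
    using g unfolding transversal_test_def by blast
  obtain \<Gamma> where \<Gamma>: "\<And>\<alpha>. \<bar>g \<alpha>\<bar> \<le> \<Gamma>" using g unfolding transversal_test_def by blast
  have g0: "cmod \<alpha> < 1/2" if "g \<alpha> \<noteq> 0" for \<alpha> using g that unfolding transversal_test_def by force
  \<comment> \<open>The three summands match the three error terms of the product rule:
    \<open>a\<close> times the leafwise derivative of \<open>G\<close>, the derivative of
    \<open>a\<close> times \<open>G - g\<close>, and \<open>a (G - g)\<close> times the derivative
    of the cutoff along a leaf of slope at most \<open>B\<close>.\<close>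
  define C where "C = A0 + A1 + A0 * K1 * B"
  have C: "C > 0" using A0 A1 K1 B by (simp add: C_def add_pos_pos)
  define d where "d = e / C"
  have d: "d > 0" "C * d = e" using e C by (auto simp: d_def)
  from leafwise_constant_approximation[where g=g and \<Lambda>=\<Lambda> and \<Gamma>=\<Gamma> and e=d, OF L(2) L(1) \<Gamma> d(1)]
  obtain G :: "C2 \<Rightarrow> real" where G0: "smooth_on (unit_disc \<times> UNIV) (\<lambda>p. complex_of_real (G p))"
    "(\<forall>\<alpha>\<in>\<tau>. 0 \<le> g \<alpha>) \<longrightarrow> (\<forall>p. 0 \<le> G p)"
    "\<forall>\<alpha> z. \<alpha> \<in> \<tau> \<longrightarrow> cmod z \<le> 1/2 \<longrightarrow> \<bar>G (z, \<phi> \<alpha> z) - g \<alpha>\<bar> \<le> d"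
    "\<forall>\<alpha> z v. \<alpha> \<in> \<tau> \<longrightarrow> cmod z \<le> 1/2 \<longrightarrow> cmod v = 1 \<longrightarrow>
       cmod (frechet_derivative (\<lambda>p. complex_of_real (G p)) (at (z, \<phi> \<alpha> z)) (v, deriv (\<phi> \<alpha>) z * v)) \<le> d"
    by (elim exE conjE)
  note G = G0(1) G0(2)[rule_format] G0(3,4)[rule_format]
  let ?G = "\<lambda>p. complex_of_real (G p)" and ?k = "\<lambda>z. complex_of_real (\<kappa> z)"
  let ?H = "leaf_extension a \<kappa> G"
  define K where "K = cball (0::complex) (1/2) \<times> cball (0::complex) (7/8)"
  have K: "compact K" "K \<subseteq> bidisc" "closed K" by (auto simp: K_def compact_Times closed_Times)
  have HK: "?H p = 0" if "p \<notin> K" for p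
    using that aK[of "fst p"] kK[of "snd p"] by (cases p) (auto simp: K_def leaf_extension_def)
  have o: "open (unit_disc \<times> (UNIV :: complex set))" by (intro open_Times) auto
  have "smooth_on (unit_disc \<times> UNIV) ?H"
    unfolding leaf_extension_def
    by (intro smooth_on_mult G(1) o)
       (auto intro!: smooth_on_subset[OF smooth_on_fst[OF open_UNIV a(1)]] smooth_on_subset[OF smooth_on_snd[OF open_UNIV k(1)]])
  then have Hs: "smooth_on UNIV ?H"
    by (rule smooth_on_extend_zero[OF o _ K(1) _ HK]) (use K(2) in auto)
  have val: "cmod (?H (z, \<phi> \<alpha> z) - a z * of_real (g \<alpha>)) \<le> e"
    "cmod v = 1 \<Longrightarrow> cmod (frechet_derivative ?H (at (z, \<phi> \<alpha> z)) (v, deriv (\<phi> \<alpha>) z * v) - frechet_derivative a (at z) v * of_real (g \<alpha>)) \<le> e"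
    if za: "z \<in> unit_disc" "\<alpha> \<in> \<tau>" for z \<alpha> v
  proof -
    let ?p = "(z, \<phi> \<alpha> z)"
    have "cmod (?H ?p - a z * of_real (g \<alpha>)) \<le> e \<and> (cmod v = 1 \<longrightarrow>
      cmod (frechet_derivative ?H (at ?p) (v, deriv (\<phi> \<alpha>) z * v) - frechet_derivative a (at z) v * of_real (g \<alpha>)) \<le> e)"
    proof (cases "cmod z \<le> 1/2")
      case False
      then have p: "?p \<notin> K" and z: "z \<notin> cball 0 (1/2)" by (auto simp: K_def)
      have "frechet_derivative ?H (at ?p) u = 0" for u
        by (rule frechet_zero_outside[OF K(3)]) (use HK p in \<open>blast+\<close>)
      moreover have "frechet_derivative a (at z) v = 0"
        by (rule frechet_zero_outside[OF closed_cball]) (use aK z in \<open>blast+\<close>)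
      moreover have "?H ?p = 0" "a z = 0" using HK[OF p] aK[OF z] .
      ultimately show ?thesis using e by simp
    next
      case True
      define x where "x = \<phi> \<alpha> z"
      have Gd: "\<bar>G ?p - g \<alpha>\<bar> \<le> d" using G(3)[OF za(2) True] .
      \<comment> \<open>Either \<open>g \<alpha>\<close> is 0, or the label is below 1/2 and the
        leaf stays below 1/2 + 1/4, where the cutoff is constant 1.\<close>
      have kx: "g \<alpha> * \<kappa> x = g \<alpha>" "\<And>u. of_real (g \<alpha>) * frechet_derivative ?k (at x) u = 0"
      proof -
        have "g \<alpha> * \<kappa> x = g \<alpha> \<and> of_real (g \<alpha>) * frechet_derivative ?k (at x) u = 0" for u
        proof (cases "g \<alpha> = 0")
          case False
          have "cmod x \<le> cmod \<alpha> + cmod (\<phi> \<alpha> z - \<alpha>)" unfolding x_def by norm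
          then have x: "cmod x < 3/4" using near[OF za(2,1)] g0[OF False] by linarith
          have "((\<lambda>z. 1) has_derivative (\<lambda>v. 0)) (at x)" by simp
          then have "(?k has_derivative (\<lambda>v. 0)) (at x)"
            by (rule has_derivative_transform_within_open[OF _ open_ball[of 0 "3/4"]]) (use x k(4) in auto)
          then have "frechet_derivative ?k (at x) = (\<lambda>v. 0)" using frechet_derivative_at by metis
          then show ?thesis using k(4)[of x] x by simp
        qed simp
        then show "g \<alpha> * \<kappa> x = g \<alpha>" "\<And>u. of_real (g \<alpha>) * frechet_derivative ?k (at x) u = 0" by auto
      qed
      have v0: "cmod (?H ?p - a z * of_real (g \<alpha>)) \<le> e"
      proof -
        have "?H ?p - a z * of_real (g \<alpha>) = a z * of_real (G ?p * \<kappa> x - g \<alpha> * \<kappa> x)"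
          unfolding kx(1) by (simp add: leaf_extension_def x_def algebra_simps)
        also have "cmod \<dots> = cmod (a z) * (\<bar>G ?p - g \<alpha>\<bar> * \<kappa> x)"
          unfolding norm_mult norm_of_real left_diff_distrib[symmetric] abs_mult using k(2)[of x] by simp
        also have "\<dots> \<le> A0 * (d * 1)"
          using A0 Gd k(2,3)[of x] by (intro mult_mono) auto
        also have "\<dots> \<le> C * d" using d(1) A1 K1 B A0 by (simp add: C_def mult_right_mono)
        finally show ?thesis using d(2) by simp
      qed
      moreover have "cmod (frechet_derivative ?H (at ?p) (v, deriv (\<phi> \<alpha>) z * v) - frechet_derivative a (at z) v * of_real (g \<alpha>)) \<le> e"
        if v: "cmod v = 1"
      proof -
        let ?u = "(v, deriv (\<phi> \<alpha>) z * v)"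
        have "?p \<in> unit_disc \<times> UNIV" using za by simp
        note dG = smooth_on_D[OF G(1) this]
        have dfst: "(fst has_derivative fst) (at ?p)" and dsnd: "(snd has_derivative snd) (at ?p)"
          by (rule bounded_linear_imp_has_derivative[OF bounded_linear_fst], rule bounded_linear_imp_has_derivative[OF bounded_linear_snd])
        have da: "((\<lambda>p. a (fst p)) has_derivative (\<lambda>u. frechet_derivative a (at z) (fst u))) (at ?p)"
          using has_derivative_compose[OF dfst smooth_on_D[OF a(1) UNIV_I]] by simp
        have dk: "((\<lambda>p. ?k (snd p)) has_derivative (\<lambda>u. frechet_derivative ?k (at x) (snd u))) (at ?p)"
          using has_derivative_compose[OF dsnd smooth_on_D[OF k(1) UNIV_I]] by (simp add: x_def)
        let ?a' = "frechet_derivative a (at z) v" and ?G' = "frechet_derivative ?G (at ?p) ?u"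
          and ?k' = "frechet_derivative ?k (at x) (deriv (\<phi> \<alpha>) z * v)"
        have "frechet_derivative ?H (at ?p) = (\<lambda>u. (a (fst ?p) * ?G ?p) * frechet_derivative ?k (at x) (snd u)
           + (a (fst ?p) * frechet_derivative ?G (at ?p) u + frechet_derivative a (at z) (fst u) * ?G ?p) * ?k (snd ?p))"
          unfolding leaf_extension_def
          by (rule frechet_derivative_at[symmetric]) (rule has_derivative_mult[OF has_derivative_mult[OF da dG] dk])
        then have "frechet_derivative ?H (at ?p) ?u - ?a' * of_real (g \<alpha>)
           = (a z * ?G ?p) * ?k' + (a z * ?G' + ?a' * ?G ?p) * ?k x - ?a' * of_real (g \<alpha> * \<kappa> x) - a z * (of_real (g \<alpha>) * ?k')"
          unfolding kx by (simp add: x_def)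
        also have "\<dots> = a z * ?G' * ?k x + ?a' * (of_real (G ?p - g \<alpha>) * ?k x) + a z * of_real (G ?p - g \<alpha>) * ?k'"
          by (simp add: algebra_simps)
        also have "cmod \<dots> \<le> A0 * d * 1 + A1 * (d * 1) + A0 * d * (K1 * B)"
        proof (intro order_trans[OF norm_triangle_ineq] add_mono)
          show "cmod (a z * ?G' * ?k x) \<le> A0 * d * 1"
            unfolding norm_mult using A0 G(4)[OF za(2) True v] k(2,3)[of x] d by (intro mult_mono) auto
          show "cmod (?a' * (of_real (G ?p - g \<alpha>) * ?k x)) \<le> A1 * (d * 1)"
            unfolding norm_mult norm_of_real using A1(1) A1(2)[of z v] v Gd k(2,3)[of x] d by (intro mult_mono) auto
          have "cmod ?k' \<le> K1 * cmod (deriv (\<phi> \<alpha>) z * v)" by (rule K1(2))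
          also have "\<dots> \<le> K1 * B" using B(2)[OF True za(2)] K1(1) v by (simp add: norm_mult)
          finally show "cmod (a z * of_real (G ?p - g \<alpha>) * ?k') \<le> A0 * d * (K1 * B)"
            unfolding norm_mult norm_of_real using A0 Gd d by (intro mult_mono) auto
        qed
        also have "\<dots> = C * d" by (simp add: C_def algebra_simps)
        finally show ?thesis using d(2) by simp
      qed
      ultimately show ?thesis by blast
    qed
    then show "cmod (?H (z, \<phi> \<alpha> z) - a z * of_real (g \<alpha>)) \<le> e"
      "cmod v = 1 \<Longrightarrow> cmod (frechet_derivative ?H (at (z, \<phi> \<alpha> z)) (v, deriv (\<phi> \<alpha>) z * v) - frechet_derivative a (at z) v * of_real (g \<alpha>)) \<le> e"
      by blast+
  qed
  have pos: "\<forall>p. ?H p \<in> \<real>\<^sub>\<ge>\<^sub>0" if "\<forall>z. a z \<in> \<real>\<^sub>\<ge>\<^sub>0" "\<forall>\<alpha>. g \<alpha> \<ge> 0"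
  proof
    fix p
    have G_nonneg: "\<forall>p. 0 \<le> G p" using G0(2) that(2) by blast
    have "0 \<le> G p * \<kappa> (snd p)" by (rule mult_nonneg_nonneg[OF spec[OF G_nonneg] k(2)])
    then have "complex_of_real (G p * \<kappa> (snd p)) \<in> \<real>\<^sub>\<ge>\<^sub>0" by (simp only: nonneg_Reals_of_real_iff)
    then have "a (fst p) * complex_of_real (G p * \<kappa> (snd p)) \<in> \<real>\<^sub>\<ge>\<^sub>0" using that(1) nonneg_Reals_mult_I by blast
    then show "?H p \<in> \<real>\<^sub>\<ge>\<^sub>0" by (simp add: leaf_extension_def mult.assoc)
  qed
  show ?thesis
    by (intro exI[of _ ?H] exI[of _ K] conjI allI impI Hs K(1,2) HK val pos[rule_format]) auto
qed

lemma test_function_bounded: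
  assumes disc: "disc_test a" and g: "transversal_test g"
  shows "\<exists>B. (\<forall>p. cmod (a (fst p) * of_real (g (snd p))) \<le> B) \<and>
    (\<forall>p. cmod (frechet_derivative a (at (fst p)) v * of_real (g (snd p))) \<le> B)"
    "(\<lambda>p. a (fst p) * of_real (g (snd p))) \<in> borel_measurable borel"
    "(\<lambda>p. frechet_derivative a (at (fst p)) v * of_real (g (snd p))) \<in> borel_measurable borel"
proof -
  note a = disc_testD[OF disc]
  have aK: "a z = 0" if "z \<notin> cball 0 (1/2)" for z using a(2) that by auto
  obtain A0 where A0: "A0 > 0" "\<And>z. cmod (a z) \<le> A0"
    using smooth_compact_bounded[OF a(1) compact_cball aK] by metis
  obtain A1 where A1: "A1 > 0" "\<And>z v. cmod (frechet_derivative a (at z) v) \<le> A1 * cmod v"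
    using smooth_compact_deriv_bounded[OF a(1) compact_cball aK] by metis
  obtain \<Gamma> where \<Gamma>: "\<And>\<alpha>. \<bar>g \<alpha>\<bar> \<le> \<Gamma>" using g unfolding transversal_test_def by blast
  have m1: "a \<in> borel_measurable borel" "(\<lambda>z. frechet_derivative a (at z) v) \<in> borel_measurable borel"
    using smooth_on_continuous[OF a(1)] smooth_on_continuous[OF smooth_on_frechet[OF a(1)]]
    by (auto intro: borel_measurable_continuous_onI)
  have f: "fst \<in> borel_measurable (borel :: (complex \<times> complex) measure)" "snd \<in> borel_measurable (borel :: (complex \<times> complex) measure)"
    by (auto intro!: borel_measurable_continuous_onI continuous_intros)
  note m = measurable_compose[OF f(1) m1(1)] measurable_compose[OF f(1) m1(2)] measurable_compose[OF f(2) transversal_test_measurable[OF g]]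
  show "\<exists>B. (\<forall>p. cmod (a (fst p) * of_real (g (snd p))) \<le> B) \<and>
    (\<forall>p. cmod (frechet_derivative a (at (fst p)) v * of_real (g (snd p))) \<le> B)"
  proof (intro exI[of _ "max (A0 * \<Gamma>) (A1 * cmod v * \<Gamma>)"] conjI allI)
    fix p :: "complex \<times> complex"
    show "cmod (a (fst p) * of_real (g (snd p))) \<le> max (A0 * \<Gamma>) (A1 * cmod v * \<Gamma>)"
      unfolding norm_mult norm_of_real by (rule max.coboundedI1) (use A0 \<Gamma> in \<open>auto intro!: mult_mono\<close>)
    show "cmod (frechet_derivative a (at (fst p)) v * of_real (g (snd p))) \<le> max (A0 * \<Gamma>) (A1 * cmod v * \<Gamma>)"
      unfolding norm_mult norm_of_real by (rule max.coboundedI2) (use A1 \<Gamma> in \<open>auto intro!: mult_mono\<close>)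
  qed
  show "(\<lambda>p. a (fst p) * of_real (g (snd p))) \<in> borel_measurable borel"
    "(\<lambda>p. frechet_derivative a (at (fst p)) v * of_real (g (snd p))) \<in> borel_measurable borel"
    using m by measurable
qed

text \<open>The weak form of constancy: the leafwise gradient of the density vanishes in the sense
  of distributions. \<open>S\<close> kills the closed test forms built from the extensions
  \<open>H\<close>, whose traces are uniformly close to the derivative of \<open>a\<close> times
  \<open>g\<close>; the error \<open>e\<close> is then sent to 0.\<close>

lemma density_leaf_derivative:
  assumes disc: "disc_test a" and g: "transversal_test g" and v: "v = 1 \<or> v = \<i>"
  shows "(LINT p|M. of_real (leaf_density p) * (frechet_derivative a (at (fst p)) v * of_real (g (snd p)))) = 0" (is "?I = 0")
proof -
  let ?F = "\<lambda>p. frechet_derivative a (at (fst p)) v * of_real (g (snd p))"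
  obtain B where B1: "\<And>p. cmod (?F p) \<le> B" using test_function_bounded(1)[OF disc g, of v] by blast
  note B = B1 test_function_bounded(3)[OF disc g, of v]
  have v1: "cmod v = 1" using v by auto
  define D where "D = (LINT p|M. \<bar>leaf_density p\<bar>)"
  have "cmod ?I \<le> e * D" if e: "e > 0" for e
  proof -
    from leaf_extension_exists[OF disc g e]
    obtain H K where H0: "smooth_on UNIV H" "compact K" "K \<subseteq> bidisc" "\<forall>p. p \<notin> K \<longrightarrow> H p = 0"
    "\<forall>z \<alpha>. z \<in> unit_disc \<longrightarrow> \<alpha> \<in> \<tau> \<longrightarrow> cmod (H (z, \<phi> \<alpha> z) - a z * of_real (g \<alpha>)) \<le> e"
    "\<forall>z \<alpha> v. z \<in> unit_disc \<longrightarrow> \<alpha> \<in> \<tau> \<longrightarrow> cmod v = 1 \<longrightarrow>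
       cmod (frechet_derivative H (at (z, \<phi> \<alpha> z)) (v, deriv (\<phi> \<alpha>) z * v) - frechet_derivative a (at z) v * of_real (g \<alpha>)) \<le> e"
    "(\<forall>z. a z \<in> \<real>\<^sub>\<ge>\<^sub>0) \<longrightarrow> (\<forall>\<alpha>. g \<alpha> \<ge> 0) \<longrightarrow> (\<forall>p. H p \<in> \<real>\<^sub>\<ge>\<^sub>0)"
      by (elim exE conjE)
    note H = H0(1-3) H0(4,6)[rule_format]
    \<comment> \<open>On the tangent pair \<open>(e, i e)\<close> with first coordinates 1 and i, dH
      wedge d(Im z) evaluates to dH(e), while dH wedge d(Re z) gives -dH(i e). This explains the
      exchange of \<open>Re\<close> and \<open>Im\<close> and the sign \<open>s\<close>.\<close>
    define L where "L = (if v = 1 then Im else Re)"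
    define s :: complex where "s = (if v = 1 then 1 else -1)"
    have L: "L \<in> {Re, Im}" by (auto simp: L_def)
    let ?w = "\<lambda>p u v. frechet_derivative H (at p) u * complex_of_real (L (fst v))
            - frechet_derivative H (at p) v * complex_of_real (L (fst u))"
    have lin: "linear (frechet_derivative H (at p))" for p
      using smooth_on_D[OF H(1)] has_derivative_linear by blast
    have w: "test_form2 bidisc ?w"
    proof (rule test_form2I[OF _ _ _ H(2,3)])
      show "bilinear (\<lambda>u v. ?w p u v)" for p
        by (rule bilinearI_C)
           (auto simp: linear_add[OF lin] linear_scale[OF lin] L_def scaleR_conv_of_real algebra_simps)
      show "smooth_on UNIV (\<lambda>p. ?w p u v)" for u v
        by (intro smooth_on_diff smooth_on_mult smooth_on_frechet smooth_on_const H(1) open_UNIV)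
      show "?w p u v = 0" if "p \<notin> K" for p u v
        using frechet_zero_outside[OF compact_imp_closed[OF H(2)] H(4) that] by simp
    qed simp
    have "S ?w = 0" by (rule S_closed[OF H(1-4) L])
    then have z: "(LINT p|M. of_real (leaf_density p) * trace ?w p) = 0" using S_density[OF w] by simp
    obtain Bw where Bw: "\<And>p. cmod (trace ?w p) \<le> Bw" using trace_bounded[OF w] by auto
    note i1 = integrable_density_mult[OF trace_measurable[OF w] Bw]
    note i2 = integrable_density_mult[OF B(2,1)]
    have AEb: "AE p in M. cmod (s * trace ?w p - ?F p) \<le> e"
      using AE_M_leaf[OF AE_tau]
    proof eventually_elim
      case (elim p)
      obtain z \<alpha> where p: "p = (z, \<alpha>)" "z \<in> unit_disc" "\<alpha> \<in> \<tau>" using elim by (cases p) auto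
      have "s * trace ?w p = frechet_derivative H (at (z, \<phi> \<alpha> z)) (v, deriv (\<phi> \<alpha>) z * v)"
        using v p by (auto simp: trace_def leaf_form_def L_def s_def cscale_def mult.commute)
      then show ?case using H(5)[OF p(2,3) v1] p(1) by simp
    qed
    have "?I = - (LINT p|M. of_real (leaf_density p) * (s * trace ?w p - ?F p))"
    proof -
      have "(LINT p|M. of_real (leaf_density p) * (s * trace ?w p - ?F p))
        = (LINT p|M. s * (of_real (leaf_density p) * trace ?w p) - of_real (leaf_density p) * ?F p)"
        by (rule Bochner_Integration.integral_cong) (auto simp: algebra_simps)
      also have "\<dots> = s * (LINT p|M. of_real (leaf_density p) * trace ?w p) - ?I"
        using i1 i2 by (subst Bochner_Integration.integral_diff) auto
      finally show ?thesis using z by simp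
    qed
    then have "cmod ?I = cmod (LINT p|M. of_real (leaf_density p) * (s * trace ?w p - ?F p))" by simp
    also have "\<dots> \<le> e * D" unfolding D_def
    proof (rule density_integral_bound[OF _ AEb])
      show "(\<lambda>p. s * trace ?w p - ?F p) \<in> borel_measurable borel"
        using trace_measurable[OF w] B(2) by measurable
      show "cmod (s * trace ?w p - ?F p) \<le> Bw + B" for p
        by (rule order_trans[OF norm_triangle_ineq4 add_mono]) (use Bw B in \<open>auto simp: norm_mult s_def\<close>)
    qed
    finally show ?thesis .
  qed
  then have "cmod ?I \<le> e" if "e > 0" for e
  proof -
    have D: "D \<ge> 0" by (simp add: D_def)
    have "e / (D + 1) > 0" using that D by simp
    then have "cmod ?I \<le> e / (D + 1) * D" by (rule \<open>\<And>e. e > 0 \<Longrightarrow> cmod ?I \<le> e * D\<close>)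
    also have "\<dots> \<le> e" using that D by (simp add: pos_divide_le_eq mult_left_mono)
    finally show ?thesis .
  qed
  then have "cmod ?I \<le> 0" by (rule field_le_epsilon[rotated]) simp
  then show ?thesis by simp
qed

text \<open>For \<open>H\<close> with nonnegative values, \<open>H\<close> times the area form of
  the first coordinate is a positive form whose trace is just \<open>H\<close> on the leaf.
  Positivity of \<open>S\<close> is thus inherited by the density up to the approximation
  error.\<close>

lemma density_nonneg_weak:
  assumes disc: "disc_test a" and a: "\<forall>z. a z \<in> \<real>\<^sub>\<ge>\<^sub>0"
    and g: "transversal_test g" "\<forall>\<alpha>. g \<alpha> \<ge> 0"
  shows "0 \<le> Re (LINT p|M. of_real (leaf_density p) * (a (fst p) * of_real (g (snd p))))" (is "0 \<le> Re ?I")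
proof -
  let ?F = "\<lambda>p. a (fst p) * of_real (g (snd p))"
  obtain B where B1: "\<And>p. cmod (?F p) \<le> B" using test_function_bounded(1)[OF disc g(1), of 1] by blast
  note B = B1 test_function_bounded(2)[OF disc g(1)]
  define D where "D = (LINT p|M. \<bar>leaf_density p\<bar>)"
  have "- (e * D) \<le> Re ?I" if e: "e > 0" for e
  proof -
    from leaf_extension_exists[OF disc g(1) e]
    obtain H K where H0: "smooth_on UNIV H" "compact K" "K \<subseteq> bidisc" "\<forall>p. p \<notin> K \<longrightarrow> H p = 0"
    "\<forall>z \<alpha>. z \<in> unit_disc \<longrightarrow> \<alpha> \<in> \<tau> \<longrightarrow> cmod (H (z, \<phi> \<alpha> z) - a z * of_real (g \<alpha>)) \<le> e"
    "\<forall>z \<alpha> v. z \<in> unit_disc \<longrightarrow> \<alpha> \<in> \<tau> \<longrightarrow> cmod v = 1 \<longrightarrow>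
       cmod (frechet_derivative H (at (z, \<phi> \<alpha> z)) (v, deriv (\<phi> \<alpha>) z * v) - frechet_derivative a (at z) v * of_real (g \<alpha>)) \<le> e"
    "(\<forall>z. a z \<in> \<real>\<^sub>\<ge>\<^sub>0) \<longrightarrow> (\<forall>\<alpha>. g \<alpha> \<ge> 0) \<longrightarrow> (\<forall>p. H p \<in> \<real>\<^sub>\<ge>\<^sub>0)"
      by (elim exE conjE)
    note H = H0(1-3) H0(4,5)[rule_format]
    have H6: "\<forall>p. H p \<in> \<real>\<^sub>\<ge>\<^sub>0" using H0(7) a g(2) by simp
    let ?w = "hermitian_form H (\<lambda>p. 0) (\<lambda>p. 0)"
    have w: "test_form2 bidisc ?w"
      by (rule test_form2_hermitian[OF H(1) smooth_on_const smooth_on_const H(2,3)]) (use H(4) in auto)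
    have "positive_form ?w"
      unfolding positive_form_def using hermitian_form_11 H6 
      by (auto simp: hermitian_form_J simp del: of_real_power intro!: nonneg_Reals_mult_I)
    from S_pos[OF w this] have z: "0 \<le> Re (LINT p|M. of_real (leaf_density p) * trace ?w p)"
      using S_density[OF w] by (simp add: complex_nonneg_Reals_iff)
    obtain Bw where Bw: "\<And>p. cmod (trace ?w p) \<le> Bw" using trace_bounded[OF w] by auto
    note i1 = integrable_density_mult[OF trace_measurable[OF w] Bw]
    note i2 = integrable_density_mult[OF B(2,1)]
    have AEb: "AE p in M. cmod (trace ?w p - ?F p) \<le> e"
      using AE_M_leaf[OF AE_tau]
    proof eventually_elim
      case (elim p)
      obtain z \<alpha> where p: "p = (z, \<alpha>)" "z \<in> unit_disc" "\<alpha> \<in> \<tau>" using elim by (cases p) auto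
      have "trace ?w p = H (z, \<phi> \<alpha> z)" using p by (simp add: trace_hermitian)
      then show ?case using H(5)[OF p(2,3)] p(1) by simp
    qed
    have "cmod (LINT p|M. of_real (leaf_density p) * (trace ?w p - ?F p)) \<le> e * D" unfolding D_def
    proof (rule density_integral_bound[OF _ AEb])
      show "(\<lambda>p. trace ?w p - ?F p) \<in> borel_measurable borel"
        using trace_measurable[OF w] B(2) by measurable
      show "cmod (trace ?w p - ?F p) \<le> Bw + B" for p
        by (rule order_trans[OF norm_triangle_ineq4 add_mono[OF Bw B(1)]])
    qed
    moreover have "(LINT p|M. of_real (leaf_density p) * (trace ?w p - ?F p)) = (LINT p|M. of_real (leaf_density p) * trace ?w p) - ?I"
      unfolding right_diff_distrib using i1 i2 by (rule Bochner_Integration.integral_diff)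
    ultimately have "cmod ((LINT p|M. of_real (leaf_density p) * trace ?w p) - ?I) \<le> e * D" by simp
    from order_trans[OF complex_Re_le_cmod this] z show ?thesis by simp
  qed
  then have "- Re ?I \<le> 0 + e" if "e > 0" for e
  proof -
    have D: "D \<ge> 0" by (simp add: D_def)
    have "e / (D + 1) > 0" using that D by simp
    then have "- (e / (D + 1) * D) \<le> Re ?I" by (rule \<open>\<And>e. e > 0 \<Longrightarrow> - (e * D) \<le> Re ?I\<close>)
    moreover have "e / (D + 1) * D \<le> e" using that D by (simp add: pos_divide_le_eq mult_left_mono)
    ultimately show ?thesis by linarith
  qed
  then have "- Re ?I \<le> 0" by (rule field_le_epsilon)
  then show ?thesis by simp
qed

end

section \<open>Taylor estimates, mollifiers and positivity tests in the plane\<close>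

lemma smooth_on_translate:
  assumes "smooth_on UNIV f"
  shows "smooth_on UNIV (\<lambda>z. f (z - w))"
    and "frechet_derivative (\<lambda>z. f (z - w)) (at z) = frechet_derivative f (at (z - w))"
proof -
  have der: "((\<lambda>z. f (z - w)) has_derivative D) (at z)" if "(f has_derivative D) (at (z - w))" for f :: "'a \<Rightarrow> complex" and D z
    using has_derivative_compose[OF has_derivative_diff[OF has_derivative_ident has_derivative_const] that] by simp
  show "frechet_derivative (\<lambda>z. f (z - w)) (at z) = frechet_derivative f (at (z - w))"
    using frechet_derivative_at[OF der[OF smooth_on_D[OF assms UNIV_I]]] by simp
  have "Ck_on n UNIV f \<Longrightarrow> Ck_on n UNIV (\<lambda>z. f (z - w))" for n and f :: "'a \<Rightarrow> complex"
  proof (induction n arbitrary: f)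
    case (Suc n)
    show ?case
      by (rule Ck_on_SucI[OF open_UNIV der[OF Ck_on_SucD[OF Suc.prems UNIV_I]]]) (rule Suc.IH, use Suc.prems in simp)
  qed simp
  then show "smooth_on UNIV (\<lambda>z. f (z - w))" using assms unfolding smooth_on_def by blast
qed

text \<open>The derivative of a compactly supported smooth function is Lipschitz; the mean value
  inequality for \<open>b\<close> minus its linearisation at \<open>y\<close>, on the disc through
  \<open>x\<close>, then gives a quadratic remainder.\<close>

lemma smooth_compact_second_order:
  fixes b :: "complex \<Rightarrow> complex"
  assumes "smooth_on UNIV b" "compact K" "\<And>p. p \<notin> K \<Longrightarrow> b p = 0"
  shows "\<exists>C>0. \<forall>x y. cmod (b x - b y - frechet_derivative b (at y) (x - y)) \<le> C * (cmod (x - y))\<^sup>2"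
proof -
  let ?D = "\<lambda>y. frechet_derivative b (at y)"
  note z = frechet_zero_outside[OF compact_imp_closed[OF assms(2)] assms(3)]
  obtain B1 where B1: "B1 > 0" "\<And>p q. cmod (?D p 1 - ?D q 1) \<le> B1 * norm (p - q)"
    using smooth_compact_lipschitz[OF smooth_on_frechet[OF assms(1)] assms(2) z] by metis
  obtain B2 where B2: "B2 > 0" "\<And>p q. cmod (?D p \<i> - ?D q \<i>) \<le> B2 * norm (p - q)"
    using smooth_compact_lipschitz[OF smooth_on_frechet[OF assms(1)] assms(2) z] by metis
  have lin: "linear (?D p)" for p using smooth_on_D[OF assms(1) UNIV_I] has_derivative_linear by blast
  have ex: "?D p v = of_real (Re v) * ?D p 1 + of_real (Im v) * ?D p \<i>" for p v
  proof -
    have "v = Re v *\<^sub>R 1 + Im v *\<^sub>R \<i>" by (simp add: complex_eq_iff)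
    then have "?D p v = ?D p (Re v *\<^sub>R 1 + Im v *\<^sub>R \<i>)" by simp
    also have "\<dots> = Re v *\<^sub>R ?D p 1 + Im v *\<^sub>R ?D p \<i>"
      by (simp only: linear_add[OF lin] linear_scale[OF lin])
    finally show ?thesis by (simp only: scaleR_conv_of_real)
  qed
  have lip: "cmod (?D p v - ?D q v) \<le> (B1 + B2) * cmod (p - q) * cmod v" for p q v
  proof -
    have "?D p v - ?D q v = of_real (Re v) * (?D p 1 - ?D q 1) + of_real (Im v) * (?D p \<i> - ?D q \<i>)"
      unfolding ex[of p v] ex[of q v] by (simp add: algebra_simps)
    also have "cmod \<dots> \<le> cmod v * (B1 * cmod (p - q)) + cmod v * (B2 * cmod (p - q))"
      by (intro order_trans[OF norm_triangle_ineq] add_mono; unfold norm_mult norm_of_real)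
         (intro mult_mono abs_Re_le_cmod abs_Im_le_cmod B1(2) B2(2); simp)+
    finally show ?thesis by (simp add: algebra_simps)
  qed
  have "cmod (b x - b y - ?D y (x - y)) \<le> (B1 + B2) * (cmod (x - y))\<^sup>2" for x y
  proof -
    let ?f = "\<lambda>t. b t - ?D y t" and ?f' = "\<lambda>t v. ?D t v - ?D y v"
    have "cmod (?f x - ?f y) \<le> ((B1 + B2) * cmod (x - y)) * cmod (x - y)"
    proof (rule differentiable_bound[of "cball y (cmod (x - y))" _ ?f'])
      fix t assume t: "t \<in> cball y (cmod (x - y))"
      show "(?f has_derivative ?f' t) (at t within cball y (cmod (x - y)))"
        by (rule has_derivative_at_withinI)
           (intro has_derivative_diff smooth_on_D[OF assms(1) UNIV_I] linear_imp_has_derivative lin)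
      show "onorm (?f' t) \<le> (B1 + B2) * cmod (x - y)"
      proof (rule onorm_le)
        fix v
        have "cmod (?D t v - ?D y v) \<le> (B1 + B2) * cmod (t - y) * cmod v" by (rule lip)
        also have "\<dots> \<le> (B1 + B2) * cmod (x - y) * cmod v"
          using t B1(1) B2(1) by (intro mult_right_mono mult_left_mono) (auto simp: dist_norm norm_minus_commute)
        finally show "cmod (?f' t v) \<le> (B1 + B2) * cmod (x - y) * cmod v" .
      qed
    qed (auto simp: dist_norm norm_minus_commute)
    then show ?thesis by (simp add: linear_diff[OF lin] power2_eq_square algebra_simps)
  qed
  then show ?thesis using B1(1) B2(1) by (intro exI[of _ "B1 + B2"]) auto
qed

definition mollifier :: "real \<Rightarrow> (complex \<Rightarrow> real) \<Rightarrow> bool" where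
  "mollifier \<delta> b \<longleftrightarrow> smooth_on UNIV (\<lambda>z. complex_of_real (b z)) \<and> (\<forall>z. 0 \<le> b z) \<and>
     (\<forall>z. cmod z > \<delta> \<longrightarrow> b z = 0) \<and> integrable lborel b \<and> integral\<^sup>L lborel b = 1"

lemma mollifier_exists:
  assumes "\<delta> > 0"
  shows "\<exists>b. mollifier \<delta> b"
proof -
  obtain c :: "complex \<Rightarrow> real" where c: "smooth_on UNIV (\<lambda>z. complex_of_real (c z))"
    "\<And>z. 0 \<le> c z" "\<And>z. c z \<le> 1" "\<And>z. cmod z \<le> \<delta> / 2 \<Longrightarrow> c z = 1" "\<And>z. cmod z \<ge> \<delta> \<Longrightarrow> c z = 0"
    using exists_cutoff[of "\<delta> / 2" \<delta>] assms by auto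
  have cont: "continuous_on UNIV c"
    using continuous_on_Re[OF smooth_on_continuous[OF c(1)]] by simp
  then have [measurable]: "c \<in> borel_measurable borel" by (rule borel_measurable_continuous_onI)
  have int: "integrable lborel c"
  proof (rule Bochner_Integration.integrable_bound[where f="indicator (cball 0 \<delta>) :: complex \<Rightarrow> real"])
    show "integrable lborel (indicator (cball 0 \<delta>) :: complex \<Rightarrow> real)"
      by (rule integrable_real_indicator) (use emeasure_lborel_cball_finite[of "0::complex" \<delta>] in auto)
    show "AE x in lborel. norm (c x) \<le> norm (indicator (cball 0 \<delta>) x :: real)"
      using c(2,3,5) by (intro AE_I2) (auto simp: indicator_def not_le less_imp_le)
  qed simp
  have "0 < measure lborel (ball (0::complex) (\<delta>/2))" using assms by (intro content_ball_pos) simp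
  also have "\<dots> = (LINT z|lborel. indicator (ball (0::complex) (\<delta>/2)) z)" by simp
  also have "\<dots> \<le> integral\<^sup>L lborel c"
  proof (rule integral_mono[OF _ int])
    show "integrable lborel (indicator (ball (0::complex) (\<delta>/2)) :: complex \<Rightarrow> real)"
      by (rule integrable_real_indicator) (use emeasure_lborel_ball_finite[of "0::complex" "\<delta>/2"] in auto)
    show "indicator (ball 0 (\<delta>/2)) z \<le> c z" for z using c(2,4)[of z] by (auto simp: indicator_def)
  qed
  finally have pos: "integral\<^sup>L lborel c > 0" .
  define b where "b z = c z / integral\<^sup>L lborel c" for z
  have "smooth_on UNIV (\<lambda>z. complex_of_real (c z) * complex_of_real (1 / integral\<^sup>L lborel c))"
    by (intro smooth_on_mult smooth_on_const c(1) open_UNIV)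
  then have "mollifier \<delta> b"
    unfolding mollifier_def using c pos int by (auto simp: b_def[abs_def])
  then show ?thesis by blast
qed

lemma mollifierD:
  assumes "mollifier \<delta> b"
  shows "smooth_on UNIV (\<lambda>z. complex_of_real (b z))" "0 \<le> b z" "cmod z > \<delta> \<Longrightarrow> b z = 0"
    "integrable lborel b" "integral\<^sup>L lborel b = 1" "b \<in> borel_measurable borel" "\<exists>B. \<forall>z. b z \<le> B"
proof -
  show s: "smooth_on UNIV (\<lambda>z. complex_of_real (b z))" and "0 \<le> b z" and zero: "cmod z > \<delta> \<Longrightarrow> b z = 0"
    and "integrable lborel b" "integral\<^sup>L lborel b = 1" for z
    using assms unfolding mollifier_def by auto
  have "continuous_on UNIV b" using continuous_on_Re[OF smooth_on_continuous[OF s]] by simp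
  then show "b \<in> borel_measurable borel" by (rule borel_measurable_continuous_onI)
  have z: "complex_of_real (b z) = 0" if "z \<notin> cball 0 \<delta>" for z using zero[of z] that by simp
  obtain B where "\<And>z. cmod (complex_of_real (b z)) \<le> B" using smooth_compact_bounded[OF s compact_cball z] by metis
  then have "b z \<le> B" for z by (metis abs_le_D1 norm_of_real)
  then show "\<exists>B. \<forall>z. b z \<le> B" by blast
qed

text \<open>Indicators of compact subsets of \<open>U\<close> are dominated limits of Lipschitz
  functions, so integrals of \<open>h\<close> over compact sets are nonnegative. By inner regularity
  the set where \<open>h\<close> is negative has no mass.\<close>

lemma AE_nonneg_if_integral_nonneg:
  fixes \<mu> :: "complex measure" and h :: "complex \<Rightarrow> real"
  assumes sets: "sets \<mu> = sets borel" and int: "integrable \<mu> h" and "open U"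
    and nn: "\<And>g. \<lbrakk>\<exists>\<Lambda>\<ge>0. \<forall>\<alpha> \<beta>. \<bar>g \<alpha> - g \<beta>\<bar> \<le> \<Lambda> * cmod (\<alpha> - \<beta>); \<forall>\<alpha>. 0 \<le> g \<alpha>; \<forall>\<alpha>. g \<alpha> \<le> 1; \<forall>\<alpha>. \<alpha> \<notin> U \<longrightarrow> g \<alpha> = 0\<rbrakk>
        \<Longrightarrow> 0 \<le> (LINT \<alpha>|\<mu>. h \<alpha> * g \<alpha>)"
  shows "AE \<alpha> in \<mu>. \<alpha> \<in> U \<longrightarrow> 0 \<le> h \<alpha>"
proof -
  have hm [measurable]: "h \<in> borel_measurable borel" using int sets by (simp cong: measurable_cong_sets)
  have sp: "space \<mu> = UNIV" using sets_eq_imp_space_eq[OF sets] by simp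
  have [measurable]: "U \<in> sets borel" using \<open>open U\<close> by simp
  note sets[measurable_cong]
  have cpt: "0 \<le> (LINT \<alpha>|\<mu>. h \<alpha> * indicator F \<alpha>)" if F: "compact F" "F \<subseteq> U" for F
  proof (cases "F = {}")
    case False
    have clF: "closed F" using F(1) compact_imp_closed by blast
    then have [measurable]: "F \<in> sets borel" by simp
    obtain d where d: "d > 0" "\<And>x y. x \<in> F \<Longrightarrow> y \<in> - U \<Longrightarrow> d \<le> dist x y"
    proof (cases "- U = {}")
      case False
      have "closed (- U)" using \<open>open U\<close> by auto
      with separate_compact_closed[OF F(1), of "- U"] F(2) that show ?thesis by blast
    qed (use that[of 1] in auto)
    \<comment> \<open>Tents over \<open>F\<close> of width d/(n+1). They decrease to the indicator
      of \<open>F\<close>, and their width of at most \<open>d\<close> makes them vanish outside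
      \<open>U\<close>.\<close>
    define g where "g n \<alpha> = max 0 (1 - (real n + 1) / d * infdist \<alpha> F)" for n :: nat and \<alpha>
    have g01: "0 \<le> g n \<alpha>" "g n \<alpha> \<le> 1" for n \<alpha>
      using d(1) by (auto simp: g_def infdist_nonneg)
    have gm [measurable]: "g n \<in> borel_measurable borel" for n
      unfolding g_def by (intro borel_measurable_continuous_onI continuous_intros)
    have lim: "(\<lambda>n. LINT \<alpha>|\<mu>. h \<alpha> * g n \<alpha>) \<longlonglongrightarrow> (LINT \<alpha>|\<mu>. h \<alpha> * indicator F \<alpha>)"
    proof (rule integral_dominated_convergence[where w="\<lambda>\<alpha>. \<bar>h \<alpha>\<bar>"])
      show "AE \<alpha> in \<mu>. (\<lambda>n. h \<alpha> * g n \<alpha>) \<longlonglongrightarrow> h \<alpha> * indicator F \<alpha>"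
      proof (intro AE_I2 tendsto_mult tendsto_const)
        fix \<alpha>
        show "(\<lambda>n. g n \<alpha>) \<longlonglongrightarrow> indicator F \<alpha>"
        proof (cases "\<alpha> \<in> F")
          case True then show ?thesis by (simp add: g_def)
        next
          case False
          then have i: "infdist \<alpha> F > 0" using clF \<open>F \<noteq> {}\<close> in_closed_iff_infdist_zero infdist_nonneg
            by (metis less_eq_real_def)
          obtain n0 :: nat where n0: "d / infdist \<alpha> F \<le> real n0" using real_arch_simple by blast
          have "g n \<alpha> = 0" if "n \<ge> n0" for n
          proof -
            have "d / infdist \<alpha> F \<le> real n + 1" using n0 that by linarith
            then have "1 \<le> (real n + 1) / d * infdist \<alpha> F" using i d(1) by (simp add: field_simps)
            then show ?thesis by (simp add: g_def)
          qed
          then have "eventually (\<lambda>n. g n \<alpha> = indicator F \<alpha>) sequentially"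
            using False by (auto simp: eventually_sequentially)
          then show ?thesis by (rule tendsto_eventually)
        qed
      qed
      show "AE \<alpha> in \<mu>. norm (h \<alpha> * g n \<alpha>) \<le> \<bar>h \<alpha>\<bar>" for n
        using g01 by (intro AE_I2) (auto simp: abs_mult mult_left_le)
      show "(\<lambda>\<alpha>. h \<alpha> * indicator F \<alpha>) \<in> borel_measurable \<mu>" by measurable
      show "integrable \<mu> (\<lambda>\<alpha>. \<bar>h \<alpha>\<bar>)" using int by simp
    qed measurable
    have "0 \<le> (LINT \<alpha>|\<mu>. h \<alpha> * g n \<alpha>)" for n
    proof (rule nn)
      have "\<bar>g n \<alpha> - g n \<beta>\<bar> \<le> (real n + 1) / d * cmod (\<alpha> - \<beta>)" for \<alpha> \<beta>
      proof -
        have "\<bar>infdist \<alpha> F - infdist \<beta> F\<bar> \<le> cmod (\<alpha> - \<beta>)"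
          using infdist_triangle[of \<alpha> F \<beta>] infdist_triangle[of \<beta> F \<alpha>] by (simp add: dist_norm norm_minus_commute abs_le_iff)
        then have "(real n + 1) / d * \<bar>infdist \<alpha> F - infdist \<beta> F\<bar> \<le> (real n + 1) / d * cmod (\<alpha> - \<beta>)"
          using d(1) by (intro mult_left_mono) auto
        moreover have "(real n + 1) / d * \<bar>infdist \<alpha> F - infdist \<beta> F\<bar> = \<bar>(real n + 1) / d * infdist \<alpha> F - (real n + 1) / d * infdist \<beta> F\<bar>"
        proof -
          have "(real n + 1) / d \<ge> 0" using d(1) by simp
          from abs_mult_pos'[OF this] show ?thesis by (simp only: right_diff_distrib[symmetric])
        qed
        ultimately have "\<bar>(real n + 1) / d * infdist \<alpha> F - (real n + 1) / d * infdist \<beta> F\<bar> \<le> (real n + 1) / d * cmod (\<alpha> - \<beta>)"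
          by simp
        moreover have "\<bar>max 0 (1 - x) - max 0 (1 - y)\<bar> \<le> \<bar>x - y\<bar>" for x y :: real by (auto simp: max_def abs_if)
        ultimately show ?thesis unfolding g_def using order_trans by blast
      qed
      then show "\<exists>\<Lambda>\<ge>0. \<forall>\<alpha> \<beta>. \<bar>g n \<alpha> - g n \<beta>\<bar> \<le> \<Lambda> * cmod (\<alpha> - \<beta>)"
        using d(1) by (intro exI[of _ "(real n + 1) / d"]) auto
      have "g n \<alpha> = 0" if "\<alpha> \<notin> U" for \<alpha>
      proof -
        have "d \<le> infdist \<alpha> F" unfolding infdist_notempty[OF \<open>F \<noteq> {}\<close>]
          using \<open>F \<noteq> {}\<close> d(2) that by (intro cINF_greatest) (auto simp: dist_commute)
        then have "(real n + 1) / d * d \<le> (real n + 1) / d * infdist \<alpha> F" using d(1) by (intro mult_left_mono) auto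
        moreover have "(real n + 1) / d * d = real n + 1" using d(1) by simp
        ultimately have "1 \<le> (real n + 1) / d * infdist \<alpha> F" by linarith
        then show ?thesis by (simp add: g_def)
      qed
      then show "\<forall>\<alpha>. \<alpha> \<notin> U \<longrightarrow> g n \<alpha> = 0" by blast
    qed (use g01 in auto)
    then show ?thesis by (intro LIMSEQ_le_const[OF lim]) auto
  qed simp
  define N where "N = {\<alpha>\<in>U. h \<alpha> < 0}"
  have N [measurable]: "N \<in> sets borel" unfolding N_def by measurable
  let ?\<nu> = "Nonnegative_Lebesgue_Integration.density \<mu> (\<lambda>\<alpha>. ennreal \<bar>h \<alpha>\<bar>)"
  have fin: "emeasure ?\<nu> (space ?\<nu>) \<noteq> \<infinity>"
  proof -
    have "emeasure ?\<nu> (space ?\<nu>) = (\<integral>\<^sup>+\<alpha>. ennreal \<bar>h \<alpha>\<bar> \<partial>\<mu>)"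
      using hm by (simp add: emeasure_density sp)
    also have "\<dots> < \<infinity>" using int unfolding integrable_iff_bounded by simp
    finally show ?thesis by simp
  qed
  \<comment> \<open>Inner regularity is applied to the finite measure |h| \<mu>. On a compact part
    of \<open>N\<close> its mass is minus the integral of \<open>h\<close>, hence 0.\<close>
  have "emeasure ?\<nu> N = (SUP K \<in> {K. K \<subseteq> N \<and> compact K}. emeasure ?\<nu> K)"
    by (rule inner_regular) (use sets fin in \<open>auto simp: sp\<close>)
  moreover have "emeasure ?\<nu> K = 0" if K: "K \<subseteq> N" "compact K" for K
  proof -
    have [measurable]: "K \<in> sets borel" by (rule borel_compact[OF K(2)])
    have "0 \<le> (LINT \<alpha>|\<mu>. h \<alpha> * indicator K \<alpha>)" using K by (intro cpt) (auto simp: N_def)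
    also have "\<dots> = - (LINT \<alpha>|\<mu>. \<bar>h \<alpha>\<bar> * indicator K \<alpha>)"
      unfolding Bochner_Integration.integral_minus[symmetric]
      by (rule Bochner_Integration.integral_cong) (use K in \<open>auto simp: N_def indicator_def\<close>)
    finally have le: "(LINT \<alpha>|\<mu>. \<bar>h \<alpha>\<bar> * indicator K \<alpha>) \<le> 0" by simp
    have "emeasure ?\<nu> K = (\<integral>\<^sup>+\<alpha>. ennreal (\<bar>h \<alpha>\<bar> * indicator K \<alpha>) \<partial>\<mu>)"
      by (subst emeasure_density) (auto simp: ennreal_mult ennreal_indicator intro!: nn_integral_cong)
    also have "\<dots> = ennreal (LINT \<alpha>|\<mu>. \<bar>h \<alpha>\<bar> * indicator K \<alpha>)"
    proof (rule nn_integral_eq_integral)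
      have "integrable \<mu> (\<lambda>\<alpha>. \<bar>h \<alpha>\<bar>)" using int by simp
      from integrable_mult_indicator[OF _ this, of K]
      show "integrable \<mu> (\<lambda>\<alpha>. \<bar>h \<alpha>\<bar> * indicator K \<alpha>)" using sets by (simp add: mult.commute)
    qed auto
    finally show ?thesis using le by (simp add: ennreal_neg)
  qed
  ultimately have "emeasure ?\<nu> N = 0" by (auto simp: SUP_eq_const intro!: antisym SUP_least)
  then have "N \<in> null_sets ?\<nu>" using sets by (auto simp: null_sets_def)
  then have "AE \<alpha> in \<mu>. \<alpha> \<in> N \<longrightarrow> ennreal \<bar>h \<alpha>\<bar> = 0"
    using null_sets_density_iff[of "\<lambda>\<alpha>. ennreal \<bar>h \<alpha>\<bar>" \<mu> N] hm by simp
  then show ?thesis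
    by eventually_elim (auto simp: N_def ennreal_eq_0_iff)
qed

lemma integral_disc_measure_eq_lborel:
  fixes f :: "complex \<Rightarrow> 'b::{banach, second_countable_topology}"
  assumes "f \<in> borel_measurable borel" "\<And>z. cmod z \<ge> 1 \<Longrightarrow> f z = 0"
  shows "integral\<^sup>L disc_measure f = integral\<^sup>L lborel f"
  unfolding integral_disc_measure[OF assms(1)] set_lebesgue_integral_def
  by (rule Bochner_Integration.integral_cong) (use assms(2) in \<open>auto simp: indicator_def\<close>)

lemma lborel_integral_reflect:
  fixes f :: "complex \<Rightarrow> 'b::{banach, second_countable_topology}"
  assumes [measurable]: "f \<in> borel_measurable borel"
  shows "(LINT u|lborel. f (z - u)) = integral\<^sup>L lborel f"
proof -
  have "(lborel :: complex measure) = density (distr lborel borel (\<lambda>x. z + (-1) *\<^sub>R x)) (\<lambda>_. ennreal (\<bar>-1\<bar> ^ DIM(complex)))"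
    by (rule lborel_affine) simp
  then have "(lborel :: complex measure) = distr lborel borel (\<lambda>x. z - x)" by (simp add: density_1)
  then have "integral\<^sup>L lborel f = integral\<^sup>L (distr lborel borel (\<lambda>x. z - x)) f" by simp
  also have "\<dots> = (LINT u|lborel. f (z - u))" by (rule integral_distr) simp_all
  finally show ?thesis by simp
qed

section \<open>Leafwise averages of the density\<close>

context dominated_leaf_current
begin

definition leaf_pairing :: "(complex \<Rightarrow> complex) \<Rightarrow> (complex \<Rightarrow> real) \<Rightarrow> complex" where
  "leaf_pairing a g = (LINT p|M. of_real (leaf_density p) * (a (fst p) * of_real (g (snd p))))"

lemma borel_fst_snd [measurable]:
  "fst \<in> borel_measurable (borel :: (complex \<times> complex) measure)"
  "snd \<in> borel_measurable (borel :: (complex \<times> complex) measure)"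
  by (auto intro!: borel_measurable_continuous_onI continuous_intros)

lemma density_leaf_derivative_gen:
  assumes "disc_test a" "transversal_test g"
  shows "(LINT p|M. of_real (leaf_density p) * (frechet_derivative a (at (fst p)) v * of_real (g (snd p)))) = 0"
proof -
  let ?D = "\<lambda>v p. frechet_derivative a (at (fst p)) v * of_real (g (snd p))"
  have lin: "linear (frechet_derivative a (at z))" for z
    using smooth_on_D[OF disc_testD(1)[OF assms(1)] UNIV_I] has_derivative_linear by blast
  have ex: "frechet_derivative a (at z) v = of_real (Re v) * frechet_derivative a (at z) 1 + of_real (Im v) * frechet_derivative a (at z) \<i>" for z
  proof -
    have "v = Re v *\<^sub>R 1 + Im v *\<^sub>R \<i>" by (simp add: complex_eq_iff)
    then have "frechet_derivative a (at z) v = frechet_derivative a (at z) (Re v *\<^sub>R 1 + Im v *\<^sub>R \<i>)" by simp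
    also have "\<dots> = Re v *\<^sub>R frechet_derivative a (at z) 1 + Im v *\<^sub>R frechet_derivative a (at z) \<i>"
      by (simp only: linear_add[OF lin] linear_scale[OF lin])
    finally show ?thesis by (simp only: scaleR_conv_of_real)
  qed
  have int: "integrable M (\<lambda>p. of_real (leaf_density p) * ?D w p)" for w
  proof -
    obtain B where "\<And>p. cmod (?D w p) \<le> B" using test_function_bounded(1)[OF assms, of w] by blast
    then show ?thesis by (rule integrable_density_mult[OF test_function_bounded(3)[OF assms]])
  qed
  have "(LINT p|M. of_real (leaf_density p) * ?D v p)
     = (LINT p|M. of_real (Re v) * (of_real (leaf_density p) * ?D 1 p) + of_real (Im v) * (of_real (leaf_density p) * ?D \<i> p))"
    by (rule Bochner_Integration.integral_cong[OF refl]) (subst ex, simp add: algebra_simps)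
  also have "\<dots> = of_real (Re v) * (LINT p|M. of_real (leaf_density p) * ?D 1 p) + of_real (Im v) * (LINT p|M. of_real (leaf_density p) * ?D \<i> p)"
    using int by simp
  also have "\<dots> = 0" using density_leaf_derivative[OF assms] by simp
  finally show ?thesis .
qed

text \<open>A kernel of radius at most 1/8 moved by at most 1/4 stays within radius 1/2.\<close>

lemma disc_test_translate:
  assumes "mollifier \<delta> b" "\<delta> \<le> 1/8" "cmod u \<le> 1/4"
  shows "disc_test (\<lambda>z. complex_of_real (b (z - u)))"
  unfolding disc_test_def
proof (intro conjI allI impI)
  show "smooth_on UNIV (\<lambda>z. complex_of_real (b (z - u)))"
    using smooth_on_translate(1)[OF mollifierD(1)[OF assms(1)]] by simp
  fix z assume "cmod z > 1/2"
  then have "cmod (z - u) > \<delta>" using norm_triangle_ineq2[of z u] assms by linarith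
  then show "complex_of_real (b (z - u)) = 0" using mollifierD(3)[OF assms(1)] by simp
qed

lemma transversal_testD:
  assumes "transversal_test g"
  shows "\<exists>\<Gamma>\<ge>0. \<forall>\<alpha>. \<bar>g \<alpha>\<bar> \<le> \<Gamma>" "cmod \<alpha> \<ge> 1/2 \<Longrightarrow> g \<alpha> = 0"
proof -
  obtain \<Gamma> where "\<And>\<alpha>. \<bar>g \<alpha>\<bar> \<le> \<Gamma>" using assms unfolding transversal_test_def by blast
  then show "\<exists>\<Gamma>\<ge>0. \<forall>\<alpha>. \<bar>g \<alpha>\<bar> \<le> \<Gamma>" by (intro exI[of _ \<Gamma>]) (metis abs_ge_zero order_trans)
  show "cmod \<alpha> \<ge> 1/2 \<Longrightarrow> g \<alpha> = 0" using assms unfolding transversal_test_def by blast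
qed

text \<open>Along the segment from 0 to \<open>u\<close> the first-order change of the pairing
  vanishes by the weak derivative identity, so two parameters \<open>s\<close>, \<open>t\<close>
  differ by at most E (s-t)^2. Cutting [0,1] into n steps leaves at most E/n, without
  differentiating under the integral.\<close>

lemma leaf_pairing_translate:
  fixes b :: "complex \<Rightarrow> real"
  assumes b: "mollifier \<delta> b" "\<delta> \<le> 1/8" and u: "cmod u \<le> 1/4" and g: "transversal_test g"
  shows "leaf_pairing (\<lambda>z. of_real (b (z - u))) g = leaf_pairing (\<lambda>z. of_real (b z)) g"
proof -
  let ?b = "\<lambda>z. complex_of_real (b z)"
  have bK: "?b z = 0" if "z \<notin> cball 0 \<delta>" for z using mollifierD(3)[OF b(1), of z] that by simp
  obtain C where C: "C > 0" "\<And>x y. cmod (?b x - ?b y - frechet_derivative ?b (at y) (x - y)) \<le> C * (cmod (x - y))\<^sup>2"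
    using smooth_compact_second_order[OF mollifierD(1)[OF b(1)] compact_cball bK] by blast
  obtain \<Gamma> where \<Gamma>: "\<Gamma> \<ge> 0" "\<And>\<alpha>. \<bar>g \<alpha>\<bar> \<le> \<Gamma>" using transversal_testD(1)[OF g] by blast
  define P where "P t = leaf_pairing (\<lambda>z. ?b (z - of_real t * u)) g" for t :: real
  define E where "E = C * \<Gamma> * (LINT p|M. \<bar>leaf_density p\<bar>)"
  have tu: "cmod (of_real t * u) \<le> 1/4" if "0 \<le> t" "t \<le> 1" for t :: real
    using that u mult_mono[of t 1 "cmod u" "1/4"] by (simp add: norm_mult)
  have step: "cmod (P s - P t) \<le> E * (s - t)\<^sup>2" if s: "0 \<le> s" "s \<le> 1" and t: "0 \<le> t" "t \<le> 1" for s t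
  proof -
    let ?s = "complex_of_real s * u" and ?t = "complex_of_real t * u"
    note ds = disc_test_translate[OF b tu[OF s]] and dt = disc_test_translate[OF b tu[OF t]]
    let ?A = "\<lambda>p. ?b (fst p - ?s) * complex_of_real (g (snd p))" and ?B = "\<lambda>p. ?b (fst p - ?t) * complex_of_real (g (snd p))"
      and ?C = "\<lambda>p. frechet_derivative (\<lambda>z. ?b (z - ?t)) (at (fst p)) (?t - ?s) * complex_of_real (g (snd p))"
    obtain B1 where B1: "\<And>p. cmod (?A p) \<le> B1" using test_function_bounded(1)[OF ds g] by blast
    obtain B2 where B2: "\<And>p. cmod (?B p) \<le> B2" using test_function_bounded(1)[OF dt g] by blast
    obtain B3 where B3: "\<And>p. cmod (?C p) \<le> B3" using test_function_bounded(1)[OF dt g, of "?t - ?s"] by blast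
    note m = test_function_bounded(2)[OF ds g] test_function_bounded(2)[OF dt g] test_function_bounded(3)[OF dt g, of "?t - ?s"]
    note i = integrable_density_mult[OF m(1) B1] integrable_density_mult[OF m(2) B2] integrable_density_mult[OF m(3) B3]
    have z: "(LINT p|M. of_real (leaf_density p) * ?C p) = 0" by (rule density_leaf_derivative_gen[OF dt g])
    have "P s - P t = (LINT p|M. of_real (leaf_density p) * ?A p) - (LINT p|M. of_real (leaf_density p) * ?B p) - (LINT p|M. of_real (leaf_density p) * ?C p)"
      unfolding P_def leaf_pairing_def z by simp
    also have "\<dots> = (LINT p|M. of_real (leaf_density p) * ?A p - of_real (leaf_density p) * ?B p - of_real (leaf_density p) * ?C p)"
      using i by (simp only: Bochner_Integration.integral_diff Bochner_Integration.integrable_diff)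
    also have "\<dots> = (LINT p|M. of_real (leaf_density p) * (?A p - ?B p - ?C p))"
      by (rule Bochner_Integration.integral_cong) (auto simp: algebra_simps)
    finally have eq: "P s - P t = (LINT p|M. of_real (leaf_density p) * (?A p - ?B p - ?C p))" .
    have bound: "cmod (?A p - ?B p - ?C p) \<le> C * (s - t)\<^sup>2 * \<Gamma>" for p
    proof -
      let ?x = "fst p - ?s" and ?y = "fst p - ?t"
      have xy: "?x - ?y = ?t - ?s" by simp
      have "?A p - ?B p - ?C p = (?b ?x - ?b ?y - frechet_derivative ?b (at ?y) (?x - ?y)) * complex_of_real (g (snd p))"
        unfolding smooth_on_translate(2)[OF mollifierD(1)[OF b(1)]] xy by (simp add: algebra_simps)
      also have "cmod \<dots> \<le> (C * (cmod (?x - ?y))\<^sup>2) * \<Gamma>"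
        unfolding norm_mult norm_of_real by (intro mult_mono C(2) \<Gamma>) (use C(1) in auto)
      also have "cmod (?x - ?y) = \<bar>s - t\<bar> * cmod u"
        unfolding xy by (simp add: norm_mult abs_minus_commute flip: left_diff_distrib of_real_diff)
      also have "(C * (\<bar>s - t\<bar> * cmod u)\<^sup>2) * \<Gamma> \<le> (C * (\<bar>s - t\<bar> * 1)\<^sup>2) * \<Gamma>"
        using u C(1) \<Gamma>(1) by (intro mult_right_mono mult_left_mono power_mono) auto
      finally show ?thesis by simp
    qed
    have "cmod (P s - P t) \<le> C * (s - t)\<^sup>2 * \<Gamma> * (LINT p|M. \<bar>leaf_density p\<bar>)"
      unfolding eq by (rule density_integral_bound[OF _ AE_I2 bound]) (use m bound in measurable)
    then show ?thesis by (simp add: E_def algebra_simps)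
  qed
  have lim: "cmod (P 1 - P 0) \<le> E / real n" if n: "n > 0" for n :: nat
  proof -
    have "P 1 - P 0 = (\<Sum>j<n. P (real (Suc j) / real n) - P (real j / real n))"
      using n by (subst sum_lessThan_telescope) simp
    also have "cmod \<dots> \<le> (\<Sum>j<n. E * (1 / real n)\<^sup>2)"
    proof (intro sum_norm_le)
      fix j assume "j \<in> {..<n}"
      then have "cmod (P (real (Suc j) / real n) - P (real j / real n)) \<le> E * (real (Suc j) / real n - real j / real n)\<^sup>2"
        by (intro step) auto
      also have "real (Suc j) / real n - real j / real n = 1 / real n" by (simp add: diff_divide_distrib[symmetric])
      finally show "cmod (P (real (Suc j) / real n) - P (real j / real n)) \<le> E * (1 / real n)\<^sup>2" .
    qed
    also have "\<dots> = E / real n" using n by (simp add: power2_eq_square)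
    finally show ?thesis .
  qed
  have "(\<lambda>n. E * (1 / real n)) \<longlonglongrightarrow> E * 0" by (intro tendsto_intros lim_1_over_n)
  then have "cmod (P 1 - P 0) \<le> E * 0"
    by (rule LIMSEQ_le_const) (use lim in \<open>auto intro!: exI[of _ 1]\<close>)
  then show ?thesis by (simp add: P_def)
qed

text \<open>The density on the leaf \<alpha> averaged with kernel \<open>b\<close> centred at
  \<open>u\<close>. It replaces the value of the density at \<open>u\<close>, which has no meaning
  for a function given almost everywhere.\<close>

definition slice :: "(complex \<Rightarrow> real) \<Rightarrow> complex \<Rightarrow> complex \<Rightarrow> real" where
  "slice b u \<alpha> = (LINT z|disc_measure. leaf_density (z, \<alpha>) * b (z - u))"

lemma mollifier_measurable [measurable]: "mollifier \<delta> b \<Longrightarrow> b \<in> borel_measurable borel"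
  by (rule mollifierD(6))

lemma slice_integral:
  assumes b: "mollifier \<delta> b" and G: "G \<in> borel_measurable borel" "\<And>\<alpha>. cmod (G \<alpha>) \<le> B"
  shows "integrable \<mu> (slice b u)"
    and "(LINT \<alpha>|\<mu>. of_real (slice b u \<alpha>) * G \<alpha>) = (LINT p|M. of_real (leaf_density p) * (of_real (b (fst p - u)) * G (snd p)))"
proof -
  obtain Bb where Bb: "\<And>z. b z \<le> Bb" using mollifierD(7)[OF b] by blast
  have [measurable]: "b \<in> borel_measurable borel" "G \<in> borel_measurable borel" using mollifierD(6)[OF b] G(1) by auto
  have Bb': "cmod (complex_of_real (b z)) \<le> Bb" for z using Bb mollifierD(2)[OF b] by simp
  have B0: "B \<ge> 0" using G(2) norm_ge_zero order_trans by blast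
  have i: "integrable M (\<lambda>p. of_real (leaf_density p) * (of_real (b (fst p - u)) * G (snd p)))"
  proof (rule integrable_density_mult)
    show "(\<lambda>p. complex_of_real (b (fst p - u)) * G (snd p)) \<in> borel_measurable borel" by measurable
    show "cmod (complex_of_real (b (fst p - u)) * G (snd p)) \<le> Bb * B" for p
      unfolding norm_mult using Bb'[of "fst p - u"] G(2)[of "snd p"] by (intro mult_mono) (auto intro: order_trans[OF norm_ge_zero])
  qed
  have i': "integrable M (\<lambda>p. leaf_density p * b (fst p - u))"
  proof (rule Bochner_Integration.integrable_bound[where f="\<lambda>p. Bb * leaf_density p"])
    show "AE p in M. norm (leaf_density p * b (fst p - u)) \<le> norm (Bb * leaf_density p)"
    proof (rule AE_I2)
      fix p
      have "\<bar>leaf_density p\<bar> * \<bar>b (fst p - u)\<bar> \<le> \<bar>leaf_density p\<bar> * \<bar>Bb\<bar>"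
        using Bb[of "fst p - u"] mollifierD(2)[OF b, of "fst p - u"] by (intro mult_left_mono) auto
      then show "norm (leaf_density p * b (fst p - u)) \<le> norm (Bb * leaf_density p)" by (simp add: abs_mult mult.commute)
    qed
    have "(\<lambda>p. leaf_density p * b (fst p - u)) \<in> borel_measurable borel" by measurable
    then show "(\<lambda>p. leaf_density p * b (fst p - u)) \<in> borel_measurable M" by simp
  qed (use integrable_density in auto)
  have "integrable (disc_measure \<Otimes>\<^sub>M \<mu>) (\<lambda>(z, \<alpha>). leaf_density (z, \<alpha>) * b (z - u))"
    using i' unfolding M_def by (simp add: case_prod_beta')
  from pair.integrable_snd[OF this] show "integrable \<mu> (slice b u)" by (simp add: slice_def[abs_def])
  have "integrable (disc_measure \<Otimes>\<^sub>M \<mu>) (\<lambda>(z, \<alpha>). of_real (leaf_density (z, \<alpha>)) * (of_real (b (z - u)) * G \<alpha>))"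
    using i unfolding M_def by (simp add: case_prod_beta')
  from pair.integral_snd[OF this]
  have "(LINT \<alpha>|\<mu>. LINT z|disc_measure. of_real (leaf_density (z, \<alpha>)) * (of_real (b (z - u)) * G \<alpha>))
     = (LINT p|M. of_real (leaf_density p) * (of_real (b (fst p - u)) * G (snd p)))"
    unfolding M_def by (simp add: case_prod_beta')
  moreover have "(LINT z|disc_measure. of_real (leaf_density (z, \<alpha>)) * (of_real (b (z - u)) * G \<alpha>)) = of_real (slice b u \<alpha>) * G \<alpha>" for \<alpha>
  proof -
    have "(LINT z|disc_measure. of_real (leaf_density (z, \<alpha>)) * (of_real (b (z - u)) * G \<alpha>))
       = (LINT z|disc_measure. complex_of_real (leaf_density (z, \<alpha>) * b (z - u)) * G \<alpha>)"
      by (rule Bochner_Integration.integral_cong) auto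
    also have "\<dots> = (LINT z|disc_measure. complex_of_real (leaf_density (z, \<alpha>) * b (z - u))) * G \<alpha>"
      by (rule integral_mult_left_zero)
    finally show ?thesis by (simp only: integral_complex_of_real slice_def)
  qed
  ultimately show "(LINT \<alpha>|\<mu>. of_real (slice b u \<alpha>) * G \<alpha>) = (LINT p|M. of_real (leaf_density p) * (of_real (b (fst p - u)) * G (snd p)))"
    by simp
qed

lemma slice_integrable: "mollifier \<delta> b \<Longrightarrow> integrable \<mu> (slice b u)"
  by (rule slice_integral(1)[where G="\<lambda>\<alpha>. 0" and B=0]) auto

lemma slice_pairing:
  assumes b: "mollifier \<delta> b" and g: "transversal_test g"
  shows "complex_of_real (LINT \<alpha>|\<mu>. slice b u \<alpha> * g \<alpha>) = leaf_pairing (\<lambda>z. of_real (b (z - u))) g"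
proof -
  obtain \<Gamma> where \<Gamma>: "\<Gamma> \<ge> 0" "\<And>\<alpha>. \<bar>g \<alpha>\<bar> \<le> \<Gamma>" using transversal_testD(1)[OF g] by blast
  have "(\<lambda>\<alpha>. complex_of_real (g \<alpha>)) \<in> borel_measurable borel" using transversal_test_measurable[OF g] by measurable
  then have "(LINT \<alpha>|\<mu>. of_real (slice b u \<alpha>) * complex_of_real (g \<alpha>)) = leaf_pairing (\<lambda>z. of_real (b (z - u))) g"
    unfolding leaf_pairing_def
    by (rule slice_integral(2)[OF b, where G="\<lambda>\<alpha>. complex_of_real (g \<alpha>)" and B=\<Gamma>]) (use \<Gamma>(2) in simp)
  then show ?thesis by (simp only: of_real_mult[symmetric] integral_complex_of_real)
qed

lemma transversal_testI:
  assumes "\<exists>\<Lambda>\<ge>0. \<forall>\<alpha> \<beta>. \<bar>g \<alpha> - g \<beta>\<bar> \<le> \<Lambda> * cmod (\<alpha> - \<beta>)" "\<forall>\<alpha>. 0 \<le> g \<alpha>" "\<forall>\<alpha>. g \<alpha> \<le> 1" "\<forall>\<alpha>. \<alpha> \<notin> ball 0 (1/2) \<longrightarrow> g \<alpha> = 0"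
  shows "transversal_test g"
  unfolding transversal_test_def using assms by (auto intro!: exI[of _ 1] simp: abs_le_iff)

text \<open>Both differences \<open>h - h'\<close> and \<open>h' - h\<close> integrate to 0 against
  all transversal tests, so the positivity criterion applies to each.\<close>

lemma slice_eq_AE:
  assumes "integrable \<mu> h" "integrable \<mu> h'"
    "\<And>g. transversal_test g \<Longrightarrow> (LINT \<alpha>|\<mu>. h \<alpha> * g \<alpha>) = (LINT \<alpha>|\<mu>. h' \<alpha> * g \<alpha>)"
  shows "AE \<alpha> in \<mu>. cmod \<alpha> < 1/2 \<longrightarrow> h \<alpha> = h' \<alpha>"
proof -
  have int: "integrable \<mu> (\<lambda>\<alpha>. f \<alpha> * g \<alpha>)" if fg: "integrable \<mu> f" "transversal_test g" for f g
  proof -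
    obtain \<Gamma> where \<Gamma>: "\<Gamma> \<ge> 0" "\<And>\<alpha>. \<bar>g \<alpha>\<bar> \<le> \<Gamma>" using transversal_testD(1)[OF fg(2)] by blast
    have [measurable]: "g \<in> borel_measurable \<mu>" using transversal_test_measurable[OF fg(2)] by simp
    have [measurable]: "f \<in> borel_measurable \<mu>" using fg(1) by simp
    show ?thesis
    proof (rule Bochner_Integration.integrable_bound[where f="\<lambda>p. \<Gamma> * f p"])
      show "AE p in \<mu>. norm (f p * g p) \<le> norm (\<Gamma> * f p)"
      proof (rule AE_I2)
        fix p have "\<bar>f p\<bar> * \<bar>g p\<bar> \<le> \<bar>f p\<bar> * \<Gamma>" using \<Gamma>(2)[of p] by (intro mult_left_mono) auto
        then show "norm (f p * g p) \<le> norm (\<Gamma> * f p)" using \<Gamma>(1) by (simp add: abs_mult mult.commute)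
      qed
    qed (use fg in auto)
  qed
  have 1: "AE \<alpha> in \<mu>. \<alpha> \<in> ball 0 (1/2) \<longrightarrow> 0 \<le> f \<alpha> - f' \<alpha>"
    if f: "integrable \<mu> f" "integrable \<mu> f'" "\<And>g. transversal_test g \<Longrightarrow> (LINT \<alpha>|\<mu>. f \<alpha> * g \<alpha>) = (LINT \<alpha>|\<mu>. f' \<alpha> * g \<alpha>)" for f f'
  proof (rule AE_nonneg_if_integral_nonneg[OF sets_mu _ open_ball])
    show "integrable \<mu> (\<lambda>\<alpha>. f \<alpha> - f' \<alpha>)" using f by simp
    fix g :: "complex \<Rightarrow> real"
    assume "\<exists>\<Lambda>\<ge>0. \<forall>\<alpha> \<beta>. \<bar>g \<alpha> - g \<beta>\<bar> \<le> \<Lambda> * cmod (\<alpha> - \<beta>)" "\<forall>\<alpha>. 0 \<le> g \<alpha>" "\<forall>\<alpha>. g \<alpha> \<le> 1" "\<forall>\<alpha>. \<alpha> \<notin> ball 0 (1/2) \<longrightarrow> g \<alpha> = 0"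
    then have g: "transversal_test g" by (rule transversal_testI)
    show "0 \<le> (LINT \<alpha>|\<mu>. (f \<alpha> - f' \<alpha>) * g \<alpha>)"
      using f(3)[OF g] int[OF f(1) g] int[OF f(2) g] by (simp add: left_diff_distrib)
  qed
  have "AE \<alpha> in \<mu>. \<alpha> \<in> ball 0 (1/2) \<longrightarrow> 0 \<le> h \<alpha> - h' \<alpha>" by (rule 1[OF assms(1,2)]) (rule assms(3))
  moreover have "AE \<alpha> in \<mu>. \<alpha> \<in> ball 0 (1/2) \<longrightarrow> 0 \<le> h' \<alpha> - h \<alpha>"
    by (rule 1[OF assms(2,1)]) (rule assms(3)[symmetric])
  ultimately show ?thesis by eventually_elim auto
qed

text \<open>Constancy along leaves in averaged form. The exceptional null set may depend on
  \<open>u\<close>; uses of this fact therefore fix \<open>u\<close> and integrate over the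
  leaves.\<close>

lemma slice_translate_AE:
  assumes "mollifier \<delta> b" "\<delta> \<le> 1/8" "cmod u \<le> 1/4"
  shows "AE \<alpha> in \<mu>. cmod \<alpha> < 1/2 \<longrightarrow> slice b u \<alpha> = slice b 0 \<alpha>"
proof (rule slice_eq_AE)
  show "integrable \<mu> (slice b u)" "integrable \<mu> (slice b 0)" using slice_integrable[OF assms(1)] by auto
  fix g assume g: "transversal_test g"
  have "complex_of_real (LINT \<alpha>|\<mu>. slice b u \<alpha> * g \<alpha>) = complex_of_real (LINT \<alpha>|\<mu>. slice b 0 \<alpha> * g \<alpha>)"
    unfolding slice_pairing[OF assms(1) g] using leaf_pairing_translate[OF assms g] by simp
  then show "(LINT \<alpha>|\<mu>. slice b u \<alpha> * g \<alpha>) = (LINT \<alpha>|\<mu>. slice b 0 \<alpha> * g \<alpha>)" by (simp only: of_real_eq_iff)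
qed

lemma slice_nonneg_AE:
  assumes "mollifier \<delta> b" "\<delta> \<le> 1/8"
  shows "AE \<alpha> in \<mu>. cmod \<alpha> < 1/2 \<longrightarrow> 0 \<le> slice b 0 \<alpha>"
proof -
  have "AE \<alpha> in \<mu>. \<alpha> \<in> ball 0 (1/2) \<longrightarrow> 0 \<le> slice b 0 \<alpha>"
  proof (rule AE_nonneg_if_integral_nonneg[OF sets_mu slice_integrable[OF assms(1)] open_ball])
    fix g :: "complex \<Rightarrow> real"
    assume g0: "\<exists>\<Lambda>\<ge>0. \<forall>\<alpha> \<beta>. \<bar>g \<alpha> - g \<beta>\<bar> \<le> \<Lambda> * cmod (\<alpha> - \<beta>)" "\<forall>\<alpha>. 0 \<le> g \<alpha>" "\<forall>\<alpha>. g \<alpha> \<le> 1" "\<forall>\<alpha>. \<alpha> \<notin> ball 0 (1/2) \<longrightarrow> g \<alpha> = 0"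
    then have g: "transversal_test g" by (rule transversal_testI)
    have d: "disc_test (\<lambda>z. complex_of_real (b z))" using disc_test_translate[OF assms, of 0] by simp
    have "0 \<le> Re (leaf_pairing (\<lambda>z. complex_of_real (b z)) g)"
      unfolding leaf_pairing_def
      by (rule density_nonneg_weak[OF d _ g g0(2)]) (use mollifierD(2)[OF assms(1)] in simp)
    also have "leaf_pairing (\<lambda>z. complex_of_real (b z)) g = complex_of_real (LINT \<alpha>|\<mu>. slice b 0 \<alpha> * g \<alpha>)"
      using slice_pairing[OF assms(1) g, of 0] by simp
    finally show "0 \<le> (LINT \<alpha>|\<mu>. slice b 0 \<alpha> * g \<alpha>)" by simp
  qed
  then show ?thesis by simp
qed

end

section \<open>From constant averages to the representation by leaves\<close>

context dominated_leaf_current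
begin

text \<open>Fubini brings the integral over \<open>u\<close> outside. For each fixed
  \<open>u\<close> the average \<open>slice b u\<close> may be exchanged for
  \<open>slice b 0\<close> almost everywhere, and Fubini restores the order. The support condition
  confines \<open>u\<close> and \<alpha> to the range where that exchange is valid.\<close>

lemma convolution_integral:
  fixes b :: "complex \<Rightarrow> real"
  assumes b: "mollifier \<delta> b" "\<delta> \<le> 1/8"
    and F: "F \<in> borel_measurable (borel :: (complex \<times> complex) measure)" "\<And>p. cmod (F p) \<le> B"
    and supp: "\<And>u \<alpha>. cmod u > 1/4 \<or> cmod \<alpha> \<ge> 1/2 \<Longrightarrow> F (u, \<alpha>) = 0"
  shows "(LINT p|M. of_real (leaf_density p) * (LINT u|disc_measure. F (u, snd p) * of_real (b (fst p - u))))
     = (LINT \<alpha>|\<mu>. of_real (slice b 0 \<alpha>) * (LINT u|disc_measure. F (u, \<alpha>)))"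
proof -
  obtain Bb where Bb: "\<And>z. b z \<le> Bb" using mollifierD(7)[OF b(1)] by blast
  have [measurable]: "b \<in> borel_measurable borel" using mollifierD(6)[OF b(1)] .
  have [measurable]: "F \<in> borel_measurable (borel \<Otimes>\<^sub>M borel)" using F(1) by (simp add: borel_prod)
  have [measurable]: "leaf_density \<in> borel_measurable (borel \<Otimes>\<^sub>M borel)" using density_measurable by (simp add: borel_prod)
  have B0: "B \<ge> 0" using F(2) norm_ge_zero order_trans by blast
  have Bb0: "Bb \<ge> 0" using Bb mollifierD(2)[OF b(1)] order_trans by blast
  have setsM: "sets M = sets (borel \<Otimes>\<^sub>M borel :: (complex \<times> complex) measure)" by (simp only: sets_M borel_prod)
  note setsM[measurable_cong]
  interpret MD: pair_sigma_finite M disc_measure ..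
  define f where "f p u = of_real (leaf_density p) * (F (u, snd p) * of_real (b (fst p - u)))" for p u
  have fm: "(\<lambda>(p, u). f p u) \<in> borel_measurable (M \<Otimes>\<^sub>M disc_measure)"
    unfolding f_def by measurable
  have fb: "cmod (f p u) \<le> \<bar>leaf_density p\<bar> * (B * Bb)" for p u
    unfolding f_def norm_mult norm_of_real
    by (intro mult_mono F(2)) (use Bb[of "fst p - u"] mollifierD(2)[OF b(1), of "fst p - u"] B0 in auto)
  have i2: "integrable disc_measure (f p)" for p
  proof (rule dm.integrable_const_bound[where B="\<bar>leaf_density p\<bar> * (B * Bb)"])
    show "f p \<in> borel_measurable disc_measure" unfolding f_def by measurable
  qed (use fb in auto)
  have int: "integrable (M \<Otimes>\<^sub>M disc_measure) (\<lambda>(p, u). f p u)"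
  proof (rule MD.Fubini_integrable[OF fm])
    show "AE p in M. integrable disc_measure (\<lambda>u. case (p, u) of (p, u) \<Rightarrow> f p u)" using i2 by simp
    show "integrable M (\<lambda>p. LINT u|disc_measure. norm (case (p, u) of (p, u) \<Rightarrow> f p u))"
    proof (rule Bochner_Integration.integrable_bound[where f="\<lambda>p. (B * Bb * measure disc_measure UNIV) * leaf_density p"])
      show "(\<lambda>p. LINT u|disc_measure. norm (case (p, u) of (p, u) \<Rightarrow> f p u)) \<in> borel_measurable M"
        unfolding f_def by measurable
      show "AE p in M. norm (LINT u|disc_measure. norm (case (p, u) of (p, u) \<Rightarrow> f p u)) \<le> norm (B * Bb * measure disc_measure UNIV * leaf_density p)"
      proof (rule AE_I2)
        fix p
        have "(LINT u|disc_measure. norm (f p u)) \<le> (LINT u|disc_measure. \<bar>leaf_density p\<bar> * (B * Bb))"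
          by (intro integral_mono) (use i2 fb in auto)
        also have "\<dots> = B * Bb * measure disc_measure UNIV * \<bar>leaf_density p\<bar>" by simp
        finally show "norm (LINT u|disc_measure. norm (case (p, u) of (p, u) \<Rightarrow> f p u)) \<le> norm (B * Bb * measure disc_measure UNIV * leaf_density p)"
          using B0 Bb0 by (simp add: abs_mult integral_nonneg_AE)
      qed
    qed (use integrable_density in auto)
  qed
  have zf: "integrable \<mu> (slice b u)" for u by (rule slice_integrable[OF b(1)])
  have Fu: "(LINT p|M. f p u) = (LINT \<alpha>|\<mu>. of_real (slice b 0 \<alpha>) * F (u, \<alpha>))" for u
  proof -
    have "(LINT p|M. f p u) = (LINT p|M. of_real (leaf_density p) * (of_real (b (fst p - u)) * F (u, snd p)))"
      unfolding f_def by (rule Bochner_Integration.integral_cong) auto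
    also have "\<dots> = (LINT \<alpha>|\<mu>. of_real (slice b u \<alpha>) * F (u, \<alpha>))"
      by (rule slice_integral(2)[OF b(1), where G="\<lambda>\<alpha>. F (u, \<alpha>)" and B=B, symmetric]) (measurable, use F(2) in simp)
    also have "\<dots> = (LINT \<alpha>|\<mu>. of_real (slice b 0 \<alpha>) * F (u, \<alpha>))"
    proof (cases "cmod u \<le> 1/4")
      case True
      have m: "(\<lambda>\<alpha>. of_real (slice b u \<alpha>) * F (u, \<alpha>)) \<in> borel_measurable \<mu>" for u
      proof -
        have [measurable]: "slice b u \<in> borel_measurable \<mu>" for u using zf[of u] by simp
        have "slice b u \<in> borel_measurable borel" for u using zf[of u] by simp
        then show ?thesis by measurable
      qed
      have m': "(\<lambda>\<alpha>. of_real (slice b 0 \<alpha>) * F (u, \<alpha>)) \<in> borel_measurable \<mu>"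
      proof -
        have "slice b 0 \<in> borel_measurable borel" using zf[of 0] by simp
        then show ?thesis by measurable
      qed
      show ?thesis
      proof (rule integral_cong_AE[OF m m'])
        show "AE \<alpha> in \<mu>. of_real (slice b u \<alpha>) * F (u, \<alpha>) = of_real (slice b 0 \<alpha>) * F (u, \<alpha>)"
          using slice_translate_AE[OF b True]
        proof eventually_elim
          case (elim \<alpha>)
          then show ?case using supp[of u \<alpha>] by (cases "cmod \<alpha> < 1/2") auto
        qed
      qed
    qed (use supp in simp)
    finally show ?thesis .
  qed
  have "(LINT p|M. of_real (leaf_density p) * (LINT u|disc_measure. F (u, snd p) * of_real (b (fst p - u))))
     = (LINT p|M. LINT u|disc_measure. f p u)"
    unfolding f_def by (simp only: integral_mult_right_zero)
  also have "\<dots> = (LINT u|disc_measure. LINT p|M. f p u)"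
    by (rule MD.Fubini_integral[OF int, symmetric])
  also have "\<dots> = (LINT u|disc_measure. LINT \<alpha>|\<mu>. of_real (slice b 0 \<alpha>) * F (u, \<alpha>))"
    by (simp only: Fu)
  also have "\<dots> = (LINT \<alpha>|\<mu>. LINT u|disc_measure. of_real (slice b 0 \<alpha>) * F (u, \<alpha>))"
  proof (rule pair.Fubini_integral[symmetric])
    have [measurable]: "slice b 0 \<in> borel_measurable borel" using zf[of 0] by simp
    have i3: "integrable \<mu> (\<lambda>\<alpha>. of_real (slice b 0 \<alpha>) * F (u, \<alpha>))" for u
    proof (rule Bochner_Integration.integrable_bound[where f="\<lambda>\<alpha>. B * slice b 0 \<alpha>"])
      show "(\<lambda>\<alpha>. of_real (slice b 0 \<alpha>) * F (u, \<alpha>)) \<in> borel_measurable \<mu>" by measurable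
      show "AE \<alpha> in \<mu>. norm (of_real (slice b 0 \<alpha>) * F (u, \<alpha>)) \<le> norm (B * slice b 0 \<alpha>)"
      proof (rule AE_I2)
        fix \<alpha> have "\<bar>slice b 0 \<alpha>\<bar> * cmod (F (u, \<alpha>)) \<le> \<bar>slice b 0 \<alpha>\<bar> * B" using F(2) by (intro mult_left_mono) auto
        then show "norm (of_real (slice b 0 \<alpha>) * F (u, \<alpha>)) \<le> norm (B * slice b 0 \<alpha>)"
          using B0 by (simp add: norm_mult abs_mult mult.commute)
      qed
    qed (use zf in auto)
    show "integrable (disc_measure \<Otimes>\<^sub>M \<mu>) (\<lambda>(u, \<alpha>). of_real (slice b 0 \<alpha>) * F (u, \<alpha>))"
    proof (rule pair.Fubini_integrable)
      show "(\<lambda>(u, \<alpha>). of_real (slice b 0 \<alpha>) * F (u, \<alpha>)) \<in> borel_measurable (disc_measure \<Otimes>\<^sub>M \<mu>)" by measurable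
      show "AE u in disc_measure. integrable \<mu> (\<lambda>\<alpha>. case (u, \<alpha>) of (u, \<alpha>) \<Rightarrow> of_real (slice b 0 \<alpha>) * F (u, \<alpha>))"
        using i3 by simp
      show "integrable disc_measure (\<lambda>u. LINT \<alpha>|\<mu>. norm (case (u, \<alpha>) of (u, \<alpha>) \<Rightarrow> of_real (slice b 0 \<alpha>) * F (u, \<alpha>)))"
      proof (rule dm.integrable_const_bound[where B="LINT \<alpha>|\<mu>. B * \<bar>slice b 0 \<alpha>\<bar>"])
        show "AE u in disc_measure. norm (LINT \<alpha>|\<mu>. norm (case (u, \<alpha>) of (u, \<alpha>) \<Rightarrow> of_real (slice b 0 \<alpha>) * F (u, \<alpha>))) \<le> (LINT \<alpha>|\<mu>. B * \<bar>slice b 0 \<alpha>\<bar>)"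
        proof (rule AE_I2)
          fix u
          have "(LINT \<alpha>|\<mu>. norm (of_real (slice b 0 \<alpha>) * F (u, \<alpha>))) \<le> (LINT \<alpha>|\<mu>. B * \<bar>slice b 0 \<alpha>\<bar>)"
          proof (rule integral_mono)
            show "integrable \<mu> (\<lambda>\<alpha>. norm (of_real (slice b 0 \<alpha>) * F (u, \<alpha>)))" using i3 by (rule integrable_norm)
            show "integrable \<mu> (\<lambda>\<alpha>. B * \<bar>slice b 0 \<alpha>\<bar>)" using zf by simp
            show "norm (of_real (slice b 0 \<alpha>) * F (u, \<alpha>)) \<le> B * \<bar>slice b 0 \<alpha>\<bar>" for \<alpha>
              using mult_right_mono[OF F(2)[of "(u, \<alpha>)"], of "\<bar>slice b 0 \<alpha>\<bar>"] by (simp add: norm_mult mult.commute)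
          qed
          then show "norm (LINT \<alpha>|\<mu>. norm (case (u, \<alpha>) of (u, \<alpha>) \<Rightarrow> of_real (slice b 0 \<alpha>) * F (u, \<alpha>))) \<le> (LINT \<alpha>|\<mu>. B * \<bar>slice b 0 \<alpha>\<bar>)"
            by (simp add: integral_nonneg_AE)
        qed
      qed measurable
    qed
  qed
  also have "\<dots> = (LINT \<alpha>|\<mu>. of_real (slice b 0 \<alpha>) * (LINT u|disc_measure. F (u, \<alpha>)))"
    by (simp only: integral_mult_right_zero)
  finally show ?thesis .
qed

lemma mollifier_disc_integral:
  fixes b :: "complex \<Rightarrow> real"
  assumes b: "mollifier \<delta> b" "\<delta> \<le> 1/8" and z: "cmod z \<le> 1/2"
  shows "(LINT u|disc_measure. b (z - u)) = 1"
proof -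
  have [measurable]: "b \<in> borel_measurable borel" using mollifierD(6)[OF b(1)] .
  have "(LINT u|disc_measure. b (z - u)) = (LINT u|lborel. b (z - u))"
  proof (rule integral_disc_measure_eq_lborel)
    fix u :: complex assume "cmod u \<ge> 1"
    then have "cmod (z - u) > \<delta>" using norm_triangle_ineq2[of u z] z b(2) by (simp add: norm_minus_commute)
    then show "b (z - u) = 0" using mollifierD(3)[OF b(1)] by simp
  qed simp
  also have "\<dots> = 1" using lborel_integral_reflect[of b z] mollifierD(5)[OF b(1)] by simp
  finally show ?thesis .
qed

text \<open>Convolving with a second kernel, the pairing of \<open>slice c 0\<close> with
  \<open>g\<close> equals that of the density with the convolution of \<open>c'\<close> and
  \<open>c\<close>, times \<open>g\<close>. Convolution is commutative, so exchanging the kernels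
  changes nothing.\<close>

lemma slice_independent_AE:
  fixes b b' :: "complex \<Rightarrow> real"
  assumes b: "mollifier \<delta> b" "\<delta> \<le> 1/8" and b': "mollifier \<delta>' b'" "\<delta>' \<le> 1/8"
  shows "AE \<alpha> in \<mu>. cmod \<alpha> < 1/2 \<longrightarrow> slice b 0 \<alpha> = slice b' 0 \<alpha>"
proof (rule slice_eq_AE[OF slice_integrable[OF b(1)] slice_integrable[OF b'(1)]])
  fix g assume g: "transversal_test g"
  obtain \<Gamma> where \<Gamma>: "\<Gamma> \<ge> 0" "\<And>\<alpha>. \<bar>g \<alpha>\<bar> \<le> \<Gamma>" using transversal_testD(1)[OF g] by blast
  have [measurable]: "g \<in> borel_measurable borel" using transversal_test_measurable[OF g] .
  have key: "complex_of_real (LINT \<alpha>|\<mu>. slice c 0 \<alpha> * g \<alpha>)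
      = (LINT p|M. of_real (leaf_density p) * of_real ((LINT u|lborel. c' u * c (fst p - u)) * g (snd p)))"
    if c: "mollifier d c" "d \<le> 1/8" and c': "mollifier d' c'" "d' \<le> 1/8" for c c' d d'
  proof -
    have [measurable]: "c \<in> borel_measurable borel" "c' \<in> borel_measurable borel" using mollifierD(6) c(1) c'(1) by auto
    obtain Bc where Bc: "\<And>z. c' z \<le> Bc" using mollifierD(7)[OF c'(1)] by blast
    have Bc0: "Bc \<ge> 0" using Bc mollifierD(2)[OF c'(1)] order_trans by blast
    have c'0: "c' u = 0" if "cmod u > 1/4" for u using mollifierD(3)[OF c'(1), of u] that c'(2) by simp
    let ?F = "\<lambda>p. complex_of_real (c' (fst p) * g (snd p))"
    have c1: "(LINT p|M. of_real (leaf_density p) * (LINT u|disc_measure. ?F (u, snd p) * of_real (c (fst p - u))))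
     = (LINT \<alpha>|\<mu>. of_real (slice c 0 \<alpha>) * (LINT u|disc_measure. ?F (u, \<alpha>)))"
    proof (rule convolution_integral[OF c, where B="Bc * \<Gamma>"])
      show "?F \<in> borel_measurable borel" by measurable
      show "cmod (?F p) \<le> Bc * \<Gamma>" for p
        unfolding norm_of_real abs_mult using Bc[of "fst p"] mollifierD(2)[OF c'(1), of "fst p"] \<Gamma> Bc0
        by (intro mult_mono) auto
      show "?F (u, \<alpha>) = 0" if "cmod u > 1/4 \<or> cmod \<alpha> \<ge> 1/2" for u \<alpha>
        using that c'0[of u] transversal_testD(2)[OF g, of \<alpha>] by auto
    qed
    have c2: "(LINT u|disc_measure. ?F (u, \<alpha>)) = of_real (g \<alpha>)" for \<alpha>
    proof -
      have "(LINT u|disc_measure. c' u * g \<alpha>) = (LINT u|disc_measure. c' u) * g \<alpha>" by (rule integral_mult_left_zero)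
      also have "(LINT u|disc_measure. c' u) = (LINT u|lborel. c' u)"
        by (rule integral_disc_measure_eq_lborel) (use c'0 in auto)
      also have "\<dots> = 1" by (rule mollifierD(5)[OF c'(1)])
      finally show ?thesis by (simp only: fst_conv snd_conv integral_complex_of_real mult_1)
    qed
    have c3: "(LINT u|disc_measure. ?F (u, snd p) * of_real (c (fst p - u))) = of_real ((LINT u|lborel. c' u * c (fst p - u)) * g (snd p))" for p
    proof -
      have "(LINT u|disc_measure. ?F (u, snd p) * of_real (c (fst p - u)))
        = (LINT u|disc_measure. complex_of_real ((c' u * c (fst p - u)) * g (snd p)))"
        by (rule Bochner_Integration.integral_cong) auto
      also have "\<dots> = complex_of_real ((LINT u|disc_measure. c' u * c (fst p - u)) * g (snd p))"
        by (simp only: integral_complex_of_real integral_mult_left_zero)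
      also have "(LINT u|disc_measure. c' u * c (fst p - u)) = (LINT u|lborel. c' u * c (fst p - u))"
        by (rule integral_disc_measure_eq_lborel) (use c'0 in auto)
      finally show ?thesis .
    qed
    have "complex_of_real (LINT \<alpha>|\<mu>. slice c 0 \<alpha> * g \<alpha>) = (LINT \<alpha>|\<mu>. of_real (slice c 0 \<alpha>) * of_real (g \<alpha>))"
      by (simp only: of_real_mult[symmetric] integral_complex_of_real)
    also have "\<dots> = (LINT \<alpha>|\<mu>. of_real (slice c 0 \<alpha>) * (LINT u|disc_measure. ?F (u, \<alpha>)))" by (simp only: c2)
    finally show ?thesis using c1 unfolding c3 by simp
  qed
  \<comment> \<open>The substitution of z - u for u exchanges the two kernels.\<close>
  have comm: "(LINT u|lborel. b' u * b (z - u)) = (LINT u|lborel. b u * b' (z - u))" for z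
  proof -
    have [measurable]: "b \<in> borel_measurable borel" "b' \<in> borel_measurable borel" using mollifierD(6) b(1) b'(1) by auto
    have "(LINT u|lborel. b' (z - u) * b (z - (z - u))) = (LINT u|lborel. b' u * b (z - u))"
      by (rule lborel_integral_reflect[of "\<lambda>u. b' u * b (z - u)" z]) measurable
    then show ?thesis by (simp add: mult.commute)
  qed
  have "complex_of_real (LINT \<alpha>|\<mu>. slice b 0 \<alpha> * g \<alpha>) = complex_of_real (LINT \<alpha>|\<mu>. slice b' 0 \<alpha> * g \<alpha>)"
    unfolding key[OF b b'] key[OF b' b] comm ..
  then show "(LINT \<alpha>|\<mu>. slice b 0 \<alpha> * g \<alpha>) = (LINT \<alpha>|\<mu>. slice b' 0 \<alpha> * g \<alpha>)" by (simp only: of_real_eq_iff)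
qed

text \<open>A leaf that reaches a height below 1/4 has label below 1/2, because its drift is at most
  1/4.\<close>

lemma trace_small_support:
  assumes \<omega>: "test_form2 (ball 0 (1/4) \<times> ball 0 (1/4)) \<omega>" and "cmod u > 1/4 \<or> cmod \<alpha> \<ge> 1/2"
  shows "trace \<omega> (u, \<alpha>) = 0"
proof (cases "u \<in> unit_disc \<and> \<alpha> \<in> \<tau>")
  case True
  obtain K where K: "compact K" "K \<subseteq> ball 0 (1/4) \<times> ball 0 (1/4)" "\<And>p u v. p \<notin> K \<Longrightarrow> \<omega> p u v = 0"
    using test_form2_support[OF \<omega>] by metis
  have "(u, \<phi> \<alpha> u) \<notin> K"
  proof
    assume "(u, \<phi> \<alpha> u) \<in> K"
    then have "cmod u < 1/4" "cmod (\<phi> \<alpha> u) < 1/4" using K(2) by auto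
    moreover have "cmod \<alpha> \<le> cmod (\<phi> \<alpha> u) + cmod (\<phi> \<alpha> u - \<alpha>)"
      using norm_triangle_ineq4[of "\<phi> \<alpha> u" "\<phi> \<alpha> u - \<alpha>"] by simp
    ultimately show False using near[of \<alpha> u] True assms(2) by auto
  qed
  then show ?thesis using K(3) by (simp add: trace_def leaf_form_def)
qed (auto simp: trace_def)

text \<open>For a narrow kernel \<open>b'\<close> the mollified trace is uniformly close to the
  trace, and its pairing with the density is exactly an average of leaf integrals weighted by
  \<open>slice b' 0\<close>. That weight agrees almost everywhere with the one of the fixed kernel
  \<open>b\<close>, so the limit is taken on one side only.\<close>

theorem leaf_representation:
  fixes b :: "complex \<Rightarrow> real"
  assumes b: "mollifier \<delta> b" "\<delta> \<le> 1/8" and \<omega>: "test_form2 (ball 0 (1/4) \<times> ball 0 (1/4)) \<omega>"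
  shows "S \<omega> = (LINT \<alpha>|\<mu>. of_real (slice b 0 \<alpha>) * (LINT u|disc_measure. trace \<omega> (u, \<alpha>)))"
proof -
  have sub: "ball 0 (1/4) \<times> ball 0 (1/4) \<subseteq> bidisc" by auto
  have \<omega>': "test_form2 bidisc \<omega>" by (rule test_form2_mono[OF \<omega> sub])
  obtain B where B: "\<And>p. cmod (trace \<omega> p) \<le> B" using trace_bounded[OF \<omega>'] by auto
  have [measurable]: "trace \<omega> \<in> borel_measurable borel" using trace_measurable[OF \<omega>'] .
  have trm [measurable]: "trace \<omega> \<in> borel_measurable (borel \<Otimes>\<^sub>M borel)" using trace_measurable[OF \<omega>'] by (simp add: borel_prod)
  define \<Phi> where "\<Phi> \<alpha> = (LINT u|disc_measure. trace \<omega> (u, \<alpha>))" for \<alpha>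
  have \<Phi>m: "\<Phi> \<in> borel_measurable borel" unfolding \<Phi>_def by measurable
  have \<Phi>0: "\<Phi> \<alpha> = 0" if "cmod \<alpha> \<ge> 1/2" for \<alpha>
    unfolding \<Phi>_def using trace_small_support[OF \<omega>] that by simp
  define D where "D = (LINT p|M. \<bar>leaf_density p\<bar>)"
  let ?I = "LINT \<alpha>|\<mu>. of_real (slice b 0 \<alpha>) * \<Phi> \<alpha>"
  have main: "cmod (?I - S \<omega>) \<le> e * D" if e: "e > 0" for e
  proof -
    \<comment> \<open>5/8 = 1/2 + 1/8: a point of the disc of radius 1/2 moved within the support of
      the kernel.\<close>
    let ?X = "cball (0::complex) (5/8) \<times> \<tau>"
    have "uniformly_continuous_on ?X (\<lambda>(z, \<alpha>). leaf_form \<omega> z \<alpha>)"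
      by (intro compact_uniformly_continuous continuous_on_subset[OF continuous_on_leaf_form[OF \<omega>]] compact_Times compact_tau compact_cball) auto
    then obtain d where d: "d > 0" "\<And>x x'. x \<in> ?X \<Longrightarrow> x' \<in> ?X \<Longrightarrow> dist x' x < d \<Longrightarrow>
        dist ((\<lambda>(z, \<alpha>). leaf_form \<omega> z \<alpha>) x') ((\<lambda>(z, \<alpha>). leaf_form \<omega> z \<alpha>) x) < e"
      unfolding uniformly_continuous_on_def using e by metis
    have tr: "cmod (trace \<omega> (u, \<alpha>) - trace \<omega> (z, \<alpha>)) \<le> e" if "cmod u \<le> 5/8" "cmod z \<le> 5/8" "\<alpha> \<in> \<tau>" "cmod (z - u) < d" for u z \<alpha>
      using d(2)[of "(z, \<alpha>)" "(u, \<alpha>)"] that by (simp add: trace_def dist_norm dist_Pair_Pair norm_minus_commute)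
    define \<delta>' where "\<delta>' = min (d / 2) (1/8)"
    have d': "\<delta>' > 0" "\<delta>' \<le> 1/8" "\<delta>' < d" using d(1) by (auto simp: \<delta>'_def)
    obtain b' where b': "mollifier \<delta>' b'" using mollifier_exists[OF d'(1)] by blast
    have b'm [measurable]: "b' \<in> borel_measurable borel" using mollifierD(6)[OF b'] .
    obtain Bb where Bb: "\<And>z. b' z \<le> Bb" using mollifierD(7)[OF b'] by blast
    have Bb0: "Bb \<ge> 0" using Bb mollifierD(2)[OF b'] order_trans by blast
    have B0: "B \<ge> 0" using B norm_ge_zero order_trans by blast
    define c where "c p = (LINT u|disc_measure. trace \<omega> (u, snd p) * of_real (b' (fst p - u)))" for p
    have cm: "c \<in> borel_measurable borel"
    proof -
      have "c \<in> borel_measurable (borel \<Otimes>\<^sub>M borel)" unfolding c_def by measurable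
      then show ?thesis by (simp add: borel_prod)
    qed
    have "?I = (LINT \<alpha>|\<mu>. of_real (slice b' 0 \<alpha>) * \<Phi> \<alpha>)"
    proof (rule integral_cong_AE)
      have "slice b 0 \<in> borel_measurable borel" "slice b' 0 \<in> borel_measurable borel"
        using slice_integrable[OF b(1), of 0] slice_integrable[OF b', of 0] by auto
      then show "(\<lambda>\<alpha>. of_real (slice b 0 \<alpha>) * \<Phi> \<alpha>) \<in> borel_measurable \<mu>" "(\<lambda>\<alpha>. of_real (slice b' 0 \<alpha>) * \<Phi> \<alpha>) \<in> borel_measurable \<mu>"
        using \<Phi>m by measurable
      show "AE \<alpha> in \<mu>. of_real (slice b 0 \<alpha>) * \<Phi> \<alpha> = of_real (slice b' 0 \<alpha>) * \<Phi> \<alpha>"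
        using slice_independent_AE[OF b b' d'(2)]
      proof eventually_elim
        case (elim \<alpha>)
        then show ?case using \<Phi>0[of \<alpha>] by (cases "cmod \<alpha> < 1/2") auto
      qed
    qed
    also have "\<dots> = (LINT p|M. of_real (leaf_density p) * c p)"
      unfolding \<Phi>_def c_def
      by (rule convolution_integral[OF b' d'(2) _ B, symmetric]) (use trace_small_support[OF \<omega>] in auto)
    finally have I: "?I = (LINT p|M. of_real (leaf_density p) * c p)" .
    have bint: "integrable disc_measure (\<lambda>u. complex_of_real (b' (z - u)))" for z
      by (rule dm.integrable_const_bound[where B=Bb]) (use Bb mollifierD(2)[OF b'] in auto)
    have tint: "integrable disc_measure (\<lambda>u. trace \<omega> (u, \<alpha>) * complex_of_real (b' (z - u)))" for z \<alpha>
    proof (rule dm.integrable_const_bound[where B="B * Bb"])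
      show "AE u in disc_measure. norm (trace \<omega> (u, \<alpha>) * complex_of_real (b' (z - u))) \<le> B * Bb"
        unfolding norm_mult norm_of_real
        by (intro AE_I2 mult_mono B) (use Bb mollifierD(2)[OF b'] B0 in auto)
    qed measurable
    have cb: "cmod (c p) \<le> B * Bb * measure disc_measure UNIV" for p
    proof -
      have "cmod (c p) \<le> (LINT u|disc_measure. norm (trace \<omega> (u, snd p) * complex_of_real (b' (fst p - u))))"
        unfolding c_def by (rule integral_norm_bound)
      also have "\<dots> \<le> (LINT u|disc_measure. B * Bb)"
      proof (rule integral_mono)
        show "norm (trace \<omega> (u, snd p) * complex_of_real (b' (fst p - u))) \<le> B * Bb" for u
          unfolding norm_mult norm_of_real by (intro mult_mono B) (use Bb mollifierD(2)[OF b'] B0 in auto)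
      qed (use tint in auto)
      finally show ?thesis by (simp add: mult.commute mult.left_commute)
    qed
    have near_c: "AE p in M. cmod (c p - trace \<omega> p) \<le> e"
      using AE_M_leaf[OF AE_tau]
    proof eventually_elim
      case (elim p)
      obtain z \<alpha> where p: "p = (z, \<alpha>)" "\<alpha> \<in> \<tau>" using elim by (cases p) auto
      show ?case
      proof (cases "cmod z \<le> 1/2")
        case True
        have one: "(LINT u|disc_measure. complex_of_real (b' (z - u))) = 1"
          using mollifier_disc_integral[OF b' d'(2) True] by simp
        have d1: "c p - trace \<omega> p = (LINT u|disc_measure. trace \<omega> (u, \<alpha>) * complex_of_real (b' (z - u))) - trace \<omega> p * (LINT u|disc_measure. complex_of_real (b' (z - u)))"
          unfolding one by (simp add: c_def p)
        have d2: "c p - trace \<omega> p = (LINT u|disc_measure. trace \<omega> (u, \<alpha>) * complex_of_real (b' (z - u)) - trace \<omega> p * complex_of_real (b' (z - u)))"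
          unfolding d1 using tint[of \<alpha> z] bint[of z] by simp
        have "cmod (c p - trace \<omega> p) \<le> (LINT u|disc_measure. norm (trace \<omega> (u, \<alpha>) * complex_of_real (b' (z - u)) - trace \<omega> p * complex_of_real (b' (z - u))))"
          unfolding d2 by (rule integral_norm_bound)
        also have "\<dots> \<le> (LINT u|disc_measure. e * b' (z - u))"
        proof (rule integral_mono)
          show "integrable disc_measure (\<lambda>u. norm (trace \<omega> (u, \<alpha>) * complex_of_real (b' (z - u)) - trace \<omega> p * complex_of_real (b' (z - u))))"
            by (intro integrable_norm Bochner_Integration.integrable_diff tint integrable_mult_right bint)
          show "integrable disc_measure (\<lambda>u. e * b' (z - u))"
            by (intro integrable_mult_right dm.integrable_const_bound[where B=Bb]) (use Bb mollifierD(2)[OF b'] in auto)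
          fix u
          show "norm (trace \<omega> (u, \<alpha>) * complex_of_real (b' (z - u)) - trace \<omega> p * complex_of_real (b' (z - u))) \<le> e * b' (z - u)"
          proof (cases "cmod (z - u) > \<delta>'")
            case True then show ?thesis using mollifierD(3)[OF b'] by simp
          next
            case False
            then have "cmod u \<le> 5/8" using \<open>cmod z \<le> 1/2\<close> d'(2) norm_triangle_ineq2[of u z] by (simp add: norm_minus_commute)
            then have "cmod (trace \<omega> (u, \<alpha>) - trace \<omega> p) \<le> e"
              unfolding p(1) by (intro tr p(2)) (use False d'(3) \<open>cmod z \<le> 1/2\<close> in auto)
            from mult_right_mono[OF this mollifierD(2)[OF b', of "z - u"]]
            show ?thesis using mollifierD(2)[OF b', of "z - u"] by (simp add: norm_mult flip: left_diff_distrib)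
          qed
        qed
        also have "\<dots> = e" using mollifier_disc_integral[OF b' d'(2) True] by simp
        finally show ?thesis .
      next
        case False
        \<comment> \<open>For |z| > 1/2 the kernel, of radius at most 1/8, cannot reach the region
          |u| <= 1/4 where the trace may be nonzero.\<close>
        have "trace \<omega> (u, \<alpha>) * complex_of_real (b' (z - u)) = 0" for u
        proof (cases "cmod u > 1/4")
          case True then show ?thesis using trace_small_support[OF \<omega>, of u \<alpha>] by simp
        next
          case F: False
          then have "cmod (z - u) > \<delta>'" using False d'(2) norm_triangle_ineq2[of z u] by simp
          then show ?thesis using mollifierD(3)[OF b'] by simp
        qed
        then have "c p = (LINT u|disc_measure. 0)"
          unfolding c_def p(1) fst_conv snd_conv by (intro Bochner_Integration.integral_cong refl)
        then have "c p = 0" by simp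
        moreover have "trace \<omega> p = 0" unfolding p(1) by (rule trace_small_support[OF \<omega>]) (use False in simp)
        ultimately show ?thesis using e by simp
      qed
    qed
    note i1 = integrable_density_mult[OF cm cb] and i2 = integrable_density_mult[OF trace_measurable[OF \<omega>'] B]
    have IS: "?I - S \<omega> = (LINT p|M. of_real (leaf_density p) * (c p - trace \<omega> p))"
      unfolding I S_density[OF \<omega>'] right_diff_distrib by (rule Bochner_Integration.integral_diff[OF i1 i2, symmetric])
    show ?thesis unfolding IS D_def
    proof (rule density_integral_bound[OF _ near_c])
      show "(\<lambda>p. c p - trace \<omega> p) \<in> borel_measurable borel" using cm trace_measurable[OF \<omega>'] by measurable
      show "cmod (c p - trace \<omega> p) \<le> B * Bb * measure disc_measure UNIV + B" for p
        by (rule order_trans[OF norm_triangle_ineq4 add_mono[OF cb B]])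
    qed
  qed
  have "cmod (?I - S \<omega>) \<le> 0 + e" if "e > 0" for e
  proof -
    have D: "D \<ge> 0" by (simp add: D_def)
    have "e / (D + 1) > 0" using that D by simp
    then have "cmod (?I - S \<omega>) \<le> e / (D + 1) * D" by (rule main)
    also have "\<dots> \<le> e" using that D by (simp add: pos_divide_le_eq mult_left_mono)
    finally show ?thesis by simp
  qed
  then have "cmod (?I - S \<omega>) \<le> 0" by (rule field_le_epsilon)
  then show ?thesis unfolding \<Phi>_def by simp
qed

end

section \<open>Averages of the integration currents\<close>

lemma lborel_integral_translate:
  fixes f :: "complex \<Rightarrow> 'b::{banach, second_countable_topology}"
  assumes [measurable]: "f \<in> borel_measurable borel"
  shows "(LINT u|lborel. f (u + v)) = integral\<^sup>L lborel f"
proof -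
  have "(LINT u|lborel. f (v - (0 - u))) = (LINT u|lborel. f (v - u))"
    by (rule lborel_integral_reflect[of "\<lambda>u. f (v - u)" 0]) measurable
  then show ?thesis using lborel_integral_reflect[of f v] by (simp add: add.commute)
qed

text \<open>Difference quotients integrate to 0 by translation invariance of Lebesgue measure. The
  Lipschitz constant of \<open>f\<close> dominates them, so the limit passes under the
  integral.\<close>

lemma integral_frechet_derivative_zero:
  fixes f :: "complex \<Rightarrow> complex"
  assumes "smooth_on UNIV f" "compact K" "\<And>p. p \<notin> K \<Longrightarrow> f p = 0"
  shows "integrable lborel (\<lambda>z. frechet_derivative f (at z) v)"
    and "(LINT z|lborel. frechet_derivative f (at z) v) = 0"
proof -
  obtain B where B: "B > 0" "\<And>p q. cmod (f p - f q) \<le> B * norm (p - q)"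
    using smooth_compact_lipschitz[OF assms] by metis
  obtain C where C: "C > 0" "\<And>p. cmod (f p) \<le> C" using smooth_compact_bounded[OF assms] by metis
  obtain R where R: "\<And>x. x \<in> K \<Longrightarrow> cmod x \<le> R" using compact_imp_bounded[OF assms(2)] bounded_iff by metis
  \<comment> \<open>Enlarging the radius by |v| captures the supports of all the difference
    quotients, whose steps are at most \<open>v\<close>.\<close>
  define Q where "Q = cball (0::complex) (R + cmod v)"
  have [measurable]: "f \<in> borel_measurable borel"
    using smooth_on_continuous[OF assms(1)] by (rule borel_measurable_continuous_onI)
  have dm [measurable]: "(\<lambda>z. frechet_derivative f (at z) v) \<in> borel_measurable borel"
    using smooth_on_continuous[OF smooth_on_frechet[OF assms(1)]] by (rule borel_measurable_continuous_onI)
  have iQ: "integrable lborel (\<lambda>z. c * indicator Q z :: real)" for c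
    unfolding Q_def using emeasure_lborel_cball_finite[of "0::complex" "R + cmod v"]
    by (intro integrable_mult_right integrable_real_indicator) auto
  have fint: "integrable lborel f"
  proof (rule Bochner_Integration.integrable_bound[OF iQ[of C]])
    show "AE z in lborel. norm (f z) \<le> norm (C * indicator Q z)"
    proof (rule AE_I2)
      fix z show "norm (f z) \<le> norm (C * indicator Q z)"
      proof (cases "z \<in> K")
        case True
        then have "z \<in> Q" using R[OF True] norm_ge_zero[of v] by (simp add: Q_def add_increasing2)
        then show ?thesis using C by simp
      qed (use assms(3) in simp)
    qed
  qed simp
  define q where "q n z = (f (z + of_real (1 / (real n + 1)) * v) - f z) * of_real (real n + 1)" for n :: nat and z
  have q_int: "(LINT z|lborel. q n z) = 0" for n
  proof -
    have "integrable lborel (\<lambda>z. f (z + w))" for w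
    proof -
      have "integrable (distr lborel borel ((+) w)) f" using fint by (simp add: lborel_distr_plus)
      then have "integrable lborel (\<lambda>z. f (w + z))" by (rule integrable_distr[rotated]) simp
      then show ?thesis by (simp add: add.commute)
    qed
    then have "(LINT z|lborel. f (z + of_real (1 / (real n + 1)) * v) - f z) = 0"
      using fint lborel_integral_translate[of f] by simp
    then show ?thesis unfolding q_def by simp
  qed
  have lim: "(\<lambda>n. q n z) \<longlonglongrightarrow> frechet_derivative f (at z) v" for z
  proof -
    have "((\<lambda>t::real. z + t *\<^sub>R v) has_derivative (\<lambda>t. t *\<^sub>R v)) (at 0)"
      by (auto intro!: derivative_eq_intros)
    moreover have "(f has_derivative frechet_derivative f (at z)) (at (z + 0 *\<^sub>R v))"
      using smooth_on_D[OF assms(1) UNIV_I] by simp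
    ultimately have "((\<lambda>t::real. f (z + t *\<^sub>R v)) has_derivative (\<lambda>t. frechet_derivative f (at z) (t *\<^sub>R v))) (at 0)"
      by (rule has_derivative_compose)
    then have "((\<lambda>t::real. f (z + t *\<^sub>R v)) has_derivative (\<lambda>t. t *\<^sub>R frechet_derivative f (at z) v)) (at 0)"
      by (simp add: linear_scale[OF has_derivative_linear[OF smooth_on_D[OF assms(1) UNIV_I]]])
    then have l: "(\<lambda>h. norm (f (z + (0 + h) *\<^sub>R v) - f (z + 0 *\<^sub>R v) - h *\<^sub>R frechet_derivative f (at z) v) / norm h) \<midarrow>0\<rightarrow> 0"
      unfolding has_derivative_at by (rule conjunct2)
    have "filterlim (\<lambda>n. 1 / (real n + 1)) (at 0) sequentially"
      unfolding filterlim_at using LIMSEQ_inverse_real_of_nat by (auto simp: inverse_eq_divide add.commute)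
    note l' = filterlim_compose[OF l this]
    have "norm (f (z + (0 + 1 / (real n + 1)) *\<^sub>R v) - f (z + 0 *\<^sub>R v) - (1 / (real n + 1)) *\<^sub>R frechet_derivative f (at z) v) / norm (1 / (real n + 1))
       = norm (q n z - frechet_derivative f (at z) v)" for n
    proof -
      have n1: "real n + 1 > 0" by simp
      then have n2: "of_real (real n + 1) \<noteq> (0::complex)" unfolding of_real_eq_0_iff by linarith
      have "q n z - frechet_derivative f (at z) v = (f (z + of_real (1 / (real n + 1)) * v) - f z - of_real (1 / (real n + 1)) * frechet_derivative f (at z) v) * of_real (real n + 1)"
        unfolding q_def left_diff_distrib using n2 by (simp add: of_real_divide del: of_real_add)
      then have "norm (q n z - frechet_derivative f (at z) v) = norm (f (z + of_real (1 / (real n + 1)) * v) - f z - of_real (1 / (real n + 1)) * frechet_derivative f (at z) v) * (real n + 1)"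
        using n1 by (simp only: norm_mult norm_of_real abs_of_pos)
      then show ?thesis using n1 by (simp add: scaleR_conv_of_real)
    qed
    then have "(\<lambda>n. norm (q n z - frechet_derivative f (at z) v)) \<longlonglongrightarrow> 0" using l' by simp
    then show ?thesis by (rule tendsto_norm_zero_cancel[THEN LIM_zero_cancel])
  qed
  have bound: "cmod (q n z) \<le> (B * cmod v) * indicator Q z" for n z
  proof (cases "z \<in> Q")
    case True
    have "cmod (q n z) = cmod (f (z + of_real (1 / (real n + 1)) * v) - f z) * (real n + 1)"
      unfolding q_def norm_mult by (simp del: of_real_add)
    also have "\<dots> \<le> (B * norm (of_real (1 / (real n + 1)) * v)) * (real n + 1)"
      using B(2)[of "z + of_real (1 / (real n + 1)) * v" z] by (intro mult_right_mono) auto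
    also have "norm (of_real (1 / (real n + 1)) * v) = 1 / (real n + 1) * cmod v"
      unfolding norm_mult norm_of_real by simp
    also have "B * (1 / (real n + 1) * cmod v) * (real n + 1) = B * cmod v"
    proof -
      have "B * (1 / x * c) * x = B * c" if "x > 0" for x c :: real using that by simp
      then show ?thesis by (simp only: of_nat_0_le_iff add_nonneg_pos zero_less_one)
    qed
    finally show ?thesis using True by simp
  next
    case False
    have "cmod (of_real (1 / (real n + 1)) * v) \<le> cmod v"
      unfolding norm_mult norm_of_real by (simp add: mult_left_le_one_le field_simps)
    moreover have "cmod z > R + cmod v" using False by (simp add: Q_def not_le)
    ultimately have "z + of_real (1 / (real n + 1)) * v \<notin> K \<and> z \<notin> K"
      using norm_ge_zero[of v] R[of z] R[of "z + of_real (1 / (real n + 1)) * v"]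
        norm_triangle_ineq4[of "z + of_real (1 / (real n + 1)) * v" "of_real (1 / (real n + 1)) * v", unfolded add_diff_cancel_right']
      by linarith
    then show ?thesis using assms(3) False by (simp add: q_def)
  qed
  have qm [measurable]: "q n \<in> borel_measurable borel" for n unfolding q_def by measurable
  have AE1: "AE z in lborel. (\<lambda>n. q n z) \<longlonglongrightarrow> frechet_derivative f (at z) v" using lim by simp
  have AE2: "\<And>n. AE z in lborel. norm (q n z) \<le> (B * cmod v) * indicator Q z" using bound by simp
  have m: "(\<lambda>z. frechet_derivative f (at z) v) \<in> borel_measurable lborel" "\<And>n. q n \<in> borel_measurable lborel"
    using dm qm by simp_all
  show "integrable lborel (\<lambda>z. frechet_derivative f (at z) v)"
    by (rule integrable_dominated_convergence[OF m iQ AE1 AE2])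
  have "(\<lambda>n. LINT z|lborel. q n z) \<longlonglongrightarrow> (LINT z|lborel. frechet_derivative f (at z) v)"
    by (rule integral_dominated_convergence[OF m iQ AE1 AE2])
  then have "(\<lambda>n. 0 :: complex) \<longlonglongrightarrow> (LINT z|lborel. frechet_derivative f (at z) v)" by (simp only: q_int)
  then show "(LINT z|lborel. frechet_derivative f (at z) v) = 0" by (simp add: LIMSEQ_const_iff)
qed

lemma test_form1D:
  assumes "test_form1 \<Omega> \<theta>"
  shows "linear (\<theta> p)" "smooth_on UNIV (\<lambda>p. \<theta> p u)"
  using assms unfolding test_form1_def Cinf_iff_smooth_on by blast+

lemma linear_C2_fst_const:
  assumes "linear (L :: C2 \<Rightarrow> complex)"
  shows "L (a, b) = L (a, 0) + (of_real (Re b) * L (0, 1) + of_real (Im b) * L (0, \<i>))"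
proof -
  have "(a, b) = (a, 0) + (Re b *\<^sub>R (0, 1) + Im b *\<^sub>R (0, \<i>))" by (auto simp: complex_eq_iff)
  then have "L (a, b) = L ((a, 0) + (Re b *\<^sub>R (0, 1) + Im b *\<^sub>R (0, \<i>)))" by simp
  then show ?thesis by (simp only: linear_add[OF assms] linear_scale[OF assms] scaleR_conv_of_real)
qed

text \<open>Stokes' theorem on a holomorphic disc: restricted to the disc, \<open>d\<theta>\<close> is
  \<open>\<partial>\<^sub>x(\<theta>(\<i>e)) - \<partial>\<^sub>y(\<theta>(e))\<close> with \<open>e = (1, f')\<close>, since the second derivatives of \<open>f\<close> cancel.\<close>

lemma integration_current_closed:
  assumes f: "f holomorphic_on unit_disc" and bd: "\<And>z. z \<in> unit_disc \<Longrightarrow> cmod (f z) \<le> 1 - \<eta>" and eta: "\<eta> > 0"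
    and \<theta>: "test_form1 bidisc \<theta>"
  shows "integration_current f (ext_deriv \<theta>) = 0"
proof -
  obtain K where K: "compact K" "K \<subseteq> bidisc" "\<And>p u. p \<notin> K \<Longrightarrow> \<theta> p u = 0"
    using \<theta> unfolding test_form1_def by metis
  have cf: "compact (fst ` K)" using K(1) by (auto intro!: compact_continuous_image continuous_intros)
  obtain r where r: "0 \<le> r" "r < 1" "fst ` K \<subseteq> cball 0 r"
    by (rule compact_in_disc_radius[OF cf]) (use K(2) in auto)
  let ?f1 = "deriv f" and ?f2 = "deriv (deriv f)"
  define c where "c u z = \<theta> (z, f z) u" for u z
  \<comment> \<open>\<open>P 1\<close> and \<open>P \<i>\<close> are the two coefficients of the
    1-form pulled back to the disc. They vanish near the boundary of the disc, so extension by zero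
    is smooth.\<close>
  define P where "P a z = (if z \<in> unit_disc then c (a, a * ?f1 z) z else 0)" for a z
  note lin = test_form1D(1)[OF \<theta>] and sm = test_form1D(2)[OF \<theta>]
  have df: "(f has_derivative (\<lambda>v. ?f1 z * v)) (at z)" and df1: "(?f1 has_derivative (\<lambda>v. ?f2 z * v)) (at z)"
    if "z \<in> unit_disc" for z
    using holomorphic_derivI[OF f open_ball that] holomorphic_derivI[OF holomorphic_deriv[OF f open_ball] open_ball that]
    by (auto dest: has_field_derivative_imp_has_derivative)
  have id: "smooth_on unit_disc (\<lambda>z::complex. z)" by (rule smooth_on_bounded_linear[OF open_ball bounded_linear_ident])
  have fs: "smooth_on unit_disc f" "smooth_on unit_disc ?f1"
    using smooth_on_holomorphic[OF open_ball] f holomorphic_deriv[OF f open_ball] by blast+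
  have cs: "smooth_on unit_disc (c u)" for u
    unfolding c_def by (rule smooth_on_compose[OF open_ball sm]) (use id fs in auto)
  have cd: "(c u has_derivative (\<lambda>v. frechet_derivative (\<lambda>q. \<theta> q u) (at (z, f z)) (v, ?f1 z * v))) (at z)" if "z \<in> unit_disc" for u z
    unfolding c_def
    by (rule has_derivative_compose[OF has_derivative_Pair[OF has_derivative_ident df[OF that]] smooth_on_D[OF sm UNIV_I]])
  have cexp: "c (a, b) z = c (a, 0) z + (of_real (Re b) * c (0, 1) z + of_real (Im b) * c (0, \<i>) z)" for a b z
    unfolding c_def by (rule linear_C2_fst_const[OF lin])
  have o: "open unit_disc" by simp
  have Ps: "smooth_on UNIV (P a)" and PK: "\<And>z. z \<notin> cball 0 r \<Longrightarrow> P a z = 0" for a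
  proof -
    show PK: "P a z = 0" if "z \<notin> cball 0 r" for z
    proof -
      have "(z, f z) \<notin> K" using that r(3) by force
      then show ?thesis using K(3) by (simp add: P_def c_def)
    qed
    have "smooth_on unit_disc (\<lambda>z. c (a, 0) z + (of_real (Re (a * ?f1 z)) * c (0, 1) z + of_real (Im (a * ?f1 z)) * c (0, \<i>) z))"
      by (intro smooth_on_add smooth_on_mult smooth_on_Re smooth_on_Im smooth_on_const cs fs o)
    then have "smooth_on unit_disc (P a)"
      by (rule smooth_on_cong[OF o, rotated]) (simp add: P_def cexp[of a "a * _"])
    then show "smooth_on UNIV (P a)"
      by (rule smooth_on_extend_zero[OF o _ compact_cball[of 0 r] _ PK]) (use r in auto)
  qed
  let ?T = "\<lambda>u z v. frechet_derivative (\<lambda>q. \<theta> q u) (at (z, f z)) (v, ?f1 z * v)"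
  have Pd: "frechet_derivative (P a) (at z) v = ?T (a, a * ?f1 z) z v
      + (of_real (Re (a * (?f2 z * v))) * c (0, 1) z + of_real (Im (a * (?f2 z * v))) * c (0, \<i>) z)"
    if z: "z \<in> unit_disc" for a z v
  proof -
    have dre: "((\<lambda>z. complex_of_real (Re (a * ?f1 z))) has_derivative (\<lambda>v. of_real (Re (a * (?f2 z * v))))) (at z)"
      and dim: "((\<lambda>z. complex_of_real (Im (a * ?f1 z))) has_derivative (\<lambda>v. of_real (Im (a * (?f2 z * v))))) (at z)"
      by (intro bounded_linear.has_derivative[OF bounded_linear_of_real] bounded_linear.has_derivative[OF bounded_linear_Re]
          bounded_linear.has_derivative[OF bounded_linear_Im] has_derivative_mult_right df1[OF z])+
    have "((\<lambda>z. c (a, 0) z + (of_real (Re (a * ?f1 z)) * c (0, 1) z + of_real (Im (a * ?f1 z)) * c (0, \<i>) z)) has_derivative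
       (\<lambda>v. ?T (a, 0) z v + ((of_real (Re (a * ?f1 z)) * ?T (0, 1) z v + of_real (Re (a * (?f2 z * v))) * c (0, 1) z)
          + (of_real (Im (a * ?f1 z)) * ?T (0, \<i>) z v + of_real (Im (a * (?f2 z * v))) * c (0, \<i>) z)))) (at z)"
      by (intro has_derivative_add has_derivative_mult cd[OF z] dre dim)
    then have "(P a has_derivative
       (\<lambda>v. ?T (a, 0) z v + ((of_real (Re (a * ?f1 z)) * ?T (0, 1) z v + of_real (Re (a * (?f2 z * v))) * c (0, 1) z)
          + (of_real (Im (a * ?f1 z)) * ?T (0, \<i>) z v + of_real (Im (a * (?f2 z * v))) * c (0, \<i>) z)))) (at z)"
      by (rule has_derivative_transform_within_open[OF _ o z]) (simp add: P_def cexp[of a "a * _"])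
    note 1 = frechet_derivative_at[OF this, symmetric]
    have ex: "(\<lambda>q. \<theta> q (a, b)) = (\<lambda>q. \<theta> q (a, 0) + (of_real (Re b) * \<theta> q (0, 1) + of_real (Im b) * \<theta> q (0, \<i>)))" for b
      using linear_C2_fst_const[OF lin] by blast
    have "((\<lambda>q. \<theta> q (a, 0) + (of_real (Re b) * \<theta> q (0, 1) + of_real (Im b) * \<theta> q (0, \<i>))) has_derivative
      (\<lambda>w. frechet_derivative (\<lambda>q. \<theta> q (a, 0)) (at p) w + (of_real (Re b) * frechet_derivative (\<lambda>q. \<theta> q (0, 1)) (at p) w
         + of_real (Im b) * frechet_derivative (\<lambda>q. \<theta> q (0, \<i>)) (at p) w))) (at p)" for b p
      by (intro has_derivative_add has_derivative_mult_right smooth_on_D[OF sm UNIV_I])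
    note 2 = frechet_derivative_at[OF this[unfolded ex[symmetric]], symmetric]
    have re: "x + ((p + y) + (q' + w)) = (x + (p + q')) + (y + w)" for x p y q' w :: complex by simp
    from fun_cong[OF 1, of v] fun_cong[OF 2[of "a * ?f1 z" "(z, f z)"], of "(v, ?f1 z * v)"]
    show ?thesis by (simp only: re)
  qed
  have key: "ext_deriv \<theta> (z, f z) (1, ?f1 z) (cscale \<i> (1, ?f1 z)) = frechet_derivative (P \<i>) (at z) 1 - frechet_derivative (P 1) (at z) \<i>"
    if z: "z \<in> unit_disc" for z
    unfolding Pd[OF z] ext_deriv_def cscale_def by (simp add: mult.commute mult.left_commute)
  have out: "frechet_derivative (P a) (at z) v = 0" if "cmod z \<ge> 1" for a z v
  proof -
    have zn: "z \<notin> cball 0 r" using that r by simp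
    show ?thesis by (rule frechet_zero_outside[where K="cball 0 r", OF closed_cball PK zn])
  qed
  have "integration_current f (ext_deriv \<theta>) = (LINT z|lborel. frechet_derivative (P \<i>) (at z) 1 - frechet_derivative (P 1) (at z) \<i>)"
    unfolding integration_current_def set_lebesgue_integral_def
    by (rule Bochner_Integration.integral_cong[OF refl]) (use key out in \<open>auto simp: indicator_def\<close>)
  also have "\<dots> = 0"
  proof -
    have z: "integrable lborel (\<lambda>z. frechet_derivative (P a) (at z) v)" "(LINT z|lborel. frechet_derivative (P a) (at z) v) = 0" for a v
      by (rule integral_frechet_derivative_zero[OF Ps compact_cball[of 0 r]], erule PK)+
    have "(LINT z|lborel. frechet_derivative (P \<i>) (at z) 1 - frechet_derivative (P 1) (at z) \<i>)
        = (LINT z|lborel. frechet_derivative (P \<i>) (at z) 1) - (LINT z|lborel. frechet_derivative (P 1) (at z) \<i>)"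
      by (rule Bochner_Integration.integral_diff[OF z(1) z(1)])
    then show ?thesis by (simp only: z(2) diff_self)
  qed
  finally show ?thesis .
qed

section \<open>Averages of leaves as uniformly laminar currents\<close>

context graph_lamination
begin

lemma leaf_integral_trace:
  assumes "test_form2 \<Omega> \<omega>" "\<alpha> \<in> \<tau>"
  shows "integration_current (\<phi> \<alpha>) \<omega> = (LINT z|disc_measure. trace \<omega> (z, \<alpha>))"
proof -
  have "trace \<omega> \<in> borel_measurable (borel \<Otimes>\<^sub>M borel)" using trace_measurable[OF assms(1)] by (simp add: borel_prod)
  then have m: "(\<lambda>z. trace \<omega> (z, \<alpha>)) \<in> borel_measurable borel" by measurable
  show ?thesis
    unfolding integration_current_leaf integral_disc_measure[OF m] set_lebesgue_integral_def
    by (rule Bochner_Integration.integral_cong[OF refl]) (use assms(2) in \<open>auto simp: trace_def indicator_def\<close>)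
qed

lemma leaf_integral_measurable:
  assumes "test_form2 \<Omega> \<omega>"
  shows "(\<lambda>\<alpha>. LINT z|disc_measure. trace \<omega> (z, \<alpha>)) \<in> borel_measurable borel"
proof -
  interpret D: finite_measure disc_measure by (rule finite_disc_measure)
  have [measurable]: "trace \<omega> \<in> borel_measurable (borel \<Otimes>\<^sub>M borel)" using trace_measurable[OF assms] by (simp add: borel_prod)
  show ?thesis by measurable
qed

lemma leaf_integral_bound:
  assumes "test_form2 \<Omega> \<omega>" "\<And>p. cmod (trace \<omega> p) \<le> B"
  shows "cmod (LINT z|disc_measure. trace \<omega> (z, \<alpha>)) \<le> B * measure disc_measure UNIV"
proof -
  interpret D: finite_measure disc_measure by (rule finite_disc_measure)
  have [measurable]: "trace \<omega> \<in> borel_measurable (borel \<Otimes>\<^sub>M borel)" using trace_measurable[OF assms(1)] by (simp add: borel_prod)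
  have i: "integrable disc_measure (\<lambda>z. trace \<omega> (z, \<alpha>))"
    by (rule D.integrable_const_bound[where B=B]) (use assms(2) in auto)
  have "cmod (LINT z|disc_measure. trace \<omega> (z, \<alpha>)) \<le> (LINT z|disc_measure. norm (trace \<omega> (z, \<alpha>)))"
    by (rule integral_norm_bound)
  also have "\<dots> \<le> (LINT z|disc_measure. B)"
    by (intro integral_mono integrable_norm i) (use assms(2) in auto)
  finally show ?thesis by (simp add: mult.commute)
qed

definition average_current :: "complex measure \<Rightarrow> current" where
  "average_current \<nu> = (\<lambda>\<omega>. LINT \<alpha>|\<nu>. integration_current (\<phi> \<alpha>) \<omega>)"

lemma average_current_trace:
  assumes \<nu>: "finite_measure_on \<tau> \<nu>" and \<omega>: "test_form2 bidisc \<omega>"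
  shows "average_current \<nu> \<omega> = (LINT \<alpha>|\<nu>. LINT z|disc_measure. trace \<omega> (z, \<alpha>))"
    and "integrable \<nu> (\<lambda>\<alpha>. LINT z|disc_measure. trace \<omega> (z, \<alpha>))"
proof -
  have sets: "sets \<nu> = sets (restrict_space borel \<tau>)" and fin: "finite_measure \<nu>"
    using \<nu> unfolding finite_measure_on_def by auto
  have sp: "space \<nu> = \<tau>" using sets_eq_imp_space_eq[OF sets] by (simp add: space_restrict_space)
  interpret finite_measure \<nu> by fact
  show "average_current \<nu> \<omega> = (LINT \<alpha>|\<nu>. LINT z|disc_measure. trace \<omega> (z, \<alpha>))"
    unfolding average_current_def
    by (rule Bochner_Integration.integral_cong[OF refl]) (use leaf_integral_trace[OF \<omega>] sp in auto)
  obtain B where B: "\<And>p. cmod (trace \<omega> p) \<le> B" using trace_bounded[OF \<omega>] by auto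
  have "(\<lambda>\<alpha>. LINT z|disc_measure. trace \<omega> (z, \<alpha>)) \<in> borel_measurable (restrict_space borel \<tau>)"
    by (rule measurable_restrict_space1[OF leaf_integral_measurable[OF \<omega>]])
  then have m: "(\<lambda>\<alpha>. LINT z|disc_measure. trace \<omega> (z, \<alpha>)) \<in> borel_measurable \<nu>"
    by (simp add: measurable_cong_sets[OF sets refl])
  show "integrable \<nu> (\<lambda>\<alpha>. LINT z|disc_measure. trace \<omega> (z, \<alpha>))"
    by (rule integrable_const_bound[OF AE_I2 m]) (rule leaf_integral_bound[OF \<omega> B])
qed

lemma leaf_integral_comb:
  assumes "test_form2 bidisc \<omega>" "test_form2 bidisc \<omega>'"
  shows "(LINT z|disc_measure. trace (\<lambda>p u v. a * \<omega> p u v + b * \<omega>' p u v) (z, \<alpha>))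
     = a * (LINT z|disc_measure. trace \<omega> (z, \<alpha>)) + b * (LINT z|disc_measure. trace \<omega>' (z, \<alpha>))"
proof -
  interpret D: finite_measure disc_measure by (rule finite_disc_measure)
  have i: "integrable disc_measure (\<lambda>z. trace \<omega> (z, \<alpha>))" if \<omega>: "test_form2 bidisc \<omega>" for \<omega>
  proof -
    obtain B where B: "\<And>p. cmod (trace \<omega> p) \<le> B" using trace_bounded[OF \<omega>] by auto
    have [measurable]: "trace \<omega> \<in> borel_measurable (borel \<Otimes>\<^sub>M borel)" using trace_measurable[OF \<omega>] by (simp add: borel_prod)
    show ?thesis by (rule D.integrable_const_bound[where B=B]) (use B in auto)
  qed
  show ?thesis unfolding trace_comb using i[OF assms(1)] i[OF assms(2)] by simp
qed

text \<open>An average of integration currents has order 0: uniformly small coefficients with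
  supports in a common compact set give uniformly small traces, because the slopes are bounded over
  that set.\<close>

lemma average_current_null_seq:
  assumes \<nu>: "finite_measure_on \<tau> \<nu>" and w: "test_form2_null_seq bidisc w"
  shows "(\<lambda>n. average_current \<nu> (w n)) \<longlonglongrightarrow> 0"
proof -
  have fin: "finite_measure \<nu>" using \<nu> unfolding finite_measure_on_def by auto
  interpret finite_measure \<nu> by fact
  have t: "test_form2 bidisc (w n)" for n using w unfolding test_form2_null_seq_def by blast
  obtain K where K: "compact K" "K \<subseteq> bidisc" "\<And>n. supported_in K (w n)"
    using w unfolding test_form2_null_seq_def by blast
  obtain r where r: "0 \<le> r" "r < 1" "K \<subseteq> cball 0 r \<times> cball 0 r"
    using compact_in_bidisc_radius[OF K(1,2)] by metis
  obtain B where B: "B > 0" "\<And>z \<alpha>. cmod z \<le> r \<Longrightarrow> \<alpha> \<in> \<tau> \<Longrightarrow> cmod (deriv (\<phi> \<alpha>) z) \<le> B"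
    using slope_bound[OF r(1,2)] by metis
  define C where "C = 16 * (1 + B) * (1 + B) * measure disc_measure UNIV * measure \<nu> (space \<nu>)"
  have C: "C \<ge> 0" using B(1) by (simp add: C_def)
  show ?thesis
  proof (rule tendstoI)
    fix e :: real assume e: "e > 0"
    define d where "d = e / (C + 1)"
    have d: "d > 0" using e C by (simp add: d_def)
    have "\<forall>\<^sub>F n in sequentially. \<forall>p. cmod (w n p u v) < d" for u v
    proof -
      have "uniform_limit UNIV (\<lambda>n. iter_deriv [] (\<lambda>p. w n p u v)) (\<lambda>p. 0) sequentially"
        using w unfolding test_form2_null_seq_def by blast
      from uniform_limitD[OF this d] show ?thesis by simp
    qed
    then have "\<forall>\<^sub>F n in sequentially. \<forall>u\<in>Basis. \<forall>v\<in>Basis. \<forall>p. cmod (w n p u v) < d"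
      by (intro eventually_ball_finite ballI finite_Basis)
    then show "\<forall>\<^sub>F n in sequentially. dist (average_current \<nu> (w n)) 0 < e"
    proof eventually_elim
      case (elim n)
      have wb: "cmod (w n p u v) \<le> 16 * d * norm u * norm v" for p u v
        by (rule bilinear_norm_bound[OF test_form2D(1)[OF t]]) (rule less_imp_le, use elim in blast)
      have tb: "cmod (trace (w n) p) \<le> 16 * d * (1 + B) * (1 + B)" for p
      proof (cases "fst p \<in> cball 0 r \<and> snd p \<in> \<tau>")
        case True
        then have p: "cmod (fst p) \<le> r" "snd p \<in> \<tau>" by auto
        have nn: "norm (1::complex, deriv (\<phi> (snd p)) (fst p)) \<le> 1 + B" by (rule norm_tangent_le[OF B(2)[OF p]])
        have "trace (w n) p = leaf_form (w n) (fst p) (snd p)" using p r by (auto simp: trace_def case_prod_beta)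
        also have "cmod \<dots> \<le> 16 * d * norm (1::complex, deriv (\<phi> (snd p)) (fst p)) * norm (1::complex, deriv (\<phi> (snd p)) (fst p))"
          unfolding leaf_form_def using wb[of _ _ "cscale \<i> _"] by simp
        also have "\<dots> \<le> 16 * d * (1 + B) * (1 + B)" using nn d B(1) by (intro mult_mono) auto
        finally show ?thesis .
      next
        case False
        have "trace (w n) p = 0"
        proof (cases "snd p \<in> \<tau>")
          case True
          with False have "(fst p, \<phi> (snd p) (fst p)) \<notin> K" using r(3) by force
          then have "w n (fst p, \<phi> (snd p) (fst p)) x y = 0" for x y using K(3)[of n] unfolding supported_in_def by blast
          then show ?thesis by (simp add: trace_def leaf_form_def case_prod_beta)
        qed (auto simp: trace_def case_prod_beta)
        then show ?thesis using d B(1) by simp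
      qed
      have "cmod (average_current \<nu> (w n)) \<le> (LINT \<alpha>|\<nu>. norm (LINT z|disc_measure. trace (w n) (z, \<alpha>)))"
        unfolding average_current_trace(1)[OF \<nu> t] by (rule integral_norm_bound)
      also have "\<dots> \<le> (LINT \<alpha>|\<nu>. 16 * d * (1 + B) * (1 + B) * measure disc_measure UNIV)"
        by (intro integral_mono integrable_norm average_current_trace(2)[OF \<nu> t] leaf_integral_bound[OF t tb]) auto
      also have "\<dots> = C * d" by (simp add: C_def)
      also have "\<dots> < e"
      proof -
        have "(C + 1) * d = e" using C by (simp add: d_def)
        then show ?thesis using d by (simp add: distrib_right)
      qed
      finally show ?case by simp
    qed
  qed
qed

theorem uniformly_laminar_average:
  assumes \<nu>: "finite_measure_on \<tau> \<nu>" and eta: "\<eta> > 0" and bd: "\<And>\<alpha> z. \<alpha> \<in> \<tau> \<Longrightarrow> z \<in> unit_disc \<Longrightarrow> cmod (\<phi> \<alpha> z) \<le> 1 - \<eta>"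
  shows "uniformly_laminar_bidisc (average_current \<nu>)"
  unfolding uniformly_laminar_bidisc_def
proof (intro conjI exI allI impI)
  have sets: "sets \<nu> = sets (restrict_space borel \<tau>)" and fin: "finite_measure \<nu>"
    using \<nu> unfolding finite_measure_on_def by auto
  have sp: "space \<nu> = \<tau>" using sets_eq_imp_space_eq[OF sets] by (simp add: space_restrict_space)
  note tr = average_current_trace[OF \<nu>]
  show "finite_measure_on \<tau> \<nu>" by fact
  show "average_current \<nu> \<omega> = (LINT \<alpha>|\<nu>. integration_current (\<phi> \<alpha>) \<omega>)" for \<omega>
    by (simp add: average_current_def)
  show "lamination_by_graphs \<tau> \<phi>"
    unfolding lamination_by_graphs_def
  proof (intro conjI)
    have "\<tau> \<subseteq> unit_disc"
    proof
      fix \<alpha> assume a: "\<alpha> \<in> \<tau>"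
      then show "\<alpha> \<in> unit_disc" using bd[OF a, of 0] base[OF a] eta by simp
    qed
    then show "closedin (top_of_set unit_disc) \<tau>"
      using compact_imp_closed[OF compact_tau] closed_subset by blast
    show "\<forall>\<alpha>\<in>\<tau>. \<phi> \<alpha> holomorphic_on unit_disc \<and> \<phi> \<alpha> 0 = \<alpha>" using hol base by blast
    show "disjoint_family_on (\<lambda>\<alpha>. graph_over_disc (\<phi> \<alpha>)) \<tau>"
      unfolding disjoint_family_on_def graph_over_disc_def using disj by fastforce
    show "\<exists>\<eta>>0. \<forall>\<alpha>\<in>\<tau>. \<forall>z\<in>unit_disc. cmod (\<phi> \<alpha> z) \<le> 1 - \<eta>" using eta bd by blast
  qed
  have lin: "average_current \<nu> (\<lambda>p u v. a * \<omega> p u v + b * \<omega>' p u v) = a * average_current \<nu> \<omega> + b * average_current \<nu> \<omega>'"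
    if w: "test_form2 bidisc \<omega>" "test_form2 bidisc \<omega>'" for a b \<omega> \<omega>'
    unfolding tr(1)[OF test_form2_comb[OF w]] tr(1)[OF w(1)] tr(1)[OF w(2)] leaf_integral_comb[OF w]
    using tr(2)[OF w(1)] tr(2)[OF w(2)] by simp
  have zero: "average_current \<nu> \<omega> = 0" if w: "test_form2 bidisc \<omega>" and ty: "type_20 \<omega> \<or> type_02 \<omega>" for \<omega>
  proof -
    \<comment> \<open>On a complex line a form of type (2,0) or (0,2) is a multiple of its value on
      \<open>(u, u)\<close>, which is 0.\<close>
    have "\<omega> p u (cscale \<i> u) = 0" for p u
    proof -
      have "\<omega> p (cscale \<i> u) u = \<i> * \<omega> p u u \<or> \<omega> p (cscale \<i> u) u = - \<i> * \<omega> p u u"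
        using ty unfolding type_20_def type_02_def by blast
      then have "\<omega> p (cscale \<i> u) u = 0" using test_form2D(2)[OF w, of p u] by auto
      then show ?thesis using test_form2D(3)[OF w, of p u "cscale \<i> u"] by simp
    qed
    then have "integration_current (\<phi> \<alpha>) \<omega> = 0" for \<alpha>
      unfolding integration_current_def by simp
    then show ?thesis by (simp add: average_current_def)
  qed
  have pos: "average_current \<nu> \<omega> \<in> \<real>\<^sub>\<ge>\<^sub>0" if w: "test_form2 bidisc \<omega>" and p: "positive_form \<omega>" for \<omega>
  proof -
    have nn: "trace \<omega> x \<in> \<real>\<^sub>\<ge>\<^sub>0" for x
      using p unfolding positive_form_def by (auto simp: trace_def leaf_form_def case_prod_beta)
    have re: "trace \<omega> x = of_real (Re (trace \<omega> x))" "Re (trace \<omega> x) \<ge> 0" for x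
      using nn[of x] by (auto simp: complex_nonneg_Reals_iff complex_eq_iff)
    have "(LINT \<alpha>|\<nu>. LINT z|disc_measure. trace \<omega> (z, \<alpha>)) = of_real (LINT \<alpha>|\<nu>. LINT z|disc_measure. Re (trace \<omega> (z, \<alpha>)))"
      by (subst re(1)) (simp only: integral_complex_of_real)
    moreover have "(LINT \<alpha>|\<nu>. LINT z|disc_measure. Re (trace \<omega> (z, \<alpha>))) \<ge> 0"
      by (intro Bochner_Integration.integral_nonneg re(2))
    ultimately show ?thesis unfolding tr(1)[OF w] by (simp only: nonneg_Reals_of_real_iff)
  qed
  show "positive_current bidisc (average_current \<nu>)"
    unfolding positive_current_def current11_def current2_def
    by (intro conjI allI impI lin zero pos average_current_null_seq[OF \<nu>])
  show "closed_current bidisc (average_current \<nu>)"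
    unfolding closed_current_def
  proof (intro allI impI)
    fix \<theta> assume th: "test_form1 bidisc \<theta>"
    have "integration_current (\<phi> \<alpha>) (ext_deriv \<theta>) = 0" if "\<alpha> \<in> space \<nu>" for \<alpha>
      by (rule integration_current_closed[OF hol bd eta th]) (use that sp in auto)
    then have "average_current \<nu> (ext_deriv \<theta>) = (LINT \<alpha>|\<nu>. 0)"
      unfolding average_current_def by (intro Bochner_Integration.integral_cong refl)
    then show "average_current \<nu> (ext_deriv \<theta>) = 0" by simp
  qed
qed

end

section \<open>Holomorphic maps of two variables are smooth\<close>

text \<open>Joint continuity with holomorphy in each variable is a class stable under both partial
  derivatives, by Cauchy estimates and uniform limits in one variable. Pointwise complex
  differentiability leads into it without presupposing a continuous derivative.\<close>

definition sep_holomorphic :: "C2 set \<Rightarrow> (C2 \<Rightarrow> complex) \<Rightarrow> bool" where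
  "sep_holomorphic V f \<longleftrightarrow> continuous_on V f \<and>
     (\<forall>p\<in>V. (\<lambda>z. f (z, snd p)) field_differentiable (at (fst p)) \<and> (\<lambda>w. f (fst p, w)) field_differentiable (at (snd p)))"

definition deriv1 :: "(C2 \<Rightarrow> complex) \<Rightarrow> C2 \<Rightarrow> complex" where
  "deriv1 f p = deriv (\<lambda>z. f (z, snd p)) (fst p)"
definition deriv2 :: "(C2 \<Rightarrow> complex) \<Rightarrow> C2 \<Rightarrow> complex" where
  "deriv2 f p = deriv (\<lambda>w. f (fst p, w)) (snd p)"

lemma bidisc_in_open:
  fixes V :: "C2 set"
  assumes "open V" "(a, b) \<in> V"
  obtains r where "r > 0" "cball a r \<times> cball b r \<subseteq> V"
proof -
  obtain A B where AB': "open A" "open B" "(a, b) \<in> A \<times> B" "A \<times> B \<subseteq> V" by (rule open_prod_elim[OF assms])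
  then have AB: "open A" "open B" "a \<in> A" "b \<in> B" "A \<times> B \<subseteq> V" by simp_all
  obtain r1 where r1: "r1 > 0" "cball a r1 \<subseteq> A" using AB(1,3) open_contains_cball by blast
  obtain r2 where r2: "r2 > 0" "cball b r2 \<subseteq> B" using AB(2,4) open_contains_cball by blast
  have "cball a (min r1 r2) \<subseteq> A" "cball b (min r1 r2) \<subseteq> B" using r1 r2 by auto
  then have "cball a (min r1 r2) \<times> cball b (min r1 r2) \<subseteq> V" using AB(5) by blast
  then show ?thesis using that[of "min r1 r2"] r1 r2 by auto
qed

lemma sep_holomorphic_slice:
  assumes "sep_holomorphic V f" "cball a r \<times> cball b r \<subseteq> V" "w \<in> cball b r"
  shows "(\<lambda>z. f (z, w)) holomorphic_on ball a r" "continuous_on (cball a r) (\<lambda>z. f (z, w))"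
proof -
  have "(\<lambda>z. f (z, w)) field_differentiable at z" if "z \<in> ball a r" for z
  proof -
    have "(z, w) \<in> V" using assms(2,3) that by auto
    then show ?thesis using assms(1) unfolding sep_holomorphic_def by fastforce
  qed
  then show "(\<lambda>z. f (z, w)) holomorphic_on ball a r" by (auto simp: holomorphic_on_def field_differentiable_at_within)
  show "continuous_on (cball a r) (\<lambda>z. f (z, w))"
    by (rule continuous_on_compose2[of V f]) (use assms in \<open>auto simp: sep_holomorphic_def intro!: continuous_intros\<close>)
qed

text \<open>The Cauchy estimate for the difference of two horizontal slices, on a disc of radius r/2
  about \<open>z\<close>.\<close>

lemma deriv1_diff_bound:
  assumes f: "sep_holomorphic V f" and sub: "cball a r \<times> cball b r \<subseteq> V" and r: "r > 0"
    and z: "z \<in> cball a (r/2)" and w: "w \<in> cball b r" "w' \<in> cball b r"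
    and B: "\<And>\<zeta>. \<zeta> \<in> cball a r \<Longrightarrow> cmod (f (\<zeta>, w) - f (\<zeta>, w')) \<le> B"
  shows "cmod (deriv1 f (z, w) - deriv1 f (z, w')) \<le> 2 * B / r"
proof -
  let ?g = "\<lambda>\<zeta>. f (\<zeta>, w) - f (\<zeta>, w')"
  note s = sep_holomorphic_slice[OF f sub]
  have inb: "cball z (r/2) \<subseteq> cball a r" "ball z (r/2) \<subseteq> ball a r" "z \<in> ball a r"
    using z r by (auto simp: dist_commute) (metric)+
  have "cmod ((deriv ^^ 1) ?g z) \<le> fact 1 * B / (r/2) ^ 1"
  proof (rule Cauchy_inequality)
    show "?g holomorphic_on ball z (r/2)"
      by (intro holomorphic_on_diff holomorphic_on_subset[OF s(1)[OF w(1)] inb(2)] holomorphic_on_subset[OF s(1)[OF w(2)] inb(2)])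
    show "continuous_on (cball z (r/2)) ?g"
      by (intro continuous_on_diff continuous_on_subset[OF s(2)[OF w(1)] inb(1)] continuous_on_subset[OF s(2)[OF w(2)] inb(1)])
    show "0 < r/2" using r by simp
    fix x assume "cmod (z - x) = r/2"
    then have "x \<in> cball z (r/2)" by (simp add: dist_norm)
    then show "cmod (?g x) \<le> B" using B inb(1) by blast
  qed
  moreover have "deriv ?g z = deriv1 f (z, w) - deriv1 f (z, w')"
    unfolding deriv1_def fst_conv snd_conv
    by (intro DERIV_imp_deriv DERIV_diff holomorphic_derivI[OF s(1)[OF w(1)] open_ball inb(3)] holomorphic_derivI[OF s(1)[OF w(2)] open_ball inb(3)])
  ultimately show ?thesis by (simp add: field_simps)
qed

text \<open>The change in the second variable is controlled by uniform continuity of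
  \<open>f\<close> through the Cauchy estimate, the change in the first by one-variable holomorphy
  of the slice through the centre.\<close>

lemma deriv1_continuous:
  assumes f: "sep_holomorphic V f" and V: "open V"
  shows "continuous_on V (deriv1 f)"
  unfolding continuous_on_iff
proof (intro ballI allI impI)
  fix p :: C2 and e :: real assume p: "p \<in> V" and e: "e > 0"
  obtain a b where ab: "p = (a, b)" by (cases p)
  obtain r where r: "r > 0" "cball a r \<times> cball b r \<subseteq> V" using bidisc_in_open[OF V] p ab by metis
  note s = sep_holomorphic_slice[OF f r(2)]
  have "compact (cball a r \<times> cball b r)" by (intro compact_Times compact_cball)
  moreover have "continuous_on (cball a r \<times> cball b r) f"
    using f r(2) continuous_on_subset unfolding sep_holomorphic_def by blast
  ultimately have "uniformly_continuous_on (cball a r \<times> cball b r) f" by (intro compact_uniformly_continuous)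
  moreover have "e * r / 8 > 0" using e r by simp
  ultimately obtain d where d: "d > 0" "\<And>x x'. x \<in> cball a r \<times> cball b r \<Longrightarrow> x' \<in> cball a r \<times> cball b r \<Longrightarrow> dist x' x < d \<Longrightarrow> dist (f x') (f x) < e * r / 8"
    unfolding uniformly_continuous_on_def by metis
  have bb: "b \<in> cball b r" using r by simp
  have "isCont (deriv (\<lambda>z. f (z, b))) a"
    using holomorphic_deriv[OF s(1)[OF bb] open_ball] r(1)
      continuous_on_eq_continuous_at[OF open_ball] holomorphic_on_imp_continuous_on centre_in_ball by metis
  then obtain d' where d': "d' > 0" "\<And>z. dist z a < d' \<Longrightarrow> dist (deriv (\<lambda>z. f (z, b)) z) (deriv (\<lambda>z. f (z, b)) a) < e / 2"
    unfolding continuous_at_eps_delta using half_gt_zero[OF e] by metis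
  define m where "m = Min {d, d', r / 2}"
  have m: "m > 0" "m \<le> d" "m \<le> d'" "m \<le> r / 2" using d d' r by (auto simp: m_def)
  have "dist (deriv1 f q) (deriv1 f p) < e" if q: "q \<in> V" "dist q p < m" for q
  proof -
    obtain z w where zw: "q = (z, w)" by (cases q)
    have dz: "dist z a < m" "dist w b < m" using q(2) dist_fst_le[of q p] dist_snd_le[of q p] by (auto simp: zw ab)
    have "cmod (deriv1 f (z, w) - deriv1 f (z, b)) \<le> 2 * (e * r / 8) / r"
    proof (rule deriv1_diff_bound[OF f r(2,1)])
      show "z \<in> cball a (r/2)" "w \<in> cball b r" "b \<in> cball b r" using dz m r by (auto simp: dist_commute)
      fix \<zeta> assume z: "\<zeta> \<in> cball a r"
      have "dist (f (\<zeta>, w)) (f (\<zeta>, b)) < e * r / 8"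
        by (rule d(2)) (use z dz m r in \<open>auto simp: dist_commute dist_Pair_Pair\<close>)
      then show "cmod (f (\<zeta>, w) - f (\<zeta>, b)) \<le> e * r / 8" by (simp add: dist_norm)
    qed
    also have "\<dots> = e / 4" using r(1) by simp
    finally have "dist (deriv1 f (z, w)) (deriv1 f (z, b)) \<le> e / 4" by (simp add: dist_norm)
    moreover have "dist (deriv1 f (z, b)) (deriv1 f (a, b)) < e / 2"
      using d'(2)[of z] dz m by (simp add: deriv1_def)
    ultimately show ?thesis using dist_triangle[of "deriv1 f (z, w)" "deriv1 f (a, b)" "deriv1 f (z, b)"] e by (simp add: zw ab)
  qed
  then show "\<exists>d>0. \<forall>x'\<in>V. dist x' p < d \<longrightarrow> dist (deriv1 f x') (deriv1 f p) < e" using m(1) by blast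
qed

text \<open>Exchanging the variables transfers every result on \<open>deriv1\<close> to
  \<open>deriv2\<close>.\<close>

definition swap_fun :: "(C2 \<Rightarrow> complex) \<Rightarrow> C2 \<Rightarrow> complex" where "swap_fun f p = f (prod.swap p)"

lemma sep_holomorphic_swap:
  assumes "sep_holomorphic V f" shows "sep_holomorphic (prod.swap -` V) (swap_fun f)"
  unfolding sep_holomorphic_def
proof (intro conjI ballI)
  show "continuous_on (prod.swap -` V) (swap_fun f)"
    unfolding swap_fun_def
    by (rule continuous_on_compose2[of V f]) (use assms in \<open>auto simp: sep_holomorphic_def intro!: continuous_on_swap\<close>)
qed (use assms in \<open>auto simp: sep_holomorphic_def swap_fun_def\<close>)

lemma open_swap_vimage: "open V \<Longrightarrow> open (prod.swap -` (V :: C2 set))"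
  by (rule open_vimage) (auto intro: continuous_on_swap)

lemma deriv2_swap: "deriv2 f p = deriv1 (swap_fun f) (prod.swap p)"
  by (simp add: deriv1_def deriv2_def swap_fun_def)

lemma deriv2_continuous:
  assumes "sep_holomorphic V f" "open V"
  shows "continuous_on V (deriv2 f)"
  unfolding deriv2_swap
  by (rule continuous_on_compose2[OF deriv1_continuous[OF sep_holomorphic_swap[OF assms(1)] open_swap_vimage[OF assms(2)]] continuous_on_swap]) auto

text \<open>\<open>\<partial>\<^sub>1 f(a, w)\<close> is the uniform limit in \<open>w\<close> of difference quotients, which gives both its holomorphy in \<open>w\<close>
  and the symmetry of the second derivatives.\<close>

lemma deriv1_holomorphic_snd:
  assumes f: "sep_holomorphic V f" and V: "open V" and p: "(a, b) \<in> V"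
  shows "(\<lambda>w. deriv1 f (a, w)) field_differentiable (at b)"
    and "(\<lambda>z. deriv2 f (z, b)) field_differentiable (at a) \<Longrightarrow> deriv2 (deriv1 f) (a, b) = deriv1 (deriv2 f) (a, b)"
proof -
  obtain r where r: "r > 0" "cball a r \<times> cball b r \<subseteq> V" using bidisc_in_open[OF V p] by metis
  note s = sep_holomorphic_slice[OF f r(2)]
  have s': "(\<lambda>w. f (z, w)) holomorphic_on ball b r" if "z \<in> cball a r" for z
  proof -
    have "(\<lambda>w. f (z, w)) field_differentiable at w" if "w \<in> ball b r" for w
    proof -
      have "(z, w) \<in> V" using r(2) that \<open>z \<in> cball a r\<close> by auto
      then show ?thesis using f unfolding sep_holomorphic_def by fastforce
    qed
    then show ?thesis by (auto simp: holomorphic_on_def field_differentiable_at_within)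
  qed
  \<comment> \<open>The denominator n + 2 keeps every step nonzero and strictly shorter than
    \<open>r\<close>, so that \<open>a + h n\<close> stays in the disc.\<close>
  define h where "h n = complex_of_real (r / (real n + 2))" for n :: nat
  have h: "h n \<noteq> 0" "cmod (h n) < r" for n
  proof -
    have "real n + 2 > 0" by simp
    then show "h n \<noteq> 0" using r(1) by (simp only: h_def of_real_eq_0_iff) simp
    have "r * 1 < r * (real n + 2)" using r(1) by (intro mult_strict_left_mono) auto
    then show "cmod (h n) < r" using r(1) unfolding h_def norm_of_real by (simp add: pos_divide_less_eq)
  qed
  have hlim: "h \<longlonglongrightarrow> 0"
  proof -
    have "(\<lambda>n. r * (1 / real (n + 2))) \<longlonglongrightarrow> r * 0" by (intro tendsto_intros LIMSEQ_ignore_initial_segment[OF lim_1_over_n])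
    then have "(\<lambda>n. complex_of_real (r * (1 / real (n + 2)))) \<longlonglongrightarrow> complex_of_real (r * 0)" by (rule tendsto_of_real)
    then show ?thesis unfolding h_def by (simp add: add.commute)
  qed
  define q where "q n w = (f (a + h n, w) - f (a, w)) / h n" for n w
  have inb: "a + h n \<in> cball a r" "a \<in> cball a r" for n using h(2)[of n] r(1) by (auto simp: dist_norm)
  have qh: "q n holomorphic_on ball b r" for n
    unfolding q_def by (intro holomorphic_on_divide holomorphic_on_diff s' inb holomorphic_on_const) (use h in auto)
  have ul: "uniform_limit (ball b r) q (\<lambda>w. deriv1 f (a, w)) sequentially"
    unfolding uniform_limit_iff
  proof (intro allI impI)
    fix e :: real assume e: "e > 0"
    have "compact (cball a r \<times> cball b r)" by (intro compact_Times compact_cball)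
    moreover have "continuous_on (cball a r \<times> cball b r) (deriv1 f)"
      using deriv1_continuous[OF f V] r(2) continuous_on_subset by blast
    ultimately have "uniformly_continuous_on (cball a r \<times> cball b r) (deriv1 f)" by (intro compact_uniformly_continuous)
    then obtain d where d: "d > 0" "\<And>x x'. x \<in> cball a r \<times> cball b r \<Longrightarrow> x' \<in> cball a r \<times> cball b r \<Longrightarrow> dist x' x < d \<Longrightarrow> dist (deriv1 f x') (deriv1 f x) < e / 2"
      unfolding uniformly_continuous_on_def using half_gt_zero[OF e] by metis
    have "\<forall>\<^sub>F n in sequentially. cmod (h n) < d" using tendsto_norm[OF hlim] order_tendstoD(2)[of "\<lambda>n. cmod (h n)" 0] d(1) by auto
    then show "\<forall>\<^sub>F n in sequentially. \<forall>w\<in>ball b r. dist (q n w) (deriv1 f (a, w)) < e"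
    proof eventually_elim
      case (elim n)
      show ?case
      proof
        fix w assume w: "w \<in> ball b r"
        then have w': "w \<in> cball b r" by simp
        let ?B = "cball a (cmod (h n))"
        have sub: "?B \<subseteq> ball a r" using h(2)[of n] by auto
        \<comment> \<open>The mean value inequality for \<open>f\<close> minus its linear term in
          \<open>z\<close>. Uniform continuity of \<open>deriv1 f\<close> makes the bound
          independent of \<open>w\<close>.\<close>
        have "cmod ((\<lambda>z. f (z, w) - deriv1 f (a, w) * z) (a + h n) - (\<lambda>z. f (z, w) - deriv1 f (a, w) * z) a) \<le> e / 2 * cmod (a + h n - a)"
        proof (rule field_differentiable_bound[where S="?B" and f'="\<lambda>z. deriv1 f (z, w) - deriv1 f (a, w)"])
          fix z assume z: "z \<in> ?B"
          have zb: "z \<in> ball a r" using z sub by blast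
          have "((\<lambda>z. f (z, w)) has_field_derivative deriv1 f (z, w)) (at z)"
            using holomorphic_derivI[OF s(1)[OF w'] open_ball zb] by (simp add: deriv1_def)
          then have "((\<lambda>z. f (z, w) - deriv1 f (a, w) * z) has_field_derivative deriv1 f (z, w) - deriv1 f (a, w) * 1) (at z)"
            by (intro DERIV_diff DERIV_cmult DERIV_ident)
          then show "((\<lambda>z. f (z, w) - deriv1 f (a, w) * z) has_field_derivative deriv1 f (z, w) - deriv1 f (a, w)) (at z within ?B)"
            by (simp add: has_field_derivative_at_within)
          have "dist (deriv1 f (z, w)) (deriv1 f (a, w)) < e / 2"
            by (rule d(2)) (use zb z w' r elim in \<open>auto simp: dist_Pair_Pair dist_commute\<close>)
          then show "cmod (deriv1 f (z, w) - deriv1 f (a, w)) \<le> e / 2" by (simp add: dist_norm)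
        qed (auto simp: dist_norm)
        then have "cmod (f (a + h n, w) - f (a, w) - deriv1 f (a, w) * h n) \<le> e / 2 * cmod (h n)"
          by (simp add: algebra_simps)
        moreover have "q n w - deriv1 f (a, w) = (f (a + h n, w) - f (a, w) - deriv1 f (a, w) * h n) / h n"
          using h(1)[of n] by (simp add: q_def field_simps)
        ultimately have "cmod (q n w - deriv1 f (a, w)) \<le> e / 2"
          using h(1)[of n] by (simp add: norm_divide pos_divide_le_eq)
        then show "dist (q n w) (deriv1 f (a, w)) < e" using e by (simp add: dist_norm)
      qed
    qed
  qed
  have hol: "(\<lambda>w. deriv1 f (a, w)) holomorphic_on ball b r"
  proof (rule holomorphic_uniform_sequence[OF open_ball qh])
    fix x assume "x \<in> ball b r"
    then obtain d where d: "d > 0" "cball x d \<subseteq> ball b r" using open_contains_cball[of "ball b r"] open_ball by metis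
    then show "\<exists>d>0. cball x d \<subseteq> ball b r \<and> uniform_limit (cball x d) q (\<lambda>w. deriv1 f (a, w)) sequentially"
      using uniform_limit_on_subset[OF ul d(2)] by blast
  qed
  have bb: "b \<in> ball b r" using r by simp
  show "(\<lambda>w. deriv1 f (a, w)) field_differentiable (at b)"
    using holomorphic_on_imp_differentiable_at[OF hol open_ball bb] .
  have "(\<lambda>n. (deriv ^^ 1) (q n) b) \<longlonglongrightarrow> (deriv ^^ 1) (\<lambda>w. deriv1 f (a, w)) b"
    by (rule higher_deriv_complex_uniform_limit[OF ul _ _ open_ball bb]) (use qh in auto)
  then have l1: "(\<lambda>n. deriv (q n) b) \<longlonglongrightarrow> deriv2 (deriv1 f) (a, b)" by (simp add: deriv2_def)
  \<comment> \<open>Differentiated in \<open>w\<close>, the quotients become difference quotients of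
    \<open>deriv2 f\<close>. They converge both to \<open>deriv2 (deriv1 f)\<close>, by uniform
    convergence, and to \<open>deriv1 (deriv2 f)\<close>, by definition.\<close>
  have dq: "deriv (q n) b = (deriv2 f (a + h n, b) - deriv2 f (a, b)) / h n" for n
    unfolding q_def deriv2_def fst_conv snd_conv
    by (intro DERIV_imp_deriv DERIV_cdivide DERIV_diff holomorphic_derivI[OF s'[OF inb(1)] open_ball bb] holomorphic_derivI[OF s'[OF inb(2)] open_ball bb])
  have "deriv2 (deriv1 f) (a, b) = deriv1 (deriv2 f) (a, b)"
    if fd: "(\<lambda>z. deriv2 f (z, b)) field_differentiable (at a)"
  proof -
    have "((\<lambda>z. deriv2 f (z, b)) has_field_derivative deriv1 (deriv2 f) (a, b)) (at a)"
      using fd by (simp add: deriv1_def field_differentiable_derivI)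
    then have l: "(\<lambda>h. (deriv2 f (a + h, b) - deriv2 f (a, b)) / h) \<midarrow>0\<rightarrow> deriv1 (deriv2 f) (a, b)" by (simp add: DERIV_def)
    have "filterlim h (at 0) sequentially" unfolding filterlim_at using hlim h(1) by simp
    from filterlim_compose[OF l this] have "(\<lambda>n. deriv (q n) b) \<longlonglongrightarrow> deriv1 (deriv2 f) (a, b)" by (simp only: dq)
    with l1 show ?thesis by (rule LIMSEQ_unique)
  qed
  then show "(\<lambda>z. deriv2 f (z, b)) field_differentiable (at a) \<Longrightarrow> deriv2 (deriv1 f) (a, b) = deriv1 (deriv2 f) (a, b)" .
qed

lemma deriv2_holomorphic_fst:
  assumes f: "sep_holomorphic V f" and V: "open V" and p: "(a, b) \<in> V"
  shows "(\<lambda>z. deriv2 f (z, b)) field_differentiable (at a)"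
proof -
  have "(b, a) \<in> prod.swap -` V" using p by simp
  from deriv1_holomorphic_snd(1)[OF sep_holomorphic_swap[OF f] open_swap_vimage[OF V] this]
  show ?thesis by (simp add: deriv2_swap)
qed

lemmas deriv_commute = deriv1_holomorphic_snd(2)[OF _ _ _ deriv2_holomorphic_fst]

lemma sep_holomorphic_deriv1:
  assumes f: "sep_holomorphic V f" and V: "open V"
  shows "sep_holomorphic V (deriv1 f)"
  unfolding sep_holomorphic_def
proof (intro conjI ballI)
  show "continuous_on V (deriv1 f)" by (rule deriv1_continuous[OF f V])
  fix p assume p: "p \<in> V"
  obtain a b where ab: "p = (a, b)" by (cases p)
  show "(\<lambda>w. deriv1 f (fst p, w)) field_differentiable at (snd p)"
    using deriv1_holomorphic_snd(1)[OF f V p[unfolded ab]] by (simp add: ab)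
  obtain r where r: "r > 0" "cball a r \<times> cball b r \<subseteq> V" using bidisc_in_open[OF V p[unfolded ab]] by metis
  have "b \<in> cball b r" using r(1) by simp
  from holomorphic_deriv[OF sep_holomorphic_slice(1)[OF f r(2) this] open_ball]
  have "deriv (\<lambda>z. f (z, b)) field_differentiable at a"
    using holomorphic_on_imp_differentiable_at[OF _ open_ball] r(1) centre_in_ball by blast
  then show "(\<lambda>z. deriv1 f (z, snd p)) field_differentiable at (fst p)" by (simp add: ab deriv1_def)
qed

lemma sep_holomorphic_deriv2:
  assumes f: "sep_holomorphic V f" and V: "open V"
  shows "sep_holomorphic V (deriv2 f)"
proof -
  have "deriv2 f = swap_fun (deriv1 (swap_fun f))" by (auto simp: deriv2_swap swap_fun_def)
  moreover have "prod.swap -` prod.swap -` V = V" by auto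
  ultimately show ?thesis
    using sep_holomorphic_swap[OF sep_holomorphic_deriv1[OF sep_holomorphic_swap[OF f] open_swap_vimage[OF V]]] by simp
qed

text \<open>Partial derivatives, one of them jointly continuous, combine to a total derivative. This
  leads back from one-variable holomorphy to the Frechet derivatives in which smoothness is
  expressed.\<close>

lemma sep_holomorphic_has_derivative:
  assumes f: "sep_holomorphic V f" and V: "open V" and p: "p \<in> V"
  shows "(f has_derivative (\<lambda>u. deriv1 f p * fst u + deriv2 f p * snd u)) (at p)"
proof -
  obtain a b where ab: "p = (a, b)" by (cases p)
  obtain r where r: "r > 0" "cball a r \<times> cball b r \<subseteq> V" using bidisc_in_open[OF V p[unfolded ab]] by metis
  have sub: "ball a r \<times> ball b r \<subseteq> V" using r(2) ball_subset_cball by blast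
  have d1: "((\<lambda>z. f (z, w)) has_field_derivative deriv1 f (z, w)) (at z)"
    and d2: "((\<lambda>w. f (z, w)) has_field_derivative deriv2 f (z, w)) (at w)" if "(z, w) \<in> V" for z w
    using f that unfolding sep_holomorphic_def deriv1_def deriv2_def by (force intro: field_differentiable_derivI)+
  have "((\<lambda>(x, y). f (x, y)) has_derivative (\<lambda>(tx, ty). (\<lambda>h. deriv1 f (a, b) * h) tx + blinfun_apply (blinfun_mult_right (deriv2 f (a, b))) ty)) (at (a, b) within ball a r \<times> ball b r)"
  proof (rule has_derivative_partialsI)
    show "((\<lambda>x. f (x, b)) has_derivative (\<lambda>h. deriv1 f (a, b) * h)) (at a within ball a r)"
      using d1[OF p[unfolded ab]] has_derivative_at_withinI has_field_derivative_imp_has_derivative by blast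
    fix x y assume xy: "x \<in> ball a r" "y \<in> ball b r"
    then have "(x, y) \<in> V" using sub by blast
    from has_derivative_at_withinI[OF has_field_derivative_imp_has_derivative[OF d2[OF this]]]
    show "((\<lambda>y. f (x, y)) has_derivative blinfun_apply (blinfun_mult_right (deriv2 f (x, y)))) (at y within ball b r)"
      by (simp only: blinfun_mult_right.rep_eq)
  next
    have "isCont (deriv2 f) (a, b)"
      using deriv2_continuous[OF f V] V p ab continuous_on_eq_continuous_at by blast
    then have "((\<lambda>x. blinfun_mult_right (deriv2 f x)) \<longlongrightarrow> blinfun_mult_right (deriv2 f (a, b))) (at (a, b))"
      unfolding isCont_def by (intro bounded_linear.tendsto[OF bounded_linear_blinfun_mult_right])
    then have "((\<lambda>x. blinfun_mult_right (deriv2 f x)) \<longlongrightarrow> blinfun_mult_right (deriv2 f (a, b))) (at (a, b) within ball a r \<times> ball b r)"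
      by (rule tendsto_within_subset) simp
    then show "continuous (at (a, b) within ball a r \<times> ball b r) (\<lambda>(x, y). blinfun_mult_right (deriv2 f (x, y)))"
      unfolding continuous_within by (simp add: case_prod_beta')
  next
    show "b \<in> ball b r" using r(1) by simp
  qed simp
  moreover have "(a, b) \<in> ball a r \<times> ball b r" using r(1) by simp
  ultimately have "((\<lambda>(x, y). f (x, y)) has_derivative (\<lambda>(tx, ty). deriv1 f (a, b) * tx + blinfun_apply (blinfun_mult_right (deriv2 f (a, b))) ty)) (at (a, b))"
    by (subst (asm) at_within_open) (auto intro: open_Times)
  then show ?thesis by (simp add: ab case_prod_beta' blinfun_mult_right.rep_eq)
qed

lemma sep_holomorphic_smooth:
  assumes f: "sep_holomorphic V f" and V: "open V"
  shows "smooth_on V f"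
proof -
  have "\<forall>f. sep_holomorphic V f \<longrightarrow> Ck_on n V f" for n
  proof (induction n)
    case 0
    then show ?case by (simp add: sep_holomorphic_def)
  next
    case (Suc n)
    show ?case
    proof (intro allI impI)
      fix f assume f: "sep_holomorphic V f"
      show "Ck_on (Suc n) V f"
      proof (rule Ck_on_SucI[OF V sep_holomorphic_has_derivative[OF f V]])
        show "Ck_on n V (\<lambda>p. deriv1 f p * fst v + deriv2 f p * snd v)" for v
          by (intro Ck_on_add Ck_on_mult Ck_on_const V mp[OF spec[OF Suc.IH]] sep_holomorphic_deriv1[OF f V] sep_holomorphic_deriv2[OF f V])
      qed
    qed
  qed
  then show ?thesis using f unfolding smooth_on_def by blast
qed

lemma holomorphic_C2_sep_holomorphic:
  assumes h: "holomorphic_C2_on V \<psi>" and V: "open V"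
  shows "sep_holomorphic V (\<lambda>p. fst (\<psi> p))" "sep_holomorphic V (\<lambda>p. snd (\<psi> p))"
proof -
  have main: "sep_holomorphic V (\<lambda>p. l (\<psi> p))" if l: "bounded_linear l" "\<And>c u. l (cscale c u) = c * l u" for l :: "C2 \<Rightarrow> complex"
    unfolding sep_holomorphic_def
  proof (intro conjI ballI)
    have hd: "\<exists>D. (\<psi> has_derivative D) (at p) \<and> (\<forall>c u. D (cscale c u) = cscale c (D u))" if "p \<in> V" for p
      using h that unfolding holomorphic_C2_on_def by blast
    have "isCont \<psi> p" if "p \<in> V" for p using hd[OF that] has_derivative_continuous by blast
    then have "continuous_on V \<psi>" by (simp add: continuous_at_imp_continuous_on)
    then show "continuous_on V (\<lambda>p. l (\<psi> p))" by (rule bounded_linear.continuous_on[OF l(1)])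
    fix p assume "p \<in> V"
    then obtain D where D: "(\<psi> has_derivative D) (at p)" "\<And>c u. D (cscale c u) = cscale c (D u)" using hd by blast
    obtain a b where ab: "p = (a, b)" by (cases p)
    have lD: "((\<lambda>p. l (\<psi> p)) has_derivative (\<lambda>u. l (D u))) (at (a, b))"
      using bounded_linear.has_derivative[OF l(1) D(1)] by (simp add: ab)
    have "((\<lambda>z. (z, b)) has_derivative (\<lambda>h. (h, 0))) (at a)" "((\<lambda>w. (a, w)) has_derivative (\<lambda>h. (0, h))) (at b)"
      by (auto intro!: derivative_eq_intros)
    note c = has_derivative_compose[OF this(1) lD] has_derivative_compose[OF this(2) lD]
    have "l (D (h, 0)) = l (D (1, 0)) * h" "l (D (0, h)) = l (D (0, 1)) * h" for h
      using D(2)[of h "(1, 0)"] D(2)[of h "(0, 1)"] l(2)[of h] by (simp_all add: cscale_def[of h "(_, _)"])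
    then have e: "(\<lambda>h. l (D (h, 0))) = (*) (l (D (1, 0)))" "(\<lambda>h. l (D (0, h))) = (*) (l (D (0, 1)))" by blast+
    have "((\<lambda>z. l (\<psi> (z, b))) has_field_derivative l (D (1, 0))) (at a)" "((\<lambda>w. l (\<psi> (a, w))) has_field_derivative l (D (0, 1))) (at b)"
      unfolding has_field_derivative_def by (rule c(1)[unfolded e(1)], rule c(2)[unfolded e(2)])
    then show "(\<lambda>z. l (\<psi> (z, snd p))) field_differentiable at (fst p)" "(\<lambda>w. l (\<psi> (fst p, w))) field_differentiable at (snd p)"
      unfolding ab fst_conv snd_conv by (auto simp: field_differentiable_def)
  qed
  show "sep_holomorphic V (\<lambda>p. fst (\<psi> p))" by (rule main[OF bounded_linear_fst]) (simp add: cscale_def)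
  show "sep_holomorphic V (\<lambda>p. snd (\<psi> p))" by (rule main[OF bounded_linear_snd]) (simp add: cscale_def)
qed

section \<open>Holomorphic charts\<close>

text \<open>Symmetry of the second real derivative, reduced to the commutation of the complex
  partial derivatives. It is what makes d(d f) vanish for a chart coordinate.\<close>

lemma sep_holomorphic_symmetric:
  assumes f: "sep_holomorphic V f" and V: "open V" and p: "p \<in> V"
  shows "frechet_derivative (\<lambda>q. frechet_derivative f (at q) v) (at p) u = frechet_derivative (\<lambda>q. frechet_derivative f (at q) u) (at p) v"
proof -
  note d1 = sep_holomorphic_deriv1[OF f V] and d2 = sep_holomorphic_deriv2[OF f V]
  have fd: "frechet_derivative f (at q) = (\<lambda>u. deriv1 f q * fst u + deriv2 f q * snd u)" if "q \<in> V" for q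
    using frechet_derivative_at[OF sep_holomorphic_has_derivative[OF f V that]] by (rule sym)
  have "((\<lambda>q. deriv1 f q * fst v + deriv2 f q * snd v) has_derivative
      (\<lambda>u. (deriv1 (deriv1 f) p * fst u + deriv2 (deriv1 f) p * snd u) * fst v + (deriv1 (deriv2 f) p * fst u + deriv2 (deriv2 f) p * snd u) * snd v)) (at p)" for v
    by (intro has_derivative_add has_derivative_mult_left sep_holomorphic_has_derivative[OF d1 V p] sep_holomorphic_has_derivative[OF d2 V p])
  then have "((\<lambda>q. frechet_derivative f (at q) v) has_derivative
      (\<lambda>u. (deriv1 (deriv1 f) p * fst u + deriv2 (deriv1 f) p * snd u) * fst v + (deriv1 (deriv2 f) p * fst u + deriv2 (deriv2 f) p * snd u) * snd v)) (at p)" for v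
    by (rule has_derivative_transform_within_open[OF _ V p]) (simp add: fd)
  note e = frechet_derivative_at[OF this, symmetric]
  have c: "deriv2 (deriv1 f) p = deriv1 (deriv2 f) p"
    using deriv_commute[OF f V, of "fst p" "snd p"] f V p by simp
  show ?thesis unfolding e c by (simp add: algebra_simps)
qed

lemma holomorphic_C2_frechet:
  assumes "holomorphic_C2_on V \<psi>" "p \<in> V"
  shows "(\<psi> has_derivative frechet_derivative \<psi> (at p)) (at p)"
    and "frechet_derivative \<psi> (at p) (cscale c u) = cscale c (frechet_derivative \<psi> (at p) u)"
    and "fst (frechet_derivative \<psi> (at p) u) = frechet_derivative (\<lambda>p. fst (\<psi> p)) (at p) u"
    and "snd (frechet_derivative \<psi> (at p) u) = frechet_derivative (\<lambda>p. snd (\<psi> p)) (at p) u"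
proof -
  obtain D where D: "(\<psi> has_derivative D) (at p)" "\<And>c u. D (cscale c u) = cscale c (D u)"
    using assms unfolding holomorphic_C2_on_def by blast
  have fd: "frechet_derivative \<psi> (at p) = D" using frechet_derivative_at[OF D(1)] by simp
  show "(\<psi> has_derivative frechet_derivative \<psi> (at p)) (at p)"
    and "frechet_derivative \<psi> (at p) (cscale c u) = cscale c (frechet_derivative \<psi> (at p) u)"
    unfolding fd by (rule D)+
  show "fst (frechet_derivative \<psi> (at p) u) = frechet_derivative (\<lambda>p. fst (\<psi> p)) (at p) u"
    unfolding fd using fun_cong[OF frechet_derivative_at[OF has_derivative_fst[OF D(1)]], of u] .
  show "snd (frechet_derivative \<psi> (at p) u) = frechet_derivative (\<lambda>p. snd (\<psi> p)) (at p) u"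
    unfolding fd using fun_cong[OF frechet_derivative_at[OF has_derivative_snd[OF D(1)]], of u] .
qed

lemma holomorphic_C2_continuous: "holomorphic_C2_on V \<psi> \<Longrightarrow> continuous_on V \<psi>"
  using holomorphic_C2_frechet(1) has_derivative_continuous continuous_at_imp_continuous_on by metis

lemma holomorphic_C2_smooth:
  assumes "holomorphic_C2_on V \<psi>" "open V"
  shows "smooth_on V (\<lambda>p. fst (\<psi> p))" "smooth_on V (\<lambda>p. snd (\<psi> p))"
    "smooth_on V (\<lambda>p. fst (frechet_derivative \<psi> (at p) u))" "smooth_on V (\<lambda>p. snd (frechet_derivative \<psi> (at p) u))"
proof -
  show s: "smooth_on V (\<lambda>p. fst (\<psi> p))" "smooth_on V (\<lambda>p. snd (\<psi> p))"
    by (intro sep_holomorphic_smooth holomorphic_C2_sep_holomorphic assms)+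
  show "smooth_on V (\<lambda>p. fst (frechet_derivative \<psi> (at p) u))"
    by (rule smooth_on_cong[OF assms(2) _ smooth_on_frechet[OF s(1), of u]]) (simp add: holomorphic_C2_frechet(3)[OF assms(1)])
  show "smooth_on V (\<lambda>p. snd (frechet_derivative \<psi> (at p) u))"
    by (rule smooth_on_cong[OF assms(2) _ smooth_on_frechet[OF s(2), of u]]) (simp add: holomorphic_C2_frechet(4)[OF assms(1)])
qed

lemma holomorphic_C2_subset: "holomorphic_C2_on V \<psi> \<Longrightarrow> U \<subseteq> V \<Longrightarrow> holomorphic_C2_on U \<psi>"
  unfolding holomorphic_C2_on_def by blast

lemma holomorphic_C2_compose:
  assumes "holomorphic_C2_on V \<psi>" "holomorphic_C2_on W \<xi>" "\<psi> ` V \<subseteq> W"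
  shows "holomorphic_C2_on V (\<lambda>p. \<xi> (\<psi> p))"
  unfolding holomorphic_C2_on_def
proof
  fix p assume p: "p \<in> V"
  then have w: "\<psi> p \<in> W" using assms(3) by blast
  show "\<exists>D. ((\<lambda>p. \<xi> (\<psi> p)) has_derivative D) (at p) \<and> (\<forall>c u. D (cscale c u) = cscale c (D u))"
    using has_derivative_compose[OF holomorphic_C2_frechet(1)[OF assms(1) p] holomorphic_C2_frechet(1)[OF assms(2) w]]
      holomorphic_C2_frechet(2)[OF assms(1) p] holomorphic_C2_frechet(2)[OF assms(2) w]
    by (intro exI conjI allI) (assumption, simp only:)
qed

lemma holomorphic_C2_cong:
  assumes "holomorphic_C2_on V \<psi>" "open V" "\<And>p. p \<in> V \<Longrightarrow> \<psi> p = \<xi> p"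
  shows "holomorphic_C2_on V \<xi>"
  unfolding holomorphic_C2_on_def
proof
  fix p assume p: "p \<in> V"
  show "\<exists>D. (\<xi> has_derivative D) (at p) \<and> (\<forall>c u. D (cscale c u) = cscale c (D u))"
    using has_derivative_transform_within_open[OF holomorphic_C2_frechet(1)[OF assms(1) p] assms(2) p assms(3)]
      holomorphic_C2_frechet(2)[OF assms(1) p] by blast
qed

section \<open>Biholomorphisms and pullback of forms\<close>

lemma biholomorphismI:
  assumes "open V" "open W" "\<And>p. p \<in> V \<Longrightarrow> \<psi> p \<in> W" "\<And>w. w \<in> W \<Longrightarrow> \<xi> w \<in> V"
    and "\<And>p. p \<in> V \<Longrightarrow> \<xi> (\<psi> p) = p" and r: "\<And>w. w \<in> W \<Longrightarrow> \<psi> (\<xi> w) = w"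
    and "holomorphic_C2_on V \<psi>" "holomorphic_C2_on W \<xi>"
  shows "biholomorphism V W \<psi>"
proof -
  have bij: "bij_betw \<psi> V W" by (rule bij_betw_byWitness[where f'=\<xi>]) (use assms in blast)+
  have "\<xi> w = inv_into V \<psi> w" if "w \<in> W" for w
    using inv_into_f_f[OF bij_betw_imp_inj_on[OF bij] assms(4)[OF that]] r[OF that] by simp
  then have "holomorphic_C2_on W (inv_into V \<psi>)" by (rule holomorphic_C2_cong[OF assms(8,2)])
  then show ?thesis unfolding biholomorphism_def using assms bij by blast
qed

lemma biholomorphismD:
  assumes "biholomorphism V W \<psi>"
  shows "open V" "open W" "holomorphic_C2_on V \<psi>" "holomorphic_C2_on W (inv_into V \<psi>)"
    and "p \<in> V \<Longrightarrow> \<psi> p \<in> W" "w \<in> W \<Longrightarrow> inv_into V \<psi> w \<in> V"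
    and "p \<in> V \<Longrightarrow> inv_into V \<psi> (\<psi> p) = p" "w \<in> W \<Longrightarrow> \<psi> (inv_into V \<psi> w) = w"
  using assms unfolding biholomorphism_def bij_betw_def by (auto intro: inv_into_into f_inv_into_f)

lemma biholomorphism_restrict:
  assumes "biholomorphism V W \<psi>" "open P" "P \<subseteq> W"
  shows "biholomorphism (V \<inter> \<psi> -` P) P \<psi>"
proof (rule biholomorphismI[where \<xi>="inv_into V \<psi>"])
  note D = biholomorphismD[OF assms(1)]
  show "open (V \<inter> \<psi> -` P)"
    using continuous_on_open_vimage[OF D(1)] holomorphic_C2_continuous[OF D(3)] assms(2) by (metis Int_commute)
qed (use assms biholomorphismD[OF assms(1)] holomorphic_C2_subset in auto)

lemma biholomorphism_compose:
  assumes "biholomorphism V W \<psi>" "biholomorphism W U \<xi>"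
  shows "biholomorphism V U (\<lambda>p. \<xi> (\<psi> p))"
proof (rule biholomorphismI[where \<xi>="\<lambda>w. inv_into V \<psi> (inv_into W \<xi> w)"])
  note D = biholomorphismD[OF assms(1)] and E = biholomorphismD[OF assms(2)]
  show "holomorphic_C2_on V (\<lambda>p. \<xi> (\<psi> p))" by (rule holomorphic_C2_compose[OF D(3) E(3)]) (use D(5) in blast)
  show "holomorphic_C2_on U (\<lambda>w. inv_into V \<psi> (inv_into W \<xi> w))" by (rule holomorphic_C2_compose[OF E(4) D(4)]) (use E(6) in blast)
qed (use biholomorphismD[OF assms(1)] biholomorphismD[OF assms(2)] in simp_all)

lemma biholomorphism_compact_preimage:
  assumes "biholomorphism V W \<psi>" "compact K" "K \<subseteq> W"
  shows "compact (inv_into V \<psi> ` K)" "inv_into V \<psi> ` K \<subseteq> V" "p \<in> V \<Longrightarrow> p \<notin> inv_into V \<psi> ` K \<Longrightarrow> \<psi> p \<notin> K"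
proof -
  note D = biholomorphismD[OF assms(1)]
  show "compact (inv_into V \<psi> ` K)"
    by (rule compact_continuous_image[OF continuous_on_subset[OF holomorphic_C2_continuous[OF D(4)] assms(3)] assms(2)])
  show "inv_into V \<psi> ` K \<subseteq> V" using D(6) assms(3) by blast
  show "\<psi> p \<notin> K" if "p \<in> V" "p \<notin> inv_into V \<psi> ` K" using D(7)[OF that(1)] that(2) by (metis imageI)
qed

text \<open>The derivative of the chart enters the coefficients, so smoothness of holomorphic maps
  is essential. Compactness of the support is carried over by the continuous inverse, and extension
  by zero does the rest.\<close>

lemma pullback_test_form2:
  assumes b: "biholomorphism V W \<psi>" and sub: "V \<subseteq> \<Omega>" and \<omega>: "test_form2 W \<omega>"
  shows "test_form2 \<Omega> (pullback V \<psi> \<omega>)"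
proof -
  note D = biholomorphismD[OF b] and w = test_form2D[OF \<omega>]
  note F = holomorphic_C2_frechet[OF D(3)] and sm = holomorphic_C2_smooth[OF D(3,1)]
  obtain K where K: "compact K" "K \<subseteq> W" "\<And>p u v. p \<notin> K \<Longrightarrow> \<omega> p u v = 0" using test_form2_support[OF \<omega>] by metis
  note KD = biholomorphism_compact_preimage[OF b K(1,2)]
  have zero: "pullback V \<psi> \<omega> p u v = 0" if "p \<notin> inv_into V \<psi> ` K" for p u v
    using KD(3)[OF _ that] K(3) by (simp add: pullback_def)
  show ?thesis
  proof (rule test_form2I[OF _ _ _ KD(1) _ zero])
    show "bilinear (pullback V \<psi> \<omega> p)" for p
    proof (cases "p \<in> V")
      case True
      note lin = linear_add[OF has_derivative_linear[OF F(1)[OF True]]] linear_scale[OF has_derivative_linear[OF F(1)[OF True]]]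
      show ?thesis using True by (intro bilinearI_C) (simp_all add: pullback_def lin bilinear_C_simps[OF w(1)])
    next
      case False
      then show ?thesis by (intro bilinearI_C) (simp_all add: pullback_def)
    qed
    show "pullback V \<psi> \<omega> p u u = 0" for p u by (simp add: pullback_def w(2))
    show "inv_into V \<psi> ` K \<subseteq> \<Omega>" using KD(2) sub by blast
    fix u v
    have "smooth_on V (\<lambda>p. \<omega> (\<psi> p) (frechet_derivative \<psi> (at p) u) (frechet_derivative \<psi> (at p) v))"
      by (rule smooth_on_form_apply[OF D(1) sm(3,4) sm(3,4), of "\<lambda>p. \<omega> (\<psi> p)"]) (intro w(1) smooth_on_compose[OF D(1) w(4) sm(1,2)])+
    then have "smooth_on V (\<lambda>p. pullback V \<psi> \<omega> p u v)"
      by (rule smooth_on_cong[OF D(1), rotated]) (simp add: pullback_def)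
    then show "smooth_on UNIV (\<lambda>p. pullback V \<psi> \<omega> p u v)"
      by (rule smooth_on_extend_zero[OF D(1) _ KD(1,2) zero])
  qed
qed

lemma pullback_types:
  assumes "biholomorphism V W \<psi>"
  shows "type_20 \<omega> \<Longrightarrow> type_20 (pullback V \<psi> \<omega>)" "type_02 \<omega> \<Longrightarrow> type_02 (pullback V \<psi> \<omega>)"
    "positive_form \<omega> \<Longrightarrow> positive_form (pullback V \<psi> \<omega>)"
proof -
  have c: "p \<in> V \<Longrightarrow> frechet_derivative \<psi> (at p) (cscale \<i> u) = cscale \<i> (frechet_derivative \<psi> (at p) u)" for p u
    by (rule holomorphic_C2_frechet(2)[OF biholomorphismD(3)[OF assms]])
  show "type_20 \<omega> \<Longrightarrow> type_20 (pullback V \<psi> \<omega>)"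
    unfolding type_20_def pullback_def by (intro allI) (simp add: c del: split_paired_All)
  show "type_02 \<omega> \<Longrightarrow> type_02 (pullback V \<psi> \<omega>)"
    unfolding type_02_def pullback_def by (intro allI) (simp add: c del: split_paired_All)
  show "positive_form \<omega> \<Longrightarrow> positive_form (pullback V \<psi> \<omega>)"
    unfolding positive_form_def type_11_def pullback_def by (intro conjI allI) (simp_all add: c del: split_paired_All)
qed

lemma pullback_comb:
  "pullback V \<psi> (\<lambda>p u v. a * \<omega> p u v + b * \<omega>' p u v) = (\<lambda>p u v. a * pullback V \<psi> \<omega> p u v + b * pullback V \<psi> \<omega>' p u v)"
  by (intro ext) (simp add: pullback_def)

text \<open>In the chart the form is \<open>dH \<and> d(L z)\<close>, whose pullback is the exterior derivative of \<open>(H \<circ> \<psi>) d(L \<psi>\<^sub>1)\<close>.\<close>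

lemma closed_current_pullback:
  assumes b: "biholomorphism V W \<psi>" and sub: "V \<subseteq> \<Omega>" and S: "closed_current \<Omega> S"
    and H: "smooth_on UNIV H" and K: "compact K" "K \<subseteq> W" "\<And>p. p \<notin> K \<Longrightarrow> H p = 0" and L: "L \<in> {Re, Im}"
  shows "S (pullback V \<psi> (\<lambda>p u v. frechet_derivative H (at p) u * complex_of_real (L (fst v))
            - frechet_derivative H (at p) v * complex_of_real (L (fst u)))) = 0"
proof -
  note D = biholomorphismD[OF b]
  note F = holomorphic_C2_frechet[OF D(3)] and sm = holomorphic_C2_smooth[OF D(3,1)] and KD = biholomorphism_compact_preimage[OF b K(1,2)]
  have Lb: "bounded_linear (\<lambda>z. complex_of_real (L z))"
    using L bounded_linear_compose[OF bounded_linear_of_real bounded_linear_Re] bounded_linear_compose[OF bounded_linear_of_real bounded_linear_Im] by blast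
  define f where "f p = fst (\<psi> p)" for p
  define G where "G u p = frechet_derivative f (at p) u" for u p
  define \<theta> where "\<theta> p u = (if p \<in> V then H (\<psi> p) * complex_of_real (L (G u p)) else 0)" for p u
  have f: "sep_holomorphic V f" unfolding f_def by (rule holomorphic_C2_sep_holomorphic(1)[OF D(3,1)])
  have fs: "smooth_on V f" by (rule sep_holomorphic_smooth[OF f D(1)])
  have Gs: "smooth_on V (G u)" for u unfolding G_def by (rule smooth_on_frechet[OF fs])
  have Gf: "fst (frechet_derivative \<psi> (at p) u) = G u p" if "p \<in> V" for p u unfolding G_def f_def by (rule F(3)[OF that])
  have sym: "frechet_derivative (G v) (at p) u = frechet_derivative (G u) (at p) v" if "p \<in> V" for u v p
    unfolding G_def by (rule sep_holomorphic_symmetric[OF f D(1) that])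
  have zero: "\<theta> p u = 0" if "p \<notin> inv_into V \<psi> ` K" for p u using KD(3)[OF _ that] K(3) by (simp add: \<theta>_def)
  have sHp: "smooth_on V (\<lambda>p. H (\<psi> p))" by (rule smooth_on_compose[OF D(1) H sm(1,2)])
  have "test_form1 \<Omega> \<theta>"
    unfolding test_form1_def Cinf_iff_smooth_on
  proof (intro conjI allI exI)
    show "linear (\<theta> p)" for p
    proof (cases "p \<in> V")
      case True
      have "linear (\<lambda>u. complex_of_real (L (G u p)))"
        unfolding G_def using has_derivative_linear[OF smooth_on_D[OF fs True]] bounded_linear.linear[OF Lb] by (rule linear_compose[unfolded o_def])
      then have "linear (\<lambda>u. H (\<psi> p) * complex_of_real (L (G u p)))"
        using bounded_linear.linear[OF bounded_linear_mult_right[of "H (\<psi> p)"]] by (rule linear_compose[unfolded o_def])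
      then show ?thesis unfolding \<theta>_def using True by simp
    next
      case False
      then show ?thesis unfolding \<theta>_def by (simp add: linear_zero)
    qed
    show "smooth_on UNIV (\<lambda>p. \<theta> p u)" for u
    proof (rule smooth_on_extend_zero[OF D(1) _ KD(1,2) zero])
      have "smooth_on V (\<lambda>p. H (\<psi> p) * complex_of_real (L (G u p)))"
        by (intro smooth_on_mult D(1) sHp smooth_on_linear[OF D(1) Lb Gs])
      then show "smooth_on V (\<lambda>p. \<theta> p u)" by (rule smooth_on_cong[OF D(1), rotated]) (simp add: \<theta>_def)
    qed
    show "compact (inv_into V \<psi> ` K)" by (rule KD(1))
    show "inv_into V \<psi> ` K \<subseteq> \<Omega>" using KD(2) sub by blast
    show "p \<notin> inv_into V \<psi> ` K \<longrightarrow> (\<forall>u. \<theta> p u = 0)" for p using zero by blast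
  qed
  moreover have "ext_deriv \<theta> = pullback V \<psi> (\<lambda>p u v. frechet_derivative H (at p) u * complex_of_real (L (fst v))
            - frechet_derivative H (at p) v * complex_of_real (L (fst u)))"
  proof (intro ext)
    fix p u v
    show "ext_deriv \<theta> p u v = pullback V \<psi> (\<lambda>p u v. frechet_derivative H (at p) u * complex_of_real (L (fst v))
            - frechet_derivative H (at p) v * complex_of_real (L (fst u))) p u v"
    proof (cases "p \<in> V")
      case True
      let ?D = "frechet_derivative \<psi> (at p)"
      have "((\<lambda>q. H (\<psi> q) * complex_of_real (L (G v q))) has_derivative
         (\<lambda>u. H (\<psi> p) * complex_of_real (L (frechet_derivative (G v) (at p) u)) + frechet_derivative H (at (\<psi> p)) (?D u) * complex_of_real (L (G v p)))) (at p)" for v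
        by (intro has_derivative_mult bounded_linear.has_derivative[OF Lb] smooth_on_D[OF Gs True] has_derivative_compose[OF F(1)[OF True]] smooth_on_D[OF H UNIV_I])
      then have "((\<lambda>q. \<theta> q v) has_derivative
         (\<lambda>u. H (\<psi> p) * complex_of_real (L (frechet_derivative (G v) (at p) u)) + frechet_derivative H (at (\<psi> p)) (?D u) * complex_of_real (L (G v p)))) (at p)" for v
        by (rule has_derivative_transform_within_open[OF _ D(1) True]) (simp add: \<theta>_def)
      note e = frechet_derivative_at[OF this, symmetric]
      \<comment> \<open>The terms with second derivatives of the chart coordinate are symmetric in
        \<open>u\<close> and \<open>v\<close> and cancel in the alternation.\<close>
      show ?thesis unfolding ext_deriv_def e sym[OF True, of v u] pullback_def using True Gf[OF True] by simp
    next
      case False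
      then have "p \<notin> inv_into V \<psi> ` K" using KD(2) by blast
      then have "frechet_derivative (\<lambda>q. \<theta> q v) (at p) u = 0" for u v
        using frechet_zero_outside[OF compact_imp_closed[OF KD(1)], of "\<lambda>q. \<theta> q v"] zero by blast
      then show ?thesis using False by (simp add: ext_deriv_def pullback_def)
    qed
  qed
  ultimately show ?thesis using S unfolding closed_current_def by metis
qed

lemma pullback_compose:
  assumes "biholomorphism V W \<psi>" "biholomorphism P U \<xi>" "P \<subseteq> W"
  shows "pullback V \<psi> (pullback P \<xi> \<omega>) = pullback (V \<inter> \<psi> -` P) (\<lambda>p. \<xi> (\<psi> p)) \<omega>"
proof (intro ext)
  fix p u v
  show "pullback V \<psi> (pullback P \<xi> \<omega>) p u v = pullback (V \<inter> \<psi> -` P) (\<lambda>p. \<xi> (\<psi> p)) \<omega> p u v"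
  proof (cases "p \<in> V \<and> \<psi> p \<in> P")
    case True
    have "frechet_derivative (\<lambda>p. \<xi> (\<psi> p)) (at p) = (\<lambda>u. frechet_derivative \<xi> (at (\<psi> p)) (frechet_derivative \<psi> (at p) u))"
      using frechet_derivative_at[OF has_derivative_compose[OF holomorphic_C2_frechet(1)[OF biholomorphismD(3)[OF assms(1)]]
        holomorphic_C2_frechet(1)[OF biholomorphismD(3)[OF assms(2)]]], of p] True by simp
    then show ?thesis using True by (simp add: pullback_def)
  qed (auto simp: pullback_def)
qed

section \<open>Laminarity of a dominated closed current\<close>

context dominated_leaf_current
begin

text \<open>The transverse measure is \<mu> weighted by a fixed average of the density and
  restricted to labels of modulus at most 1/2. These leaves stay below 1/2 + 1/4, which gives the
  uniform distance 1/4 from the boundary.\<close>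

theorem laminar_near_origin:
  "\<exists>R. uniformly_laminar_bidisc R \<and> (\<forall>\<omega>. test_form2 (ball 0 (1/4) \<times> ball 0 (1/4)) \<omega> \<longrightarrow> S \<omega> = R \<omega>)"
proof -
  obtain b where b: "mollifier (1/8) b" using mollifier_exists[of "1/8"] by auto
  define \<tau>' where "\<tau>' = \<tau> \<inter> cball 0 (1/2)"
  have \<tau>': "\<alpha> \<in> \<tau>' \<longleftrightarrow> \<alpha> \<in> \<tau> \<and> cmod \<alpha> \<le> 1/2" for \<alpha> by (simp add: \<tau>'_def)
  interpret L: graph_lamination \<tau>' \<phi>
    by unfold_locales (use compact_Int_closed[OF compact_tau closed_cball] hol base disj close in \<open>auto simp: \<tau>'_def\<close>)
  have [measurable]: "\<tau>' \<in> sets borel" using compact_imp_closed[OF L.compact_tau] by (rule borel_closed)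
  \<comment> \<open>The average is nonnegative only almost everywhere and only for labels below 1/2;
    truncation at 0 makes it a density everywhere and is invisible to forms supported near the
    origin.\<close>
  define h where "h \<alpha> = max 0 (slice b 0 \<alpha>)" for \<alpha>
  have hint: "integrable \<mu> h" unfolding h_def by (intro integrable_max slice_integrable[OF b]) simp
  have hm: "h \<in> borel_measurable \<mu>" using borel_measurable_integrable[OF hint] .
  have h0: "h \<alpha> \<ge> 0" for \<alpha> by (simp add: h_def)
  define \<nu>0 where "\<nu>0 = density \<mu> (\<lambda>\<alpha>. ennreal (h \<alpha>))"
  define \<nu> where "\<nu> = restrict_space \<nu>0 \<tau>'"
  have s0: "sets \<nu>0 = sets borel" "space \<nu>0 = UNIV" by (simp_all add: \<nu>0_def)
  have "finite_measure_on \<tau>' \<nu>"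
    unfolding finite_measure_on_def
  proof
    show "sets \<nu> = sets (restrict_space borel \<tau>')" unfolding \<nu>_def by (rule sets_restrict_space_cong[OF s0(1)])
    have "emeasure \<nu>0 (space \<nu>0) = (\<integral>\<^sup>+\<alpha>. ennreal (h \<alpha>) \<partial>\<mu>)"
      using hm by (simp add: \<nu>0_def emeasure_density)
    also have "\<dots> = ennreal (integral\<^sup>L \<mu> h)" by (rule nn_integral_eq_integral[OF hint]) (simp add: h0)
    finally have "finite_measure \<nu>0" by (intro finite_measureI) simp
    then show "finite_measure \<nu>" unfolding \<nu>_def by (rule finite_measure_restrict_space) (simp add: s0)
  qed
  moreover have "cmod (\<phi> \<alpha> z) \<le> 1 - 1/4" if "\<alpha> \<in> \<tau>'" "z \<in> unit_disc" for \<alpha> z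
    using near[of \<alpha> z] norm_triangle_sub[of "\<phi> \<alpha> z" \<alpha>] that \<tau>' by auto
  ultimately have "uniformly_laminar_bidisc (L.average_current \<nu>)" by (intro L.uniformly_laminar_average[where \<eta>="1/4"]) simp_all
  moreover have "S \<omega> = L.average_current \<nu> \<omega>" if \<omega>: "test_form2 (ball 0 (1/4) \<times> ball 0 (1/4)) \<omega>" for \<omega>
  proof -
    define \<Phi> where "\<Phi> \<alpha> = (LINT z|disc_measure. trace \<omega> (z, \<alpha>))" for \<alpha>
    have \<omega>': "test_form2 bidisc \<omega>" by (rule test_form2_mono[OF \<omega>]) auto
    have [measurable]: "\<Phi> \<in> borel_measurable borel" unfolding \<Phi>_def by (rule leaf_integral_measurable[OF \<omega>'])
    have \<Phi>0: "\<Phi> \<alpha> = 0" if "cmod \<alpha> \<ge> 1/2" for \<alpha> unfolding \<Phi>_def using trace_small_support[OF \<omega>] that by simp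
    have sp: "space \<nu> = \<tau>'" by (simp add: \<nu>_def space_restrict_space s0)
    have "L.average_current \<nu> \<omega> = (LINT \<alpha>|\<nu>. \<Phi> \<alpha>)"
      unfolding L.average_current_def \<Phi>_def
      by (rule Bochner_Integration.integral_cong[OF refl]) (use leaf_integral_trace[OF \<omega>'] sp \<tau>' in auto)
    also have "\<dots> = (LINT \<alpha>:\<tau>'|\<nu>0. \<Phi> \<alpha>)"
      unfolding \<nu>_def set_lebesgue_integral_def by (rule integral_restrict_space) (simp add: s0)
    also have "\<dots> = (LINT \<alpha>|\<mu>. h \<alpha> *\<^sub>R (indicator \<tau>' \<alpha> *\<^sub>R \<Phi> \<alpha>))"
      unfolding \<nu>0_def set_lebesgue_integral_def using hm h0 by (intro integral_density) simp_all
    also have "\<dots> = (LINT \<alpha>|\<mu>. of_real (slice b 0 \<alpha>) * \<Phi> \<alpha>)"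
    proof (rule integral_cong_AE)
      have "(\<lambda>\<alpha>. slice b 0 \<alpha>) \<in> borel_measurable \<mu>" using borel_measurable_integrable[OF slice_integrable[OF b]] .
      then show "(\<lambda>\<alpha>. of_real (slice b 0 \<alpha>) * \<Phi> \<alpha>) \<in> borel_measurable \<mu>" by simp
      show "(\<lambda>\<alpha>. h \<alpha> *\<^sub>R (indicator \<tau>' \<alpha> *\<^sub>R \<Phi> \<alpha>)) \<in> borel_measurable \<mu>" using hm by simp
      have "AE \<alpha> in \<mu>. cmod \<alpha> < 1/2 \<longrightarrow> 0 \<le> slice b 0 \<alpha>" using slice_nonneg_AE[OF b] by simp
      then show "AE \<alpha> in \<mu>. h \<alpha> *\<^sub>R (indicator \<tau>' \<alpha> *\<^sub>R \<Phi> \<alpha>) = of_real (slice b 0 \<alpha>) * \<Phi> \<alpha>"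
        using AE_tau
      proof eventually_elim
        case (elim \<alpha>)
        show ?case
        proof (cases "cmod \<alpha> < 1/2")
          case True
          with elim show ?thesis by (simp add: h_def \<tau>' scaleR_conv_of_real)
        qed (use \<Phi>0 in simp)
      qed
    qed
    also have "\<dots> = S \<omega>" unfolding \<Phi>_def by (rule leaf_representation[OF b _ \<omega>, symmetric]) simp
    finally show ?thesis by simp
  qed
  ultimately show ?thesis by blast
qed

end

section \<open>Zooming into a chart at a given point\<close>

lemma lborel_integral_affine:
  fixes f :: "complex \<Rightarrow> 'b::{banach, second_countable_topology}"
  assumes [measurable]: "f \<in> borel_measurable borel" and c: "c \<noteq> (0::real)"
  shows "integral\<^sup>L lborel f = (LINT x|lborel. c\<^sup>2 *\<^sub>R f (t + c *\<^sub>R x))"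
proof -
  have "integral\<^sup>L lborel f = integral\<^sup>L (density (distr lborel borel (\<lambda>x. t + c *\<^sub>R x)) (\<lambda>_. ennreal (\<bar>c\<bar> ^ DIM(complex)))) f"
    by (rule arg_cong[OF lborel_affine[OF c], of "\<lambda>M. integral\<^sup>L M f"])
  also have "\<dots> = (LINT x|distr lborel borel (\<lambda>x. t + c *\<^sub>R x). \<bar>c\<bar> ^ DIM(complex) *\<^sub>R f x)"
    by (rule integral_density) simp_all
  also have "\<dots> = (LINT x|lborel. \<bar>c\<bar> ^ DIM(complex) *\<^sub>R f (t + c *\<^sub>R x))"
    by (rule integral_distr) simp_all
  finally show ?thesis by simp
qed

text \<open>Horizontal and vertical radii are separate: \<open>r1\<close> is taken so small against
  \<open>r\<close> that, after the box is scaled to the bidisc, leaves drift by at most 1/4.\<close>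

locale rescaled_lamination = graph_lamination +
  fixes q1 q2 :: complex and r1 r :: real
  assumes r1: "r1 > 0" and r: "r > 0" and in_disc: "ball q1 r1 \<subseteq> unit_disc"
    and variation: "\<And>\<alpha> z. \<alpha> \<in> \<tau> \<Longrightarrow> z \<in> ball q1 r1 \<Longrightarrow> cmod (\<phi> \<alpha> z - \<phi> \<alpha> q1) \<le> r / 4"
begin

text \<open>The rescaled height at which a leaf crosses the vertical line through the new centre. It
  becomes the base point of the leaf in the zoomed chart.\<close>

definition label :: "complex \<Rightarrow> complex" where "label \<alpha> = (\<phi> \<alpha> q1 - q2) / of_real r"
definition zoom :: "complex \<Rightarrow> complex" where "zoom z = q1 + of_real r1 * z"
text \<open>The bound 2 contains all leaves that meet the box, whose labels are below 5/4. It also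
  keeps retained leaves at mutual distance at most 4 + 1/4 + 1/4, below the 5 required of a
  \<open>graph_lamination\<close>.\<close>

definition zoom_tau :: "complex set" where "zoom_tau = label ` {\<alpha> \<in> \<tau>. cmod (label \<alpha>) \<le> 2}"
definition zoom_phi :: "complex \<Rightarrow> complex \<Rightarrow> complex" where
  "zoom_phi \<beta> z = (\<phi> (inv_into \<tau> label \<beta>) (zoom z) - q2) / of_real r"
definition zoom_box :: "C2 set" where "zoom_box = ball q1 r1 \<times> ball q2 r"
definition zoom_chart :: "C2 \<Rightarrow> C2" where "zoom_chart p = ((fst p - q1) / of_real r1, (snd p - q2) / of_real r)"

lemma q1_in: "q1 \<in> unit_disc" using in_disc r1 centre_in_ball by blast

lemma zoom_in: "z \<in> unit_disc \<Longrightarrow> zoom z \<in> ball q1 r1"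
  using r1 by (simp add: zoom_def dist_norm norm_mult)

lemma label_inj: "inj_on label \<tau>"
  using disj[OF _ _ _ q1_in] r by (auto simp: inj_on_def label_def)

lemma zoom_phi_label: "\<alpha> \<in> \<tau> \<Longrightarrow> zoom_phi (label \<alpha>) z = (\<phi> \<alpha> (zoom z) - q2) / of_real r"
  by (simp add: zoom_phi_def inv_into_f_f[OF label_inj])

lemma zoom_near: "\<alpha> \<in> \<tau> \<Longrightarrow> z \<in> unit_disc \<Longrightarrow> cmod (zoom_phi (label \<alpha>) z - label \<alpha>) \<le> 1/4"
proof -
  assume a: "\<alpha> \<in> \<tau>" and z: "z \<in> unit_disc"
  have "zoom_phi (label \<alpha>) z - label \<alpha> = (\<phi> \<alpha> (zoom z) - \<phi> \<alpha> q1) / of_real r"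
    unfolding zoom_phi_label[OF a] unfolding label_def by (simp add: diff_divide_distrib)
  then show ?thesis using variation[OF a zoom_in[OF z]] r by (simp add: norm_divide pos_divide_le_eq)
qed

lemma continuous_label: "continuous_on \<tau> label"
proof -
  have "continuous_on \<tau> (\<lambda>\<alpha>. (\<lambda>(z, \<alpha>). \<phi> \<alpha> z) (q1, \<alpha>))"
    by (rule continuous_on_compose2[OF continuous_on_leaf]) (use q1_in in \<open>auto intro!: continuous_intros\<close>)
  then show ?thesis unfolding label_def using r by (auto intro!: continuous_intros)
qed

lemma zoom_phi_deriv:
  assumes "\<alpha> \<in> \<tau>" "z \<in> unit_disc"
  shows "(zoom_phi (label \<alpha>) has_field_derivative deriv (\<phi> \<alpha>) (zoom z) * of_real r1 / of_real r) (at z)"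
proof -
  have "zoom z \<in> unit_disc" using zoom_in[OF assms(2)] in_disc by blast
  then have d: "(\<phi> \<alpha> has_field_derivative deriv (\<phi> \<alpha>) (zoom z)) (at (zoom z))" by (rule holomorphic_derivI[OF hol[OF assms(1)] open_ball])
  have "(zoom has_field_derivative of_real r1) (at z)" unfolding zoom_def by (auto intro!: derivative_eq_intros)
  from DERIV_chain2[OF d this]
  have "((\<lambda>z. (\<phi> \<alpha> (zoom z) - q2) / of_real r) has_field_derivative (deriv (\<phi> \<alpha>) (zoom z) * of_real r1 - 0) / of_real r) (at z)"
    by (intro DERIV_cdivide DERIV_diff DERIV_const)
  moreover have "zoom_phi (label \<alpha>) = (\<lambda>z. (\<phi> \<alpha> (zoom z) - q2) / of_real r)" using zoom_phi_label[OF assms(1)] by blast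
  ultimately show ?thesis by simp
qed

lemma zoom_lamination: "graph_lamination zoom_tau zoom_phi"
proof
  have "closedin (top_of_set \<tau>) (\<tau> \<inter> label -` cball 0 2)"
    by (rule continuous_closedin_preimage[OF continuous_label closed_cball])
  moreover have "\<tau> \<inter> label -` cball 0 2 = {\<alpha> \<in> \<tau>. cmod (label \<alpha>) \<le> 2}" by auto
  ultimately have "compact {\<alpha> \<in> \<tau>. cmod (label \<alpha>) \<le> 2}" using closedin_compact[OF compact_tau] by metis
  then show "compact zoom_tau"
    unfolding zoom_tau_def by (intro compact_continuous_image continuous_on_subset[OF continuous_label]) auto
next
  fix \<beta> assume "\<beta> \<in> zoom_tau"
  then obtain \<alpha> where a: "\<alpha> \<in> \<tau>" "\<beta> = label \<alpha>" unfolding zoom_tau_def by blast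
  show "zoom_phi \<beta> holomorphic_on unit_disc"
    unfolding a(2) holomorphic_on_open[OF open_ball] using zoom_phi_deriv[OF a(1)] by blast
  show "zoom_phi \<beta> 0 = \<beta>" using zoom_phi_label[OF a(1), of 0] unfolding a(2) by (simp add: zoom_def label_def)
next
  fix \<beta> \<beta>' z assume "\<beta> \<in> zoom_tau" "\<beta>' \<in> zoom_tau" and z: "z \<in> unit_disc"
  then obtain \<alpha> \<alpha>' where a: "\<alpha> \<in> \<tau>" "\<beta> = label \<alpha>" "\<alpha>' \<in> \<tau>" "\<beta>' = label \<alpha>'" and l: "cmod \<beta> \<le> 2" "cmod \<beta>' \<le> 2"
    unfolding zoom_tau_def by blast
  have zu: "zoom z \<in> unit_disc" using zoom_in[OF z] in_disc by blast
  show "zoom_phi \<beta> z \<noteq> zoom_phi \<beta>' z" if "\<beta> \<noteq> \<beta>'"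
    using disj[OF a(1,3) _ zu] that r unfolding a(2,4) zoom_phi_label[OF a(1)] zoom_phi_label[OF a(3)] by auto
  have "cmod (zoom_phi \<beta> z - zoom_phi \<beta>' z) \<le> cmod (zoom_phi \<beta> z - \<beta>) + cmod (\<beta> - zoom_phi \<beta>' z)"
    using norm_triangle_ineq[of "zoom_phi \<beta> z - \<beta>" "\<beta> - zoom_phi \<beta>' z"] by simp
  moreover have "cmod (\<beta> - zoom_phi \<beta>' z) \<le> cmod (\<beta> - \<beta>') + cmod (zoom_phi \<beta>' z - \<beta>')"
    using norm_triangle_ineq4[of "\<beta> - \<beta>'" "zoom_phi \<beta>' z - \<beta>'"] by simp
  moreover have "cmod (\<beta> - \<beta>') \<le> 4" using norm_triangle_ineq4[of \<beta> \<beta>'] l by linarith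
  ultimately show "cmod (zoom_phi \<beta> z - zoom_phi \<beta>' z) < 5"
    using zoom_near[OF a(1) z] zoom_near[OF a(3) z] unfolding a(2,4) by linarith
qed

sublocale Z: graph_lamination zoom_tau zoom_phi by (rule zoom_lamination)

lemma zoom_chart_derivative:
  "(zoom_chart has_derivative (\<lambda>u. (fst u / of_real r1, snd u / of_real r))) (at p)"
  unfolding zoom_chart_def[abs_def]
  by (auto intro!: derivative_eq_intros simp: divide_inverse)

lemma zoom_chart_frechet: "frechet_derivative zoom_chart (at p) u = (fst u / of_real r1, snd u / of_real r)"
  using frechet_derivative_at[OF zoom_chart_derivative[of p]] by metis

lemma zoom_chart_box: "zoom_chart p \<in> bidisc \<longleftrightarrow> p \<in> zoom_box"
proof -
  have "cmod ((x - a) / of_real s) < 1 \<longleftrightarrow> dist a x < s" if "s > 0" for x a and s :: real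
    using that by (simp add: norm_divide dist_norm norm_minus_commute)
  then show ?thesis using r1 r by (cases p) (simp add: zoom_chart_def zoom_box_def)
qed

lemma biholomorphism_zoom_chart: "biholomorphism zoom_box bidisc zoom_chart"
proof (rule biholomorphismI[where \<xi>="\<lambda>p. (zoom (fst p), q2 + of_real r * snd p)"])
  show "open zoom_box" unfolding zoom_box_def by (intro open_Times open_ball)
  show "open bidisc" by (intro open_Times open_ball)
  show "zoom_chart p \<in> bidisc" if "p \<in> zoom_box" for p using that zoom_chart_box by blast
  have inv: "zoom_chart (zoom (fst p), q2 + of_real r * snd p) = p" for p
    using r1 r by (simp add: zoom_chart_def zoom_def)
  then show "zoom_chart (zoom (fst p), q2 + of_real r * snd p) = p" for p .
  show "(zoom (fst p), q2 + of_real r * snd p) \<in> zoom_box" if "p \<in> bidisc" for p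
    unfolding zoom_chart_box[symmetric] inv by (rule that)
  show "(zoom (fst (zoom_chart p)), q2 + of_real r * snd (zoom_chart p)) = p" for p
    using r1 r by (simp add: zoom_chart_def zoom_def)
  show "holomorphic_C2_on zoom_box zoom_chart"
    unfolding holomorphic_C2_on_def
    by (intro ballI exI[of _ "\<lambda>u. (fst u / of_real r1, snd u / of_real r)"] conjI allI zoom_chart_derivative) (simp add: cscale_def)
  show "holomorphic_C2_on bidisc (\<lambda>p. (zoom (fst p), q2 + of_real r * snd p))"
    unfolding holomorphic_C2_on_def zoom_def
    by (intro ballI exI[of _ "\<lambda>u. (of_real r1 * fst u, of_real r * snd u)"] conjI allI)
      (auto intro!: derivative_eq_intros simp: cscale_def)
qed

text \<open>Affine change of variables in the disc. The Jacobian r1^2 cancels the factor 1/r1 that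
  each of the two tangent vectors acquires in the zoomed chart.\<close>

lemma integration_current_zoom:
  assumes \<omega>: "test_form2 bidisc \<omega>" and a: "\<alpha> \<in> \<tau>"
  shows "integration_current (\<phi> \<alpha>) (pullback zoom_box zoom_chart \<omega>) = integration_current (zoom_phi (label \<alpha>)) \<omega>"
proof -
  let ?w = "pullback zoom_box zoom_chart \<omega>"
  have w: "test_form2 zoom_box ?w" by (rule pullback_test_form2[OF biholomorphism_zoom_chart order_refl \<omega>])
  have [measurable]: "trace ?w \<in> borel_measurable (borel \<Otimes>\<^sub>M borel)" using trace_measurable[OF w] by (simp add: borel_prod)
  have m: "(\<lambda>z. trace ?w (z, \<alpha>)) \<in> borel_measurable borel" by measurable
  obtain K where K: "K \<subseteq> bidisc" "\<And>p u v. p \<notin> K \<Longrightarrow> \<omega> p u v = 0" using test_form2_support[OF \<omega>] by metis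
  have "integration_current (\<phi> \<alpha>) ?w = (LINT z|lborel. trace ?w (z, \<alpha>))"
    unfolding integration_current_leaf set_lebesgue_integral_def
    by (rule Bochner_Integration.integral_cong[OF refl]) (use a in \<open>auto simp: trace_def indicator_def\<close>)
  also have "\<dots> = (LINT z|lborel. r1\<^sup>2 *\<^sub>R trace ?w (q1 + r1 *\<^sub>R z, \<alpha>))"
    by (rule lborel_integral_affine[OF m]) (use r1 in simp)
  also have "\<dots> = integration_current (zoom_phi (label \<alpha>)) \<omega>"
    unfolding integration_current_def set_lebesgue_integral_def
  proof (rule Bochner_Integration.integral_cong[OF refl])
    fix z
    have zz: "q1 + r1 *\<^sub>R z = zoom z" by (simp add: zoom_def scaleR_conv_of_real)
    let ?f = "zoom_phi (label \<alpha>)"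
    show "r1\<^sup>2 *\<^sub>R trace ?w (q1 + r1 *\<^sub>R z, \<alpha>) = indicator unit_disc z *\<^sub>R \<omega> (z, ?f z) (1, deriv ?f z) (cscale \<i> (1, deriv ?f z))"
    proof (cases "z \<in> unit_disc")
      case True
      have zu: "zoom z \<in> unit_disc" using zoom_in[OF True] in_disc by blast
      have c: "zoom_chart (zoom z, \<phi> \<alpha> (zoom z)) = (z, ?f z)"
        using r1 by (simp add: zoom_chart_def zoom_phi_label[OF a] zoom_def)
      have tr: "trace ?w (zoom z, \<alpha>) = ?w (zoom z, \<phi> \<alpha> (zoom z)) (1, deriv (\<phi> \<alpha>) (zoom z)) (cscale \<i> (1, deriv (\<phi> \<alpha>) (zoom z)))"
        using zu a by (simp add: trace_def leaf_form_def)
      show ?thesis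
      proof (cases "(zoom z, \<phi> \<alpha> (zoom z)) \<in> zoom_box")
        case box: True
        let ?e = "(1::complex, deriv ?f z)"
        have df: "deriv ?f z = deriv (\<phi> \<alpha>) (zoom z) * of_real r1 / of_real r" by (rule DERIV_imp_deriv[OF zoom_phi_deriv[OF a True]])
        \<comment> \<open>The chart maps the tangent of the leaf to 1/r1 times the normalised
          tangent of the zoomed leaf, whose slope is the old one times r1/r.\<close>
        have e1: "(1 / of_real r1, deriv (\<phi> \<alpha>) (zoom z) / of_real r) = inverse r1 *\<^sub>R ?e"
          using r1 by (simp add: df scaleR_conv_of_real divide_inverse)
        have e2: "(\<i> / of_real r1, \<i> * deriv (\<phi> \<alpha>) (zoom z) / of_real r) = inverse r1 *\<^sub>R cscale \<i> ?e"
          using r1 by (simp add: df scaleR_conv_of_real divide_inverse cscale_def)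
        have "trace ?w (zoom z, \<alpha>) = of_real (inverse r1) * (of_real (inverse r1) * \<omega> (z, ?f z) ?e (cscale \<i> ?e))"
          unfolding tr unfolding pullback_def zoom_chart_frechet c
          using box by (simp only: if_True fst_conv snd_conv cscale_simps mult_1_right e1 e2 bilinear_C_simps[OF test_form2D(1)[OF \<omega>]])
        then show ?thesis using True r1 unfolding zz by (simp add: scaleR_conv_of_real power2_eq_square field_simps)
      next
        case False
        then have "(z, ?f z) \<notin> K" using zoom_chart_box c K(1) by (metis subsetD)
        then show ?thesis using False tr K(2) unfolding zz by (simp add: pullback_def)
      qed
    next
      case False
      then have "zoom z \<notin> ball q1 r1" using r1 by (simp add: zoom_def dist_norm norm_mult)
      then have "trace ?w (zoom z, \<alpha>) = 0" by (simp add: trace_def leaf_form_def pullback_def zoom_box_def)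
      then show ?thesis using False unfolding zz by simp
    qed
  qed
  finally show ?thesis .
qed

text \<open>The image of the transverse measure under relabelling, cut down to the retained labels
  by a density rather than a restriction, so that it remains a measure on all Borel sets of the
  plane.\<close>

definition zoom_measure :: "complex measure \<Rightarrow> complex measure" where
  "zoom_measure \<mu> = density (distr \<mu> borel label) (\<lambda>\<beta>. ennreal (indicator zoom_tau \<beta>))"

lemma zoom_tau_borel [measurable]: "zoom_tau \<in> sets borel"
  using compact_imp_closed[OF Z.compact_tau] by (rule borel_closed)

lemma sets_zoom_measure: "sets (zoom_measure \<mu>) = sets borel" by (simp add: zoom_measure_def)

lemma label_measurable: "finite_measure_on \<tau> \<mu> \<Longrightarrow> label \<in> measurable \<mu> borel"
  using borel_measurable_continuous_on_restrict[OF continuous_label] measurable_cong_sets[OF _ refl]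
  unfolding finite_measure_on_def by blast

lemma zoom_measure_AE: "AE \<beta> in zoom_measure \<mu>. \<beta> \<in> zoom_tau"
proof -
  have "AE \<beta> in distr \<mu> borel label. 0 < ennreal (indicator zoom_tau \<beta>) \<longrightarrow> \<beta> \<in> zoom_tau"
    by (intro AE_I2) (simp add: indicator_def)
  then show ?thesis unfolding zoom_measure_def by (subst AE_density) simp_all
qed

lemma finite_zoom_measure:
  assumes "finite_measure_on \<tau> \<mu>"
  shows "finite_measure (zoom_measure \<mu>)"
proof -
  have "finite_measure \<mu>" using assms by (simp add: finite_measure_on_def)
  then interpret D: finite_measure "distr \<mu> borel label" by (rule finite_measure.finite_measure_distr[OF _ label_measurable[OF assms]])
  have "emeasure (zoom_measure \<mu>) UNIV = (\<integral>\<^sup>+\<beta>. ennreal (indicator zoom_tau \<beta>) \<partial>distr \<mu> borel label)"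
    unfolding zoom_measure_def by (subst emeasure_density) simp_all
  also have "\<dots> \<le> (\<integral>\<^sup>+\<beta>. 1 \<partial>distr \<mu> borel label)"
    by (intro nn_integral_mono) (simp add: indicator_def)
  also have "\<dots> = emeasure (distr \<mu> borel label) UNIV" by simp
  also have "\<dots> < \<infinity>" by (metis D.emeasure_finite infinity_ennreal_def less_top)
  finally show ?thesis by (intro finite_measureI) (simp add: sets_eq_imp_space_eq[OF sets_zoom_measure])
qed

text \<open>Leaves with labels above 2 drop out, since by the drift bound they stay above height 2 -
  1/4 and miss the bidisc. The remaining average becomes an integral over the product of the disc
  with the new transversal by Fubini.\<close>

lemma average_current_zoom:
  assumes \<mu>: "finite_measure_on \<tau> \<mu>" and \<omega>: "test_form2 bidisc \<omega>"
  shows "average_current \<mu> (pullback zoom_box zoom_chart \<omega>) = (LINT p|(disc_measure \<Otimes>\<^sub>M zoom_measure \<mu>). Z.trace \<omega> p)"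
proof -
  interpret N: finite_measure "zoom_measure \<mu>" by (rule finite_zoom_measure[OF \<mu>])
  interpret D: finite_measure disc_measure by (rule finite_disc_measure)
  interpret pair: pair_sigma_finite disc_measure "zoom_measure \<mu>" ..
  interpret Q: finite_measure "disc_measure \<Otimes>\<^sub>M zoom_measure \<mu>"
    by (rule finite_measure_pair_measure[OF N.finite_measure_axioms D.finite_measure_axioms])
  define \<Psi> where "\<Psi> \<beta> = (LINT z|disc_measure. Z.trace \<omega> (z, \<beta>))" for \<beta>
  have \<Psi>m [measurable]: "\<Psi> \<in> borel_measurable borel" unfolding \<Psi>_def by (rule Z.leaf_integral_measurable[OF \<omega>])
  have \<Psi>0: "\<Psi> \<beta> = 0" if "\<beta> \<notin> zoom_tau" for \<beta> using that by (simp add: \<Psi>_def Z.trace_def)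
  have sp: "space \<mu> = \<tau>"
    using \<mu> sets_eq_imp_space_eq[of \<mu> "restrict_space borel \<tau>"] by (simp add: finite_measure_on_def space_restrict_space)
  have leaf: "integration_current (zoom_phi (label \<alpha>)) \<omega> = \<Psi> (label \<alpha>)" if a: "\<alpha> \<in> \<tau>" for \<alpha>
  proof (cases "cmod (label \<alpha>) \<le> 2")
    case True
    then have "label \<alpha> \<in> zoom_tau" using a by (auto simp: zoom_tau_def)
    then show ?thesis unfolding \<Psi>_def by (rule Z.leaf_integral_trace[OF \<omega>])
  next
    case False
    obtain K where K: "K \<subseteq> bidisc" "\<And>p u v. p \<notin> K \<Longrightarrow> \<omega> p u v = 0" using test_form2_support[OF \<omega>] by metis
    have "\<omega> (z, zoom_phi (label \<alpha>) z) u v = 0" if z: "z \<in> unit_disc" for z u v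
    proof (rule K(2))
      have "cmod (label \<alpha>) \<le> cmod (zoom_phi (label \<alpha>) z) + 1/4"
        using zoom_near[OF a z] norm_triangle_sub[of "label \<alpha>" "zoom_phi (label \<alpha>) z"] by (simp add: norm_minus_commute)
      then have "cmod (zoom_phi (label \<alpha>) z) > 1" using False by linarith
      then show "(z, zoom_phi (label \<alpha>) z) \<notin> K" using K(1) by auto
    qed
    then have "integration_current (zoom_phi (label \<alpha>)) \<omega> = (LINT z:unit_disc|lborel. 0)"
      unfolding integration_current_def by (intro set_lebesgue_integral_cong) simp_all
    moreover have "label \<alpha> \<notin> zoom_tau" using False by (auto simp: zoom_tau_def)
    ultimately show ?thesis using \<Psi>0 by simp
  qed
  have "average_current \<mu> (pullback zoom_box zoom_chart \<omega>) = (LINT \<alpha>|\<mu>. \<Psi> (label \<alpha>))"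
    unfolding average_current_def
    by (rule Bochner_Integration.integral_cong[OF refl]) (use sp leaf integration_current_zoom[OF \<omega>] in simp)
  also have "\<dots> = (LINT \<beta>|distr \<mu> borel label. \<Psi> \<beta>)"
    by (rule integral_distr[OF label_measurable[OF \<mu>] \<Psi>m, symmetric])
  also have "\<dots> = (LINT \<beta>|distr \<mu> borel label. indicator zoom_tau \<beta> *\<^sub>R \<Psi> \<beta>)"
    by (rule Bochner_Integration.integral_cong[OF refl]) (use \<Psi>0 in \<open>simp add: indicator_def\<close>)
  also have "\<dots> = (LINT \<beta>|zoom_measure \<mu>. \<Psi> \<beta>)"
    unfolding zoom_measure_def by (rule integral_density[symmetric]) simp_all
  also have "\<dots> = (LINT p|(disc_measure \<Otimes>\<^sub>M zoom_measure \<mu>). Z.trace \<omega> p)"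
  proof -
    obtain B where B: "\<And>p. cmod (Z.trace \<omega> p) \<le> B" using Z.trace_bounded[OF \<omega>] by auto
    have "sets (disc_measure \<Otimes>\<^sub>M zoom_measure \<mu>) = sets (borel \<Otimes>\<^sub>M borel)"
      by (rule sets_pair_measure_cong) (simp_all add: sets_zoom_measure)
    moreover have "Z.trace \<omega> \<in> borel_measurable (borel \<Otimes>\<^sub>M borel)" using Z.trace_measurable[OF \<omega>] by (simp add: borel_prod)
    ultimately have "Z.trace \<omega> \<in> borel_measurable (disc_measure \<Otimes>\<^sub>M zoom_measure \<mu>)" using measurable_cong_sets[OF _ refl] by blast
    then have "integrable (disc_measure \<Otimes>\<^sub>M zoom_measure \<mu>) (Z.trace \<omega>)" by (rule Q.integrable_const_bound[OF AE_I2, OF B])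
    then have "integrable (disc_measure \<Otimes>\<^sub>M zoom_measure \<mu>) (\<lambda>(z, \<beta>). Z.trace \<omega> (z, \<beta>))" by simp
    from pair.integral_snd[OF this] show ?thesis by (simp add: \<Psi>_def)
  qed
  finally show ?thesis .
qed

text \<open>Pulling back along the composed chart is pulling back in two stages. The zoomed form is
  a test form in the old chart, where \<open>T\<close> is an average of leaves; that average is
  rewritten over the new transversal, and S <= T then yields the domination.\<close>

lemma zoomed_current:
  assumes \<mu>: "finite_measure_on \<tau> \<mu>" and b: "biholomorphism V W \<psi>" and box: "zoom_box \<subseteq> W" and W: "W \<subseteq> bidisc" and V: "V \<subseteq> \<Omega>"
    and S: "positive_current \<Omega> S" "closed_current \<Omega> S" and le: "current_le \<Omega> S T"
    and T: "\<And>\<omega>. test_form2 W \<omega> \<Longrightarrow> pushforward V \<psi> T \<omega> = average_current \<mu> \<omega>"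
  defines "V1 \<equiv> V \<inter> \<psi> -` zoom_box" and "\<psi>1 \<equiv> \<lambda>p. zoom_chart (\<psi> p)"
  shows "biholomorphism V1 bidisc \<psi>1" "dominated_leaf_current zoom_tau zoom_phi (zoom_measure \<mu>) (pushforward V1 \<psi>1 S)"
proof -
  have ob: "open zoom_box" by (rule biholomorphismD(1)[OF biholomorphism_zoom_chart])
  show b1: "biholomorphism V1 bidisc \<psi>1"
    unfolding V1_def \<psi>1_def by (rule biholomorphism_compose[OF biholomorphism_restrict[OF b ob box] biholomorphism_zoom_chart])
  have V1: "V1 \<subseteq> \<Omega>" unfolding V1_def using V by blast
  note pt = pullback_test_form2[OF b1 V1] and ty = pullback_types[OF b1]
  have S2: "current2 \<Omega> S" and S11: "current11 \<Omega> S" using S(1) unfolding positive_current_def current11_def by blast+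
  show "dominated_leaf_current zoom_tau zoom_phi (zoom_measure \<mu>) (pushforward V1 \<psi>1 S)"
  proof (intro dominated_leaf_current.intro dominated_current.intro zoom_lamination dominated_current_axioms.intro dominated_leaf_current_axioms.intro)
    show "finite_measure (zoom_measure \<mu>)" by (rule finite_zoom_measure[OF \<mu>])
    show "sets (zoom_measure \<mu>) = sets borel" by (rule sets_zoom_measure)
    show "AE \<beta> in zoom_measure \<mu>. \<beta> \<in> zoom_tau" by (rule zoom_measure_AE)
    show "cmod (zoom_phi \<beta> z - \<beta>) \<le> 1/4" if "\<beta> \<in> zoom_tau" "z \<in> unit_disc" for \<beta> z
      using that zoom_near by (auto simp: zoom_tau_def)
    fix \<omega> assume \<omega>: "test_form2 bidisc \<omega>"
    show "pushforward V1 \<psi>1 S (\<lambda>p u v. a * \<omega> p u v + b * \<omega>' p u v) = a * pushforward V1 \<psi>1 S \<omega> + b * pushforward V1 \<psi>1 S \<omega>'"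
      if \<omega>': "test_form2 bidisc \<omega>'" for a b \<omega>'
      unfolding pushforward_def pullback_comb using S2 pt[OF \<omega>] pt[OF \<omega>'] unfolding current2_def by blast
    show "pushforward V1 \<psi>1 S \<omega> = 0" if "type_20 \<omega> \<or> type_02 \<omega>"
      unfolding pushforward_def using S11 pt[OF \<omega>] ty(1,2)[of \<omega>] that unfolding current11_def by blast
    assume pos: "positive_form \<omega>"
    show "pushforward V1 \<psi>1 S \<omega> \<in> \<real>\<^sub>\<ge>\<^sub>0"
      unfolding pushforward_def using S(1) pt[OF \<omega>] ty(3)[OF pos] unfolding positive_current_def by blast
    have zt: "test_form2 W (pullback zoom_box zoom_chart \<omega>)"
      by (rule test_form2_mono[OF pullback_test_form2[OF biholomorphism_zoom_chart order_refl \<omega>] box])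
    have "T (pullback V1 \<psi>1 \<omega>) = pushforward V \<psi> T (pullback zoom_box zoom_chart \<omega>)"
      unfolding pushforward_def V1_def \<psi>1_def pullback_compose[OF b biholomorphism_zoom_chart box] ..
    also have "\<dots> = (LINT p|(disc_measure \<Otimes>\<^sub>M zoom_measure \<mu>). Z.trace \<omega> p)"
      unfolding T[OF zt] by (rule average_current_zoom[OF \<mu> \<omega>])
    finally have Te: "T (pullback V1 \<psi>1 \<omega>) = (LINT p|(disc_measure \<Otimes>\<^sub>M zoom_measure \<mu>). Z.trace \<omega> p)" .
    have "T (pullback V1 \<psi>1 \<omega>) - S (pullback V1 \<psi>1 \<omega>) \<in> \<real>\<^sub>\<ge>\<^sub>0"
      using le pt[OF \<omega>] ty(3)[OF pos] unfolding current_le_def positive_current_def by blast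
    then show "(LINT p|(disc_measure \<Otimes>\<^sub>M zoom_measure \<mu>). Z.trace \<omega> p) - pushforward V1 \<psi>1 S \<omega> \<in> \<real>\<^sub>\<ge>\<^sub>0"
      unfolding Te pushforward_def .
  next
    fix H :: "C2 \<Rightarrow> complex" and L :: "complex \<Rightarrow> real" and K
    assume "smooth_on UNIV H" "compact K" "K \<subseteq> bidisc" "\<And>p. p \<notin> K \<Longrightarrow> H p = 0" "L \<in> {Re, Im}"
    from closed_current_pullback[OF b1 V1 S(2) this]
    show "pushforward V1 \<psi>1 S (\<lambda>p u v. frechet_derivative H (at p) u * complex_of_real (L (fst v))
            - frechet_derivative H (at p) v * complex_of_real (L (fst u))) = 0"
      unfolding pushforward_def .
  qed
qed

end

section \<open>Choice of the small chart and conclusion\<close>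

lemma graph_lamination_of_lamination_by_graphs:
  assumes "lamination_by_graphs \<tau> \<phi>"
  shows "graph_lamination \<tau> \<phi>"
proof -
  obtain \<eta> where eta: "\<eta> > 0" "\<And>\<alpha> z. \<alpha> \<in> \<tau> \<Longrightarrow> z \<in> unit_disc \<Longrightarrow> cmod (\<phi> \<alpha> z) \<le> 1 - \<eta>"
    and ci: "closedin (top_of_set unit_disc) \<tau>" and hol: "\<And>\<alpha>. \<alpha> \<in> \<tau> \<Longrightarrow> \<phi> \<alpha> holomorphic_on unit_disc"
    and base: "\<And>\<alpha>. \<alpha> \<in> \<tau> \<Longrightarrow> \<phi> \<alpha> 0 = \<alpha>" and disj: "disjoint_family_on (\<lambda>\<alpha>. graph_over_disc (\<phi> \<alpha>)) \<tau>"
    using assms unfolding lamination_by_graphs_def by blast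
  show ?thesis
  proof
    obtain C where C: "closed C" "\<tau> = unit_disc \<inter> C" using ci unfolding closedin_closed by blast
    \<comment> \<open>A base point is a value of its own leaf, so the uniform bound places \<tau> in
      a compact disc inside the unit disc, where relatively closed means compact.\<close>
    have "\<tau> \<subseteq> cball 0 (1 - \<eta>)" using eta(2)[of _ 0] base by force
    moreover have "cball 0 (1 - \<eta>) \<subseteq> unit_disc" using eta(1) by auto
    ultimately have "\<tau> = cball 0 (1 - \<eta>) \<inter> C" using C(2) by blast
    then show "compact \<tau>" using compact_Int_closed[OF compact_cball C(1)] by simp
    show "\<phi> \<alpha> z \<noteq> \<phi> \<beta> z" if "\<alpha> \<in> \<tau>" "\<beta> \<in> \<tau>" "\<alpha> \<noteq> \<beta>" "z \<in> unit_disc" for \<alpha> \<beta> z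
    proof
      assume "\<phi> \<alpha> z = \<phi> \<beta> z"
      then have "(z, \<phi> \<alpha> z) \<in> graph_over_disc (\<phi> \<alpha>) \<inter> graph_over_disc (\<phi> \<beta>)"
        using that(4) by (auto simp: graph_over_disc_def)
      then show False using disj that(1-3) unfolding disjoint_family_on_def by blast
    qed
    show "cmod (\<phi> \<alpha> z - \<phi> \<beta> z) < 5" if "\<alpha> \<in> \<tau>" "\<beta> \<in> \<tau>" "z \<in> unit_disc" for \<alpha> \<beta> z
      using norm_triangle_ineq4[of "\<phi> \<alpha> z" "\<phi> \<beta> z"] eta(2)[OF that(1,3)] eta(2)[OF that(2,3)] eta(1) by linarith
  qed (use hol base in blast)+
qed

lemma (in graph_lamination) rescaling_exists:
  assumes q: "q1 \<in> unit_disc" and s: "s > 0"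
  shows "\<exists>r1>0. r1 \<le> s \<and> rescaled_lamination \<tau> \<phi> q1 r1 s"
proof -
  define d where "d = 1 - cmod q1"
  have d: "d > 0" using q by (simp add: d_def)
  have qd: "0 \<le> cmod q1 + d / 2" "cmod q1 + d / 2 < 1" using d by (auto simp: d_def field_simps)
  then obtain B where B: "B > 0" "\<And>z \<alpha>. cmod z \<le> cmod q1 + d / 2 \<Longrightarrow> \<alpha> \<in> \<tau> \<Longrightarrow> cmod (deriv (\<phi> \<alpha>) z) \<le> B"
    using slope_bound by metis
  \<comment> \<open>The three bounds keep the box inside the given polydisc, keep its base inside
    the smaller disc where slopes are at most \<open>B\<close>, and make the variation of a leaf at
    most B * s/(4 B) = s/4.\<close>
  define r1 where "r1 = min s (min (d / 2) (s / (4 * B)))"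
  have r1: "r1 > 0" "r1 \<le> s" "r1 \<le> d / 2" "r1 \<le> s / (4 * B)" using s d B(1) by (auto simp: r1_def)
  have inb: "cmod z \<le> cmod q1 + d / 2" "z \<in> unit_disc" if "z \<in> ball q1 r1" for z
  proof -
    have "cmod (z - q1) < d / 2" using that r1(3) by (simp add: dist_norm norm_minus_commute)
    then show "cmod z \<le> cmod q1 + d / 2" using norm_triangle_sub[of z q1] by linarith
    then show "z \<in> unit_disc" using qd by simp
  qed
  have "rescaled_lamination \<tau> \<phi> q1 r1 s"
  proof unfold_locales
    show "r1 > 0" "s > 0" by fact+
    show "ball q1 r1 \<subseteq> unit_disc" using inb(2) by blast
    fix \<alpha> z assume a: "\<alpha> \<in> \<tau>" and z: "z \<in> ball q1 r1"
    have "cmod (\<phi> \<alpha> z - \<phi> \<alpha> q1) \<le> B * cmod (z - q1)"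
    proof (rule field_differentiable_bound[OF convex_ball[of q1 r1]])
      fix w assume w: "w \<in> ball q1 r1"
      show "(\<phi> \<alpha> has_field_derivative deriv (\<phi> \<alpha>) w) (at w within ball q1 r1)"
        using holomorphic_derivI[OF hol[OF a] open_ball inb(2)[OF w]] by (rule has_field_derivative_at_within)
      show "cmod (deriv (\<phi> \<alpha>) w) \<le> B" by (rule B(2)[OF inb(1)[OF w] a])
    qed (use z r1 in auto)
    also have "\<dots> \<le> B * (s / (4 * B))"
      using z r1(4) B(1) by (intro mult_left_mono) (auto simp: dist_norm norm_minus_commute)
    also have "\<dots> = s / 4" using B(1) by simp
    finally show "cmod (\<phi> \<alpha> z - \<phi> \<alpha> q1) \<le> s / 4" .
  qed
  then show ?thesis using r1 by blast
qed

theorem mainTheorem2: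
  fixes \<Omega> :: "C2 set" and S T :: current
  assumes "open \<Omega>"
    and "uniformly_laminar \<Omega> T"
    and "positive_current \<Omega> S"
    and "closed_current \<Omega> S"
    and "current_le \<Omega> S T"
  shows "uniformly_laminar \<Omega> S"
  unfolding uniformly_laminar_def
proof (intro conjI ballI)
  show "positive_current \<Omega> S" by fact
  fix p assume "p \<in> \<Omega>"
  then obtain V W \<psi> R where p: "p \<in> V" and V: "V \<subseteq> \<Omega>" and W: "W \<subseteq> bidisc" and b: "biholomorphism V W \<psi>"
    and R: "uniformly_laminar_bidisc R" and T: "\<And>\<omega>. test_form2 W \<omega> \<Longrightarrow> pushforward V \<psi> T \<omega> = R \<omega>"
    using assms(2) unfolding uniformly_laminar_def by blast
  obtain \<tau> \<phi> \<mu> where lam: "lamination_by_graphs \<tau> \<phi>" and \<mu>: "finite_measure_on \<tau> \<mu>"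
    and Re: "\<And>\<omega>. test_form2 bidisc \<omega> \<Longrightarrow> R \<omega> = (LINT \<alpha>|\<mu>. integration_current (\<phi> \<alpha>) \<omega>)"
    using R unfolding uniformly_laminar_bidisc_def by blast
  interpret L: graph_lamination \<tau> \<phi> by (rule graph_lamination_of_lamination_by_graphs[OF lam])
  obtain q1 q2 where q: "\<psi> p = (q1, q2)" by (cases "\<psi> p")
  have qW: "(q1, q2) \<in> W" using biholomorphismD(5)[OF b p] q by simp
  obtain s where s: "s > 0" "cball q1 s \<times> cball q2 s \<subseteq> W"
    using bidisc_in_open[OF biholomorphismD(2)[OF b] qW] by metis
  have "q1 \<in> unit_disc" using qW W by auto
  from L.rescaling_exists[OF this s(1)] obtain r1 where r1: "r1 > 0" "r1 \<le> s" "rescaled_lamination \<tau> \<phi> q1 r1 s" by blast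
  interpret Z: rescaled_lamination \<tau> \<phi> q1 q2 r1 s by (rule r1(3))
  have "ball q1 r1 \<subseteq> cball q1 s" "ball q2 s \<subseteq> cball q2 s" using r1(2) by auto
  then have box: "Z.zoom_box \<subseteq> W" unfolding Z.zoom_box_def using s(2) by blast
  \<comment> \<open>The chart is cut twice: to the box, whose zoomed image is the bidisc on which
    \<open>S\<close> is studied, and then to the preimage of \<open>W'\<close>, where the
    representation of \<open>S\<close> holds.\<close>
  define V1 where "V1 = V \<inter> \<psi> -` Z.zoom_box"
  define \<psi>1 where "\<psi>1 = (\<lambda>p. Z.zoom_chart (\<psi> p))"
  have T': "pushforward V \<psi> T \<omega> = L.average_current \<mu> \<omega>" if "test_form2 W \<omega>" for \<omega>
    unfolding T[OF that] Re[OF test_form2_mono[OF that W]] L.average_current_def ..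
  note zc = Z.zoomed_current[OF \<mu> b box W V assms(3-5) T', folded V1_def \<psi>1_def]
  obtain R' where R': "uniformly_laminar_bidisc R'"
    "\<And>\<omega>. test_form2 (ball 0 (1/4) \<times> ball 0 (1/4)) \<omega> \<Longrightarrow> pushforward V1 \<psi>1 S \<omega> = R' \<omega>"
    using dominated_leaf_current.laminar_near_origin[OF zc(2)] by blast
  define W' where "W' = ball (0::complex) (1/4) \<times> ball (0::complex) (1/4)"
  have W': "open W'" "W' \<subseteq> bidisc" unfolding W'_def by (auto intro!: open_Times)
  have "\<psi>1 p \<in> W'" using q by (simp add: \<psi>1_def Z.zoom_chart_def W'_def)
  moreover have "p \<in> V1" using p q r1(1) s(1) by (simp add: V1_def Z.zoom_box_def)
  ultimately have pV: "p \<in> V1 \<inter> \<psi>1 -` W'" by simp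
  have "V1 \<inter> \<psi>1 -` W' \<subseteq> \<Omega>" using V by (auto simp: V1_def)
  moreover have "biholomorphism (V1 \<inter> \<psi>1 -` W') W' \<psi>1" by (rule biholomorphism_restrict[OF zc(1) W'])
  moreover have "pushforward (V1 \<inter> \<psi>1 -` W') \<psi>1 S \<omega> = R' \<omega>" if \<omega>: "test_form2 W' \<omega>" for \<omega>
  proof -
    obtain K where K: "K \<subseteq> W'" "\<And>p u v. p \<notin> K \<Longrightarrow> \<omega> p u v = 0" using test_form2_support[OF \<omega>] by metis
    have "\<omega> x u v = 0" if "x \<notin> W'" for x u v using K that by blast
    \<comment> \<open>A form supported in \<open>W'\<close> has the same pullback from the smaller
      domain and from \<open>V1\<close>, both being extended by zero.\<close>
    then have "pullback (V1 \<inter> \<psi>1 -` W') \<psi>1 \<omega> = pullback V1 \<psi>1 \<omega>" by (intro ext) (simp add: pullback_def)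
    then show ?thesis using R'(2)[OF \<omega>[unfolded W'_def]] by (simp add: pushforward_def)
  qed
  moreover note W'(2) R'(1) pV
  ultimately show "\<exists>V W \<psi> R. p \<in> V \<and> V \<subseteq> \<Omega> \<and> W \<subseteq> bidisc \<and> biholomorphism V W \<psi> \<and> uniformly_laminar_bidisc R \<and>
      (\<forall>\<omega>. test_form2 W \<omega> \<longrightarrow> pushforward V \<psi> S \<omega> = R \<omega>)"
    by (intro exI conjI allI impI) assumption+
qed

end
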